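(* Let $F_{s,t}$ be the odd-ballooning of $K_{s,t}$ with $t\ge s\ge 2$, where $(s,t)\notin\{(2,2),(2,3)\}$ and each odd cycle has length at least $5$. Then for $n$ large enough, $$\mathrm{ex}(n,F_{s,t})=\left\lceil \frac{n-s+1}{2}\right\rceil\left\lfloor \frac{n-s+1}{2}\right\rfloor+(s-1)(n-s+1)+\binom{s-1}{2}+t^2-3t+3 .$$ Moreover, $G_{s,t}$ is the only extremal graph for $t\ge 4$. For $t=3$, there are at least two extremal graphs $G_{3,3}$ and $G'_{3,3}$.
   Context: A graph is $L$-free if it does not contain $L$ as a subgraph. The Turán number $\mathrm{ex}(n,L)$ is the maximum number of edges in an $n$-vertex $L$-free graph; an $n$-vertex $L$-free graph with exactly $\mathrm{ex}(n,L)$ edges is called an extremal graph for $L$. Odd-ballooning: the odd-ballooning of a graph $G$ is a graph obtained from $G$ by replacing each edge of $G$ by an odd cycle (containing that edge), where all new vertices for different odd cycles are distinct. The lengths of the odd cycles are not necessarily equal. The join $G\otimes G'$ is obtained from the vertex-disjoint union of $G$ and $G'$ by connecting each vertex of $G$ with each vertex of $G'$. $T_2(m)$ is the balanced complete bipartite graph on $m$ vertices. The graph $H$: the graph obtained from $K_{t-1,t-1}$, with classes $\{u_1,\dots,u_{t-1}\}$ and $\{v_1,\dots,v_{t-1}\}$, by removing the matching $\{u_2v_2,\dots,u_{t-1}v_{t-1}\}$ of $t-2$ edges. For $t=3$, $H$ is $P_4$, the path on four vertices. For $2\le s\le t$, $G_{s,t}$ is the $n$-vertex graph obtained from $T_2(n-s+1)\otimes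 K_{s-1}$ by embedding $H$ into one class of $T_2(n-s+1)$ (that is, adding the edges of a copy of $H$ inside that class). Similarly, $G'_{3,3}$ is the $n$-vertex graph obtained from $T_2(n-2)\otimes K_2$ by embedding a triangle into one class of $T_2(n-2)$. *)

theory Defs
  imports Complex_Main "HOL-Library.Ramsey" "HOL-Library.Disjoint_Sets"
begin

type_synonym 'a graph = "'a set \<times> 'a set set"

abbreviation verts :: "'a graph \<Rightarrow> 'a set" where "verts \<equiv> fst"
abbreviation edges :: "'a graph \<Rightarrow> 'a set set" where "edges \<equiv> snd"

definition simple_graph :: "'a graph \<Rightarrow> bool" where
  "simple_graph G \<longleftrightarrow> finite (verts G) \<and> edges G \<subseteq> nsets (verts G) 2"

definition subgraph :: "'a graph \<Rightarrow> 'a graph \<Rightarrow> bool" where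
  "subgraph G' G \<longleftrightarrow> verts G' \<subseteq> verts G \<and> edges G' \<subseteq> edges G"

definition graph_iso :: "'a graph \<Rightarrow> 'b graph \<Rightarrow> bool" where
  "graph_iso G G' \<longleftrightarrow>
     (\<exists>f. bij_betw f (verts G) (verts G') \<and> edges G' = (\<lambda>e. f ` e) ` edges G)"

definition graph_free :: "'a graph \<Rightarrow> 'b graph \<Rightarrow> bool" where
  "graph_free L G \<longleftrightarrow> \<not> (\<exists>L'. subgraph L' G \<and> graph_iso L L')"

text \<open>Every finite graph has an isomorphic copy with vertices in \<^typ>\<open>nat\<close>, so host graphs
  are taken over \<^typ>\<open>nat\<close>; edge counts are bounded, so the maximum below is over a
  finite set.\<close>

definition turan_number :: "nat \<Rightarrow> 'a graph \<Rightarrow> nat" where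
  "turan_number n L =
     Max {card (edges G) | G :: nat graph. simple_graph G \<and> card (verts G) = n \<and> graph_free L G}"

definition extremal_graph :: "nat \<Rightarrow> 'a graph \<Rightarrow> nat graph \<Rightarrow> bool" where
  "extremal_graph n L G \<longleftrightarrow>
     simple_graph G \<and> card (verts G) = n \<and> graph_free L G \<and> card (edges G) = turan_number n L"

definition complete_graph :: "'a set \<Rightarrow> 'a graph" where
  "complete_graph A = (A, nsets A 2)"

definition complete_bipartite :: "'a set \<Rightarrow> 'a set \<Rightarrow> 'a graph" where
  "complete_bipartite A B = (A \<union> B, {{a, b} | a b. a \<in> A \<and> b \<in> B})"

definition is_complete_bipartite :: "nat \<Rightarrow> nat \<Rightarrow> 'a graph \<Rightarrow> bool" where
  "is_complete_bipartite s t K \<longleftrightarrow>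
     (\<exists>A B. finite A \<and> finite B \<and> A \<inter> B = {} \<and> card A = s \<and> card B = t \<and>
            K = complete_bipartite A B)"

definition is_cycle :: "'a graph \<Rightarrow> bool" where
  "is_cycle Q \<longleftrightarrow>
     (\<exists>xs. 3 \<le> length xs \<and> distinct xs \<and>
           Q = (set xs, {{xs ! i, xs ! (Suc i mod length xs)} | i. i < length xs}))"

text \<open>\<open>C e\<close> is the odd cycle replacing the edge \<open>e\<close>; its length is the number of its
  vertices. The new vertices of \<open>C e\<close> are those outside \<open>verts G\<close>.\<close>

definition odd_ballooning :: "'a graph \<Rightarrow> ('a set \<Rightarrow> 'a graph) \<Rightarrow> 'a graph \<Rightarrow> bool" where
  "odd_ballooning G C F \<longleftrightarrow>
     (\<forall>e\<in>edges G. is_cycle (C e) \<and> odd (card (verts (C e))) \<and>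
                  e \<in> edges (C e) \<and> verts (C e) \<inter> verts G = e) \<and>
     disjoint_family_on (\<lambda>e. verts (C e) - verts G) (edges G) \<and>
     F = (verts G \<union> (\<Union>e\<in>edges G. verts (C e)), \<Union>e\<in>edges G. edges (C e))"

text \<open>Only used for graphs with disjoint vertex sets.\<close>

definition graph_join :: "'a graph \<Rightarrow> 'a graph \<Rightarrow> 'a graph" where
  "graph_join G G' =
     (verts G \<union> verts G', edges G \<union> edges G' \<union> edges (complete_bipartite (verts G) (verts G')))"

definition balanced_classes :: "nat \<Rightarrow> 'a set \<Rightarrow> 'a set \<Rightarrow> bool" where
  "balanced_classes m X Y \<longleftrightarrow>
     finite X \<and> finite Y \<and> X \<inter> Y = {} \<and> card X + card Y = m \<and>
     card X \<le> card Y + 1 \<and> card Y \<le> card X + 1"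

text \<open>\<open>G\<close> arises from the join of the balanced complete bipartite graph on \<open>m\<close> vertices and
  the complete graph on \<open>k\<close> vertices by adding the edges of \<open>Q\<close> inside one class. For odd
  \<open>m\<close> this class \<open>X\<close> may be either the larger or the smaller one.\<close>

definition embedded_in_join :: "nat \<Rightarrow> nat \<Rightarrow> 'a graph \<Rightarrow> 'a graph \<Rightarrow> bool" where
  "embedded_in_join m k Q G \<longleftrightarrow>
     (\<exists>X Y S. balanced_classes m X Y \<and> finite S \<and> card S = k \<and> S \<inter> (X \<union> Y) = {} \<and>
        verts Q \<subseteq> X \<and>
        (let J = graph_join (complete_bipartite X Y) (complete_graph S)
         in G = (verts J, edges J \<union> edges Q)))"

definition is_H :: "nat \<Rightarrow> 'a graph \<Rightarrow> bool" where
  "is_H t Q \<longleftrightarrow>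
     (\<exists>u v. inj_on u {1..t - 1} \<and> inj_on v {1..t - 1} \<and> u ` {1..t - 1} \<inter> v ` {1..t - 1} = {} \<and>
        (let K = complete_bipartite (u ` {1..t - 1}) (v ` {1..t - 1})
         in Q = (verts K, edges K - {{u i, v i} | i. i \<in> {2..t - 1}})))"

definition is_Gst :: "nat \<Rightarrow> nat \<Rightarrow> nat \<Rightarrow> 'a graph \<Rightarrow> bool" where
  "is_Gst s t n G \<longleftrightarrow> (\<exists>Q. is_H t Q \<and> embedded_in_join (n - s + 1) (s - 1) Q G)"

definition is_G33' :: "nat \<Rightarrow> 'a graph \<Rightarrow> bool" where
  "is_G33' n G \<longleftrightarrow> (\<exists>T. card T = 3 \<and> embedded_in_join (n - 2) 2 (complete_graph T) G)"

end

theory Submission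
  imports Defs
begin

text \<open>
  Let \<^term>\<open>G\<close> be free of the odd-ballooning and have the claimed number of edges. Deleting a vertex
  of degree smaller than the increment of the claimed formula increases the excess over that formula,
  so one may assume that the minimum degree is at least half the number of vertices. Many triangles
  would give a large complete tripartite graph, which contains the odd-ballooning; hence some edge
  lies in few triangles and its two neighbourhoods are the classes of a nearly bipartite graph. In a
  maximum cut, the vertices with many neighbours in their own class form a set \<^term>\<open>W\<close>: counting
  edges shows that \<^term>\<open>W\<close> has exactly \<^term>\<open>s - 1\<close> vertices and that all remaining vertices see
  almost the whole opposite class. Embedding the odd-ballooning then becomes a question about the
  graph \<^term>\<open>L\<close> inside the classes, because paths of even length at least \<^term>\<open>4\<close> can be routed
  greedily: with \<^term>\<open>W\<close> on one side of the bipartition, \<^term>\<open>L\<close> may not contain \<^term>\<open>t\<close> edges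
  that pairwise meet only in one common vertex, and this forces a vertex of degree \<^term>\<open>t - 1\<close>
  whose neighbourhood covers \<^term>\<open>L\<close>. With one vertex of \<^term>\<open>W\<close> on the other side, two full rows
  of the resulting bipartite graph are excluded as well, and weighing the missing edges leaves exactly
  the graph \<^term>\<open>H\<close>.
\<close>

section \<open>Embeddings, paths and cycles\<close>

text \<open>Everything turns on parity. In an odd cycle through an edge, of length at least 5, the
  rest is a path with an odd number, at least 3, of inner vertices. Outside \<open>W\<close> such a
  path joins two vertices of the same class by alternating between the classes, and a vertex of
  \<open>W\<close> can reach either class; between opposite classes one edge inside a class is
  needed. So an embedding either keeps both sides in one class and \<open>W\<close>, or it spends
  inside edges, and each type of placement yields one restriction on \<open>L\<close>. The constant
  is (t - 1)^2 - (t - 2): the first restriction still allows a complete bipartite graph with classes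
  of size t - 1, the second removes t - 2 of its edges.

  The obstacle is that inside edges can be bought by missing cross edges, so only a net count can be
  bounded: it is at most (t - 1)(t - 2), one below the constant, unless some vertex has t - 1 inside
  neighbours and misses nothing across.

  For the lower bound, each cycle that avoids the clique of s - 1 vertices must use an edge of the
  embedded graph. Distinct cycles share at most a branch vertex, so too many distinct vertices would
  be needed to cover those edges.\<close>

definition adj :: "'b graph \<Rightarrow> 'b \<Rightarrow> 'b \<Rightarrow> bool" where
  "adj G u v \<longleftrightarrow> {u, v} \<in> edges G"

definition nbrs :: "'b graph \<Rightarrow> 'b \<Rightarrow> 'b set" where
  "nbrs G v = {u \<in> verts G. adj G v u}"

lemma adj_sym: "adj G u v \<Longrightarrow> adj G v u"
  by (simp add: adj_def insert_commute)

lemma adj_commute: "adj G u v \<longleftrightarrow> adj G v u"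
  by (simp add: adj_def insert_commute)

lemma adj_verts:
  assumes "simple_graph G" "adj G u v"
  shows "u \<in> verts G" "v \<in> verts G" "u \<noteq> v"
  using assms by (auto simp: simple_graph_def adj_def nsets_def card_2_iff doubleton_eq_iff)

definition embeds :: "'a graph \<Rightarrow> 'b graph \<Rightarrow> bool" where
  "embeds F G \<longleftrightarrow> (\<exists>g. inj_on g (verts F) \<and> g ` verts F \<subseteq> verts G \<and>
     (\<forall>e\<in>edges F. g ` e \<in> edges G))"

text \<open>The image of an injective edge-preserving map is itself a copy of the graph, so no
  separate object is needed for the copy; everything below works with such maps.\<close>

lemma graph_free_iff: "graph_free L G \<longleftrightarrow> \<not> embeds L G"
proof
  assume free: "graph_free L G"
  show "\<not> embeds L G"
  proof
    assume "embeds L G"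
    then obtain g where g: "inj_on g (verts L)" "g ` verts L \<subseteq> verts G" "\<forall>e\<in>edges L. g ` e \<in> edges G"
      unfolding embeds_def by blast
    define L' where "L' = (g ` verts L, (\<lambda>e. g ` e) ` edges L)"
    have "subgraph L' G" using g by (auto simp: subgraph_def L'_def)
    moreover have "graph_iso L L'"
      unfolding graph_iso_def L'_def using g(1) by (intro exI[of _ g]) (simp add: bij_betw_imageI)
    ultimately show False using free unfolding graph_free_def by blast
  qed
next
  assume ne: "\<not> embeds L G"
  show "graph_free L G"
    unfolding graph_free_def
  proof
    assume "\<exists>L'. subgraph L' G \<and> graph_iso L L'"
    then obtain L' f where "subgraph L' G" "bij_betw f (verts L) (verts L')"
      "edges L' = (\<lambda>e. f ` e) ` edges L" by (auto simp: graph_iso_def)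
    hence "embeds L G" unfolding embeds_def subgraph_def bij_betw_def
      by (intro exI[of _ f]) auto
    with ne show False by blast
  qed
qed

section \<open>Paths as vertex lists, and cutting a cycle open at an edge\<close>

definition path_edges :: "'a list \<Rightarrow> 'a set set" where
  "path_edges xs = {{xs ! i, xs ! Suc i} | i. Suc i < length xs}"

lemma path_edges_rev: "path_edges (rev xs) = path_edges xs"
proof -
  have *: "path_edges (rev xs) \<subseteq> path_edges xs" for xs :: "'a list"
  proof
    fix e assume "e \<in> path_edges (rev xs)"
    then obtain i where i: "Suc i < length xs" "e = {rev xs ! i, rev xs ! Suc i}"
      by (auto simp: path_edges_def)
    define j where "j = length xs - Suc (Suc i)"
    have "Suc j < length xs" "rev xs ! i = xs ! Suc j" "rev xs ! Suc i = xs ! j"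
      using i by (auto simp: rev_nth j_def Suc_diff_Suc)
    thus "e \<in> path_edges xs" using i by (auto simp: path_edges_def)
  qed
  from *[of xs] *[of "rev xs"] show ?thesis by auto
qed

text \<open>Trades a set of edges for a list predicate that unfolds along cons and append, the form
  in which paths are assembled later.\<close>

lemma path_edges_subset_iff: "path_edges xs \<subseteq> edges G \<longleftrightarrow> successively (adj G) xs"
proof (induction xs rule: induct_list012)
  case (3 x y zs)
  have "path_edges (x # y # zs) = insert {x, y} (path_edges (y # zs))"
    unfolding path_edges_def
  proof (rule set_eqI, rule iffI)
    fix e assume "e \<in> {{(x # y # zs) ! i, (x # y # zs) ! Suc i} |i. Suc i < length (x # y # zs)}"
    then obtain i where "Suc i < length (x # y # zs)" "e = {(x # y # zs) ! i, (x # y # zs) ! Suc i}" by blast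
    thus "e \<in> insert {x, y} {{(y # zs) ! i, (y # zs) ! Suc i} |i. Suc i < length (y # zs)}"
      by (cases i) auto
  next
    fix e assume "e \<in> insert {x, y} {{(y # zs) ! i, (y # zs) ! Suc i} |i. Suc i < length (y # zs)}"
    thus "e \<in> {{(x # y # zs) ! i, (x # y # zs) ! Suc i} |i. Suc i < length (x # y # zs)}"
    proof
      assume "e = {x, y}"
      thus ?thesis by (auto intro!: exI[of _ 0])
    next
      assume "e \<in> {{(y # zs) ! i, (y # zs) ! Suc i} |i. Suc i < length (y # zs)}"
      then obtain i where "Suc i < length (y # zs)" "e = {(y # zs) ! i, (y # zs) ! Suc i}" by blast
      thus ?thesis by (auto intro!: exI[of _ "Suc i"])
    qed
  qed
  thus ?case using 3 by (simp add: adj_def)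
qed (auto simp: path_edges_def)

lemma path_edges_map: "path_edges (map g xs) = (\<lambda>e. g ` e) ` path_edges xs"
proof -
  have "path_edges (map g xs) = {g ` {xs ! i, xs ! Suc i} | i. Suc i < length xs}"
    unfolding path_edges_def by (auto; metis Suc_lessD nth_map)
  also have "\<dots> = (\<lambda>e. g ` e) ` path_edges xs" unfolding path_edges_def by blast
  finally show ?thesis .
qed

lemma cycle_edges_rotate:
  assumes "xs \<noteq> []" "n = length xs"
  shows "{{rotate k xs ! i, rotate k xs ! (Suc i mod n)} | i. i < n} =
         {{xs ! i, xs ! (Suc i mod n)} | i. i < n}"
proof -
  have n: "n > 0" using assms by simp
  have eq: "{rotate k xs ! i, rotate k xs ! (Suc i mod n)} =
      {xs ! ((k + i) mod n), xs ! (Suc ((k + i) mod n) mod n)}" if "i < n" for i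
    using that n assms by (simp add: nth_rotate mod_simps)
  show ?thesis
  proof (intro equalityI subsetI)
    fix e assume "e \<in> {{rotate k xs ! i, rotate k xs ! (Suc i mod n)} | i. i < n}"
    then obtain i where "i < n" "e = {rotate k xs ! i, rotate k xs ! (Suc i mod n)}" by blast
    thus "e \<in> {{xs ! i, xs ! (Suc i mod n)} | i. i < n}"
      using eq n by (auto intro!: exI[of _ "(k + i) mod n"])
  next
    fix e assume "e \<in> {{xs ! i, xs ! (Suc i mod n)} | i. i < n}"
    then obtain j where j: "j < n" "e = {xs ! j, xs ! (Suc j mod n)}" by blast
    define i where "i = (j + (n - k mod n)) mod n"
    have "(k + i) mod n = (k mod n + (j + (n - k mod n))) mod n"
      unfolding i_def by (metis mod_add_left_eq mod_add_right_eq)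
    also have "k mod n + (j + (n - k mod n)) = j + n"
      using mod_less_divisor[OF n, of k] by linarith
    finally have "(k + i) mod n = j" using j by simp
    moreover have "i < n" using n by (simp add: i_def)
    ultimately show "e \<in> {{rotate k xs ! i, rotate k xs ! (Suc i mod n)} | i. i < n}"
      using eq[of i] j by auto
  qed
qed

lemma cycle_edges_conv_path:
  assumes "length xs = n" "n \<ge> 2"
  shows "{{xs ! i, xs ! (Suc i mod n)} | i. i < n} = insert {last xs, hd xs} (path_edges xs)"
proof -
  have ne: "xs \<noteq> []" using assms by auto
  show ?thesis
  proof (intro equalityI subsetI)
    fix e assume "e \<in> {{xs ! i, xs ! (Suc i mod n)} | i. i < n}"
    then obtain i where i: "i < n" "e = {xs ! i, xs ! (Suc i mod n)}" by blast
    show "e \<in> insert {last xs, hd xs} (path_edges xs)"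
    proof (cases "Suc i = n")
      case True
      thus ?thesis using i ne assms by (auto simp: last_conv_nth hd_conv_nth)
    next
      case False
      thus ?thesis using i assms by (auto simp: path_edges_def)
    qed
  next
    fix e assume "e \<in> insert {last xs, hd xs} (path_edges xs)"
    thus "e \<in> {{xs ! i, xs ! (Suc i mod n)} | i. i < n}"
    proof
      assume "e = {last xs, hd xs}"
      thus ?thesis using ne assms
        by (auto simp: last_conv_nth hd_conv_nth intro!: exI[of _ "n - 1"])
    next
      assume "e \<in> path_edges xs"
      then obtain i where "Suc i < n" "e = {xs ! i, xs ! Suc i}" using assms by (auto simp: path_edges_def)
      thus ?thesis by (auto intro!: exI[of _ i])
    qed
  qed
qed

text \<open>Rotating the vertex list moves the given edge to the place where the list closes up, and
  what remains is a path between its ends. If this path runs from \<open>b\<close> to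
  \<open>a\<close>, reversing the list repairs the orientation.\<close>

lemma cycle_unroll:
  assumes "is_cycle Q" "{a, b} \<in> edges Q"
  shows "\<exists>ps. distinct (a # ps @ [b]) \<and> verts Q = set (a # ps @ [b]) \<and>
              edges Q = insert {a, b} (path_edges (a # ps @ [b]))"
proof -
  obtain xs where xs: "3 \<le> length xs" "distinct xs" "verts Q = set xs"
    "edges Q = {{xs ! i, xs ! (Suc i mod length xs)} | i. i < length xs}"
    using assms(1) unfolding is_cycle_def by auto
  define n where "n = length xs"
  obtain k where k: "k < n" "{a, b} = {xs ! k, xs ! (Suc k mod n)}"
    using assms(2) xs(4) by (auto simp: n_def)
  \<comment> \<open>The shift \<open>Suc k\<close> makes the entry at \<open>Suc k mod n\<close> the
    head and the entry at \<open>k\<close> the last one.\<close>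
  define ys where "ys = rotate (Suc k) xs"
  have ne: "xs \<noteq> []" using xs by auto
  have ys: "length ys = n" "distinct ys" "set ys = set xs"
    using xs by (auto simp: ys_def n_def)
  have yne: "ys \<noteq> []" using ys(1) k by auto
  have hd: "hd ys = xs ! (Suc k mod n)"
    using yne ys(1) k by (simp add: hd_conv_nth ys_def nth_rotate n_def del: rotate_Suc)
  have "last ys = xs ! ((Suc k + (n - 1)) mod n)"
    using yne ys(1) k by (simp add: last_conv_nth ys_def nth_rotate n_def del: rotate_Suc)
  hence lst: "last ys = xs ! k" using k by simp
  have E: "edges Q = insert {last ys, hd ys} (path_edges ys)"
    using cycle_edges_rotate[OF ne n_def, of "Suc k"] cycle_edges_conv_path[of ys n] ys xs
    unfolding n_def ys_def by simp
  have *: "\<exists>ps. zs = hd zs # ps @ [last zs]" if "length zs = n" for zs :: "'a list"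
  proof -
    from that xs(1) have "zs \<noteq> []" by (auto simp: n_def)
    then obtain z zs' where z: "zs = z # zs'" by (cases zs) auto
    hence "zs' \<noteq> []" using that xs(1) by (auto simp: n_def)
    hence "zs' = butlast zs' @ [last zs']" by simp
    thus ?thesis using z \<open>zs' \<noteq> []\<close> by (intro exI[of _ "butlast zs'"]) simp
  qed
  consider "a = hd ys" "b = last ys" | "a = last ys" "b = hd ys"
    using k hd lst by (metis doubleton_eq_iff)
  thus ?thesis
  proof cases
    case 1
    obtain ps where "ys = a # ps @ [b]" using *[OF ys(1)] 1 by auto
    thus ?thesis using ys xs E by (intro exI[of _ ps]) (auto simp: insert_commute)
  next
    case 2
    have "hd (rev ys) = a" "last (rev ys) = b" using yne 2 by (simp_all add: hd_rev last_rev)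
    then obtain ps where ps: "rev ys = a # ps @ [b]" using *[of "rev ys"] ys(1) by auto
    have "distinct (a # ps @ [b])" using ps ys(2) by (metis distinct_rev)
    moreover have "verts Q = set (a # ps @ [b])" using ps ys(3) xs(3) by (metis set_rev)
    moreover have "edges Q = insert {a, b} (path_edges (a # ps @ [b]))"
      using E path_edges_rev[of ys] unfolding ps 2[symmetric] by simp
    ultimately show ?thesis by blast
  qed
qed

lemma in_path_edges_subset: "e \<in> path_edges xs \<Longrightarrow> e \<subseteq> set xs"
  unfolding path_edges_def by force

section \<open>Odd-ballooning as a system of paths\<close>

text \<open>The paths \<^term>\<open>ps a b\<close> are the new vertices of the cycle replacing the edge
  \<^term>\<open>{a, b}\<close>, listed along the cycle from \<^term>\<open>a\<close> to \<^term>\<open>b\<close>.\<close>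

locale balloon =
  fixes A B :: "'a set" and ps :: "'a \<Rightarrow> 'a \<Rightarrow> 'a list" and F :: "'a graph"
  assumes finA: "finite A" and finB: "finite B" and AB: "A \<inter> B = {}"
    and odd_ps: "\<And>a b. a \<in> A \<Longrightarrow> b \<in> B \<Longrightarrow> odd (length (ps a b))"
    and len_ps: "\<And>a b. a \<in> A \<Longrightarrow> b \<in> B \<Longrightarrow> 3 \<le> length (ps a b)"
    and dist_ps: "\<And>a b. a \<in> A \<Longrightarrow> b \<in> B \<Longrightarrow> distinct (ps a b)"
    and ps_AB: "\<And>a b. a \<in> A \<Longrightarrow> b \<in> B \<Longrightarrow> set (ps a b) \<inter> (A \<union> B) = {}"
    and ps_disj: "\<And>a b a' b'. a \<in> A \<Longrightarrow> b \<in> B \<Longrightarrow> a' \<in> A \<Longrightarrow> b' \<in> B \<Longrightarrow> (a, b) \<noteq> (a', b') \<Longrightarrow>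
        set (ps a b) \<inter> set (ps a' b') = {}"
    and verts_F: "verts F = A \<union> B \<union> (\<Union>a\<in>A. \<Union>b\<in>B. set (ps a b))"
    and edges_F: "edges F = (\<Union>a\<in>A. \<Union>b\<in>B. insert {a, b} (path_edges (a # ps a b @ [b])))"

text \<open>Since the classes are disjoint, an edge determines its end in \<open>A\<close> and its
  end in \<open>B\<close>, so cycles can be indexed by ordered pairs. Besides these two ends, an odd
  cycle of length at least 5 has an odd number, at least 3, of new vertices.\<close>

lemma odd_ballooning_imp_balloon:
  assumes K: "is_complete_bipartite s t K" and ob: "odd_ballooning K C F"
    and len: "\<forall>e\<in>edges K. 5 \<le> card (verts (C e))" and st: "1 \<le> s" "1 \<le> t"
  shows "\<exists>A B ps. balloon A B ps F \<and> card A = s \<and> card B = t"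
proof -
  obtain A B where AB: "finite A" "finite B" "A \<inter> B = {}" "card A = s" "card B = t"
    "K = complete_bipartite A B" using K unfolding is_complete_bipartite_def by blast
  have vK: "verts K = A \<union> B" and eK: "edges K = {{a, b} | a b. a \<in> A \<and> b \<in> B}"
    using AB by (auto simp: complete_bipartite_def)
  note ob' = ob[unfolded odd_ballooning_def]
  have inK: "{a, b} \<in> edges K" if "a \<in> A" "b \<in> B" for a b
    using that unfolding eK by blast
  have ob1: "is_cycle (C {a, b}) \<and> odd (card (verts (C {a, b}))) \<and> {a, b} \<in> edges (C {a, b}) \<and>
    verts (C {a, b}) \<inter> (A \<union> B) = {a, b}" if "a \<in> A" "b \<in> B" for a b
    using bspec[OF conjunct1[OF ob'] inK[OF that]] unfolding vK .
  have ob2: "(verts (C {a, b}) - (A \<union> B)) \<inter> (verts (C {a', b'}) - (A \<union> B)) = {}"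
    if "a \<in> A" "b \<in> B" "a' \<in> A" "b' \<in> B" "(a, b) \<noteq> (a', b')" for a b a' b'
  proof -
    have "{a, b} \<noteq> {a', b'}" using that AB(3) by (auto simp: doubleton_eq_iff)
    from disjoint_family_onD[OF conjunct1[OF conjunct2[OF ob']] inK[OF that(1,2)] inK[OF that(3,4)] this]
    show ?thesis unfolding vK .
  qed
  have ob3: "F = (A \<union> B \<union> (\<Union>e\<in>edges K. verts (C e)), \<Union>e\<in>edges K. edges (C e))"
    using conjunct2[OF conjunct2[OF ob']] unfolding vK .
  define ps where "ps a b = (SOME ps. distinct (a # ps @ [b]) \<and>
    verts (C {a, b}) = set (a # ps @ [b]) \<and>
    edges (C {a, b}) = insert {a, b} (path_edges (a # ps @ [b])))" for a b
  have ps: "distinct (a # ps a b @ [b]) \<and> verts (C {a, b}) = set (a # ps a b @ [b]) \<and>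
      edges (C {a, b}) = insert {a, b} (path_edges (a # ps a b @ [b]))" if "a \<in> A" "b \<in> B" for a b
    unfolding ps_def by (rule someI_ex, rule cycle_unroll) (use ob1[OF that] in blast)+
  have card_ps: "card (verts (C {a, b})) = length (ps a b) + 2" if "a \<in> A" "b \<in> B" for a b
    using ps[OF that] distinct_card[of "a # ps a b @ [b]"] by simp
  have set_ps: "set (ps a b) = verts (C {a, b}) - (A \<union> B)" if "a \<in> A" "b \<in> B" for a b
    using ps[OF that] ob1[OF that] by auto
  have uK: "(\<Union>e\<in>edges K. f e) = (\<Union>a\<in>A. \<Union>b\<in>B. f {a, b})" for f :: "'a set \<Rightarrow> 'b set"
    unfolding eK by auto
  have "balloon A B ps F"
  proof
    fix a b assume ab: "a \<in> A" "b \<in> B"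
    show "odd (length (ps a b))" using ob1[OF ab] card_ps[OF ab] by simp
    have "{a, b} \<in> edges K" using ab eK by blast
    hence "5 \<le> card (verts (C {a, b}))" using len by blast
    thus "3 \<le> length (ps a b)" using card_ps[OF ab] by simp
    show "distinct (ps a b)" using ps[OF ab] by simp
    show "set (ps a b) \<inter> (A \<union> B) = {}" using set_ps[OF ab] by blast
  next
    fix a b a' b' assume "a \<in> A" "b \<in> B" "a' \<in> A" "b' \<in> B" "(a, b) \<noteq> (a', b')"
    thus "set (ps a b) \<inter> set (ps a' b') = {}" using ob2[of a b a' b'] set_ps by simp
  next
    have "(\<Union>a\<in>A. \<Union>b\<in>B. verts (C {a, b})) \<union> (A \<union> B) = A \<union> B \<union> (\<Union>a\<in>A. \<Union>b\<in>B. set (ps a b))"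
      using set_ps by blast
    thus "verts F = A \<union> B \<union> (\<Union>a\<in>A. \<Union>b\<in>B. set (ps a b))" unfolding ob3 uK by auto
    have "(\<Union>a\<in>A. \<Union>b\<in>B. edges (C {a, b})) =
        (\<Union>a\<in>A. \<Union>b\<in>B. insert {a, b} (path_edges (a # ps a b @ [b])))"
      using ps by (intro SUP_cong refl) simp
    thus "edges F = (\<Union>a\<in>A. \<Union>b\<in>B. insert {a, b} (path_edges (a # ps a b @ [b])))"
      unfolding ob3 uK by simp
  qed (use AB in auto)
  thus ?thesis using AB by blast
qed

text \<open>The set \<^term>\<open>R\<close> holds the vertices reserved for the path between \<^term>\<open>x\<close> and
  \<^term>\<open>y\<close>; the other paths have to avoid it.\<close>

definition linked :: "'b graph \<Rightarrow> nat \<Rightarrow> 'b \<Rightarrow> 'b \<Rightarrow> 'b set \<Rightarrow> bool" where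
  "linked G q x y R \<longleftrightarrow> (\<forall>Z l. finite Z \<and> card Z + l \<le> q \<and> Z \<inter> R = {} \<and> odd l \<and> 3 \<le> l \<longrightarrow>
     (\<exists>qs. length qs = l \<and> distinct qs \<and> set qs \<inter> Z = {} \<and> set qs \<subseteq> verts G \<and>
        successively (adj G) (x # qs @ [y])))"

context balloon
begin

text \<open>A budget for greedy routing: the two sides, all path vertices, and two reserved vertices
  for every pair. What is forbidden at any moment together with the path to be placed next never
  exceeds it.\<close>

definition qF :: nat where
  "qF = card A + card B + (\<Sum>p\<in>A \<times> B. length (ps (fst p) (snd p)) + 2)"

lemma embeds_if_paths:
  fixes G :: "'b graph"
  assumes f: "inj_on f (A \<union> B)" "f ` (A \<union> B) \<subseteq> verts G"
    and adj: "\<And>a b. a \<in> A \<Longrightarrow> b \<in> B \<Longrightarrow> adj G (f a) (f b)"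
    and qs: "\<And>a b. a \<in> A \<Longrightarrow> b \<in> B \<Longrightarrow> length (qs a b) = length (ps a b) \<and> distinct (qs a b) \<and>
        set (qs a b) \<subseteq> verts G - f ` (A \<union> B) \<and> successively (adj G) (f a # qs a b @ [f b])"
    and qdisj: "\<And>a b a' b'. a \<in> A \<Longrightarrow> b \<in> B \<Longrightarrow> a' \<in> A \<Longrightarrow> b' \<in> B \<Longrightarrow> (a, b) \<noteq> (a', b') \<Longrightarrow>
        set (qs a b) \<inter> set (qs a' b') = {}"
  shows "embeds F G"
proof -
  \<comment> \<open>A new vertex is found again through the pair whose path contains it and through
    its position there. Both are unique because the paths are disjoint and repetition-free.\<close>
  define pr where "pr v = (SOME p. fst p \<in> A \<and> snd p \<in> B \<and> v \<in> set (ps (fst p) (snd p)))" for v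
  define ix where "ix v = (SOME i. i < length (ps (fst (pr v)) (snd (pr v))) \<and>
      ps (fst (pr v)) (snd (pr v)) ! i = v)" for v
  define g where "g v = (if v \<in> A \<union> B then f v else qs (fst (pr v)) (snd (pr v)) ! ix v)" for v
  have pr: "pr v = (a, b)" if "a \<in> A" "b \<in> B" "v \<in> set (ps a b)" for v a b
  proof -
    have "fst (pr v) \<in> A \<and> snd (pr v) \<in> B \<and> v \<in> set (ps (fst (pr v)) (snd (pr v)))"
      unfolding pr_def by (rule someI[of _ "(a, b)"]) (use that in simp)
    thus ?thesis using ps_disj[OF that(1,2), of "fst (pr v)" "snd (pr v)"] that by fastforce
  qed
  have g_ps: "g (ps a b ! i) = qs a b ! i" if "a \<in> A" "b \<in> B" "i < length (ps a b)" for a b i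
  proof -
    have v: "ps a b ! i \<in> set (ps a b)" using that by simp
    have 1: "pr (ps a b ! i) = (a, b)" using pr[OF that(1,2) v] .
    have "ix (ps a b ! i) < length (ps a b) \<and> ps a b ! ix (ps a b ! i) = ps a b ! i"
      unfolding ix_def 1 fst_conv snd_conv by (rule someI[of _ i]) (use that in simp)
    hence "ix (ps a b ! i) = i" using dist_ps[OF that(1,2)] that(3) by (metis nth_eq_iff_index_eq)
    thus ?thesis using 1 ps_AB[OF that(1,2)] v by (auto simp: g_def)
  qed
  have g_map: "map g (ps a b) = qs a b" if "a \<in> A" "b \<in> B" for a b
    by (rule nth_equalityI) (use qs[OF that] g_ps[OF that] in auto)
  have g_f: "g v = f v" if "v \<in> A \<union> B" for v using that by (simp add: g_def)
  have g_set: "g ` set (ps a b) = set (qs a b)" if "a \<in> A" "b \<in> B" for a b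
    using g_map[OF that] by (metis set_map)
  have inj_ps: "inj_on g (set (ps a b))" if "a \<in> A" "b \<in> B" for a b
    using qs[OF that] g_map[OF that] by (metis distinct_map)
  have "inj_on g (verts F)"
  proof (rule inj_onI)
    fix u v assume uv: "u \<in> verts F" "v \<in> verts F" "g u = g v"
    have new: "g w \<notin> f ` (A \<union> B)" if "a \<in> A" "b \<in> B" "w \<in> set (ps a b)" for w a b
      using qs[OF that(1,2)] g_set[OF that(1,2)] that(3) by blast
    have cs: "w \<in> A \<union> B \<or> (\<exists>a b. a \<in> A \<and> b \<in> B \<and> w \<in> set (ps a b))" if "w \<in> verts F" for w
      using that unfolding verts_F by blast
    show "u = v"
    proof (cases "u \<in> A \<union> B")
      case True
      hence "g v \<in> f ` (A \<union> B)" using uv g_f by (metis image_eqI)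
      hence "v \<in> A \<union> B" using cs[OF uv(2)] new by blast
      thus ?thesis using True uv f(1) g_f by (metis inj_onD)
    next
      case False
      then obtain a b where ab: "a \<in> A" "b \<in> B" "u \<in> set (ps a b)" using cs[OF uv(1)] by blast
      have "v \<notin> A \<union> B" using new[OF ab] uv(3) g_f by (metis image_eqI)
      then obtain a' b' where ab': "a' \<in> A" "b' \<in> B" "v \<in> set (ps a' b')" using cs[OF uv(2)] by blast
      have "g u \<in> set (qs a b)" using g_set[OF ab(1,2)] ab(3) by blast
      moreover have "g u \<in> set (qs a' b')" using g_set[OF ab'(1,2)] ab'(3) uv(3) by auto
      ultimately have "(a, b) = (a', b')" using qdisj[OF ab(1,2) ab'(1,2)] by blast
      thus ?thesis using inj_ps[OF ab(1,2)] ab ab' uv(3) by (auto dest: inj_onD)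
    qed
  qed
  moreover have "g ` verts F \<subseteq> verts G"
  proof -
    have "g ` (A \<union> B) \<subseteq> verts G" using f(2) g_f by (metis image_cong)
    moreover have "g ` set (ps a b) \<subseteq> verts G" if "a \<in> A" "b \<in> B" for a b
      using g_set[OF that] qs[OF that] by blast
    ultimately show ?thesis unfolding verts_F by blast
  qed
  moreover have "g ` e \<in> edges G" if eF: "e \<in> edges F" for e
  proof -
    obtain a b where ab: "a \<in> A" "b \<in> B" "e \<in> insert {a, b} (path_edges (a # ps a b @ [b]))"
      using eF unfolding edges_F by blast
    have gab: "g a = f a" "g b = f b" using ab g_f by auto
    have "map g (a # ps a b @ [b]) = f a # qs a b @ [f b]" using gab g_map[OF ab(1,2)] by simp
    hence "path_edges (map g (a # ps a b @ [b])) \<subseteq> edges G"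
      using qs[OF ab(1,2)] path_edges_subset_iff by metis
    hence "(\<lambda>e. g ` e) ` path_edges (a # ps a b @ [b]) \<subseteq> edges G" by (simp only: path_edges_map)
    thus ?thesis using ab(3) adj[OF ab(1,2)] gab by (auto simp: adj_def)
  qed
  ultimately show ?thesis unfolding embeds_def by blast
qed

text \<open>The paths are chosen one pair at a time. Linkedness tolerates every forbidden set within
  the budget that avoids the pair's own reserve, so only the forbidden set has to be
  controlled.\<close>

lemma embeds_if_linked:
  fixes G :: "'b graph"
  assumes fin: "finite A'" "finite B'" and V: "A' \<subseteq> verts G" "B' \<subseteq> verts G"
    and card: "card A' = card A" "card B' = card B" and disj: "A' \<inter> B' = {}"
    and adj: "\<And>x y. x \<in> A' \<Longrightarrow> y \<in> B' \<Longrightarrow> adj G x y"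
    and R: "\<And>x y. x \<in> A' \<Longrightarrow> y \<in> B' \<Longrightarrow> finite (R x y) \<and> card (R x y) \<le> 2 \<and> R x y \<inter> (A' \<union> B') = {}"
    and Rdisj: "\<And>x y x' y'. x \<in> A' \<Longrightarrow> y \<in> B' \<Longrightarrow> x' \<in> A' \<Longrightarrow> y' \<in> B' \<Longrightarrow> (x, y) \<noteq> (x', y') \<Longrightarrow>
        R x y \<inter> R x' y' = {}"
    and lnk: "\<And>x y. x \<in> A' \<Longrightarrow> y \<in> B' \<Longrightarrow> linked G q x y (R x y)" and q: "qF \<le> q"
  shows "embeds F G"
proof -
  obtain fA where fA: "bij_betw fA A A'" using finA fin card by (metis finite_same_card_bij)
  obtain fB where fB: "bij_betw fB B B'" using finB fin card by (metis finite_same_card_bij)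
  define f where "f v = (if v \<in> A then fA v else fB v)" for v
  have fa: "f v \<in> A'" if "v \<in> A" for v using that fA by (auto simp: f_def bij_betw_def)
  have fb: "f v \<in> B'" if "v \<in> B" for v using that fB AB by (auto simp: f_def bij_betw_def)
  have injf: "inj_on f (A \<union> B)"
  proof (rule inj_onI)
    fix u v assume uv: "u \<in> A \<union> B" "v \<in> A \<union> B" "f u = f v"
    have "u \<in> A \<longleftrightarrow> v \<in> A" using uv fa fb disj AB by (metis IntI UnE empty_iff)
    thus "u = v" using uv fA fB AB unfolding f_def bij_betw_def inj_on_def
      by (metis UnE)
  qed
  have imf: "f ` (A \<union> B) \<subseteq> A' \<union> B'" using fa fb by auto
  define RR where "RR p = R (f (fst p)) (f (snd p))" for p
  have finRR: "finite (RR p) \<and> card (RR p) \<le> 2 \<and> RR p \<inter> (A' \<union> B') = {}" if "p \<in> A \<times> B" for p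
    using that R fa fb unfolding RR_def by (cases p) auto
  have RRd: "RR p \<inter> RR p' = {}" if "p \<in> A \<times> B" "p' \<in> A \<times> B" "p \<noteq> p'" for p p'
  proof -
    have "(f (fst p), f (snd p)) \<noteq> (f (fst p'), f (snd p'))"
      using that injf by (cases p; cases p') (auto dest: inj_onD)
    thus ?thesis using that Rdisj fa fb unfolding RR_def by (cases p; cases p') auto
  qed
  \<comment> \<open>A chosen path avoids the reserves of all other pairs, including those not yet
    treated; otherwise an early path could destroy a gadget needed later.\<close>
  define good where "good P Q \<longleftrightarrow> (\<forall>p\<in>P. length (Q p) = length (ps (fst p) (snd p)) \<and> distinct (Q p) \<and>
        set (Q p) \<subseteq> verts G - (A' \<union> B') \<and>
        successively (adj G) (f (fst p) # Q p @ [f (snd p)]) \<and>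
        (\<forall>p'\<in>A\<times>B. p' \<noteq> p \<longrightarrow> set (Q p) \<inter> RR p' = {}) \<and>
        (\<forall>p'\<in>P. p' \<noteq> p \<longrightarrow> set (Q p) \<inter> set (Q p') = {}))" for P Q
  have "finite P \<Longrightarrow> P \<subseteq> A \<times> B \<Longrightarrow> \<exists>Q. good P Q" for P
  proof (induction P rule: finite_induct)
    case empty
    show ?case by (simp add: good_def)
  next
    case (insert p P)
    then obtain Q where Q: "good P Q" by auto
    define l where "l = length (ps (fst p) (snd p))"
    define Z where "Z = A' \<union> B' \<union> (\<Union>p'\<in>P. set (Q p')) \<union> (\<Union>p'\<in>A\<times>B - {p}. RR p')"
    have pAB: "p \<in> A \<times> B" "fst p \<in> A" "snd p \<in> B" using insert by auto
    have finZ: "finite Z" unfolding Z_def using fin insert finRR finA finB by auto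
    have "card Z + l \<le> qF"
    proof -
      have "card Z \<le> (card A' + card B') + card (\<Union>p'\<in>P. set (Q p')) + card (\<Union>p'\<in>A\<times>B - {p}. RR p')"
        unfolding Z_def by (meson add_mono card_Un_le order_trans order_refl)
      moreover have "card (\<Union>p'\<in>P. set (Q p')) \<le> (\<Sum>p'\<in>P. length (ps (fst p') (snd p')))"
      proof -
        have "card (\<Union>p'\<in>P. set (Q p')) \<le> (\<Sum>p'\<in>P. card (set (Q p')))" using insert card_UN_le by blast
        also have "\<dots> \<le> (\<Sum>p'\<in>P. length (ps (fst p') (snd p')))"
          by (rule sum_mono) (use Q in \<open>auto simp: good_def intro: order_trans[OF card_length]\<close>)
        finally show ?thesis .
      qed
      moreover have "card (\<Union>p'\<in>A\<times>B - {p}. RR p') \<le> (\<Sum>p'\<in>A\<times>B. 2)"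
      proof -
        have "card (\<Union>p'\<in>A\<times>B - {p}. RR p') \<le> (\<Sum>p'\<in>A\<times>B-{p}. card (RR p'))"
          using finA finB by (intro card_UN_le) auto
        also have "\<dots> \<le> (\<Sum>p'\<in>A\<times>B-{p}. 2)" by (rule sum_mono) (use finRR in auto)
        also have "\<dots> \<le> (\<Sum>p'\<in>A\<times>B. 2)" using finA finB by (intro sum_mono2) auto
        finally show ?thesis .
      qed
      moreover have "(\<Sum>p'\<in>P. length (ps (fst p') (snd p'))) + l \<le> (\<Sum>p'\<in>A\<times>B. length (ps (fst p') (snd p')))"
      proof -
        have "(\<Sum>p'\<in>P. length (ps (fst p') (snd p'))) + l = (\<Sum>p'\<in>insert p P. length (ps (fst p') (snd p')))"
          using insert by (simp add: l_def)
        also have "\<dots> \<le> (\<Sum>p'\<in>A\<times>B. length (ps (fst p') (snd p')))"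
          using finA finB insert by (intro sum_mono2) auto
        finally show ?thesis .
      qed
      ultimately show ?thesis unfolding qF_def sum.distrib using card by linarith
    qed
    hence cz: "card Z + l \<le> q" using q by simp
    have "Z \<inter> RR p = {}"
    proof -
      have "set (Q p') \<inter> RR p = {}" if "p' \<in> P" for p'
      proof -
        have "p \<noteq> p'" using that insert(2) by auto
        thus ?thesis using Q that pAB(1) unfolding good_def by blast
      qed
      moreover have "RR p' \<inter> RR p = {}" if "p' \<in> A \<times> B - {p}" for p' using RRd[of p' p] that pAB by auto
      ultimately show ?thesis unfolding Z_def using finRR[OF pAB(1)] by blast
    qed
    moreover have "odd l" "3 \<le> l" using pAB odd_ps len_ps by (auto simp: l_def)
    moreover have "linked G q (f (fst p)) (f (snd p)) (RR p)"
      unfolding RR_def using lnk fa fb pAB by auto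
    ultimately obtain qs where qs: "length qs = l" "distinct qs" "set qs \<inter> Z = {}" "set qs \<subseteq> verts G"
      "successively (adj G) (f (fst p) # qs @ [f (snd p)])"
      using cz finZ unfolding linked_def by blast
    have "good (insert p P) (Q(p := qs))"
    proof -
      have 1: "set qs \<inter> (A' \<union> B') = {}" "\<And>p'. p' \<in> A \<times> B \<Longrightarrow> p' \<noteq> p \<Longrightarrow> set qs \<inter> RR p' = {}"
        "\<And>p'. p' \<in> P \<Longrightarrow> set qs \<inter> set (Q p') = {}"
        using qs(3) unfolding Z_def by blast+
      show ?thesis unfolding good_def
      proof
        fix p1 assume p1: "p1 \<in> insert p P"
        show "length ((Q(p := qs)) p1) = length (ps (fst p1) (snd p1)) \<and> distinct ((Q(p := qs)) p1) \<and>
          set ((Q(p := qs)) p1) \<subseteq> verts G - (A' \<union> B') \<and>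
          successively (adj G) (f (fst p1) # (Q(p := qs)) p1 @ [f (snd p1)]) \<and>
          (\<forall>p'\<in>A\<times>B. p' \<noteq> p1 \<longrightarrow> set ((Q(p := qs)) p1) \<inter> RR p' = {}) \<and>
          (\<forall>p'\<in>insert p P. p' \<noteq> p1 \<longrightarrow> set ((Q(p := qs)) p1) \<inter> set ((Q(p := qs)) p') = {})"
        proof (cases "p1 = p")
          case True
          have "\<forall>p'\<in>insert p P. p' \<noteq> p \<longrightarrow> set qs \<inter> set ((Q(p := qs)) p') = {}" using 1(3) by auto
          thus ?thesis using True 1 qs by (auto simp: l_def)
        next
          case False
          hence p1P: "p1 \<in> P" using p1 by simp
          have "\<forall>p'\<in>insert p P. p' \<noteq> p1 \<longrightarrow> set (Q p1) \<inter> set ((Q(p := qs)) p') = {}"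
            using Q p1P 1(3) unfolding good_def by (auto simp: Int_commute)
          thus ?thesis using False Q p1P unfolding good_def by simp
        qed
      qed
    qed
    thus ?case by blast
  qed
  from this[of "A \<times> B"] obtain Q where Q: "good (A \<times> B) Q" using finA finB by auto
  show ?thesis
  proof (rule embeds_if_paths[where f = f and qs = "\<lambda>a b. Q (a, b)"])
    show "f ` (A \<union> B) \<subseteq> verts G" using imf V by blast
    fix a b assume ab: "a \<in> A" "b \<in> B"
    thus "adj G (f a) (f b)" using adj fa fb by simp
    show "length (Q (a, b)) = length (ps a b) \<and> distinct (Q (a, b)) \<and>
        set (Q (a, b)) \<subseteq> verts G - f ` (A \<union> B) \<and>
        successively (adj G) (f a # Q (a, b) @ [f b])"
      using Q ab imf unfolding good_def by fastforce
  next
    fix a b a' b' assume *: "a \<in> A" "b \<in> B" "a' \<in> A" "b' \<in> B" "(a, b) \<noteq> (a', b')"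
    hence m: "(a, b) \<in> A \<times> B" "(a', b') \<in> A \<times> B" "(a', b') \<noteq> (a, b)" by auto
    from bspec[OF Q[unfolded good_def] m(1)]
    have "\<forall>p'\<in>A\<times>B. p' \<noteq> (a, b) \<longrightarrow> set (Q (a, b)) \<inter> set (Q p') = {}" by blast
    thus "set (Q (a, b)) \<inter> set (Q (a', b')) = {}" using m by blast
  qed (rule injf)
qed

end

section \<open>Hubs and gadgets\<close>

text \<open>Nothing is required about where the common neighbours lie. Thus a class of a nearly
  bipartite graph and a part of a complete tripartite graph both qualify.\<close>

definition hub :: "'b graph \<Rightarrow> nat \<Rightarrow> 'b set \<Rightarrow> bool" where
  "hub G q Y \<longleftrightarrow> finite Y \<and> Y \<subseteq> verts G \<and> q \<le> card Y \<and>
     (\<forall>y\<in>Y. \<forall>y'\<in>Y. y \<noteq> y' \<longrightarrow> q \<le> card (nbrs G y \<inter> nbrs G y'))"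

lemma ex_avoiding: "finite Z \<Longrightarrow> card Z < card S \<Longrightarrow> \<exists>x\<in>S. x \<notin> Z"
  by (meson card_mono linorder_not_less subsetI)

lemma nbrs_simps: "u \<in> nbrs G v \<longleftrightarrow> u \<in> verts G \<and> adj G v u"
  by (auto simp: nbrs_def)

lemma finite_nbrs: "simple_graph G \<Longrightarrow> finite (nbrs G v)"
  by (auto simp: nbrs_def simple_graph_def)

text \<open>Induction in steps of two: a fresh hub vertex \<open>y1\<close> and a fresh common
  neighbour of \<open>y\<close> and \<open>y1\<close> are put in front, until one common neighbour
  closes the path. Each step moves two vertices from \<open>l\<close> to \<open>Z\<close>, so the
  budget \<open>card Z + l\<close> does not grow.\<close>

lemma hub_path:
  assumes G: "simple_graph G" and hub: "hub G q Y"
  shows "odd l \<Longrightarrow> y \<in> Y \<Longrightarrow> y' \<in> Y \<Longrightarrow> y \<noteq> y' \<Longrightarrow> finite Z \<Longrightarrow> card Z + l \<le> q \<Longrightarrow>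
    \<exists>qs. length qs = l \<and> distinct qs \<and> set qs \<inter> Z = {} \<and> set qs \<subseteq> verts G \<and>
      successively (adj G) (y # qs @ [y'])"
proof (induction l arbitrary: y Z rule: less_induct)
  case (less l)
  show ?case
  proof (cases "l = 1")
    case True
    have "card Z < card (nbrs G y \<inter> nbrs G y')" using less.prems hub True unfolding hub_def by fastforce
    then obtain z where "z \<in> nbrs G y \<inter> nbrs G y'" "z \<notin> Z" using ex_avoiding less.prems by blast
    thus ?thesis using True by (intro exI[of _ "[z]"]) (auto simp: nbrs_simps adj_commute)
  next
    case False
    have "l \<noteq> 2" "l \<noteq> 0" using less.prems(1) by (auto intro!: Nat.gr0I)
    hence l3: "l \<ge> 3" using False by linarith
    define l' where "l' = l - 2"
    have l': "l = l' + 2" "odd l'" "l' < l" using l3 less.prems(1) by (auto simp: l'_def)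
    have "card (insert y (insert y' Z)) \<le> card Z + 2" by (simp add: card_insert_if less.prems(5))
    also have "\<dots> < card Y" using hub less.prems(6) l3 by (simp add: hub_def)
    finally obtain y1 where y1: "y1 \<in> Y" "y1 \<notin> Z" "y1 \<noteq> y" "y1 \<noteq> y'"
      using ex_avoiding[of "insert y (insert y' Z)" Y] less.prems(5) by auto
    have "card (insert y1 Z) \<le> card Z + 1" by (simp add: card_insert_if less.prems(5))
    also have "\<dots> < card (nbrs G y \<inter> nbrs G y1)"
      using hub less.prems(2,6) y1 l3 unfolding hub_def by fastforce
    finally obtain z where z: "z \<in> nbrs G y \<inter> nbrs G y1" "z \<notin> Z" "z \<noteq> y1"
      using ex_avoiding[of "insert y1 Z"] less.prems(5) by auto
    define Z' where "Z' = insert y1 (insert z Z)"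
    have "card Z' \<le> card Z + 2" by (simp add: Z'_def card_insert_if less.prems(5))
    hence "card Z' + l' \<le> q" using less.prems(6) l' by simp
    then obtain qs where qs: "length qs = l'" "distinct qs" "set qs \<inter> Z' = {}" "set qs \<subseteq> verts G"
      "successively (adj G) (y1 # qs @ [y'])"
      using less.IH[OF l'(3,2) y1(1) less.prems(3) y1(4), of Z'] less.prems(5) unfolding Z'_def by auto
    have "successively (adj G) (y # (z # y1 # qs) @ [y'])"
      using qs(5) z by (auto simp: nbrs_simps adj_commute)
    moreover have "y1 \<in> verts G" "z \<in> verts G" using y1 z hub by (auto simp: hub_def nbrs_simps)
    ultimately show ?thesis using qs z y1 l'
      by (intro exI[of _ "z # y1 # qs"]) (auto simp: Z'_def)
  qed
qed

text \<open>Entering and leaving the hub costs two of the \<open>l\<close> inner vertices and keeps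
  the parity. Here \<open>3 \<le> l\<close>, that is cycle length at least 5, is essential: for
  \<open>l = 1\<close> the ends themselves would need a common neighbour.\<close>

lemma linked_via_hub:
  assumes G: "simple_graph G" and hub: "hub G q Y"
    and x: "q \<le> card (nbrs G x \<inter> Y)" and x': "q \<le> card (nbrs G x' \<inter> Y)"
  shows "linked G q x x' {}"
  unfolding linked_def
proof (intro allI impI, elim conjE)
  fix Z :: "'a set" and l :: nat
  assume a: "finite Z" "card Z + l \<le> q" "odd l" "3 \<le> l"
  obtain y where y: "y \<in> nbrs G x \<inter> Y" "y \<notin> Z" using ex_avoiding[of Z "nbrs G x \<inter> Y"] a x by auto
  have "card (insert y Z) \<le> card Z + 1" by (simp add: card_insert_if a(1))
  hence "card (insert y Z) < card (nbrs G x' \<inter> Y)" using a x' by linarith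
  then obtain y' where y': "y' \<in> nbrs G x' \<inter> Y" "y' \<notin> Z" "y' \<noteq> y"
    using ex_avoiding[of "insert y Z"] a(1) by auto
  define Z' where "Z' = insert y (insert y' Z)"
  have "l \<noteq> 4" using a by auto
  have "card Z' \<le> card Z + 2" by (simp add: Z'_def card_insert_if a(1))
  hence "card Z' + (l - 2) \<le> q" using a by linarith
  moreover have "odd (l - 2)" using a by auto
  ultimately obtain qs where qs: "length qs = l - 2" "distinct qs" "set qs \<inter> Z' = {}"
     "set qs \<subseteq> verts G" "successively (adj G) (y # qs @ [y'])"
    using hub_path[OF G hub, of "l - 2" y y' Z'] y y' a(1) unfolding Z'_def by auto
  have "successively (adj G) (x # (y # qs @ [y']) @ [x'])"
  proof -
    have "adj G x y" "adj G y' x'" using y y' by (auto simp: nbrs_simps adj_commute)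
    thus ?thesis using qs(5) successively_append_iff[of "adj G" "y # qs @ [y']" "[x']"]
      by auto
  qed
  moreover have "y \<in> verts G" "y' \<in> verts G" using y y' by (auto simp: nbrs_simps)
  ultimately show "\<exists>qs. length qs = l \<and> distinct qs \<and> set qs \<inter> Z = {} \<and> set qs \<subseteq> verts G \<and>
        successively (adj G) (x # qs @ [x'])"
    using qs y y' a by (intro exI[of _ "y # qs @ [y']"]) (auto simp: Z'_def)
qed

lemma linked_mono: "linked G q x y {} \<Longrightarrow> linked G q x y R"
  unfolding linked_def by blast

text \<open>A gadget at \<^term>\<open>a \<in> X\<close> supplies the one edge inside \<^term>\<open>X\<close> or inside \<^term>\<open>Y\<close> which an
  even path from \<^term>\<open>a\<close> to the other class needs: a neighbour \<^term>\<open>p = p'\<close> of \<^term>\<open>a\<close> in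
  \<^term>\<open>X\<close>, or an edge \<^term>\<open>{p, p'}\<close> disjoint from \<^term>\<open>a\<close>.\<close>

definition gadget :: "'b graph \<Rightarrow> 'b set \<Rightarrow> 'b set \<Rightarrow> 'b \<Rightarrow> 'b \<times> 'b \<Rightarrow> bool" where
  "gadget G X Y a g \<longleftrightarrow> a \<noteq> fst g \<and> a \<noteq> snd g \<and>
     ((fst g = snd g \<and> fst g \<in> X \<and> adj G a (fst g)) \<or>
      (adj G (fst g) (snd g) \<and> fst g \<in> X \<and> snd g \<in> X) \<or>
      (adj G (fst g) (snd g) \<and> fst g \<in> Y \<and> snd g \<in> Y \<and> adj G a (fst g)))"

text \<open>The hub supplies paths between vertices of one class, so the gadget must provide the
  change of class with the right parity. A leaf is used as \<open>a\<close>, \<open>p\<close>, then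
  a path inside the reach of hub \<open>Y\<close>; an edge in \<open>X\<close> is reached from
  \<open>a\<close> through hub \<open>X\<close> and left towards \<open>b\<close> by
  \<open>sb\<close>; an edge in \<open>Y\<close> is entered directly from \<open>a\<close> and left
  through hub \<open>Y\<close>.\<close>

lemma gadget_linked:
  assumes G: "simple_graph G" and hubs: "hub G q X" "hub G q Y"
    and a: "a \<in> X" and b: "b \<in> Y" "b \<noteq> fst g" "b \<noteq> snd g"
    and g: "gadget G X Y a g"
    and leaf: "fst g = snd g \<Longrightarrow> q \<le> card (nbrs G (fst g) \<inter> Y)"
    and sb: "snd g \<in> X \<Longrightarrow> fst g \<noteq> snd g \<Longrightarrow> adj G (snd g) b"
  shows "linked G q a b {fst g, snd g}"
  unfolding linked_def
proof (intro allI impI, elim conjE)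
  fix Z :: "'a set" and l :: nat
  assume A: "finite Z" "card Z + l \<le> q" "odd l" "3 \<le> l" "Z \<inter> {fst g, snd g} = {}"
  obtain p p' where gp: "g = (p, p')" by (cases g)
  have odd2: "odd (l - 2)" using A by auto
  have ne: "a \<noteq> p" "a \<noteq> p'" "b \<noteq> p" "b \<noteq> p'" "p \<notin> Z" "p' \<notin> Z" using g A b gp by (auto simp: gadget_def)
  consider (lf) "p = p'" "p \<in> X" "adj G a p" | (X) "adj G p p'" "p \<in> X" "p' \<in> X"
    | (Y) "adj G p p'" "p \<in> Y" "p' \<in> Y" "adj G a p"
    using g gp by (auto simp: gadget_def)
  thus "\<exists>qs. length qs = l \<and> distinct qs \<and> set qs \<inter> Z = {} \<and> set qs \<subseteq> verts G \<and>
        successively (adj G) (a # qs @ [b])"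
  proof cases
    case lf
    have "card (insert p (insert b Z)) \<le> card Z + 2" by (simp add: card_insert_if A(1))
    also have "\<dots> < card (nbrs G p \<inter> Y)" using leaf gp lf A by simp
    finally obtain y where y: "y \<in> nbrs G p \<inter> Y" "y \<notin> Z" "y \<noteq> p" "y \<noteq> b"
      using ex_avoiding[of "insert p (insert b Z)"] A(1) by auto
    define Z' where "Z' = insert p (insert y Z)"
    have "card Z' \<le> card Z + 2" by (simp add: Z'_def card_insert_if A(1))
    hence "card Z' + (l - 2) \<le> q" using A by linarith
    then obtain qs where qs: "length qs = l - 2" "distinct qs" "set qs \<inter> Z' = {}"
       "set qs \<subseteq> verts G" "successively (adj G) (y # qs @ [b])"
      using hub_path[OF G hubs(2) odd2, of y b Z'] y b A(1) unfolding Z'_def by auto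
    have "successively (adj G) (a # (p # y # qs) @ [b])"
      using qs(5) lf y by (auto simp: nbrs_simps)
    moreover have "y \<in> verts G" "p \<in> verts G" using y lf adj_verts[OF G] by (auto simp: nbrs_simps)
    ultimately show ?thesis using qs y ne A by (intro exI[of _ "p # y # qs"]) (auto simp: Z'_def)
  next
    case X
    have pp: "p \<noteq> p'" using adj_verts[OF G X(1)] by simp
    define Z' where "Z' = insert p (insert p' Z)"
    have "card Z' \<le> card Z + 2" by (simp add: Z'_def card_insert_if A(1))
    hence "card Z' + (l - 2) \<le> q" using A by linarith
    then obtain qs where qs: "length qs = l - 2" "distinct qs" "set qs \<inter> Z' = {}"
       "set qs \<subseteq> verts G" "successively (adj G) (a # qs @ [p])"
      using hub_path[OF G hubs(1) odd2 a X(2) ne(1), of Z'] A(1) unfolding Z'_def by auto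
    have "adj G p' b" using sb gp X pp by auto
    hence "successively (adj G) ((a # qs @ [p]) @ [p', b])"
      using qs(5) X successively_append_iff[of "adj G" "a # qs @ [p]" "[p', b]"] by auto
    moreover have "p \<in> verts G" "p' \<in> verts G" using adj_verts[OF G X(1)] by auto
    ultimately show ?thesis using qs ne A pp
      by (intro exI[of _ "qs @ [p, p']"]) (auto simp: Z'_def)
  next
    case Y
    have pp: "p \<noteq> p'" using adj_verts[OF G Y(1)] by simp
    define Z' where "Z' = insert p (insert p' Z)"
    have "card Z' \<le> card Z + 2" by (simp add: Z'_def card_insert_if A(1))
    hence "card Z' + (l - 2) \<le> q" using A by linarith
    then obtain qs where qs: "length qs = l - 2" "distinct qs" "set qs \<inter> Z' = {}"
       "set qs \<subseteq> verts G" "successively (adj G) (p' # qs @ [b])"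
      using hub_path[OF G hubs(2) odd2 Y(3) b(1), of Z'] ne A(1) unfolding Z'_def by auto
    have "successively (adj G) (a # (p # p' # qs) @ [b])" using qs(5) Y by auto
    moreover have "p \<in> verts G" "p' \<in> verts G" using adj_verts[OF G Y(1)] by auto
    ultimately show ?thesis using qs ne A pp
      by (intro exI[of _ "p # p' # qs"]) (auto simp: Z'_def)
  qed
qed

definition rich :: "'b graph \<Rightarrow> nat \<Rightarrow> nat \<Rightarrow> 'b set \<Rightarrow> 'b set \<Rightarrow> bool" where
  "rich G c Q S Y \<longleftrightarrow> (\<forall>T\<subseteq>S. finite T \<and> card T \<le> c \<longrightarrow> Q \<le> card {y \<in> Y. \<forall>v\<in>T. adj G v y})"

lemma rich_subset: "rich G c Q S Y \<Longrightarrow> S' \<subseteq> S \<Longrightarrow> c' \<le> c \<Longrightarrow> Q' \<le> Q \<Longrightarrow> rich G c' Q' S' Y"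
  unfolding rich_def by (meson order_trans)

lemma rich_sees:
  assumes "rich G c Q S Y" "1 \<le> c" "v \<in> S" "Y \<subseteq> verts G"
  shows "Q \<le> card (nbrs G v \<inter> Y)"
proof -
  have "Q \<le> card {y \<in> Y. \<forall>u\<in>{v}. adj G u y}"
    using assms(1)[unfolded rich_def, rule_format, of "{v}"] assms(2,3) by simp
  also have "{y \<in> Y. \<forall>u\<in>{v}. adj G u y} = nbrs G v \<inter> Y" using assms(4) by (auto simp: nbrs_simps)
  finally show ?thesis .
qed

lemma rich_hub:
  assumes G: "simple_graph G" and "rich G c Q X Y" "rich G c Q Y X" "2 \<le> c"
    "X \<subseteq> verts G" "Y \<subseteq> verts G"
  shows "hub G Q X"
  unfolding hub_def
proof (intro conjI ballI impI)
  show "finite X" using assms by (auto simp: simple_graph_def intro: finite_subset)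
  have "Q \<le> card {x \<in> X. \<forall>v\<in>{}. adj G v x}"
    using assms(3)[unfolded rich_def, rule_format, of "{}"] by simp
  thus "Q \<le> card X" by simp
  fix x x' assume x: "x \<in> X" "x' \<in> X" "x \<noteq> x'"
  have "Q \<le> card {y \<in> Y. \<forall>u\<in>{x, x'}. adj G u y}"
    using assms(2)[unfolded rich_def, rule_format, of "{x, x'}"] x assms(4) by simp
  also have "\<dots> \<le> card (nbrs G x \<inter> nbrs G x')"
    using assms(6) by (intro card_mono finite_Int disjI1 finite_nbrs[OF G]) (auto simp: nbrs_simps)
  finally show "Q \<le> card (nbrs G x \<inter> nbrs G x')" .
qed (use assms in simp)

context balloon
begin

text \<open>When all branch vertices see the same hub, every path has the right parity without help,
  so nothing has to be reserved.\<close>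

lemma embeds_if_hub:
  fixes G :: "'b graph"
  assumes G: "simple_graph G" and hub: "hub G q Y" and q: "qF \<le> q"
    and V: "A' \<subseteq> verts G" "B' \<subseteq> verts G"
    and card: "card A' = card A" "card B' = card B" and disj: "A' \<inter> B' = {}"
    and adj: "\<And>x y. x \<in> A' \<Longrightarrow> y \<in> B' \<Longrightarrow> adj G x y"
    and sees: "\<And>x. x \<in> A' \<union> B' \<Longrightarrow> q \<le> card (nbrs G x \<inter> Y)"
  shows "embeds F G"
proof (rule embeds_if_linked[where R = "\<lambda>_ _. {}" and q = q])
  show "finite A'" "finite B'" using V G by (auto simp: simple_graph_def intro: finite_subset)
  show "linked G q x y {}" if "x \<in> A'" "y \<in> B'" for x y
    using linked_via_hub[OF G hub] sees that by auto
qed (use assms in auto)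

text \<open>The vertices of \<open>W\<close> see both classes, so their paths to \<open>B'\<close>,
  which lies in \<open>Y\<close>, run through the hub \<open>X\<close>; only the pairs in
  \<open>A1 \<times> B'\<close> consume gadgets. Every gadget serves every vertex of
  \<open>A1\<close>, hence any bijection between these pairs and \<open>\<Gamma>\<close> will
  do.\<close>

lemma embeds_if_gadgets:
  fixes G :: "'b graph"
  assumes G: "simple_graph G" and XY: "X \<subseteq> verts G" "Y \<subseteq> verts G" "W \<subseteq> verts G"
    "X \<inter> Y = {}" "W \<inter> (X \<union> Y) = {}"
    and rX: "rich G c Q (W \<union> X) Y" and rY: "rich G c Q (W \<union> Y) X"
    and c: "card A + card A * card B \<le> c" "2 \<le> c"
    and Q: "qF \<le> Q" "2 * (card A * card B) + card B \<le> Q"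
    and A1: "A1 \<subseteq> X" "card W + card A1 = card A" and finW: "finite A1" "finite W"
    and \<Gamma>: "finite \<Gamma>" "card \<Gamma> = card A1 * card B"
    and gad: "\<And>a g. a \<in> A1 \<Longrightarrow> g \<in> \<Gamma> \<Longrightarrow> gadget G X Y a g"
    and gdisj: "\<And>g g'. g \<in> \<Gamma> \<Longrightarrow> g' \<in> \<Gamma> \<Longrightarrow> g \<noteq> g' \<Longrightarrow> {fst g, snd g} \<inter> {fst g', snd g'} = {}"
  shows "embeds F G"
proof -
  have cA1: "card A1 \<le> card A" using A1 by simp
  define V\<Gamma> where "V\<Gamma> = fst ` \<Gamma> \<union> snd ` \<Gamma>"
  have finV: "finite V\<Gamma>" using \<Gamma> by (simp add: V\<Gamma>_def)
  have "card V\<Gamma> \<le> card (fst ` \<Gamma>) + card (snd ` \<Gamma>)" unfolding V\<Gamma>_def by (rule card_Un_le)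
  also have "\<dots> \<le> card \<Gamma> + card \<Gamma>" using \<Gamma> by (intro add_mono card_image_le)
  finally have cV: "card V\<Gamma> \<le> 2 * card \<Gamma>" by simp
  have cG: "card \<Gamma> \<le> card A * card B" using \<Gamma> cA1 by simp
  have gv: "fst g \<in> V\<Gamma>" "snd g \<in> V\<Gamma>" if "g \<in> \<Gamma>" for g using that by (auto simp: V\<Gamma>_def)
  \<comment> \<open>The vertices of \<open>B'\<close> are taken from the common neighbours of this
    set: \<open>W\<close> and \<open>A1\<close> form the opposite branch side, and a gadget edge
    inside \<open>X\<close> is left through its second end.\<close>
  define T where "T = W \<union> A1 \<union> (snd ` \<Gamma> \<inter> X)"
  have "card T \<le> (card W + card A1) + card (snd ` \<Gamma> \<inter> X)"
    unfolding T_def by (meson add_mono card_Un_le order_trans order_refl)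
  also have "card (snd ` \<Gamma> \<inter> X) \<le> card (snd ` \<Gamma>)" using \<Gamma> by (intro card_mono) auto
  also have "card (snd ` \<Gamma>) \<le> card \<Gamma>" using \<Gamma> by (intro card_image_le)
  finally have cT: "card T \<le> c" using c A1 cG by linarith
  have "T \<subseteq> W \<union> X" "finite T" using A1 finW \<Gamma> by (auto simp: T_def)
  hence "Q \<le> card {y \<in> Y. \<forall>v\<in>T. adj G v y}" using rX cT unfolding rich_def by blast
  moreover have "card {y \<in> Y. \<forall>v\<in>T. adj G v y} - card V\<Gamma> \<le> card ({y \<in> Y. \<forall>v\<in>T. adj G v y} - V\<Gamma>)"
    by (rule diff_card_le_card_Diff[OF finV])
  ultimately have "card B \<le> card ({y \<in> Y. \<forall>v\<in>T. adj G v y} - V\<Gamma>)"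
    using order_trans[OF cV mult_le_mono2[OF cG]] Q(2) by linarith
  from obtain_subset_with_card_n[OF this]
  obtain B' where B': "B' \<subseteq> {y \<in> Y. \<forall>v\<in>T. adj G v y} - V\<Gamma>" "card B' = card B" "finite B'"
    by blast
  have BY: "B' \<subseteq> Y" "B' \<inter> V\<Gamma> = {}" and BT: "\<And>v b. v \<in> T \<Longrightarrow> b \<in> B' \<Longrightarrow> adj G v b" using B' by auto
  have "card (A1 \<times> B') = card \<Gamma>" using B' \<Gamma> by (simp add: card_cartesian_product)
  then obtain h where h: "bij_betw h (A1 \<times> B') \<Gamma>"
    using finite_same_card_bij[of "A1 \<times> B'" \<Gamma>] finW B' \<Gamma> by auto
  have hG: "h (a, b) \<in> \<Gamma>" if "a \<in> A1" "b \<in> B'" for a b using h that by (auto simp: bij_betw_def)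
  define R where "R x y = (if x \<in> A1 then {fst (h (x, y)), snd (h (x, y))} else {})" for x y
  have r2: "rich G 2 Q X Y" "rich G 2 Q Y X"
    using rX rY c by (auto intro: rich_subset)
  have hX: "hub G Q X" by (rule rich_hub[OF G r2 _ XY(1,2)]) simp
  have hY: "hub G Q Y" by (rule rich_hub[OF G r2(2,1) _ XY(2,1)]) simp
  have seeY: "Q \<le> card (nbrs G v \<inter> Y)" if "v \<in> W \<union> X" for v
    using rich_sees[OF rX] that c XY by auto
  have seeX: "Q \<le> card (nbrs G v \<inter> X)" if "v \<in> W \<union> Y" for v
    using rich_sees[OF rY] that c XY by auto
  show ?thesis
  proof (rule embeds_if_linked[where A' = "W \<union> A1" and B' = B' and R = R and q = Q])
    show "card (W \<union> A1) = card A" using A1 finW XY by (subst card_Un_disjoint) auto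
    show "(W \<union> A1) \<inter> B' = {}" using A1 BY XY by auto
    show "adj G x y" if "x \<in> W \<union> A1" "y \<in> B'" for x y using that BT by (auto simp: T_def)
    show "W \<union> A1 \<subseteq> verts G" "B' \<subseteq> verts G" using A1 BY XY by auto
    show "finite (R x y) \<and> card (R x y) \<le> 2 \<and> R x y \<inter> (W \<union> A1 \<union> B') = {}"
      if "x \<in> W \<union> A1" "y \<in> B'" for x y
    proof (cases "x \<in> A1")
      case True
      have g: "gadget G X Y a (h (x, y))" if "a \<in> A1" for a using gad hG[OF True \<open>y \<in> B'\<close>] that by blast
      have "{fst (h (x, y)), snd (h (x, y))} \<subseteq> X \<union> Y" using g[OF True] by (auto simp: gadget_def)
      moreover have "A1 \<inter> {fst (h (x, y)), snd (h (x, y))} = {}" using g by (fastforce simp: gadget_def)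
      moreover have "{fst (h (x, y)), snd (h (x, y))} \<subseteq> V\<Gamma>" using gv hG[OF True that(2)] by auto
      moreover have "card {fst (h (x, y)), snd (h (x, y))} \<le> 2" by (simp add: card_insert_if)
      ultimately show ?thesis using True XY BY unfolding R_def by auto
    qed (simp add: R_def)
    show "R x y \<inter> R x' y' = {}" if "x \<in> W \<union> A1" "y \<in> B'" "x' \<in> W \<union> A1" "y' \<in> B'" "(x, y) \<noteq> (x', y')"
      for x y x' y'
    proof (cases "x \<in> A1 \<and> x' \<in> A1")
      case True
      have "h (x, y) \<noteq> h (x', y')" using h True that unfolding bij_betw_def inj_on_def by blast
      thus ?thesis using gdisj hG True that unfolding R_def by simp
    qed (auto simp: R_def)
    show "linked G Q x y (R x y)" if x: "x \<in> W \<union> A1" and y: "y \<in> B'" for x y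
    proof (cases "x \<in> A1")
      case True
      have hg: "h (x, y) \<in> \<Gamma>" using hG True y by blast
      have "linked G Q x y {fst (h (x, y)), snd (h (x, y))}"
      proof (rule gadget_linked[OF G hX hY])
        show "gadget G X Y x (h (x, y))" using gad True hg by blast
        thus "Q \<le> card (nbrs G (fst (h (x, y))) \<inter> Y)" if "fst (h (x, y)) = snd (h (x, y))"
          using that seeY adj_verts(3)[OF G] by (auto simp: gadget_def)
        show "adj G (snd (h (x, y))) y" if "snd (h (x, y)) \<in> X"
          using BT[of "snd (h (x, y))" y] that hg y by (auto simp: T_def)
      qed (use True A1 BY y gv[OF hg] in auto)
      thus ?thesis using True by (simp add: R_def)
    next
      case False
      hence "x \<in> W" using x by simp
      hence "linked G Q x y {}" using seeX BY y by (intro linked_via_hub[OF G hX]) auto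
      thus ?thesis by (rule linked_mono)
    qed
  qed (use finW B' Q in auto)
qed

end

section \<open>The graph inside the classes\<close>

text \<open>A pair \<open>(p, p)\<close> stands for the single vertex \<open>p\<close>. In this way
  the leaves of a star and the edges of a matching form one family.\<close>

definition pairwise_disjoint :: "('b \<times> 'b) set \<Rightarrow> bool" where
  "pairwise_disjoint \<Gamma> \<longleftrightarrow> (\<forall>g\<in>\<Gamma>. \<forall>g'\<in>\<Gamma>. g \<noteq> g' \<longrightarrow> {fst g, snd g} \<inter> {fst g', snd g'} = {})"

lemma pairwise_disjointI:
  "(\<And>g g'. g \<in> \<Gamma> \<Longrightarrow> g' \<in> \<Gamma> \<Longrightarrow> g \<noteq> g' \<Longrightarrow> {fst g, snd g} \<inter> {fst g', snd g'} = {}) \<Longrightarrow> pairwise_disjoint \<Gamma>"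
  by (simp add: pairwise_disjoint_def)

lemma pairwise_disjoint_insert:
  assumes "pairwise_disjoint \<Gamma>" "\<And>g. g \<in> \<Gamma> \<Longrightarrow> {fst h, snd h} \<inter> {fst g, snd g} = {}"
  shows "pairwise_disjoint (insert h \<Gamma>)"
proof (rule pairwise_disjointI)
  fix g g' assume g: "g \<in> insert h \<Gamma>" "g' \<in> insert h \<Gamma>" "g \<noteq> g'"
  consider "g = h" "g' \<in> \<Gamma>" | "g' = h" "g \<in> \<Gamma>" | "g \<in> \<Gamma>" "g' \<in> \<Gamma>" using g by blast
  thus "{fst g, snd g} \<inter> {fst g', snd g'} = {}"
  proof cases
    case 1 thus ?thesis using assms(2)[of g'] by simp
  next
    case 2 thus ?thesis using assms(2)[of g] by (simp add: Int_commute)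
  next
    case 3 thus ?thesis using assms(1) g(3) by (simp add: pairwise_disjoint_def)
  qed
qed

lemma sum_card_swap:
  assumes "finite A" "finite B" and sym: "\<And>a b. R a b \<longleftrightarrow> R' b a"
  shows "(\<Sum>a\<in>A. card {b\<in>B. R a b}) = (\<Sum>b\<in>B. card {a\<in>A. R' b a})"
proof -
  have "(\<Sum>a\<in>A. card {b\<in>B. R a b}) = (\<Sum>a\<in>A. \<Sum>b\<in>B. if R a b then 1 else 0)"
    using assms(2) by (simp add: sum.If_cases Int_def conj_commute)
  also have "\<dots> = (\<Sum>b\<in>B. \<Sum>a\<in>A. if R a b then 1 else 0)" by (rule sum.swap)
  also have "\<dots> = (\<Sum>b\<in>B. card {a\<in>A. R' b a})"
    using assms(1) by (simp add: sum.If_cases Int_def conj_commute sym)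
  finally show ?thesis .
qed

text \<open>\<^term>\<open>L\<close> is the graph of edges inside the two classes and \<^term>\<open>M\<close> the graph of missing
  edges between them. Compare with a maximum matching \<^term>\<open>\<Gamma>\<close> of \<^term>\<open>L\<close>: the uncovered
  vertices are independent, so the sum of degrees is controlled by the covered ones, and at those
  the hypothesis on stars combined with matchings bounds the degree into the uncovered set.\<close>

lemma sum_degrees_le_if_net_degrees_small:
  fixes V :: "'b set" and L M :: "'b \<Rightarrow> 'b \<Rightarrow> bool" and t :: nat
  assumes fin: "finite V" and t: "3 \<le> t"
    and Lsym: "\<And>a b. L a b \<Longrightarrow> L b a" and Lirr: "\<And>a. \<not> L a a"
    and LV: "\<And>a b. L a b \<Longrightarrow> a \<in> V \<and> b \<in> V" and Mirr: "\<And>a. \<not> M a a"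
    and S: "\<And>a \<Gamma>. a \<in> V \<Longrightarrow> finite \<Gamma> \<Longrightarrow>
        (\<And>g. g \<in> \<Gamma> \<Longrightarrow> a \<noteq> fst g \<and> a \<noteq> snd g \<and>
          ((fst g = snd g \<and> L a (fst g)) \<or> (L (fst g) (snd g) \<and> \<not> M a (fst g)))) \<Longrightarrow>
        pairwise_disjoint \<Gamma> \<Longrightarrow> card \<Gamma> < t"
    and S0: "\<And>\<Gamma>. finite \<Gamma> \<Longrightarrow> (\<And>g. g \<in> \<Gamma> \<Longrightarrow> L (fst g) (snd g)) \<Longrightarrow> pairwise_disjoint \<Gamma> \<Longrightarrow> card \<Gamma> < t"
    and D: "\<And>a. a \<in> V \<Longrightarrow> card {b\<in>V. L a b} \<le> t - 2 + card {b\<in>V. M a b}"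
  shows "(\<Sum>a\<in>V. card {b\<in>V. L a b}) \<le> (\<Sum>a\<in>V. card {b\<in>V. M a b}) + 2 * ((t - 1) * (t - 2))"
proof -
  define mt where "mt \<Gamma> \<longleftrightarrow> finite \<Gamma> \<and> (\<forall>g\<in>\<Gamma>. L (fst g) (snd g)) \<and> pairwise_disjoint \<Gamma>" for \<Gamma>
  have "mt {}" by (simp add: mt_def pairwise_disjoint_def)
  moreover have "\<forall>\<Gamma>. mt \<Gamma> \<longrightarrow> card \<Gamma> < t" using S0 by (auto simp: mt_def)
  ultimately obtain \<Gamma> where \<Gamma>: "mt \<Gamma>" and \<Gamma>max: "\<And>\<Gamma>'. mt \<Gamma>' \<Longrightarrow> card \<Gamma>' \<le> card \<Gamma>"
    using ex_has_greatest_nat[of mt "{}" card t] by blast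
  have fin\<Gamma>: "finite \<Gamma>" and \<Gamma>L: "\<And>g. g \<in> \<Gamma> \<Longrightarrow> L (fst g) (snd g)" and pd: "pairwise_disjoint \<Gamma>"
    using \<Gamma> by (auto simp: mt_def)
  have pdD: "g = g'" if "g \<in> \<Gamma>" "g' \<in> \<Gamma>" "x \<in> {fst g, snd g}" "x \<in> {fst g', snd g'}" for g g' x
    using pd that unfolding pairwise_disjoint_def by blast
  define \<nu> where "\<nu> = card \<Gamma>"
  have \<nu>t: "\<nu> < t" using S0[OF fin\<Gamma>] \<Gamma>L pd by (simp add: \<nu>_def)
  define VM where "VM = (\<Union>g\<in>\<Gamma>. {fst g, snd g})"
  define I where "I = V - VM"
  define d where "d a = card {b\<in>V. L a b}" for a
  define dI where "dI a = card {b\<in>I. L a b}" for a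
  define m where "m a = card {b\<in>V. M a b}" for a
  \<comment> \<open>Matching edges that are useless at \<open>a\<close>: the hypothesis on stars and
    matchings asks for an end that \<open>a\<close> does not miss, and here \<open>a\<close> misses
    both.\<close>
  define inv where "inv a = card {g\<in>\<Gamma>. M a (fst g) \<and> M a (snd g)}" for a
  have VMV: "VM \<subseteq> V" using \<Gamma>L LV by (auto simp: VM_def)
  have finVM: "finite VM" using VMV fin by (rule finite_subset)
  have finI: "finite I" using fin by (simp add: I_def)
  have Iindep: "\<not> L a b" if "a \<in> I" "b \<in> I" for a b
  proof
    assume L: "L a b"
    have new: "(a, b) \<notin> \<Gamma>" using that by (force simp: I_def VM_def)
    have "mt (insert (a, b) \<Gamma>)"
      using fin\<Gamma> \<Gamma>L pd L that unfolding mt_def pairwise_disjoint_def I_def VM_def by auto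
    from \<Gamma>max[OF this] show False using new fin\<Gamma> by simp
  qed
  \<comment> \<open>Two different neighbours would give an augmenting path: the edge
    \<open>g\<close> could be replaced by two edges into \<open>I\<close>.\<close>
  have same_nbr: "i = i'" if g: "g \<in> \<Gamma>" and i: "i \<in> I" "L (fst g) i" "i' \<in> I" "L (snd g) i'" for g i i'
  proof (rule ccontr)
    assume ne: "i \<noteq> i'"
    define \<Gamma>' where "\<Gamma>' = insert (fst g, i) (insert (snd g, i') (\<Gamma> - {g}))"
    have fs: "fst g \<noteq> snd g" using \<Gamma>L[OF g] Lirr by metis
    have iV: "i \<notin> VM" "i' \<notin> VM" using i by (auto simp: I_def)
    have gVM: "fst g \<in> VM" "snd g \<in> VM" using g by (auto simp: VM_def)
    have n1: "(snd g, i') \<notin> \<Gamma> - {g}" using iV by (force simp: VM_def)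
    have n2: "(fst g, i) \<notin> insert (snd g, i') (\<Gamma> - {g})" using iV fs by (force simp: VM_def)
    have o: "x \<notin> {fst g, snd g, i, i'}" if "h \<in> \<Gamma> - {g}" "x \<in> {fst h, snd h}" for h x
    proof -
      have "x \<in> VM" using that by (auto simp: VM_def)
      moreover have "x \<notin> {fst g, snd g}" using pdD[OF g, of h x] that by auto
      ultimately show ?thesis using iV by auto
    qed
    have "pairwise_disjoint (\<Gamma> - {g})" using pd by (simp add: pairwise_disjoint_def)
    moreover have "{fst g, i} \<inter> {fst h, snd h} = {}" "{snd g, i'} \<inter> {fst h, snd h} = {}"
      if "h \<in> \<Gamma> - {g}" for h using o[OF that] by blast+
    moreover have "{fst g, i} \<inter> {snd g, i'} = {}" using fs ne iV gVM by auto
    ultimately have "pairwise_disjoint \<Gamma>'"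
      unfolding \<Gamma>'_def by (intro pairwise_disjoint_insert) auto
    hence "mt \<Gamma>'" using fin\<Gamma> \<Gamma>L i unfolding mt_def \<Gamma>'_def by auto
    from \<Gamma>max[OF this] have "card \<Gamma>' \<le> card \<Gamma>" .
    moreover have "card \<Gamma>' = Suc (Suc (card (\<Gamma> - {g})))" using n1 n2 fin\<Gamma> by (simp add: \<Gamma>'_def)
    moreover have "card \<Gamma> = Suc (card (\<Gamma> - {g}))" using g fin\<Gamma> by (metis card.remove)
    ultimately show False by simp
  qed
  have d_le: "d a \<le> t - 1" if "a \<in> V" for a
  proof -
    have "card ((\<lambda>b. (b, b)) ` {b\<in>V. L a b}) < t"
      by (rule S[OF that]) (use fin Lirr in \<open>auto simp: pairwise_disjoint_def\<close>)
    thus ?thesis by (simp add: card_image inj_on_def d_def)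
  qed
  have inv_m: "2 * inv a \<le> m a" for a
  proof -
    let ?J = "{g\<in>\<Gamma>. M a (fst g) \<and> M a (snd g)}"
    have "card (\<Union>g\<in>?J. {fst g, snd g}) = (\<Sum>g\<in>?J. card {fst g, snd g})"
      by (rule card_UN_disjoint) (use fin\<Gamma> pd in \<open>auto simp: pairwise_disjoint_def\<close>)
    also have "\<dots> = (\<Sum>g\<in>?J. 2)"
      by (rule sum.cong) (use \<Gamma>L Lirr in \<open>auto simp: card_insert_if dest: \<Gamma>L\<close>)
    finally have cu: "card (\<Union>g\<in>?J. {fst g, snd g}) = 2 * inv a" by (simp add: inv_def)
    have "(\<Union>g\<in>?J. {fst g, snd g}) \<subseteq> {b\<in>V. M a b}" using \<Gamma>L LV by auto
    moreover have "finite {b\<in>V. M a b}" using fin by simp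
    ultimately have "card (\<Union>g\<in>?J. {fst g, snd g}) \<le> m a" unfolding m_def by (intro card_mono)
    thus ?thesis using cu by simp
  qed
  \<comment> \<open>The neighbours of \<open>a\<close> in \<open>I\<close> and the partner of
    \<open>a\<close> in the matching serve as leaves, and all other matching edges usable at
    \<open>a\<close> are added. This family is pairwise disjoint, so it has fewer than
    \<open>t\<close> members.\<close>
  have dI_le: "dI a + \<nu> \<le> t - 1 + inv a" if aVM: "a \<in> VM" for a
  proof -
    obtain g where g: "g \<in> \<Gamma>" "a \<in> {fst g, snd g}" using aVM unfolding VM_def by blast
    define a' where "a' = (if a = fst g then snd g else fst g)"
    have fs: "fst g \<noteq> snd g" using \<Gamma>L[OF g(1)] Lirr by metis
    have La': "L a a'" using g \<Gamma>L[OF g(1)] Lsym by (auto simp: a'_def)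
    have a'VM: "a' \<in> VM" using g by (auto simp: a'_def VM_def)
    define J where "J = {h\<in>\<Gamma> - {g}. \<not> (M a (fst h) \<and> M a (snd h))}"
    \<comment> \<open>Turns an edge so that its first end is one that \<open>a\<close> does not
      miss.\<close>
    define orient where "orient h = (if M a (fst h) then (snd h, fst h) else h)" for h
    define \<Gamma>1 where "\<Gamma>1 = (\<lambda>i. (i, i)) ` {i\<in>I. L a i}"
    define \<Gamma>' where "\<Gamma>' = \<Gamma>1 \<union> insert (a', a') (orient ` J)"
    have os: "{fst (orient h), snd (orient h)} = {fst h, snd h}" for h by (auto simp: orient_def)
    have fin': "finite \<Gamma>1" "finite J" using finI fin\<Gamma> by (auto simp: \<Gamma>1_def J_def)
    have oVM: "{fst h, snd h} \<subseteq> VM" if hJ: "h \<in> orient ` J" for h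
    proof -
      obtain k where "k \<in> J" "h = orient k" using hJ by blast
      thus ?thesis using os[of k] by (auto simp: J_def VM_def)
    qed
    have oa: "{fst h, snd h} \<inter> {a, a'} = {}" if hJ: "h \<in> orient ` J" for h
    proof -
      obtain k where k: "k \<in> J" "h = orient k" using hJ by blast
      hence "{fst k, snd k} \<inter> {fst g, snd g} = {}"
        using pd g(1) unfolding pairwise_disjoint_def J_def by blast
      moreover have "{a, a'} \<subseteq> {fst g, snd g}" using g(2) by (auto simp: a'_def)
      ultimately show ?thesis using os[of k] k(2) by blast
    qed
    have pdJ: "{fst h, snd h} \<inter> {fst h', snd h'} = {}" if hJ: "h \<in> orient ` J" "h' \<in> orient ` J" "h \<noteq> h'" for h h'
    proof -
      obtain k k' where k: "k \<in> J" "h = orient k" "k' \<in> J" "h' = orient k'" using hJ by blast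
      hence "k \<noteq> k'" using hJ by auto
      hence "{fst k, snd k} \<inter> {fst k', snd k'} = {}"
        using k pd unfolding pairwise_disjoint_def J_def by blast
      thus ?thesis using os k by metis
    qed
    have injo: "inj_on orient J"
    proof (rule inj_onI)
      fix h h' assume h: "h \<in> J" "h' \<in> J" "orient h = orient h'"
      have "fst h \<in> {fst h', snd h'}" using os[of h] os[of h'] h(3) by auto
      thus "h = h'" using pdD[of h h' "fst h"] h by (auto simp: J_def)
    qed
    have d1: "\<Gamma>1 \<inter> insert (a', a') (orient ` J) = {}"
    proof -
      have "fst h \<notin> VM" if "h \<in> \<Gamma>1" for h using that by (auto simp: \<Gamma>1_def I_def)
      thus ?thesis using a'VM oVM by fastforce
    qed
    have d2: "(a', a') \<notin> orient ` J" using oa by fastforce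
    have "card \<Gamma>' = dI a + Suc (card J)"
    proof -
      have "card \<Gamma>' = card \<Gamma>1 + card (insert (a', a') (orient ` J))"
        unfolding \<Gamma>'_def using fin' d1 by (intro card_Un_disjoint) auto
      also have "card \<Gamma>1 = dI a" unfolding \<Gamma>1_def dI_def by (simp add: card_image inj_on_def)
      also have "card (insert (a', a') (orient ` J)) = Suc (card J)"
        using d2 fin' injo by (simp add: card_image)
      finally show ?thesis .
    qed
    moreover have "card \<Gamma>' < t"
    proof (rule S)
      show "a \<in> V" using aVM VMV by blast
      show "finite \<Gamma>'" using fin' by (simp add: \<Gamma>'_def)
      show "pairwise_disjoint \<Gamma>'"
      proof -
        have 1: "{fst h, snd h} \<inter> {fst h', snd h'} = {}" if hh: "h \<in> \<Gamma>1" "h' \<in> \<Gamma>'" "h \<noteq> h'" for h h'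
        proof -
          obtain i where i: "h = (i, i)" "i \<in> I" using hh(1) unfolding \<Gamma>1_def by blast
          have "i \<notin> {fst h', snd h'}" using hh(2) unfolding \<Gamma>'_def
          proof (elim UnE insertE)
            assume "h' \<in> \<Gamma>1" thus ?thesis using hh(3) i by (auto simp: \<Gamma>1_def)
          next
            assume "h' = (a', a')" thus ?thesis using i(2) a'VM by (auto simp: I_def)
          next
            assume "h' \<in> orient ` J" thus ?thesis using oVM[of h'] i(2) unfolding I_def by blast
          qed
          thus ?thesis using i by auto
        qed
        have 2: "{fst h, snd h} \<inter> {fst h', snd h'} = {}"
          if hh: "h \<in> insert (a', a') (orient ` J)" "h' \<in> insert (a', a') (orient ` J)" "h \<noteq> h'" for h h'
        proof -
          consider "h = (a', a')" "h' \<in> orient ` J" | "h' = (a', a')" "h \<in> orient ` J"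
            | "h \<in> orient ` J" "h' \<in> orient ` J" using hh by blast
          thus ?thesis
          proof cases
            case 1 thus ?thesis using oa[of h'] by auto
          next
            case 2 thus ?thesis using oa[of h] by auto
          next
            case 3 thus ?thesis using pdJ hh by blast
          qed
        qed
        show ?thesis unfolding pairwise_disjoint_def
        proof (intro ballI impI)
          fix h h' assume *: "h \<in> \<Gamma>'" "h' \<in> \<Gamma>'" "h \<noteq> h'"
          show "{fst h, snd h} \<inter> {fst h', snd h'} = {}"
            using * 1[of h h'] 1[of h' h] 2[of h h'] unfolding \<Gamma>'_def by blast
        qed
      qed
      fix h assume "h \<in> \<Gamma>'"
      thus "a \<noteq> fst h \<and> a \<noteq> snd h \<and>
          ((fst h = snd h \<and> L a (fst h)) \<or> (L (fst h) (snd h) \<and> \<not> M a (fst h)))"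
        unfolding \<Gamma>'_def
      proof (elim UnE insertE)
        assume "h \<in> \<Gamma>1" thus ?thesis using Lirr by (auto simp: \<Gamma>1_def)
      next
        assume "h = (a', a')" thus ?thesis using La' Lirr by auto
      next
        assume h: "h \<in> orient ` J"
        then obtain k where k: "k \<in> J" "h = orient k" by blast
        have "L (fst h) (snd h)" using k \<Gamma>L Lsym by (auto simp: orient_def J_def)
        moreover have "\<not> M a (fst h)" using k by (auto simp: orient_def J_def)
        ultimately show ?thesis using oa[OF h] by auto
      qed
    qed
    moreover have "\<nu> \<le> Suc (card J + inv a)"
    proof -
      have "\<Gamma> \<subseteq> insert g (J \<union> {g\<in>\<Gamma>. M a (fst g) \<and> M a (snd g)})" by (auto simp: J_def)
      hence "\<nu> \<le> card (insert g (J \<union> {g\<in>\<Gamma>. M a (fst g) \<and> M a (snd g)}))"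
        unfolding \<nu>_def using fin' fin\<Gamma> by (intro card_mono) auto
      also have "\<dots> \<le> Suc (card (J \<union> {g\<in>\<Gamma>. M a (fst g) \<and> M a (snd g)}))" by (rule card_insert_le_m1) auto
      also have "card (J \<union> {g\<in>\<Gamma>. M a (fst g) \<and> M a (snd g)}) \<le> card J + inv a"
        unfolding inv_def by (rule card_Un_le)
      finally show ?thesis by simp
    qed
    ultimately show ?thesis using t by linarith
  qed
  \<comment> \<open>Vertices of \<open>I\<close> have neighbours only in \<open>VM\<close>, so their
    degrees are charged to the covered vertices as \<open>dI\<close>. What a covered vertex
    contributes after paying for its missing pairs is \<open>\<phi>\<close>.\<close>
  define \<phi> where "\<phi> a = int (d a) + int (dI a) - int (m a)" for a
  define j where "j = int t - 1 - int \<nu>"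
  have j0: "0 \<le> j" using \<nu>t by (simp add: j_def)
  have D': "int (d a) \<le> int t - 2 + int (m a)" if "a \<in> V" for a
    using D[OF that] t by (simp add: d_def m_def)
  have d': "int (d a) \<le> int t - 1" if "a \<in> V" for a using d_le[OF that] t by linarith
  have dI': "int (dI a) \<le> j + int (inv a)" if "a \<in> VM" for a
    using dI_le[OF that] t unfolding j_def by linarith
  have \<phi>0: "\<phi> a \<le> int t - 2" if "a \<in> VM" "dI a = 0" for a
    using D'[of a] VMV that by (auto simp: \<phi>_def)
  \<comment> \<open>If \<open>inv a\<close> is positive, only \<open>d a \<le> t - 1\<close> is
    used, which is one worse than \<open>t - 2\<close>, and \<open>dI a\<close> may exceed
    \<open>j\<close> by \<open>inv a\<close>. Both losses are covered by
    \<open>2 * inv a \<le> m a\<close>.\<close>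
  have \<phi>j: "\<phi> a \<le> int t - 2 + j" if "a \<in> VM" for a
  proof (cases "inv a = 0")
    case True
    thus ?thesis using D'[of a] dI'[OF that] VMV that by (auto simp: \<phi>_def)
  next
    case False
    thus ?thesis using d'[of a] dI'[OF that] inv_m[of a] VMV that unfolding \<phi>_def by force
  qed
  \<comment> \<open>The extra allowance for one matching edge. If one end has no neighbour in
    \<open>I\<close>, the excess is at most \<open>j\<close>; otherwise both ends have exactly one
    and the excess is at most the minimum of \<open>2\<close> and \<open>2 * j\<close>.\<close>
  define K where "K = (if j = 0 then 0 else if j = 1 then 2 else j)"
  have pair: "\<phi> (fst g) + \<phi> (snd g) \<le> 2 * (int t - 2) + K" if g: "g \<in> \<Gamma>" for g
  proof -
    have gV: "fst g \<in> VM" "snd g \<in> VM" using g by (auto simp: VM_def)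
    have Kj: "j \<le> K" using j0 by (simp add: K_def)
    show ?thesis
    proof (cases "dI (fst g) = 0 \<or> dI (snd g) = 0")
      case True
      thus ?thesis
      proof
        assume "dI (fst g) = 0"
        hence "\<phi> (fst g) + \<phi> (snd g) \<le> (int t - 2) + (int t - 2 + K)"
          using \<phi>0[OF gV(1)] \<phi>j[OF gV(2)] Kj by (intro add_mono) auto
        thus ?thesis by simp
      next
        assume "dI (snd g) = 0"
        hence "\<phi> (fst g) + \<phi> (snd g) \<le> (int t - 2 + K) + (int t - 2)"
          using \<phi>0[OF gV(2)] \<phi>j[OF gV(1)] Kj by (intro add_mono) auto
        thus ?thesis by simp
      qed
    next
      case False
      have *: "dI (fst g) \<noteq> 0" "dI (snd g) \<noteq> 0" using False by auto
      have "{i\<in>I. L (fst g) i} \<noteq> {}" using *(1) unfolding dI_def by (metis card.empty)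
      then obtain i where i: "i \<in> I" "L (fst g) i" by blast
      have "{i\<in>I. L (snd g) i} \<noteq> {}" using *(2) unfolding dI_def by (metis card.empty)
      then obtain i' where i': "i' \<in> I" "L (snd g) i'" by blast
      have "{i\<in>I. L (fst g) i} = {i'}" "{i\<in>I. L (snd g) i} = {i}"
        using same_nbr[OF g] i i' by blast+
      hence 1: "dI (fst g) = 1" "dI (snd g) = 1" by (simp_all add: dI_def)
      have \<phi>1: "\<phi> a \<le> int t - 1" if "a \<in> VM" "dI a = 1" for a
        using D'[of a] VMV that by (auto simp: \<phi>_def)
      have "\<phi> (fst g) + \<phi> (snd g) \<le> 2 * (int t - 2) + 2"
        using add_mono[OF \<phi>1[OF gV(1) 1(1)] \<phi>1[OF gV(2) 1(2)]] by simp
      moreover have "\<phi> (fst g) + \<phi> (snd g) \<le> 2 * (int t - 2) + 2 * j"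
        using add_mono[OF \<phi>j[OF gV(1)] \<phi>j[OF gV(2)]] by simp
      ultimately show ?thesis using j0 unfolding K_def by auto
    qed
  qed
  have sumVM: "(\<Sum>a\<in>VM. h a) = (\<Sum>g\<in>\<Gamma>. h (fst g) + h (snd g))" for h :: "'b \<Rightarrow> int"
  proof -
    have "(\<Sum>a\<in>VM. h a) = (\<Sum>g\<in>\<Gamma>. \<Sum>a\<in>{fst g, snd g}. h a)"
      unfolding VM_def by (rule sum.UNION_disjoint) (use fin\<Gamma> pd in \<open>auto simp: pairwise_disjoint_def\<close>)
    also have "\<dots> = (\<Sum>g\<in>\<Gamma>. h (fst g) + h (snd g))"
    proof (rule sum.cong)
      fix g assume "g \<in> \<Gamma>"
      hence "fst g \<noteq> snd g" using \<Gamma>L Lirr by metis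
      thus "(\<Sum>a\<in>{fst g, snd g}. h a) = h (fst g) + h (snd g)" by simp
    qed simp
    finally show ?thesis .
  qed
  have "(\<Sum>a\<in>I. d a) = (\<Sum>a\<in>VM. dI a)"
  proof -
    have "d a = card {b\<in>VM. L a b}" if "a \<in> I" for a
    proof -
      have "{b\<in>V. L a b} = {b\<in>VM. L a b}" using Iindep[OF that] VMV unfolding I_def by blast
      thus ?thesis by (simp add: d_def)
    qed
    hence "(\<Sum>a\<in>I. d a) = (\<Sum>a\<in>I. card {b\<in>VM. L a b})" by simp
    also have "\<dots> = (\<Sum>b\<in>VM. card {a\<in>I. L b a})"
      by (rule sum_card_swap) (use finI finVM Lsym in blast)+
    finally show ?thesis by (simp add: dI_def)
  qed
  moreover have "(\<Sum>a\<in>V. d a) = (\<Sum>a\<in>VM. d a) + (\<Sum>a\<in>I. d a)"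
    unfolding I_def using VMV fin by (simp add: sum.subset_diff add.commute)
  ultimately have "int (\<Sum>a\<in>V. d a) = (\<Sum>a\<in>VM. \<phi> a + int (m a))"
    by (simp add: \<phi>_def sum.distrib)
  also have "\<dots> = (\<Sum>a\<in>VM. \<phi> a) + int (\<Sum>a\<in>VM. m a)" by (simp add: sum.distrib)
  also have "(\<Sum>a\<in>VM. \<phi> a) \<le> (\<Sum>g\<in>\<Gamma>. 2 * (int t - 2) + K)"
    unfolding sumVM by (rule sum_mono) (rule pair)
  also have "\<dots> = int \<nu> * (2 * (int t - 2) + K)" by (simp add: \<nu>_def)
  \<comment> \<open>Fewer matching edges leave more slack \<open>j\<close> for each of them.
    Equality holds for \<open>j = 0\<close> and \<open>j = 1\<close>; for larger \<open>j\<close>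
    the difference is \<open>j * (3 - t - j)\<close>, which is not positive for
    \<open>t \<ge> 3\<close>.\<close>
  also have "\<dots> \<le> 2 * ((int t - 1) * (int t - 2))"
  proof -
    have \<nu>: "int \<nu> = int t - 1 - j" by (simp add: j_def)
    consider "j = 0" | "j = 1" | "j \<ge> 2" using j0 by linarith
    thus ?thesis
    proof cases
      case 3
      have "int \<nu> * (2 * (int t - 2) + K) - 2 * ((int t - 1) * (int t - 2)) = j * (3 - int t - j)"
        unfolding \<nu> K_def using 3 by (simp add: algebra_simps)
      also have "\<dots> \<le> 0" using 3 t by (intro mult_nonneg_nonpos) auto
      finally show ?thesis by simp
    qed (simp_all add: \<nu> K_def algebra_simps)
  qed
  also have "int (\<Sum>a\<in>VM. m a) \<le> int (\<Sum>a\<in>V. m a)"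
    using VMV fin by (intro iffD2[OF of_nat_le_iff] sum_mono2) auto
  finally have "int (\<Sum>a\<in>V. d a) \<le> 2 * ((int t - 1) * (int t - 2)) + int (\<Sum>a\<in>V. m a)" by simp
  also have "2 * ((int t - 1) * (int t - 2)) = int (2 * ((t - 1) * (t - 2)))"
    using t by (simp add: of_nat_diff)
  finally show ?thesis unfolding d_def m_def by linarith
qed


text \<open>The second alternative occurs for the complete bipartite graph with classes of sizes
  \<^term>\<open>t - 2\<close> and \<^term>\<open>t - 1\<close> with one edge added to the larger class.\<close>

lemma structure_of_covered_graph:
  fixes X :: "'b set" and L :: "'b \<Rightarrow> 'b \<Rightarrow> bool" and t :: nat
  assumes fin: "finite X" and t: "3 \<le> t"
    and Lsym: "\<And>a b. L a b \<Longrightarrow> L b a" and Lirr: "\<And>a. \<not> L a a"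
    and LX: "\<And>a b. L a b \<Longrightarrow> a \<in> X \<and> b \<in> X"
    and deg: "\<And>a. a \<in> X \<Longrightarrow> card {b\<in>X. L a b} \<le> t - 1"
    and v0: "v0 \<in> X" "card {b\<in>X. L v0 b} = t - 1"
    and cover: "\<And>x a b. x \<in> X \<Longrightarrow> card {b\<in>X. L x b} = t - 1 \<Longrightarrow> L a b \<Longrightarrow> L x a \<or> L x b"
    and large: "2 * t * t + 6 \<le> (\<Sum>a\<in>X. card {b\<in>X. L a b}) + 6 * t"
  shows "(\<exists>U N. U \<subseteq> X \<and> N \<subseteq> X \<and> U \<inter> N = {} \<and> card U = t - 1 \<and> card N = t - 1 \<and>
             (\<forall>a b. L a b \<longrightarrow> a \<in> U \<and> b \<in> N \<or> a \<in> N \<and> b \<in> U)) \<or>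
         (2 * t * t + 6 = (\<Sum>a\<in>X. card {b\<in>X. L a b}) + 6 * t \<and>
          (4 \<le> t \<longrightarrow> (\<exists>P Q. P \<subseteq> X \<and> Q \<subseteq> X \<and> P \<inter> Q = {} \<and> card P = 2 \<and> card Q = t - 1 \<and>
             (\<forall>p\<in>P. \<forall>q\<in>Q. L p q))))"
proof -
  define d where "d a = card {b\<in>X. L a b}" for a
  define N where "N = {b\<in>X. L v0 b}"
  define O' where "O' = X - N"
  define dN where "dN a = card {b\<in>N. L a b}" for a
  define \<Delta> where "\<Delta> = (\<Sum>a\<in>N. t - 1 - d a)"
  define FF where "FF = {a\<in>N. d a = t - 1}"
  have NX: "N \<subseteq> X" and finN: "finite N" and finO: "finite O'" and cN: "card N = t - 1"
    using fin v0 by (auto simp: N_def O'_def)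
  have finF: "finite FF" using finN by (simp add: FF_def)
  have d_le: "d a \<le> t - 1" if "a \<in> X" for a using deg that by (simp add: d_def)
  have cov0: "a \<in> N \<or> b \<in> N" if "L a b" for a b
    using cover[OF v0 that] LX[OF that] unfolding N_def by blast
  have split: "d a = dN a + card {b\<in>O'. L a b}" for a
  proof -
    have "{b\<in>X. L a b} = {b\<in>N. L a b} \<union> {b\<in>O'. L a b}" using NX by (auto simp: O'_def)
    thus ?thesis unfolding d_def dN_def using finN finO
      by (simp add: card_Un_disjoint O'_def disjoint_iff)
  qed
  have "(\<Sum>a\<in>O'. d a) = (\<Sum>a\<in>O'. card {b\<in>N. L a b})"
  proof (rule sum.cong)
    fix a assume "a \<in> O'"
    hence "{b\<in>O'. L a b} = {}" using cov0 by (auto simp: O'_def)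
    thus "d a = card {b\<in>N. L a b}" using split[of a] unfolding dN_def by (metis card.empty add_0_right)
  qed simp
  also have "\<dots> = (\<Sum>b\<in>N. card {a\<in>O'. L b a})"
    by (rule sum_card_swap) (use finO finN Lsym in blast)+
  finally have sO: "(\<Sum>a\<in>O'. d a) = (\<Sum>b\<in>N. card {a\<in>O'. L b a})" .
  have sX: "(\<Sum>a\<in>X. d a) = (\<Sum>a\<in>N. d a) + (\<Sum>a\<in>O'. d a)"
    unfolding O'_def using NX fin by (simp add: sum.subset_diff add.commute)
  have sN: "(\<Sum>a\<in>N. d a) = (\<Sum>a\<in>N. dN a) + (\<Sum>b\<in>N. card {a\<in>O'. L b a})"
    using split by (simp add: sum.distrib)
  define E2 where "E2 = (\<Sum>a\<in>N. dN a)"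
  have "(\<Sum>a\<in>N. d a) + \<Delta> = (\<Sum>a\<in>N. t - 1)"
    unfolding \<Delta>_def sum.distrib[symmetric]
  proof (rule sum.cong)
    fix a assume "a \<in> N"
    thus "d a + (t - 1 - d a) = t - 1" using d_le[of a] NX by auto
  qed simp
  hence s\<Delta>: "(\<Sum>a\<in>N. d a) + \<Delta> = (t - 1) * (t - 1)" by (simp add: cN)
  have tt: "(t - 1) * (t - 1) + 2 * t = t * t + 1" using t by (cases t) (auto simp: algebra_simps)
  \<comment> \<open>As \<open>N\<close> meets every edge, the degree sum is twice the degree sum
    over \<open>N\<close> minus \<open>E2\<close>. Hence it is \<open>2 * (t - 1)^2\<close> less
    twice the deficiency \<open>\<Delta>\<close> in \<open>N\<close> and less the degrees within
    \<open>N\<close>.\<close>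
  have tot: "(\<Sum>a\<in>X. d a) + 2 * \<Delta> + E2 + 4 * t = 2 * t * t + 2"
    using sX sO sN s\<Delta> tt unfolding E2_def by linarith
  have large': "2 * \<Delta> + E2 + 4 \<le> 2 * t" using tot large unfolding d_def[symmetric] by linarith
  have nF: "card (N - FF) \<le> \<Delta>"
  proof -
    have "card (N - FF) = (\<Sum>a\<in>N - FF. 1)" by simp
    also have "\<dots> \<le> (\<Sum>a\<in>N - FF. t - 1 - d a)"
    proof (rule sum_mono)
      fix a assume "a \<in> N - FF"
      hence "a \<in> X" "d a \<noteq> t - 1" using NX by (auto simp: FF_def)
      thus "1 \<le> t - 1 - d a" using d_le[of a] by linarith
    qed
    also have "\<dots> \<le> \<Delta>" unfolding \<Delta>_def using finN by (intro sum_mono2) auto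
    finally show ?thesis .
  qed
  have cF: "card FF + card (N - FF) = t - 1"
    using cN finN by (metis (no_types, lifting) FF_def card_Diff_subset card_mono finF le_add_diff_inverse mem_Collect_eq subsetI)
  show ?thesis
  proof (cases "\<exists>x\<in>FF. dN x = 0")
    case True
    then obtain x where x: "x \<in> N" "d x = t - 1" "dN x = 0" by (auto simp: FF_def)
    \<comment> \<open>Both \<open>N\<close> and the neighbourhood of the full vertex
      \<open>x\<close> meet every edge. If they are disjoint, every edge runs between them.\<close>
    define U where "U = {b\<in>X. L x b}"
    have "{b\<in>N. L x b} = {}" using x(3) finN by (simp add: dN_def)
    hence UN: "U \<inter> N = {}" by (auto simp: U_def)
    have "a \<in> U \<and> b \<in> N \<or> a \<in> N \<and> b \<in> U" if "L a b" for a b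
    proof -
      have "x \<in> X" "card {b\<in>X. L x b} = t - 1" using x NX by (auto simp: d_def)
      from cover[OF this that] have "a \<in> U \<or> b \<in> U" using LX[OF that] by (auto simp: U_def)
      thus ?thesis using cov0[OF that] UN by blast
    qed
    moreover have "card U = t - 1" using x by (simp add: U_def d_def)
    moreover have "U \<subseteq> X" by (auto simp: U_def)
    ultimately show ?thesis using UN NX cN by blast
  next
    case False
    \<comment> \<open>Otherwise each full vertex of \<open>N\<close> costs at least 2 in
      \<open>E2\<close> and each other one at least 2 in \<open>2 * \<Delta>\<close>. That makes
      \<open>2 * (t - 1)\<close>, while only \<open>2 * t - 4\<close> is available.\<close>
    have "\<exists>x\<in>FF. dN x = 1"
    proof (rule ccontr)
      assume "\<not> (\<exists>x\<in>FF. dN x = 1)"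
      have "2 \<le> dN x" if "x \<in> FF" for x
      proof -
        have "dN x \<noteq> 0" "dN x \<noteq> 1" using that False \<open>\<not> (\<exists>x\<in>FF. dN x = 1)\<close> by auto
        thus ?thesis by linarith
      qed
      hence "(\<Sum>x\<in>FF. 2) \<le> (\<Sum>x\<in>FF. dN x)" by (rule sum_mono)
      also have "\<dots> \<le> E2" unfolding E2_def using finN by (intro sum_mono2) (auto simp: FF_def)
      finally show False using large' nF cF t by simp
    qed
    then obtain x0 where x0: "x0 \<in> N" "d x0 = t - 1" "dN x0 = 1" by (auto simp: FF_def)
    then obtain x1 where x1: "{b\<in>N. L x0 b} = {x1}" unfolding dN_def by (meson card_1_singletonE)
    have x1': "x1 \<in> N" "L x0 x1" "L x1 x0" using x1 Lsym by blast+
    have c: "L x a \<or> L x b" if "x \<in> N" "d x = t - 1" "L a b" for x a b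
      using cover[of x a b] that NX by (auto simp: d_def)
    \<comment> \<open>The neighbourhood of \<open>x0\<close> meets every edge and has only
      \<open>x1\<close> in common with \<open>N\<close>; so the edges within \<open>N\<close> form a
      star with centre \<open>x1\<close>.\<close>
    have Nedge: "a = x1 \<or> b = x1" if "a \<in> N" "b \<in> N" "L a b" for a b
      using c[OF x0(1,2) that(3)] that x1 by blast
    define S where "S = {b\<in>N. L x1 b}"
    have S: "x0 \<in> S" "x1 \<notin> S" "finite S" "S \<subseteq> N" using x0 x1' Lirr finN by (auto simp: S_def)
    have dN1: "dN x1 = card S" by (simp add: dN_def S_def)
    have dNx: "dN x = (if x \<in> S then 1 else 0)" if "x \<in> N" "x \<noteq> x1" for x
    proof -
      have only: "b = x1" if "b \<in> N" "L x b" for b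
        using Nedge[OF \<open>x \<in> N\<close> that] \<open>x \<noteq> x1\<close> by blast
      show ?thesis
      proof (cases "x \<in> S")
        case True
        hence "L x x1" using Lsym by (simp add: S_def)
        hence "{b\<in>N. L x b} = {x1}" using only x1'(1) by blast
        thus ?thesis using True by (simp add: dN_def)
      next
        case False
        hence "\<not> L x x1" using that(1) Lsym[of x x1] by (simp add: S_def) blast
        hence "{b\<in>N. L x b} = {}" using only by blast
        hence "dN x = 0" unfolding dN_def by (metis card.empty)
        thus ?thesis using False by simp
      qed
    qed
    have "E2 = dN x1 + (\<Sum>x\<in>N - {x1}. dN x)" unfolding E2_def using finN x1' by (simp add: sum.remove)
    also have "(\<Sum>x\<in>N - {x1}. dN x) = (\<Sum>x\<in>N - {x1}. if x \<in> S then 1 else 0)"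
      by (rule sum.cong) (use dNx in auto)
    also have "\<dots> = card ((N - {x1}) \<inter> S)" using finN by (simp add: sum.If_cases)
    also have "(N - {x1}) \<inter> S = S" using S by auto
    finally have E2: "E2 = 2 * card S" using dN1 by simp
    have FS: "FF \<subseteq> insert x1 S"
    proof
      fix x assume x: "x \<in> FF"
      hence "dN x \<noteq> 0" "x \<in> N" using False by (auto simp: FF_def)
      thus "x \<in> insert x1 S" using dNx[of x] by (cases "x = x1"; cases "x \<in> S") auto
    qed
    have cFS: "card FF \<le> card S + 1" using card_mono[OF _ FS] S by simp
    \<comment> \<open>A star with \<open>card S\<close> leaves contributes \<open>2 * card S\<close>
      to \<open>E2\<close> and contains all full vertices of \<open>N\<close>, so the total cost is
      at least \<open>2 * t - 4\<close>. The budget is met exactly and all estimates become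
      equalities.\<close>
    have eq1: "card FF = card S + 1" and eq\<Delta>: "\<Delta> = card (N - FF)" and eqE: "2 * \<Delta> + E2 + 4 = 2 * t"
      using cFS large' nF cF t E2 by linarith+
    have FFeq: "FF = insert x1 S"
      by (rule card_subset_eq[OF _ FS]) (use S eq1 in auto)
    have "2 * t * t + 6 = (\<Sum>a\<in>X. card {b\<in>X. L a b}) + 6 * t"
      using tot eqE unfolding d_def[symmetric] by linarith
    moreover have "\<exists>P Q. P \<subseteq> X \<and> Q \<subseteq> X \<and> P \<inter> Q = {} \<and> card P = 2 \<and> card Q = t - 1 \<and>
             (\<forall>p\<in>P. \<forall>q\<in>Q. L p q)" if t4: "4 \<le> t"
    proof (cases "S = {x0}")
      case False
      then obtain x2 where x2: "x2 \<in> S" "x2 \<noteq> x0" using S by blast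
      have m: "x0 \<in> N" "x2 \<in> N" "x0 \<noteq> x1" "x2 \<noteq> x1" "x2 \<in> FF" using x2 S FFeq by auto
      have d2: "d x2 = t - 1" using m by (simp add: FF_def)
      have na: "\<not> L x0 x2" using Nedge[OF m(1,2)] m by auto
      \<comment> \<open>Every edge at \<open>x2\<close> must meet the neighbourhood of the full
        vertex \<open>x0\<close>, and \<open>x2\<close> itself is not in it. So the
        \<open>t - 1\<close> neighbours of \<open>x2\<close> are also neighbours of
        \<open>x0\<close>.\<close>
      have "L x0 q" if "L x2 q" for q using c[OF x0(1,2) that] na by blast
      hence 1: "\<forall>p\<in>{x0, x2}. \<forall>q\<in>{b\<in>X. L x2 b}. L p q" by blast
      have 2: "{x0, x2} \<inter> {b\<in>X. L x2 b} = {}" using na Lirr Lsym by blast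
      have 3: "card {b\<in>X. L x2 b} = t - 1" using d2 by (simp add: d_def)
      have 4: "card {x0, x2} = 2" using x2 by simp
      have 5: "{x0, x2} \<subseteq> X" "{b\<in>X. L x2 b} \<subseteq> X" using m NX by auto
      show ?thesis
        by (rule exI[of _ "{x0, x2}"], rule exI[of _ "{b\<in>X. L x2 b}"]) (intro conjI 1 2 3 4 5)
    next
      case True
      have F2: "FF = {x0, x1}" using FFeq True by auto
      have d1: "d x1 = t - 1" using F2 by (auto simp: FF_def)
      define O1 where "O1 = {b\<in>O'. L x1 b}"
      have "d x1 = card S + card O1" using split[of x1] dN1 by (simp add: O1_def)
      hence cO1: "card O1 = t - 2" using d1 True by simp
      have "(\<Sum>a\<in>N - FF. t - 1 - d a) = \<Delta>"
      proof -
        have "(\<Sum>a\<in>FF. t - 1 - d a) = 0" by (simp add: FF_def)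
        moreover have "\<Delta> = (\<Sum>a\<in>FF. t - 1 - d a) + (\<Sum>a\<in>N - FF. t - 1 - d a)"
          unfolding \<Delta>_def using finN by (simp add: sum.subset_diff[of FF N] FF_def add.commute)
        ultimately show ?thesis by simp
      qed
      hence s1: "(\<Sum>a\<in>N - FF. 1) = (\<Sum>a\<in>N - FF. t - 1 - d a)" using eq\<Delta> by simp
      have dy: "d y = t - 2" if "y \<in> N - FF" for y
      proof -
        have "1 \<le> t - 1 - d a" if "a \<in> N - FF" for a
        proof -
          have "a \<in> X" "d a \<noteq> t - 1" using that NX by (auto simp: FF_def)
          thus ?thesis using d_le[of a] by linarith
        qed
        hence "1 = t - 1 - d y" by (rule sum_mono_inv[OF s1]) (use that finN in auto)
        thus ?thesis by simp
      qed
      \<comment> \<open>A vertex \<open>y\<close> of \<open>N\<close> that is not full has degree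
        \<open>t - 2\<close> by tightness. Each of its edges must be met by the neighbourhood of
        \<open>x1\<close>, which avoids \<open>y\<close>; its neighbours thus lie in
        \<open>O1\<close>, and the sizes agree.\<close>
      have Ny: "{b\<in>X. L y b} = O1" if y: "y \<in> N - FF" for y
      proof (rule card_subset_eq)
        show "finite O1" using finO by (simp add: O1_def)
        show "{b\<in>X. L y b} \<subseteq> O1"
        proof
          fix b assume b: "b \<in> {b\<in>X. L y b}"
          have n1: "\<not> L x1 y" using y F2 FFeq by (auto simp: S_def)
          hence L1b: "L x1 b" using c[OF x1'(1) d1, of y b] b by blast
          have "b \<notin> N"
          proof
            assume "b \<in> N"
            hence "y = x1 \<or> b = x1" using Nedge[of y b] y b by blast
            thus False using y F2 b n1 Lsym by blast
          qed
          thus "b \<in> O1" using b L1b by (simp add: O1_def O'_def)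
        qed
        show "card {b\<in>X. L y b} = card O1" using dy[OF y] cO1 by (simp add: d_def)
      qed
      have x01: "x0 \<noteq> x1" using S by auto
      have "card (N - FF) > 0" using cF F2 x01 t4 by simp
      then obtain y where y: "y \<in> N - FF" by (metis card_gt_0_iff ex_in_conv)
      have O10: "L x0 b" if "b \<in> O1" for b
      proof -
        have "L y b" using Ny[OF y] that by blast
        moreover have "\<not> L x0 y" using Nedge[OF x0(1), of y] y F2 x01 by blast
        ultimately show ?thesis using c[OF x0(1,2)] by blast
      qed
      have NO: "L p q" if "q \<in> N" "p \<in> O1" for p q
      proof (cases "q \<in> FF")
        case True
        thus ?thesis using O10[OF that(2)] that(2) F2 Lsym by (auto simp: O1_def)
      next
        case False
        hence "p \<in> {b\<in>X. L q b}" using Ny[of q] that by blast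
        thus ?thesis using Lsym by blast
      qed
      \<comment> \<open>\<open>O1\<close> has \<open>t - 2\<close> elements, so two of them exist
        only from \<open>t = 4\<close> on.\<close>
      have "2 \<le> card O1" using cO1 t4 by simp
      from obtain_subset_with_card_n[OF this] obtain P where P: "P \<subseteq> O1" "card P = 2" by blast
      have "P \<subseteq> X" "P \<inter> N = {}" using P by (auto simp: O1_def O'_def)
      moreover have "\<forall>p\<in>P. \<forall>q\<in>N. L p q" using P(1) NO by blast
      ultimately show ?thesis using P(2) NX cN by blast
    qed
    ultimately show ?thesis by blast
  qed
qed

section \<open>Many triangles\<close>

text \<open>By averaging, a proportion \<open>\<epsilon> / 2\<close> of the points lies in at least
  \<open>N\<close> of the sets. Each such point selects \<open>N\<close> indices, and pigeonhole
  over the \<open>2 ^ card I\<close> subsets finds a selection shared by many points. The loss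
  depends on \<open>card I\<close> alone, which callers keep constant.\<close>

lemma dense_family:
  fixes S :: "'i \<Rightarrow> 'w set" and \<epsilon> :: real
  assumes fin: "finite I" "finite \<Omega>" and ne: "I \<noteq> {}" "\<Omega> \<noteq> {}" and S: "\<And>i. i \<in> I \<Longrightarrow> S i \<subseteq> \<Omega>"
    and \<epsilon>: "0 < \<epsilon>" and dense: "\<And>i. i \<in> I \<Longrightarrow> \<epsilon> * real (card \<Omega>) \<le> real (card (S i))"
    and N: "real N \<le> \<epsilon> / 2 * real (card I)"
  shows "\<exists>J\<subseteq>I. card J = N \<and> \<epsilon> / 2 * real (card \<Omega>) \<le> 2 ^ card I * real (card {w\<in>\<Omega>. \<forall>i\<in>J. w \<in> S i})"
proof -
  define cnt where "cnt w = card {i\<in>I. w \<in> S i}" for w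
  define good where "good = {w\<in>\<Omega>. N \<le> cnt w}"
  have fing: "finite good" using fin by (simp add: good_def)
  have cI: "0 < card I" using fin ne by (simp add: card_gt_0_iff)
  have c\<Omega>: "0 < card \<Omega>" using fin ne by (simp add: card_gt_0_iff)
  have "(\<Sum>i\<in>I. card (S i)) = (\<Sum>i\<in>I. card {w\<in>\<Omega>. w \<in> S i})"
    by (rule sum.cong) (use S in \<open>auto intro!: arg_cong[of _ _ card]\<close>)
  also have "\<dots> = (\<Sum>w\<in>\<Omega>. cnt w)"
    unfolding cnt_def by (rule sum_card_swap) (use fin in auto)
  finally have sw: "(\<Sum>i\<in>I. card (S i)) = (\<Sum>w\<in>\<Omega>. cnt w)" .
  have "\<epsilon> * real (card \<Omega>) * real (card I) = (\<Sum>i\<in>I. \<epsilon> * real (card \<Omega>))" by simp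
  also have "\<dots> \<le> (\<Sum>i\<in>I. real (card (S i)))" by (rule sum_mono) (rule dense)
  also have "\<dots> = (\<Sum>w\<in>\<Omega>. real (cnt w))" using sw by (metis of_nat_sum)
  also have "\<dots> \<le> (\<Sum>w\<in>\<Omega>. (if w \<in> good then real (card I) else 0) + real N)"
  proof (rule sum_mono)
    fix w assume "w \<in> \<Omega>"
    have "cnt w \<le> card I" unfolding cnt_def using fin by (intro card_mono) auto
    thus "real (cnt w) \<le> (if w \<in> good then real (card I) else 0) + real N"
      using \<open>w \<in> \<Omega>\<close> by (auto simp: good_def)
  qed
  also have "\<dots> = real (card good) * real (card I) + real (card \<Omega>) * real N"
  proof -
    have "\<Omega> \<inter> good = good" by (auto simp: good_def)
    thus ?thesis using fin by (simp add: sum.distrib sum.If_cases)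
  qed
  also have "\<dots> \<le> real (card good) * real (card I) + real (card \<Omega>) * (\<epsilon> / 2 * real (card I))"
    using N by (intro add_left_mono mult_left_mono) auto
  finally have "(\<epsilon> / 2 * real (card \<Omega>)) * real (card I) \<le> real (card good) * real (card I)"
    by (simp add: algebra_simps)
  hence g: "\<epsilon> / 2 * real (card \<Omega>) \<le> real (card good)" using cI by simp
  hence gpos: "0 < card good" using \<epsilon> c\<Omega> by (smt (verit) divide_pos_pos mult_pos_pos of_nat_0_less_iff)
  define Jf where "Jf w = (SOME J. J \<subseteq> {i\<in>I. w \<in> S i} \<and> card J = N)" for w
  have Jf: "Jf w \<subseteq> {i\<in>I. w \<in> S i} \<and> card (Jf w) = N" if "w \<in> good" for w
  proof -
    have "N \<le> card {i\<in>I. w \<in> S i}" using that by (simp add: good_def cnt_def)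
    from obtain_subset_with_card_n[OF this]
    have "\<exists>J. J \<subseteq> {i\<in>I. w \<in> S i} \<and> card J = N" by blast
    thus ?thesis unfolding Jf_def by (rule someI_ex)
  qed
  have cg: "card good = (\<Sum>J\<in>Pow I. card {w\<in>good. Jf w = J})"
  proof -
    have "good = (\<Union>J\<in>Pow I. {w\<in>good. Jf w = J})" using Jf by blast
    from arg_cong[OF this, of card]
    have "card good = card (\<Union>J\<in>Pow I. {w\<in>good. Jf w = J})" .
    also have "\<dots> = (\<Sum>J\<in>Pow I. card {w\<in>good. Jf w = J})"
      by (rule card_UN_disjoint) (use fin fing in auto)
    finally show ?thesis .
  qed
  have "\<exists>J\<in>Pow I. card good \<le> 2 ^ card I * card {w\<in>good. Jf w = J}"
  proof (rule ccontr)
    assume "\<not> ?thesis"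
    hence lt: "2 ^ card I * card {w\<in>good. Jf w = J} < card good" if "J \<in> Pow I" for J
      using that by (meson not_le)
    have "(\<Sum>J\<in>Pow I. 2 ^ card I * card {w\<in>good. Jf w = J}) < (\<Sum>J\<in>Pow I. card good)"
      by (rule sum_strict_mono) (use fin lt in blast)+
    hence "2 ^ card I * card good < card (Pow I) * card good"
      by (simp add: sum_distrib_left[symmetric] cg[symmetric])
    thus False using fin by (simp add: card_Pow)
  qed
  then obtain J where J: "J \<subseteq> I" "card good \<le> 2 ^ card I * card {w\<in>good. Jf w = J}" by blast
  have "{w\<in>good. Jf w = J} \<noteq> {}" using J(2) gpos by (metis card.empty mult_0_right not_less)
  then obtain w where "w \<in> good" "Jf w = J" by blast
  hence cJ: "card J = N" using Jf by blast
  have "card {w\<in>good. Jf w = J} \<le> card {w\<in>\<Omega>. \<forall>i\<in>J. w \<in> S i}"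
    by (rule card_mono) (use fin Jf in \<open>auto simp: good_def\<close>)
  hence "card good \<le> 2 ^ card I * card {w\<in>\<Omega>. \<forall>i\<in>J. w \<in> S i}" using J(2) by (meson le_trans mult_le_mono2)
  hence "real (card good) \<le> real (2 ^ card I * card {w\<in>\<Omega>. \<forall>i\<in>J. w \<in> S i})" by (rule of_nat_mono)
  hence "real (card good) \<le> 2 ^ card I * real (card {w\<in>\<Omega>. \<forall>i\<in>J. w \<in> S i})" by simp
  thus ?thesis using J(1) cJ g by (intro exI[of _ J]) linarith
qed

section \<open>Degrees into a set and triangles at a vertex\<close>

definition dg :: "'b graph \<Rightarrow> 'b \<Rightarrow> 'b set \<Rightarrow> nat" where
  "dg G v S = card (nbrs G v \<inter> S)"

text \<open>Twice the number of edges inside \<open>S\<close>; keeping the factor avoids division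
  and matches the ordered pairs in \<open>tri\<close>.\<close>

definition ins :: "'b graph \<Rightarrow> 'b set \<Rightarrow> nat" where
  "ins G S = (\<Sum>x\<in>S. dg G x S)"

definition tri :: "'b graph \<Rightarrow> 'b \<Rightarrow> ('b \<times> 'b) set" where
  "tri G u = (SIGMA x:nbrs G u. nbrs G x \<inter> nbrs G u)"

lemma card_tri: "simple_graph G \<Longrightarrow> card (tri G u) = ins G (nbrs G u)"
  unfolding tri_def ins_def dg_def by (subst card_SigmaI) (auto simp: finite_nbrs)

lemma subset_common:
  assumes "finite S" "real q \<le> r" "r \<le> real (card S)"
  shows "\<exists>T\<subseteq>S. card T = q"
proof -
  have "q \<le> card S" using assms by linarith
  from obtain_subset_with_card_n[OF this] show ?thesis by blast
qed

text \<open>Two rounds of \<open>dense_family\<close>. Boundedly many heavy vertices, with their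
  sets of adjacent pairs, give \<open>P\<close> and a dense set \<open>E\<close> of pairs that form
  triangles with all of \<open>P\<close>. Boundedly many long rows of \<open>E\<close> then give
  \<open>Q\<close> and a linear common part, from which \<open>R\<close> is taken.\<close>

lemma dense_triangles_imp_tripartite:
  fixes \<epsilon> :: real
  assumes \<epsilon>: "0 < \<epsilon>" and q: "0 < q"
  obtains N where "\<And>G :: 'b graph. simple_graph G \<Longrightarrow> N \<le> card (verts G) \<Longrightarrow>
      \<epsilon> * card (verts G) \<le> card {u\<in>verts G. \<epsilon> * (real (card (verts G)))\<^sup>2 \<le> ins G (nbrs G u)} \<Longrightarrow>
      \<exists>P Q R. P \<subseteq> verts G \<and> Q \<subseteq> verts G \<and> R \<subseteq> verts G \<and> card P = q \<and> card Q = q \<and> card R = q \<and>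
         (\<forall>x\<in>P. \<forall>y\<in>Q. adj G x y) \<and> (\<forall>x\<in>P. \<forall>y\<in>R. adj G x y) \<and> (\<forall>x\<in>Q. \<forall>y\<in>R. adj G x y)"
proof -
  \<comment> \<open>\<open>M1\<close> and \<open>M2\<close> are the numbers of sets fed into the two
    rounds: just large enough for \<open>q\<close> survivors, and independent of the graph, so that
    the densities \<open>\<epsilon>1\<close>, \<open>\<epsilon>2\<close>, \<open>\<epsilon>3\<close>
    are constants.\<close>
  define M1 where "M1 = nat \<lceil>2 * q / \<epsilon>\<rceil> + 1"
  define \<epsilon>1 where "\<epsilon>1 = \<epsilon> / 2 / 2 ^ M1"
  define \<epsilon>2 where "\<epsilon>2 = \<epsilon>1 / 2"
  define M2 where "M2 = nat \<lceil>2 * q / \<epsilon>2\<rceil> + 1"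
  define \<epsilon>3 where "\<epsilon>3 = \<epsilon>2 / 2 / 2 ^ M2"
  have pos: "0 < \<epsilon>1" "0 < \<epsilon>2" "0 < \<epsilon>3" using \<epsilon> by (auto simp: \<epsilon>1_def \<epsilon>2_def \<epsilon>3_def)
  have M1: "real q \<le> \<epsilon> / 2 * real M1"
  proof -
    have "2 * q / \<epsilon> \<le> real M1" unfolding M1_def by linarith
    thus ?thesis using \<epsilon> by (simp add: field_simps)
  qed
  have M2: "real q \<le> \<epsilon>2 / 2 * real M2"
  proof -
    have "2 * q / \<epsilon>2 \<le> real M2" unfolding M2_def by linarith
    thus ?thesis using pos by (simp add: field_simps)
  qed
  define N where "N = nat \<lceil>M1 / \<epsilon>\<rceil> + nat \<lceil>M2 / \<epsilon>2\<rceil> + nat \<lceil>q / \<epsilon>3\<rceil> + 1"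
  have main: "\<exists>P Q R. P \<subseteq> verts G \<and> Q \<subseteq> verts G \<and> R \<subseteq> verts G \<and> card P = q \<and> card Q = q \<and> card R = q \<and>
         (\<forall>x\<in>P. \<forall>y\<in>Q. adj G x y) \<and> (\<forall>x\<in>P. \<forall>y\<in>R. adj G x y) \<and> (\<forall>x\<in>Q. \<forall>y\<in>R. adj G x y)"
    if G: "simple_graph G" and n: "N \<le> card (verts G)"
      and heavy: "\<epsilon> * card (verts G) \<le> card {u\<in>verts G. \<epsilon> * (real (card (verts G)))\<^sup>2 \<le> ins G (nbrs G u)}"
    for G :: "'b graph"
  proof -
    define V where "V = verts G"
    define n' where "n' = real (card V)"
    have finV: "finite V" using G by (simp add: simple_graph_def V_def)
    have n1: "M1 \<le> \<epsilon> * n'" "M2 \<le> \<epsilon>2 * n'" "q \<le> \<epsilon>3 * n'" "0 < n'"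
    proof -
      have "real N \<le> n'" using n by (simp add: n'_def V_def)
      hence "M1 / \<epsilon> \<le> n'" "M2 / \<epsilon>2 \<le> n'" "q / \<epsilon>3 \<le> n'" "0 < n'" unfolding N_def by linarith+
      thus "M1 \<le> \<epsilon> * n'" "M2 \<le> \<epsilon>2 * n'" "q \<le> \<epsilon>3 * n'" "0 < n'" using pos \<epsilon> by (auto simp: field_simps)
    qed
    have Vne: "V \<noteq> {}" using n1(4) by (auto simp: n'_def)
    define Hv where "Hv = {u\<in>V. \<epsilon> * n'\<^sup>2 \<le> ins G (nbrs G u)}"
    have "\<exists>I\<subseteq>Hv. card I = M1"
      by (rule subset_common[of _ _ "\<epsilon> * n'"]) (use finV n1 heavy in \<open>auto simp: Hv_def n'_def V_def\<close>)
    then obtain I where I: "I \<subseteq> Hv" "card I = M1" by blast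
    have finI: "finite I" and Ine: "I \<noteq> {}" using I(2) by (auto simp: M1_def intro: card_ge_0_finite)
    have cVV: "real (card (V \<times> V)) = n'\<^sup>2" by (simp add: card_cartesian_product n'_def power2_eq_square)
    have tsub: "tri G u \<subseteq> V \<times> V" for u by (auto simp: tri_def nbrs_simps V_def)
    have "\<exists>J\<subseteq>I. card J = q \<and> \<epsilon> / 2 * real (card (V \<times> V)) \<le>
        2 ^ card I * real (card {w\<in>V \<times> V. \<forall>i\<in>J. w \<in> tri G i})"
    proof (rule dense_family)
      show "\<epsilon> * real (card (V \<times> V)) \<le> real (card (tri G i))" if "i \<in> I" for i
        using that I(1) card_tri[OF G, of i] by (auto simp: Hv_def cVV)
    qed (use finI finV Ine Vne tsub \<epsilon> M1 I in auto)
    then obtain P where P: "P \<subseteq> I" "card P = q" and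
      P2: "\<epsilon> / 2 * n'\<^sup>2 \<le> 2 ^ M1 * real (card {w\<in>V \<times> V. \<forall>i\<in>P. w \<in> tri G i})"
      using cVV I(2) by auto
    define E where "E = {w\<in>V \<times> V. \<forall>i\<in>P. w \<in> tri G i}"
    have cE: "\<epsilon>1 * n'\<^sup>2 \<le> card E" using P2 unfolding \<epsilon>1_def E_def by (simp add: field_simps)
    define row where "row x = {y\<in>V. (x, y) \<in> E}" for x
    \<comment> \<open>Rows with at least half of the average density. Short rows hold at most half
      of the guaranteed part of \<open>E\<close>, so many long ones remain.\<close>
    define Big where "Big = {x\<in>V. \<epsilon>2 * n' \<le> card (row x)}"
    have finBig: "finite Big" using finV by (simp add: Big_def)
    have cB: "\<epsilon>2 * n' \<le> card Big"
    proof -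
      have "E = (SIGMA x:V. row x)" by (auto simp: row_def E_def)
      moreover have "card (SIGMA x:V. row x) = (\<Sum>x\<in>V. card (row x))"
        by (rule card_SigmaI) (use finV in \<open>auto simp: row_def\<close>)
      ultimately have "card E = (\<Sum>x\<in>V. card (row x))" by metis
      hence "real (card E) = (\<Sum>x\<in>V. real (card (row x)))" by simp
      also have "\<dots> \<le> (\<Sum>x\<in>V. (if x \<in> Big then n' else 0) + \<epsilon>2 * n')"
      proof (rule sum_mono)
        fix x assume x: "x \<in> V"
        have "card (row x) \<le> card V" unfolding row_def using finV by (intro card_mono) auto
        thus "real (card (row x)) \<le> (if x \<in> Big then n' else 0) + \<epsilon>2 * n'"
          using x pos n1 by (auto simp: Big_def n'_def)
      qed
      also have "\<dots> = real (card Big) * n' + \<epsilon>2 * n' * n'"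
      proof -
        have "V \<inter> Big = Big" by (auto simp: Big_def)
        thus ?thesis using finV by (simp add: sum.distrib sum.If_cases n'_def)
      qed
      finally have "\<epsilon>1 * n'\<^sup>2 \<le> real (card Big) * n' + \<epsilon>2 * n' * n'" using cE by linarith
      hence "(\<epsilon>2 * n') * n' \<le> real (card Big) * n'" unfolding \<epsilon>2_def by (simp add: power2_eq_square algebra_simps)
      thus ?thesis using n1(4) by simp
    qed
    have "\<exists>I\<subseteq>Big. card I = M2"
      by (rule subset_common[of _ _ "\<epsilon>2 * n'"]) (use finBig n1 cB in auto)
    then obtain I2 where I2: "I2 \<subseteq> Big" "card I2 = M2" by blast
    have finI2: "finite I2" and I2ne: "I2 \<noteq> {}" using I2(2) by (auto simp: M2_def intro: card_ge_0_finite)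
    have "\<exists>J\<subseteq>I2. card J = q \<and> \<epsilon>2 / 2 * real (card V) \<le>
        2 ^ card I2 * real (card {w\<in>V. \<forall>i\<in>J. w \<in> row i})"
    proof (rule dense_family)
      show "\<epsilon>2 * real (card V) \<le> real (card (row i))" if "i \<in> I2" for i
        using that I2(1) by (auto simp: Big_def n'_def)
    qed (use finI2 finV I2ne Vne pos M2 I2 in \<open>auto simp: row_def\<close>)
    then obtain Q where Q: "Q \<subseteq> I2" "card Q = q" and
      Q2: "\<epsilon>2 / 2 * n' \<le> 2 ^ M2 * real (card {w\<in>V. \<forall>i\<in>Q. w \<in> row i})"
      using I2(2) by (auto simp: n'_def)
    have "\<epsilon>3 * n' \<le> card {w\<in>V. \<forall>i\<in>Q. w \<in> row i}" using Q2 unfolding \<epsilon>3_def by (simp add: field_simps)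
    hence "\<exists>R\<subseteq>{w\<in>V. \<forall>i\<in>Q. w \<in> row i}. card R = q"
      using n1 finV by (intro subset_common[of _ _ "\<epsilon>3 * n'"]) auto
    then obtain R where R: "R \<subseteq> {w\<in>V. \<forall>i\<in>Q. w \<in> row i}" "card R = q" by blast
    have sub: "P \<subseteq> V" "Q \<subseteq> V" "R \<subseteq> V" using P I Q I2 R by (auto simp: Hv_def Big_def)
    have inE: "(x, y) \<in> tri G u" if "x \<in> Q" "y \<in> R" "u \<in> P" for x y u
      using that R(1) by (auto simp: row_def E_def)
    have ne: "P \<noteq> {}" "Q \<noteq> {}" "R \<noteq> {}" using P(2) Q(2) R(2) q by auto
    have "adj G u x \<and> adj G u y \<and> adj G x y" if "x \<in> Q" "y \<in> R" "u \<in> P" for x y u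
      using inE[OF that] by (auto simp: tri_def nbrs_simps)
    hence "(\<forall>x\<in>P. \<forall>y\<in>Q. adj G x y) \<and> (\<forall>x\<in>P. \<forall>y\<in>R. adj G x y) \<and> (\<forall>x\<in>Q. \<forall>y\<in>R. adj G x y)"
      using ne by blast
    thus ?thesis using sub P(2) Q(2) R(2) unfolding V_def by blast
  qed
  show thesis by (rule that[of N]) (rule main)
qed

text \<open>The part \<open>R\<close> is a hub because \<open>P\<close> consists of common
  neighbours of any two of its vertices. The branch vertices go into \<open>P\<close> and
  \<open>Q\<close>, which see all of \<open>R\<close>.\<close>

lemma (in balloon) embeds_if_tripartite:
  fixes G :: "'b graph"
  assumes G: "simple_graph G" and sub: "P \<subseteq> verts G" "Q \<subseteq> verts G" "R \<subseteq> verts G"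
    and card: "card P = q" "card Q = q" "card R = q"
    and adj: "\<forall>x\<in>P. \<forall>y\<in>Q. adj G x y" "\<forall>x\<in>P. \<forall>y\<in>R. adj G x y" "\<forall>x\<in>Q. \<forall>y\<in>R. adj G x y"
    and q: "qF \<le> q" "card A \<le> q" "card B \<le> q"
  shows "embeds F G"
proof -
  obtain A' where A': "A' \<subseteq> P" "card A' = card A"
    using q(2) card(1) obtain_subset_with_card_n by metis
  obtain B' where B': "B' \<subseteq> Q" "card B' = card B"
    using q(3) card(2) obtain_subset_with_card_n by metis
  have hub: "hub G q R"
    unfolding hub_def
  proof (intro conjI ballI impI)
    show "finite R" using sub(3) G by (auto simp: simple_graph_def intro: finite_subset)
    fix y y' assume "y \<in> R" "y' \<in> R"
    hence "P \<subseteq> nbrs G y \<inter> nbrs G y'" using adj(2) sub by (auto simp: nbrs_simps adj_commute)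
    thus "q \<le> card (nbrs G y \<inter> nbrs G y')"
      using card(1) finite_nbrs[OF G] by (metis card_mono finite_Int)
  qed (use sub card in auto)
  show ?thesis
  proof (rule embeds_if_hub[OF G hub q(1)])
    show "A' \<inter> B' = {}" using A' B' adj(1) adj_verts(3)[OF G] by blast
    show "q \<le> card (nbrs G x \<inter> R)" if "x \<in> A' \<union> B'" for x
    proof -
      have "x \<in> P \<union> Q" using that A' B' by blast
      hence "adj G x y" if "y \<in> R" for y using adj that by blast
      hence "nbrs G x \<inter> R = R" using sub(3) by (auto simp: nbrs_simps)
      thus ?thesis using card by simp
    qed
    show "A' \<subseteq> verts G" "B' \<subseteq> verts G" using A' B' sub by blast+
    show "adj G x y" if "x \<in> A'" "y \<in> B'" for x y using that A' B' adj(1) by blast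
  qed (use A' B' in blast)+
qed

section \<open>Near-bipartite structure\<close>

lemma nbrs_irrefl: "simple_graph G \<Longrightarrow> x \<notin> nbrs G x"
  using adj_verts(3) by (fastforce simp: nbrs_simps)

lemma ins_insert:
  assumes G: "simple_graph G" and S: "finite S" "x \<notin> S" and V: "insert x S \<subseteq> verts G"
  shows "ins G (insert x S) = ins G S + 2 * dg G x S"
proof -
  have dgx: "dg G x (insert x S) = dg G x S"
  proof -
    have "nbrs G x \<inter> insert x S = nbrs G x \<inter> S" using nbrs_irrefl[OF G, of x] by blast
    thus ?thesis by (simp add: dg_def)
  qed
  have dgy: "dg G y (insert x S) = dg G y S + (if adj G x y then 1 else 0)" if "y \<in> S" for y
  proof (cases "adj G x y")
    case True
    have "nbrs G y \<inter> insert x S = insert x (nbrs G y \<inter> S)"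
      using True V by (auto simp: nbrs_simps adj_commute)
    thus ?thesis using True S finite_nbrs[OF G, of y] by (simp add: dg_def)
  next
    case False
    have "nbrs G y \<inter> insert x S = nbrs G y \<inter> S"
      using False by (auto simp: nbrs_simps adj_commute)
    thus ?thesis using False by (simp add: dg_def)
  qed
  have "ins G (insert x S) = dg G x S + (\<Sum>y\<in>S. dg G y S + (if adj G x y then 1 else 0))"
    unfolding ins_def using S dgx dgy by simp
  also have "\<dots> = dg G x S + ins G S + card {y\<in>S. adj G x y}"
    using S by (simp add: sum.distrib ins_def sum.If_cases Int_def)
  also have "{y\<in>S. adj G x y} = nbrs G x \<inter> S" using V by (auto simp: nbrs_simps)
  finally show ?thesis by (simp add: dg_def)
qed

text \<open>A partition with fewest inside edges. Moving one vertex across changes the count by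
  twice the difference of its two degrees, so minimality forbids a vertex with more neighbours in
  its own class.\<close>

lemma max_cut:
  assumes G: "simple_graph G" and X0: "X0 \<subseteq> verts G"
  obtains X where "X \<subseteq> verts G" "ins G X + ins G (verts G - X) \<le> ins G X0 + ins G (verts G - X0)"
     "\<forall>x\<in>X. dg G x X \<le> dg G x (verts G - X)" "\<forall>x\<in>verts G - X. dg G x (verts G - X) \<le> dg G x X"
proof -
  define V where "V = verts G"
  define c where "c X = ins G X + ins G (V - X)" for X
  have finV: "finite V" using G by (simp add: V_def simple_graph_def)
  obtain X where X: "X \<subseteq> V" and Xmin: "\<And>X'. X' \<subseteq> V \<Longrightarrow> c X \<le> c X'"
    using ex_has_least_nat[of "\<lambda>X. X \<subseteq> V" X0 c] X0 unfolding V_def by blast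
  have 1: "dg G x X \<le> dg G x (V - X)" if X: "X \<subseteq> V" and x: "x \<in> X" and min: "c X \<le> c (X - {x})" for X x
  proof -
    have e: "ins G X = ins G (X - {x}) + 2 * dg G x (X - {x})"
      using ins_insert[OF G, of "X - {x}" x] X x finV by (simp add: V_def insert_absorb finite_subset)
    have "V - (X - {x}) = insert x (V - X)" using x X by auto
    hence e': "ins G (V - (X - {x})) = ins G (V - X) + 2 * dg G x (V - X)"
      using ins_insert[OF G, of "V - X" x] X x finV by (auto simp: V_def)
    have "nbrs G x \<inter> (X - {x}) = nbrs G x \<inter> X" using nbrs_irrefl[OF G, of x] by blast
    hence "dg G x (X - {x}) = dg G x X" by (simp add: dg_def)
    thus ?thesis using min e e' by (simp add: c_def)
  qed
  have sym: "c (V - X) = c X" if "X \<subseteq> V" for X using that by (simp add: c_def double_diff add.commute)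
  have "dg G x X \<le> dg G x (V - X)" if "x \<in> X" for x
    using 1[OF X that] Xmin[of "X - {x}"] X by blast
  moreover have "dg G x (V - X) \<le> dg G x X" if "x \<in> V - X" for x
  proof -
    have "c (V - X) \<le> c (V - X - {x})"
    proof -
      have "V - X - {x} \<subseteq> V" by blast
      from Xmin[OF this] show ?thesis using sym[OF X] by simp
    qed
    from 1[OF _ that this] X show ?thesis by (simp add: double_diff)
  qed
  moreover have "c X \<le> c X0" using Xmin X0 V_def by blast
  ultimately show thesis using X that[of X] unfolding c_def V_def by blast
qed

lemma dg_mono: "simple_graph G \<Longrightarrow> S \<subseteq> T \<Longrightarrow> dg G v S \<le> dg G v T"
  unfolding dg_def by (intro card_mono) (auto simp: finite_nbrs)

lemma dg_Un:
  assumes "simple_graph G" "S \<inter> T = {}"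
  shows "dg G v (S \<union> T) = dg G v S + dg G v T"
  unfolding dg_def Int_Un_distrib using assms finite_nbrs[OF assms(1)]
  by (intro card_Un_disjoint) auto

lemma dg_verts: "dg G v (verts G) = card (nbrs G v)"
  unfolding dg_def by (auto intro!: arg_cong[of _ _ card] simp: nbrs_simps)

lemma dg_le_card: "finite S \<Longrightarrow> dg G v S \<le> card S"
  unfolding dg_def by (intro card_mono) auto

text \<open>The classes are the neighbourhood of a light vertex \<open>u\<close> and its complement,
  most of which is the neighbourhood of a light neighbour \<open>v\<close> of \<open>u\<close>. The
  factor 10 is 1 for the first class, 1 for the neighbourhood of \<open>v\<close>, and 8 for the
  pairs meeting the few vertices outside both.\<close>

lemma (in balloon) near_bipartite:
  fixes \<epsilon> :: real
  assumes \<epsilon>: "0 < \<epsilon>" "\<epsilon> \<le> 1 / 4"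
  obtains N where "\<And>G :: 'b graph. simple_graph G \<Longrightarrow> N \<le> card (verts G) \<Longrightarrow> \<not> embeds F G \<Longrightarrow>
     \<forall>v\<in>verts G. card (verts G) \<le> 2 * card (nbrs G v) \<Longrightarrow>
     \<exists>X\<subseteq>verts G. ins G X + ins G (verts G - X) \<le> 10 * \<epsilon> * (real (card (verts G)))\<^sup>2"
proof -
  define q where "q = qF + card A + card B + 1"
  have q0: "0 < q" by (simp add: q_def)
  obtain N where N: "\<And>G :: 'b graph. simple_graph G \<Longrightarrow> N \<le> card (verts G) \<Longrightarrow>
      \<epsilon> * card (verts G) \<le> card {u\<in>verts G. \<epsilon> * (real (card (verts G)))\<^sup>2 \<le> ins G (nbrs G u)} \<Longrightarrow>
      \<exists>P Q R. P \<subseteq> verts G \<and> Q \<subseteq> verts G \<and> R \<subseteq> verts G \<and> card P = q \<and> card Q = q \<and> card R = q \<and>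
         (\<forall>x\<in>P. \<forall>y\<in>Q. adj G x y) \<and> (\<forall>x\<in>P. \<forall>y\<in>R. adj G x y) \<and> (\<forall>x\<in>Q. \<forall>y\<in>R. adj G x y)"
    by (fact dense_triangles_imp_tripartite[OF \<epsilon>(1) q0])
  have main: "\<exists>X\<subseteq>verts G. ins G X + ins G (verts G - X) \<le> 10 * \<epsilon> * (real (card (verts G)))\<^sup>2"
    if G: "simple_graph G" and n: "Suc N \<le> card (verts G)" and free: "\<not> embeds F G"
      and deg: "\<forall>v\<in>verts G. card (verts G) \<le> 2 * card (nbrs G v)" for G :: "'b graph"
  proof -
    define V where "V = verts G"
    define n' where "n' = real (card V)"
    have finV: "finite V" using G by (simp add: V_def simple_graph_def)
    have n0: "0 < n'" using n by (simp add: n'_def V_def)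
    define Hv where "Hv = {u\<in>V. \<epsilon> * n'\<^sup>2 \<le> ins G (nbrs G u)}"
    have light: "card Hv < \<epsilon> * n'"
    proof (rule ccontr)
      assume "\<not> card Hv < \<epsilon> * n'"
      hence "\<exists>P Q R. P \<subseteq> verts G \<and> Q \<subseteq> verts G \<and> R \<subseteq> verts G \<and> card P = q \<and> card Q = q \<and> card R = q \<and>
         (\<forall>x\<in>P. \<forall>y\<in>Q. adj G x y) \<and> (\<forall>x\<in>P. \<forall>y\<in>R. adj G x y) \<and> (\<forall>x\<in>Q. \<forall>y\<in>R. adj G x y)"
        using N[OF G] n by (simp add: Hv_def V_def n'_def)
      moreover have "qF \<le> q" "card A \<le> q" "card B \<le> q" by (auto simp: q_def)
      ultimately show False using embeds_if_tripartite[OF G, where q = q] free by blast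
    qed
    have degV: "n' \<le> 2 * real (card (nbrs G v))" if "v \<in> V" for v
      using deg that unfolding V_def n'_def by (metis of_nat_le_iff of_nat_mult of_nat_numeral)
    have "\<exists>u\<in>V. u \<notin> Hv"
    proof (rule ccontr)
      assume "\<not> (\<exists>u\<in>V. u \<notin> Hv)"
      hence "Hv = V" by (auto simp: Hv_def)
      hence "n' < \<epsilon> * n'" using light by (simp add: n'_def)
      thus False using \<epsilon> n0 by auto
    qed
    then obtain u where u: "u \<in> V" "u \<notin> Hv" by blast
    have uins: "ins G (nbrs G u) < \<epsilon> * n'\<^sup>2" using u by (auto simp: Hv_def)
    define X where "X = nbrs G u"
    have XV: "X \<subseteq> V" by (auto simp: X_def nbrs_simps V_def)
    have finX: "finite X" using XV finV by (rule finite_subset)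
    \<comment> \<open>At least \<open>n' / 4\<close> vertices of \<open>X\<close> are light. If each
      had \<open>4 * \<epsilon> * n'\<close> neighbours in \<open>X\<close>, then \<open>u\<close>
      would not be light.\<close>
    have "\<exists>v\<in>X. v \<notin> Hv \<and> dg G v X < 4 * \<epsilon> * n'"
    proof (rule ccontr)
      assume "\<not> ?thesis"
      hence large: "4 * \<epsilon> * n' \<le> dg G v X" if "v \<in> X - Hv" for v using that by auto
      have "real (card X) - real (card Hv) \<le> real (card (X - Hv))"
        using diff_card_le_card_Diff[of Hv X] finV by (simp add: Hv_def)
      hence "n' / 2 - \<epsilon> * n' \<le> card (X - Hv)" using light degV[OF u(1)] by (simp add: X_def)
      moreover have "n' / 4 \<le> n' / 2 - \<epsilon> * n'" using mult_right_mono[OF \<epsilon>(2), of n'] n0 by simp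
      ultimately have "n' / 4 \<le> card (X - Hv)" by linarith
      hence "(n' / 4) * (4 * \<epsilon> * n') \<le> card (X - Hv) * (4 * \<epsilon> * n')"
        using \<epsilon> n0 by (intro mult_right_mono) auto
      also have "\<dots> = (\<Sum>v\<in>X - Hv. 4 * \<epsilon> * n')" by simp
      also have "\<dots> \<le> (\<Sum>v\<in>X - Hv. real (dg G v X))" by (rule sum_mono) (rule large)
      also have "\<dots> \<le> (\<Sum>v\<in>X. real (dg G v X))" using finX by (intro sum_mono2) auto
      also have "\<dots> = ins G X" by (simp add: ins_def)
      finally show False using uins by (simp add: X_def power2_eq_square mult.left_commute)
    qed
    then obtain v where v: "v \<in> X" "v \<notin> Hv" "dg G v X < 4 * \<epsilon> * n'" by blast
    have vV: "v \<in> V" using v XV by blast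
    have vins: "ins G (nbrs G v) < \<epsilon> * n'\<^sup>2" using v vV by (auto simp: Hv_def)
    define Y1 where "Y1 = nbrs G v - X"
    define Y2 where "Y2 = V - X - Y1"
    have fin: "finite Y1" "finite Y2" using finite_nbrs[OF G] finV by (auto simp: Y1_def Y2_def)
    have YY: "V - X = Y1 \<union> Y2" "Y1 \<inter> Y2 = {}" by (auto simp: Y1_def Y2_def nbrs_simps V_def)
    have cY1: "real (card Y1) = card (nbrs G v) - real (dg G v X)"
    proof -
      have "nbrs G v = Y1 \<union> (nbrs G v \<inter> X)" "Y1 \<inter> (nbrs G v \<inter> X) = {}" by (auto simp: Y1_def)
      hence "card (nbrs G v) = card Y1 + dg G v X"
        unfolding dg_def using fin(1) finX by (metis card_Un_disjoint finite_Int)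
      thus ?thesis by simp
    qed
    have "card V = card X + (card Y1 + card Y2)"
    proof -
      have "V = X \<union> (Y1 \<union> Y2)" "X \<inter> (Y1 \<union> Y2) = {}" using XV YY by blast+
      thus ?thesis using finX fin YY(2) by (simp add: card_Un_disjoint)
    qed
    hence "n' = card X + (card Y1 + real (card Y2))" by (simp add: n'_def)
    \<comment> \<open>Both neighbourhoods have at least \<open>n' / 2\<close> vertices and overlap
      in fewer than \<open>4 * \<epsilon> * n'\<close>, so no more than this many vertices lie
      outside both.\<close>
    hence cY2: "card Y2 \<le> 4 * \<epsilon> * n'"
      using cY1 degV[OF u(1)] degV[OF vV] v(3) unfolding X_def by linarith
    have "ins G (V - X) \<le> ins G (nbrs G v) + 8 * \<epsilon> * n'\<^sup>2"
    proof -
      have dle: "dg G y (V - X) \<le> dg G y Y1 + card Y2" for y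
        unfolding YY(1) dg_Un[OF G YY(2)] using dg_le_card[OF fin(2)] by simp
      have "ins G (V - X) = (\<Sum>y\<in>Y1. dg G y (V - X)) + (\<Sum>y\<in>Y2. dg G y (V - X))"
        unfolding ins_def YY(1) using fin YY(2) by (rule sum.union_disjoint)
      also have "\<dots> \<le> (\<Sum>y\<in>Y1. dg G y Y1 + card Y2) + (\<Sum>y\<in>Y2. card V)"
        by (intro add_mono sum_mono dle order_trans[OF dg_le_card])
          (use finV in \<open>auto intro: card_mono\<close>)
      also have "\<dots> = (\<Sum>y\<in>Y1. dg G y Y1) + card Y1 * card Y2 + card Y2 * card V" by (simp add: sum.distrib)
      also have "(\<Sum>y\<in>Y1. dg G y Y1) \<le> ins G (nbrs G v)"
      proof -
        have "(\<Sum>y\<in>Y1. dg G y Y1) \<le> (\<Sum>y\<in>Y1. dg G y (nbrs G v))"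
          by (intro sum_mono dg_mono G) (auto simp: Y1_def)
        also have "\<dots> \<le> ins G (nbrs G v)" unfolding ins_def
          by (rule sum_mono2) (auto simp: finite_nbrs[OF G] Y1_def)
        finally show ?thesis .
      qed
      also have "card Y1 \<le> card V" using YY(1) finV by (intro card_mono) auto
      finally have "ins G (V - X) \<le> ins G (nbrs G v) + card V * card Y2 + card Y2 * card V" by simp
      hence "real (ins G (V - X)) \<le> real (ins G (nbrs G v) + card V * card Y2 + card Y2 * card V)"
        by (rule of_nat_mono)
      also have "\<dots> = real (ins G (nbrs G v)) + 2 * (n' * real (card Y2))" by (simp add: n'_def)
      also have "n' * real (card Y2) \<le> n' * (4 * \<epsilon> * n')" using cY2 n0 by (intro mult_left_mono) auto
      finally show ?thesis by (simp add: power2_eq_square algebra_simps)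
    qed
    hence "ins G X + ins G (V - X) \<le> 10 * \<epsilon> * n'\<^sup>2" using uins vins unfolding X_def by linarith
    thus ?thesis using XV unfolding V_def n'_def by blast
  qed
  show thesis by (rule that[of "Suc N"]) (rule main)
qed

text \<open>The exceptional set \<^term>\<open>W\<close> consists of the vertices with many neighbours in their own
  class of a maximum cut.\<close>

lemma (in balloon) cleaned_partition:
  fixes \<gamma> :: real
  assumes \<gamma>: "0 < \<gamma>" "\<gamma> \<le> 1"
  obtains N where "\<And>G :: 'b graph. simple_graph G \<Longrightarrow> N \<le> card (verts G) \<Longrightarrow> \<not> embeds F G \<Longrightarrow>
     \<forall>v\<in>verts G. card (verts G) \<le> 2 * card (nbrs G v) \<Longrightarrow>
     \<exists>X Y W. verts G = W \<union> (X \<union> Y) \<and> X \<inter> Y = {} \<and> W \<inter> (X \<union> Y) = {} \<and>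
       (\<forall>x\<in>X. dg G x X \<le> \<gamma> * card (verts G)) \<and> (\<forall>y\<in>Y. dg G y Y \<le> \<gamma> * card (verts G)) \<and>
       (\<forall>x\<in>X. card Y \<le> dg G x Y + 2 * \<gamma> * card (verts G)) \<and>
       (\<forall>y\<in>Y. card X \<le> dg G y X + 2 * \<gamma> * card (verts G)) \<and>
       (\<forall>w\<in>W. \<gamma> / 2 * card (verts G) \<le> dg G w X \<and> \<gamma> / 2 * card (verts G) \<le> dg G w Y) \<and>
       card (verts G) / 2 - \<gamma> * card (verts G) \<le> card X \<and>
       card (verts G) / 2 - \<gamma> * card (verts G) \<le> card Y"
proof -
  \<comment> \<open>Then \<open>10 * \<epsilon>\<close> is \<open>\<gamma>^2 / 2\<close>. A vertex
    of \<open>W\<close> contributes at least \<open>\<gamma> * n'\<close> to the inside sum, so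
    \<open>W\<close> has at most \<open>\<gamma> / 2 * n'\<close> vertices.\<close>
  define \<epsilon> where "\<epsilon> = \<gamma>\<^sup>2 / 20"
  have "\<gamma>\<^sup>2 \<le> 1" using \<gamma> by (simp add: power_le_one)
  hence \<epsilon>: "0 < \<epsilon>" "\<epsilon> \<le> 1 / 4" using \<gamma> by (simp_all add: \<epsilon>_def)
  obtain N where N: "\<And>G :: 'b graph. simple_graph G \<Longrightarrow> N \<le> card (verts G) \<Longrightarrow> \<not> embeds F G \<Longrightarrow>
     \<forall>v\<in>verts G. card (verts G) \<le> 2 * card (nbrs G v) \<Longrightarrow>
     \<exists>X\<subseteq>verts G. ins G X + ins G (verts G - X) \<le> 10 * \<epsilon> * (real (card (verts G)))\<^sup>2"
    by (fact near_bipartite[OF \<epsilon>])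
  have main: "\<exists>X Y W. verts G = W \<union> (X \<union> Y) \<and> X \<inter> Y = {} \<and> W \<inter> (X \<union> Y) = {} \<and>
       (\<forall>x\<in>X. dg G x X \<le> \<gamma> * card (verts G)) \<and> (\<forall>y\<in>Y. dg G y Y \<le> \<gamma> * card (verts G)) \<and>
       (\<forall>x\<in>X. card Y \<le> dg G x Y + 2 * \<gamma> * card (verts G)) \<and>
       (\<forall>y\<in>Y. card X \<le> dg G y X + 2 * \<gamma> * card (verts G)) \<and>
       (\<forall>w\<in>W. \<gamma> / 2 * card (verts G) \<le> dg G w X \<and> \<gamma> / 2 * card (verts G) \<le> dg G w Y) \<and>
       card (verts G) / 2 - \<gamma> * card (verts G) \<le> card X \<and>
       card (verts G) / 2 - \<gamma> * card (verts G) \<le> card Y"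
    if G: "simple_graph G" and n: "Suc N \<le> card (verts G)" and free: "\<not> embeds F G"
      and deg: "\<forall>v\<in>verts G. card (verts G) \<le> 2 * card (nbrs G v)" for G :: "'b graph"
  proof -
    define V where "V = verts G"
    define n' where "n' = real (card V)"
    have finV: "finite V" using G by (simp add: V_def simple_graph_def)
    have n0: "0 < n'" using n by (simp add: n'_def V_def)
    obtain X00 where X00: "X00 \<subseteq> V" "ins G X00 + ins G (V - X00) \<le> 10 * \<epsilon> * n'\<^sup>2"
      using N[OF G] n free deg unfolding V_def n'_def by auto
    obtain X0 where X0: "X0 \<subseteq> V" and c0: "ins G X0 + ins G (V - X0) \<le> ins G X00 + ins G (V - X00)"
      and cut: "\<forall>x\<in>X0. dg G x X0 \<le> dg G x (V - X0)" "\<forall>x\<in>V - X0. dg G x (V - X0) \<le> dg G x X0"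
      unfolding V_def by (fact max_cut[OF G X00(1)[unfolded V_def]])
    define Y0 where "Y0 = V - X0"
    have fin0: "finite X0" "finite Y0" using X0 finV by (auto simp: Y0_def intro: finite_subset)
    have V0: "V = X0 \<union> Y0" "X0 \<inter> Y0 = {}" using X0 by (auto simp: Y0_def)
    have inside: "real (ins G X0) + real (ins G Y0) \<le> \<gamma>\<^sup>2 / 2 * n'\<^sup>2"
      using c0 X00(2) unfolding Y0_def \<epsilon>_def by linarith
    have degV: "n' / 2 \<le> real (dg G v X0) + real (dg G v Y0)" if "v \<in> V" for v
    proof -
      have "dg G v X0 + dg G v Y0 = card (nbrs G v)"
        using dg_Un[OF G V0(2), of v] dg_verts[of G v] V0(1) by (simp add: V_def)
      moreover have "card V \<le> 2 * card (nbrs G v)" using deg that by (simp add: V_def)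
      ultimately show ?thesis unfolding n'_def by linarith
    qed
    have sizes: "n' / 2 - \<gamma> / 2 * n' \<le> card X0 \<and> n' / 2 - \<gamma> / 2 * n' \<le> card Y0 \<and>
        card X0 \<le> n' / 2 + \<gamma> / 2 * n' \<and> card Y0 \<le> n' / 2 + \<gamma> / 2 * n'"
    proof -
      have cV: "n' = real (card X0) + real (card Y0)"
        unfolding n'_def V0(1) using card_Un_disjoint[OF fin0 V0(2)] by simp
      have "n' * (n' / 2) = (\<Sum>v\<in>V. n' / 2)" by (simp add: n'_def)
      also have "\<dots> \<le> (\<Sum>v\<in>V. real (dg G v X0) + real (dg G v Y0))" by (rule sum_mono) (rule degV)
      also have "\<dots> = (\<Sum>v\<in>X0. real (dg G v X0) + real (dg G v Y0)) + (\<Sum>v\<in>Y0. real (dg G v X0) + real (dg G v Y0))"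
        unfolding V0(1) using fin0 V0(2) by (rule sum.union_disjoint)
      also have "\<dots> = real (ins G X0) + real (ins G Y0) + (\<Sum>v\<in>X0. real (dg G v Y0)) + (\<Sum>v\<in>Y0. real (dg G v X0))"
        by (simp add: sum.distrib ins_def)
      also have "(\<Sum>v\<in>X0. real (dg G v Y0)) \<le> (\<Sum>v\<in>X0. real (card Y0))"
        using dg_le_card[OF fin0(2)] by (intro sum_mono) simp
      also have "(\<Sum>v\<in>Y0. real (dg G v X0)) \<le> (\<Sum>v\<in>Y0. real (card X0))"
        using dg_le_card[OF fin0(1)] by (intro sum_mono) simp
      finally have "n' * (n' / 2) \<le> \<gamma>\<^sup>2 / 2 * n'\<^sup>2 + 2 * (real (card X0) * real (card Y0))"
        using inside by simp
      hence main2: "n' * (n' / 2) \<le> \<gamma>\<^sup>2 / 2 * n'\<^sup>2 + 2 * (real (card X0) * real (card Y0))" .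
      \<comment> \<open>The minimum degree forces nearly \<open>n'^2 / 4\<close> crossing pairs, and
        a deviation \<open>z\<close> of a class from half of the vertices costs \<open>z^2\<close>
        of them.\<close>
      define z where "z = real (card X0) - n' / 2"
      have e: "real (card X0) = n' / 2 + z" "real (card Y0) = n' / 2 - z" using cV by (auto simp: z_def)
      have "real (card X0) * real (card Y0) = n'\<^sup>2 / 4 - z\<^sup>2"
        unfolding e by (simp add: power2_eq_square algebra_simps)
      hence "2 * z\<^sup>2 \<le> \<gamma>\<^sup>2 / 2 * n'\<^sup>2" using main2 by (simp add: power2_eq_square)
      hence "z\<^sup>2 \<le> (\<gamma> / 2 * n')\<^sup>2" by (simp add: power_mult_distrib power_divide)
      hence "\<bar>z\<bar> \<le> \<bar>\<gamma> / 2 * n'\<bar>" by (simp only: abs_le_square_iff)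
      also have "\<bar>\<gamma> / 2 * n'\<bar> = \<gamma> / 2 * n'" using \<gamma> n0 by simp
      finally have "z \<le> \<gamma> / 2 * n'" "- z \<le> \<gamma> / 2 * n'" by linarith+
      thus ?thesis using e by linarith
    qed
    define W where "W = {x\<in>X0. \<gamma> * n' \<le> dg G x X0} \<union> {y\<in>Y0. \<gamma> * n' \<le> dg G y Y0}"
    define X where "X = X0 - W"
    define Y where "Y = Y0 - W"
    have finW: "finite W" using fin0 by (simp add: W_def)
    have cW: "card W \<le> \<gamma> / 2 * n'"
    proof -
      define g where "g v = (if v \<in> X0 then real (dg G v X0) else real (dg G v Y0))" for v
      have "real (card W) * (\<gamma> * n') = (\<Sum>v\<in>W. \<gamma> * n')" by simp
      also have "\<dots> \<le> (\<Sum>v\<in>W. g v)" by (rule sum_mono) (use V0(2) in \<open>auto simp: W_def g_def\<close>)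
      also have "\<dots> \<le> (\<Sum>v\<in>X0 \<union> Y0. g v)" using fin0 by (intro sum_mono2) (auto simp: W_def g_def)
      also have "\<dots> = (\<Sum>v\<in>X0. g v) + (\<Sum>v\<in>Y0. g v)" using fin0 V0(2) by (rule sum.union_disjoint)
      also have "(\<Sum>v\<in>X0. g v) = real (ins G X0)" by (simp add: g_def ins_def)
      also have "(\<Sum>v\<in>Y0. g v) = (\<Sum>v\<in>Y0. real (dg G v Y0))"
        by (rule sum.cong) (use V0(2) in \<open>auto simp: g_def\<close>)
      also have "\<dots> = real (ins G Y0)" by (simp add: ins_def)
      finally have "real (card W) * (\<gamma> * n') \<le> (\<gamma> / 2 * n') * (\<gamma> * n')"
        using inside by (simp add: power2_eq_square algebra_simps)
      thus ?thesis using \<gamma> n0 by simp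
    qed
    have dgW: "real (dg G v S0) - \<gamma> / 2 * n' \<le> real (dg G v (S0 - W))" for v S0
    proof -
      have "dg G v S0 \<le> dg G v ((S0 - W) \<union> W)" by (rule dg_mono[OF G]) blast
      also have "\<dots> = dg G v (S0 - W) + dg G v W" by (rule dg_Un[OF G]) blast
      also have "dg G v W \<le> card W" by (rule dg_le_card[OF finW])
      finally show ?thesis using cW by linarith
    qed
    have szW: "real (card S0) - \<gamma> / 2 * n' \<le> real (card (S0 - W))" for S0
    proof -
      have "card S0 - card W \<le> card (S0 - W)" by (rule diff_card_le_card_Diff[OF finW])
      thus ?thesis using cW by linarith
    qed
    have own: "dg G x X0 < \<gamma> * n'" if "x \<in> X" for x using that by (auto simp: X_def W_def)
    have own': "dg G y Y0 < \<gamma> * n'" if "y \<in> Y" for y using that by (auto simp: Y_def W_def)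
    have XV: "X \<subseteq> V" "Y \<subseteq> V" using V0 by (auto simp: X_def Y_def)
    have "verts G = W \<union> (X \<union> Y)" "X \<inter> Y = {}" "W \<inter> (X \<union> Y) = {}"
      using V0 by (auto simp: X_def Y_def W_def V_def)
    moreover have "\<forall>x\<in>X. dg G x X \<le> \<gamma> * n'"
    proof
      fix x assume "x \<in> X"
      have "dg G x X \<le> dg G x X0" by (rule dg_mono[OF G]) (auto simp: X_def)
      thus "dg G x X \<le> \<gamma> * n'" using own[OF \<open>x \<in> X\<close>] by linarith
    qed
    moreover have "\<forall>y\<in>Y. dg G y Y \<le> \<gamma> * n'"
    proof
      fix y assume "y \<in> Y"
      have "dg G y Y \<le> dg G y Y0" by (rule dg_mono[OF G]) (auto simp: Y_def)
      thus "dg G y Y \<le> \<gamma> * n'" using own'[OF \<open>y \<in> Y\<close>] by linarith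
    qed
    moreover have "\<forall>x\<in>X. card Y \<le> dg G x Y + 2 * \<gamma> * n'"
    proof
      fix x assume x: "x \<in> X"
      have "card Y \<le> card Y0" using fin0 by (intro card_mono) (auto simp: Y_def)
      moreover have "n' / 2 \<le> real (dg G x X0) + real (dg G x Y0)" using degV x XV by blast
      moreover have "real (dg G x Y0) - \<gamma> / 2 * n' \<le> real (dg G x Y)" unfolding Y_def by (rule dgW)
      ultimately show "card Y \<le> dg G x Y + 2 * \<gamma> * n'" using own[OF x] sizes by linarith
    qed
    moreover have "\<forall>y\<in>Y. card X \<le> dg G y X + 2 * \<gamma> * n'"
    proof
      fix y assume y: "y \<in> Y"
      have "card X \<le> card X0" using fin0 by (intro card_mono) (auto simp: X_def)
      moreover have "n' / 2 \<le> real (dg G y X0) + real (dg G y Y0)" using degV y XV by blast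
      moreover have "real (dg G y X0) - \<gamma> / 2 * n' \<le> real (dg G y X)" unfolding X_def by (rule dgW)
      ultimately show "card X \<le> dg G y X + 2 * \<gamma> * n'" using own'[OF y] sizes by linarith
    qed
    \<comment> \<open>In a maximum cut a vertex has at least as many neighbours across as in its own
      class, so members of \<open>W\<close> have many on both sides; removing \<open>W\<close>
      itself costs at most half of them.\<close>
    moreover have "\<forall>w\<in>W. \<gamma> / 2 * n' \<le> dg G w X \<and> \<gamma> / 2 * n' \<le> dg G w Y"
    proof
      fix w assume w: "w \<in> W"
      have "\<gamma> * n' \<le> dg G w X0 \<and> \<gamma> * n' \<le> dg G w Y0"
      proof (cases "w \<in> X0")
        case True
        hence "\<gamma> * n' \<le> dg G w X0" using w V0(2) by (auto simp: W_def)
        thus ?thesis using cut(1) True unfolding Y0_def by force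
      next
        case False
        hence wY: "w \<in> Y0" "\<gamma> * n' \<le> dg G w Y0" using w by (auto simp: W_def)
        thus ?thesis using cut(2) unfolding Y0_def by force
      qed
      moreover have "real (dg G w X0) - \<gamma> / 2 * n' \<le> real (dg G w X)" unfolding X_def by (rule dgW)
      moreover have "real (dg G w Y0) - \<gamma> / 2 * n' \<le> real (dg G w Y)" unfolding Y_def by (rule dgW)
      ultimately show "\<gamma> / 2 * n' \<le> dg G w X \<and> \<gamma> / 2 * n' \<le> dg G w Y" by linarith
    qed
    moreover have "n' / 2 - \<gamma> * n' \<le> card X \<and> n' / 2 - \<gamma> * n' \<le> card Y"
      using szW[of X0] szW[of Y0] sizes unfolding X_def Y_def by linarith
    ultimately show ?thesis unfolding n'_def V_def by blast
  qed
  show thesis by (rule that[of "Suc N"]) (rule main)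
qed

text \<open>A union bound: each of the at most \<open>c\<close> vertices excludes at most
  \<open>\<mu>\<close> elements of \<open>Y\<close>.\<close>

lemma rich_if_few_missing:
  fixes \<mu> Q' :: real
  assumes fin: "finite Y" "Y \<subseteq> verts G" and miss: "\<And>v. v \<in> S \<Longrightarrow> card Y \<le> dg G v Y + \<mu>"
    and Q: "Q + c * \<mu> \<le> card Y" and \<mu>: "0 \<le> \<mu>"
  shows "rich G c Q S Y"
  unfolding rich_def
proof (intro allI impI, elim conjE)
  fix T assume T: "T \<subseteq> S" "finite T" "card T \<le> c"
  have "Y \<subseteq> {y\<in>Y. \<forall>v\<in>T. adj G v y} \<union> (\<Union>v\<in>T. Y - nbrs G v)" using fin by (auto simp: nbrs_simps)
  hence "card Y \<le> card ({y\<in>Y. \<forall>v\<in>T. adj G v y} \<union> (\<Union>v\<in>T. Y - nbrs G v))"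
    using fin T by (intro card_mono) auto
  also have "\<dots> \<le> card {y\<in>Y. \<forall>v\<in>T. adj G v y} + card (\<Union>v\<in>T. Y - nbrs G v)" by (rule card_Un_le)
  also have "card (\<Union>v\<in>T. Y - nbrs G v) \<le> (\<Sum>v\<in>T. card (Y - nbrs G v))" using T(2) by (rule card_UN_le)
  finally have "real (card Y) \<le> real (card {y\<in>Y. \<forall>v\<in>T. adj G v y}) + (\<Sum>v\<in>T. real (card (Y - nbrs G v)))"
    unfolding of_nat_sum[symmetric] of_nat_add[symmetric] of_nat_le_iff by simp
  also have "(\<Sum>v\<in>T. real (card (Y - nbrs G v))) \<le> (\<Sum>v\<in>T. \<mu>)"
  proof (rule sum_mono)
    fix v assume "v \<in> T"
    hence "card Y \<le> dg G v Y + \<mu>" using miss T by blast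
    moreover have "card Y = dg G v Y + card (Y - nbrs G v)"
      unfolding dg_def using fin(1) by (metis Int_commute card_Int_Diff)
    ultimately show "real (card (Y - nbrs G v)) \<le> \<mu>" by linarith
  qed
  also have "\<dots> = card T * \<mu>" by simp
  also have "\<dots> \<le> c * \<mu>" using T(3) \<mu> by (intro mult_right_mono) auto
  finally show "Q \<le> card {y\<in>Y. \<forall>v\<in>T. adj G v y}" using Q by linarith
qed

section \<open>The exceptional set\<close>

lemma handshake:
  assumes G: "simple_graph G"
  shows "ins G (verts G) = 2 * card (edges G)"
proof -
  have finE: "finite (edges G)" using G finite_imp_finite_nsets[of "verts G" 2]
    unfolding simple_graph_def by (meson finite_subset)
  have finV: "finite (verts G)" using G by (simp add: simple_graph_def)
  have "ins G (verts G) = (\<Sum>v\<in>verts G. card (nbrs G v))" by (simp add: ins_def dg_verts)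
  also have "\<dots> = card (SIGMA v:verts G. nbrs G v)"
    using finV finite_nbrs[OF G] by (intro card_SigmaI[symmetric]) auto
  also have "(SIGMA v:verts G. nbrs G v) = (\<Union>e\<in>edges G. {p. {fst p, snd p} = e})"
    using adj_verts[OF G] by (auto simp: nbrs_simps adj_def)
  also have "card \<dots> = (\<Sum>e\<in>edges G. card {p. {fst p, snd p} = e})"
  proof (rule card_UN_disjoint)
    show "\<forall>e\<in>edges G. finite {p. {fst p, snd p} = e}"
    proof
      fix e assume "e \<in> edges G"
      hence "finite e" using G by (auto simp: simple_graph_def nsets_def)
      moreover have "{p. {fst p, snd p} = e} \<subseteq> e \<times> e" by auto
      ultimately show "finite {p. {fst p, snd p} = e}" by (meson finite_SigmaI finite_subset)
    qed
  qed (use finE in auto)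
  also have "\<dots> = (\<Sum>e\<in>edges G. 2)"
  proof (rule sum.cong)
    fix e assume "e \<in> edges G"
    hence "card e = 2" using G by (auto simp: simple_graph_def nsets_def)
    then obtain a b where ab: "e = {a, b}" "a \<noteq> b" by (auto simp: card_2_iff)
    have "{p. {fst p, snd p} = e} = {(a, b), (b, a)}"
      using ab by (auto simp: doubleton_eq_iff)
    thus "card {p. {fst p, snd p} = e} = 2" using ab by simp
  qed simp
  finally show ?thesis by simp
qed

lemma sum_dg_swap:
  assumes "simple_graph G" "finite S" "finite T" "S \<subseteq> verts G" "T \<subseteq> verts G"
  shows "(\<Sum>x\<in>S. dg G x T) = (\<Sum>y\<in>T. dg G y S)"
proof -
  have *: "dg G x U = card {y\<in>U. adj G x y}" if "U \<subseteq> verts G" for x U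
    using that unfolding dg_def by (auto intro!: arg_cong[of _ _ card] simp: nbrs_simps)
  show ?thesis unfolding *[OF assms(4)] *[OF assms(5)]
    by (rule sum_card_swap[OF assms(2,3)]) (rule adj_commute)
qed

lemma ins_partition:
  assumes G: "simple_graph G" and V: "verts G = W \<union> (X \<union> Y)" "X \<inter> Y = {}" "W \<inter> (X \<union> Y) = {}"
  shows "ins G (verts G) = ins G W + ins G X + ins G Y + 2 * (\<Sum>x\<in>X. dg G x Y)
    + 2 * (\<Sum>w\<in>W. dg G w X) + 2 * (\<Sum>w\<in>W. dg G w Y)"
proof -
  have fin: "finite W" "finite X" "finite Y" using G V by (auto simp: simple_graph_def)
  have sub: "W \<subseteq> verts G" "X \<subseteq> verts G" "Y \<subseteq> verts G" using V by auto
  have d: "dg G v (verts G) = dg G v W + (dg G v X + dg G v Y)" for v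
    unfolding V(1) dg_Un[OF G V(3)] dg_Un[OF G V(2)] ..
  have "ins G (verts G) = (\<Sum>v\<in>W \<union> (X \<union> Y). dg G v W + (dg G v X + dg G v Y))"
    unfolding ins_def d by (simp add: V(1))
  also have "\<dots> = (\<Sum>v\<in>W. dg G v W + (dg G v X + dg G v Y)) + ((\<Sum>v\<in>X. dg G v W + (dg G v X + dg G v Y))
      + (\<Sum>v\<in>Y. dg G v W + (dg G v X + dg G v Y)))"
    using fin V by (simp add: sum.union_disjoint)
  finally show ?thesis
    using sum_dg_swap[OF G fin(1,2) sub(1,2)] sum_dg_swap[OF G fin(1,3) sub(1,3)]
      sum_dg_swap[OF G fin(2,3) sub(2,3)]
    by (simp add: sum.distrib ins_def)
qed

context balloon
begin

text \<open>With \<open>card B\<close> common neighbours in \<open>X\<close>, the set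
  \<open>J\<close> and these neighbours would be the branch sides of an embedding; all of them see
  the hub \<open>Y\<close>.\<close>

lemma few_common_neighbours:
  fixes G :: "'b graph"
  assumes G: "simple_graph G" and free: "\<not> embeds F G" and V: "verts G = W \<union> (X \<union> Y)"
    and disj: "W \<inter> (X \<union> Y) = {}" and hub: "hub G q Y" and q: "qF \<le> q"
    and W: "\<And>w. w \<in> W \<Longrightarrow> q \<le> dg G w Y" and X: "\<And>x. x \<in> X \<Longrightarrow> q \<le> dg G x Y"
    and J: "J \<subseteq> W" "card J = card A"
  shows "card {x\<in>X. \<forall>w\<in>J. adj G w x} < card B"
proof (rule ccontr)
  assume "\<not> ?thesis"
  hence le: "card B \<le> card {x\<in>X. \<forall>w\<in>J. adj G w x}" by simp
  obtain B' where B': "B' \<subseteq> {x\<in>X. \<forall>w\<in>J. adj G w x}" "card B' = card B" "finite B'"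
    by (fact obtain_subset_with_card_n[OF le])
  have "embeds F G"
  proof (rule embeds_if_hub[OF G hub q])
    have B'X: "B' \<subseteq> X" using B'(1) by auto
    show "J \<subseteq> verts G" unfolding V using J(1) by blast
    show "B' \<subseteq> verts G" unfolding V using B'X by blast
    show "J \<inter> B' = {}" using J(1) B'X disj by blast
    show "card J = card A" "card B' = card B" using J B' by auto
    show "adj G x y" if "x \<in> J" "y \<in> B'" for x y using that B'(1) by blast
    show "q \<le> card (nbrs G x \<inter> Y)" if "x \<in> J \<union> B'" for x
    proof -
      have "x \<in> W \<union> X" using that J(1) B'(1) by blast
      thus ?thesis using W X unfolding dg_def by blast
    qed
  qed
  thus False using free by simp
qed

text \<open>A vertex of \<open>X\<close> with at least \<open>card A\<close> neighbours in
  \<open>W\<close> is a common neighbour of some \<open>J\<close>, so there are at most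
  \<open>2 ^ card W * card B\<close> of these. Every other vertex contributes at most
  \<open>card A - 1\<close>.\<close>

lemma sum_dg_exceptional_le:
  fixes G :: "'b graph"
  assumes G: "simple_graph G" and V: "X \<subseteq> verts G" "W \<subseteq> verts G"
    and s: "1 \<le> card A"
    and few: "\<And>J. J \<subseteq> W \<Longrightarrow> card J = card A \<Longrightarrow> card {x\<in>X. \<forall>w\<in>J. adj G w x} < card B"
  shows "(\<Sum>w\<in>W. dg G w X) \<le> (card A - 1) * card X + 2 ^ card W * card B * card W"
proof -
  have fin: "finite X" "finite W" using G V by (auto simp: simple_graph_def intro: finite_subset)
  define Z where "Z = {x\<in>X. card A \<le> dg G x W}"
  have finZ: "finite Z" using fin by (simp add: Z_def)
  define JJ where "JJ = {J \<in> Pow W. card J = card A}"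
  have finJ: "finite JJ" using fin by (simp add: JJ_def)
  have "Z \<subseteq> (\<Union>J\<in>JJ. {x\<in>X. \<forall>w\<in>J. adj G w x})"
  proof
    fix x assume x: "x \<in> Z"
    hence le: "card A \<le> card (nbrs G x \<inter> W)" by (simp add: Z_def dg_def)
    obtain J where J: "J \<subseteq> nbrs G x \<inter> W" "card J = card A" "finite J"
      by (fact obtain_subset_with_card_n[OF le])
    hence "\<forall>w\<in>J. adj G w x" by (auto simp: nbrs_simps adj_commute)
    moreover have "J \<in> JJ" using J by (auto simp: JJ_def)
    ultimately show "x \<in> (\<Union>J\<in>JJ. {x\<in>X. \<forall>w\<in>J. adj G w x})" using x by (auto simp: Z_def)
  qed
  hence "card Z \<le> card (\<Union>J\<in>JJ. {x\<in>X. \<forall>w\<in>J. adj G w x})" using finJ fin by (intro card_mono) auto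
  also have "\<dots> \<le> (\<Sum>J\<in>JJ. card {x\<in>X. \<forall>w\<in>J. adj G w x})" using finJ by (rule card_UN_le)
  also have "\<dots> \<le> (\<Sum>J\<in>JJ. card B)"
    by (rule sum_mono) (use few in \<open>auto simp: JJ_def intro: less_imp_le\<close>)
  also have "\<dots> = card JJ * card B" by simp
  also have "card JJ \<le> card (Pow W)" using fin by (intro card_mono) (auto simp: JJ_def)
  finally have cZ: "card Z \<le> 2 ^ card W * card B" using fin by (simp add: card_Pow)
  have "(\<Sum>w\<in>W. dg G w X) = (\<Sum>x\<in>X. dg G x W)" using sum_dg_swap[OF G fin(2,1) V(2,1)] .
  also have "\<dots> \<le> (\<Sum>x\<in>X. (card A - 1) + (if x \<in> Z then card W else 0))"
  proof (rule sum_mono)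
    fix x assume "x \<in> X"
    show "dg G x W \<le> (card A - 1) + (if x \<in> Z then card W else 0)"
      using dg_le_card[OF fin(2), of G x] \<open>x \<in> X\<close> s by (auto simp: Z_def)
  qed
  also have "\<dots> = (card A - 1) * card X + card Z * card W"
  proof -
    have "X \<inter> Z = Z" by (auto simp: Z_def)
    thus ?thesis using fin by (simp add: sum.distrib sum.If_cases)
  qed
  also have "card Z * card W \<le> 2 ^ card W * card B * card W" using cZ by (rule mult_le_mono1)
  finally show ?thesis by simp
qed

text \<open>With \<open>W\<close> empty, one whole branch side lies in \<open>X\<close> and the
  other in \<open>Y\<close>. Each of the \<open>card A * card B\<close> pairs then needs a gadget,
  and disjoint inside edges are gadgets.\<close>

lemma no_large_inside_matching:
  fixes G :: "'b graph"
  assumes G: "simple_graph G" and free: "\<not> embeds F G"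
    and XY: "X \<subseteq> verts G" "Y \<subseteq> verts G" "X \<inter> Y = {}"
    and rX: "rich G c Q X Y" and rY: "rich G c Q Y X"
    and c: "card A + card A * card B \<le> c" "2 \<le> c"
    and Q: "qF \<le> Q" "2 * (card A * card B) + card A + card B \<le> Q"
    and \<Gamma>: "finite \<Gamma>" "pairwise_disjoint \<Gamma>"
      "\<And>g. g \<in> \<Gamma> \<Longrightarrow> adj G (fst g) (snd g) \<and> ({fst g, snd g} \<subseteq> X \<or> {fst g, snd g} \<subseteq> Y)"
  shows "card \<Gamma> < card A * card B"
proof (rule ccontr)
  assume "\<not> ?thesis"
  hence le: "card A * card B \<le> card \<Gamma>" by simp
  obtain \<Gamma>' where \<Gamma>': "\<Gamma>' \<subseteq> \<Gamma>" "card \<Gamma>' = card A * card B" "finite \<Gamma>'"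
    by (fact obtain_subset_with_card_n[OF le])
  define V\<Gamma> where "V\<Gamma> = fst ` \<Gamma>' \<union> snd ` \<Gamma>'"
  have finV: "finite V\<Gamma>" using \<Gamma>' by (simp add: V\<Gamma>_def)
  have "card V\<Gamma> \<le> card (fst ` \<Gamma>') + card (snd ` \<Gamma>')" unfolding V\<Gamma>_def by (rule card_Un_le)
  also have "\<dots> \<le> card \<Gamma>' + card \<Gamma>'" using \<Gamma>' by (intro add_mono card_image_le)
  finally have cV: "card V\<Gamma> \<le> 2 * (card A * card B)" using \<Gamma>' by simp
  \<comment> \<open>A gadget edge in \<open>Y\<close> is entered directly from the branch vertex in
    \<open>X\<close>; hence \<open>A1\<close> is chosen among the common neighbours of these first
    ends.\<close>
  define T where "T = fst ` \<Gamma>' \<inter> Y"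
  have "card T \<le> card (fst ` \<Gamma>')" unfolding T_def using \<Gamma>' by (intro card_mono) auto
  also have "\<dots> \<le> card \<Gamma>'" using \<Gamma>' by (intro card_image_le)
  finally have cT: "card T \<le> c" using \<Gamma>' c by linarith
  have "T \<subseteq> Y" "finite T" using \<Gamma>' by (auto simp: T_def)
  hence "Q \<le> card {x\<in>X. \<forall>v\<in>T. adj G v x}" using rY cT unfolding rich_def by blast
  moreover have "card {x\<in>X. \<forall>v\<in>T. adj G v x} - card V\<Gamma> \<le> card ({x\<in>X. \<forall>v\<in>T. adj G v x} - V\<Gamma>)"
    by (rule diff_card_le_card_Diff[OF finV])
  ultimately have le: "card A \<le> card ({x\<in>X. \<forall>v\<in>T. adj G v x} - V\<Gamma>)" using cV Q(2) by linarith
  obtain A1 where A1: "A1 \<subseteq> {x\<in>X. \<forall>v\<in>T. adj G v x} - V\<Gamma>" "card A1 = card A" "finite A1"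
    by (fact obtain_subset_with_card_n[OF le])
  have "embeds F G"
  proof (rule embeds_if_gadgets[where W = "{}" and ?A1.0 = A1 and \<Gamma> = \<Gamma>' and X = X and Y = Y and c = c and Q = Q])
    show "gadget G X Y a g" if "a \<in> A1" "g \<in> \<Gamma>'" for a g
    proof -
      have "fst g \<in> V\<Gamma>" "snd g \<in> V\<Gamma>" using that(2) by (auto simp: V\<Gamma>_def)
      hence ne: "a \<noteq> fst g" "a \<noteq> snd g" using that(1) A1(1) by auto
      have g: "adj G (fst g) (snd g)" "{fst g, snd g} \<subseteq> X \<or> {fst g, snd g} \<subseteq> Y"
        using \<Gamma>(3)[of g] \<Gamma>'(1) that(2) by blast+
      have "adj G a (fst g)" if "fst g \<in> Y"
      proof -
        have "fst g \<in> T" using that \<open>g \<in> \<Gamma>'\<close> by (simp add: T_def)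
        thus ?thesis using A1(1) \<open>a \<in> A1\<close> adj_sym[of G "fst g" a] by blast
      qed
      thus ?thesis using ne g unfolding gadget_def by blast
    qed
    show "{fst g, snd g} \<inter> {fst g', snd g'} = {}" if "g \<in> \<Gamma>'" "g' \<in> \<Gamma>'" "g \<noteq> g'" for g g'
      using that \<Gamma>(2) \<Gamma>'(1) unfolding pairwise_disjoint_def by blast
    show "A1 \<subseteq> X" using A1 by blast
  qed (use G XY rX rY c Q A1 \<Gamma>' in simp_all)
  thus False using free by simp
qed

text \<open>The vertices of a maximum matching of inside edges meet all inside edges. There are at
  most \<open>2 * (card A * card B)\<close> of them, each of inside degree at most \<open>k\<close>,
  and the degree sums count every edge twice.\<close>

lemma inside_edges_le:
  fixes G :: "'b graph"
  assumes G: "simple_graph G" and free: "\<not> embeds F G"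
    and XY: "X \<subseteq> verts G" "Y \<subseteq> verts G" "X \<inter> Y = {}"
    and rX: "rich G c Q X Y" and rY: "rich G c Q Y X"
    and c: "card A + card A * card B \<le> c" "2 \<le> c"
    and Q: "qF \<le> Q" "2 * (card A * card B) + card A + card B \<le> Q"
    and dX: "\<And>x. x \<in> X \<Longrightarrow> dg G x X \<le> k" and dY: "\<And>y. y \<in> Y \<Longrightarrow> dg G y Y \<le> k"
  shows "ins G X + ins G Y \<le> 4 * (card A * card B) * k"
proof -
  have finX: "finite X" and finY: "finite Y" using G XY by (auto simp: simple_graph_def intro: finite_subset)
  define mt where "mt \<Gamma> \<longleftrightarrow> finite \<Gamma> \<and> pairwise_disjoint \<Gamma> \<and>
    (\<forall>g\<in>\<Gamma>. adj G (fst g) (snd g) \<and> ({fst g, snd g} \<subseteq> X \<or> {fst g, snd g} \<subseteq> Y))" for \<Gamma>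
  have "mt {}" by (simp add: mt_def pairwise_disjoint_def)
  moreover have small: "card \<Gamma> < card A * card B" if "mt \<Gamma>" for \<Gamma>
    by (rule no_large_inside_matching[OF G free XY rX rY c Q]) (use that in \<open>auto simp: mt_def\<close>)
  ultimately obtain \<Gamma> where \<Gamma>: "mt \<Gamma>" and \<Gamma>max: "\<And>\<Gamma>'. mt \<Gamma>' \<Longrightarrow> card \<Gamma>' \<le> card \<Gamma>"
    using ex_has_greatest_nat[of mt "{}" card "card A * card B"] by blast
  define VM where "VM = fst ` \<Gamma> \<union> snd ` \<Gamma>"
  have fin\<Gamma>: "finite \<Gamma>" using \<Gamma> by (simp add: mt_def)
  have finVM: "finite VM" using fin\<Gamma> by (simp add: VM_def)
  have "card VM \<le> card (fst ` \<Gamma>) + card (snd ` \<Gamma>)" unfolding VM_def by (rule card_Un_le)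
  also have "\<dots> \<le> card \<Gamma> + card \<Gamma>" using fin\<Gamma> by (intro add_mono card_image_le)
  also have "\<dots> \<le> 2 * (card A * card B)" using small[OF \<Gamma>] by simp
  finally have cVM: "card VM \<le> 2 * (card A * card B)" .
  have hit: "a \<in> VM \<or> b \<in> VM" if ab: "adj G a b" "{a, b} \<subseteq> X \<or> {a, b} \<subseteq> Y" for a b
  proof (rule ccontr)
    assume n: "\<not> (a \<in> VM \<or> b \<in> VM)"
    have VMg: "fst g \<in> VM" "snd g \<in> VM" if "g \<in> \<Gamma>" for g using that by (auto simp: VM_def)
    have new: "(a, b) \<notin> \<Gamma>" using n VMg by fastforce
    have "pairwise_disjoint (insert (a, b) \<Gamma>)"
      by (rule pairwise_disjoint_insert) (use \<Gamma> n VMg in \<open>auto simp: mt_def\<close>)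
    hence "mt (insert (a, b) \<Gamma>)" using \<Gamma> ab by (simp add: mt_def)
    from \<Gamma>max[OF this] show False using new fin\<Gamma> by simp
  qed
  have 1: "ins G S \<le> 2 * (card (VM \<inter> S) * k)"
    if S: "S \<subseteq> verts G" "finite S" "\<And>a b. a \<in> S \<Longrightarrow> b \<in> S \<Longrightarrow> adj G a b \<Longrightarrow> a \<in> VM \<or> b \<in> VM"
      "\<And>x. x \<in> S \<Longrightarrow> dg G x S \<le> k" for S
  proof -
    have "ins G S = (\<Sum>x\<in>S \<inter> VM. dg G x S) + (\<Sum>x\<in>S - VM. dg G x S)"
      unfolding ins_def using S(2) by (rule sum.Int_Diff)
    also have "(\<Sum>x\<in>S - VM. dg G x S) = (\<Sum>x\<in>S - VM. dg G x (S \<inter> VM))"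
    proof (rule sum.cong)
      fix x assume "x \<in> S - VM"
      hence "nbrs G x \<inter> S = nbrs G x \<inter> (S \<inter> VM)" using S(3)[of x] by (auto simp: nbrs_simps)
      thus "dg G x S = dg G x (S \<inter> VM)" by (simp add: dg_def)
    qed simp
    also have "\<dots> = (\<Sum>x\<in>S \<inter> VM. dg G x (S - VM))"
      by (rule sum_dg_swap[OF G]) (use S in auto)
    also have "\<dots> \<le> (\<Sum>x\<in>S \<inter> VM. dg G x S)" by (intro sum_mono dg_mono[OF G]) auto
    also have "(\<Sum>x\<in>S \<inter> VM. dg G x S) \<le> (\<Sum>x\<in>S \<inter> VM. k)" by (rule sum_mono) (use S(4) in auto)
    finally show ?thesis by (simp add: Int_commute)
  qed
  have "ins G X + ins G Y \<le> 2 * (card (VM \<inter> X) * k) + 2 * (card (VM \<inter> Y) * k)"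
    by (intro add_mono 1) (use XY finX finY hit dX dY in auto)
  also have "\<dots> = 2 * ((card (VM \<inter> X) + card (VM \<inter> Y)) * k)" by (simp add: algebra_simps)
  also have "card (VM \<inter> X) + card (VM \<inter> Y) = card (VM \<inter> X \<union> VM \<inter> Y)"
    using finVM XY(3) by (subst card_Un_disjoint) auto
  also have "card (VM \<inter> X \<union> VM \<inter> Y) \<le> card VM" using finVM by (intro card_mono) auto
  also have "card VM \<le> 2 * (card A * card B)" by (rule cVM)
  finally show ?thesis by (simp add: algebra_simps)
qed

end

text \<open>Let \<open>h\<close> be the size of \<open>W\<close> and \<open>DW\<close> the number of
  edges from \<open>W\<close> to the classes. Few vertices see \<open>s\<close> members of
  \<open>W\<close>, so \<open>DW\<close> is at most about \<open>(s - 1) * n'\<close>, and trivially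
  at most \<open>h * n'\<close>. The edge count demands about \<open>(h + s - 1) * n' / 2\<close>.
  The first bound excludes \<open>h \<ge> s\<close>, the second excludes
  \<open>h \<le> s - 2\<close>, each by a margin of about \<open>n' / 2\<close>.\<close>

lemma (in balloon) exceptional_set:
  fixes K :: real and c Q :: nat
  assumes s: "2 \<le> card A" and t: "1 \<le> card B" and c: "card A + card A * card B \<le> c"
    and Q: "qF \<le> Q" "2 * (card A * card B) + card A + card B \<le> Q" and K: "0 \<le> K"
  obtains N where "\<And>G :: 'b graph. simple_graph G \<Longrightarrow> N \<le> card (verts G) \<Longrightarrow> \<not> embeds F G \<Longrightarrow>
     \<forall>v\<in>verts G. card (verts G) \<le> 2 * card (nbrs G v) \<Longrightarrow>
     (real (card (verts G)))\<^sup>2 / 4 + (real (card A) - 1) / 2 * real (card (verts G)) - K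
        \<le> real (card (edges G)) \<Longrightarrow>
     \<exists>X Y W. verts G = W \<union> (X \<union> Y) \<and> X \<inter> Y = {} \<and> W \<inter> (X \<union> Y) = {} \<and> card W = card A - 1 \<and>
       rich G c Q (W \<union> X) Y \<and> rich G c Q (W \<union> Y) X"
proof -
  define s' where "s' = real (card A)"
  define st where "st = real (card A) * real (card B)"
  \<comment> \<open>So small that \<open>c\<close> vertices, each missing
    \<open>3 * st * \<gamma> * n'\<close> of a class, still have linearly many common neighbours
    there.\<close>
  define \<gamma> where "\<gamma> = 1 / (40 * (st * (real c + 1)))"
  \<comment> \<open>With \<open>M\<close> members of \<open>W\<close>, \<open>dense_family\<close>
    yields \<open>card A\<close> of them having linearly many common neighbours in \<open>X\<close>.
    This bounds \<open>card W\<close> independently of the graph.\<close>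
  define M where "M = nat \<lceil>4 * s' / \<gamma>\<rceil> + 1"
  define K1 where "K1 = 2 * (2 ^ M * real (card B) * real M)"
  define K2 where "K2 = K + (real M)\<^sup>2"
  have s2: "2 \<le> s'" using s by (simp add: s'_def)
  have st1: "1 \<le> st" using s t mult_mono[of 1 "real (card A)" 1 "real (card B)"] by (simp add: st_def)
  have c2: "2 \<le> c" using c s by linarith
  have \<gamma>0: "0 < \<gamma>" using st1 by (simp add: \<gamma>_def)
  have stc: "0 < st * (real c + 1)" using st1 by simp
  have st\<gamma>: "st * \<gamma> * (real c + 1) = 1 / 40"
  proof -
    define D where "D = st * (real c + 1)"
    have "st * \<gamma> * (real c + 1) = D * \<gamma>" by (simp add: D_def)
    also have "\<dots> = 1 / 40" using stc unfolding \<gamma>_def D_def[symmetric] by simp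
    finally show ?thesis .
  qed
  have st\<gamma>2: "2 * (st * \<gamma>) \<le> 1 / 60"
  proof -
    have "st * \<gamma> * 3 \<le> st * \<gamma> * (real c + 1)" using c2 st1 \<gamma>0 by (intro mult_left_mono) auto
    thus ?thesis using st\<gamma> by linarith
  qed
  have \<gamma>st: "\<gamma> \<le> st * \<gamma>" using st1 \<gamma>0 by simp
  have cst\<gamma>: "real c * (st * \<gamma>) \<le> 1 / 40"
  proof -
    have "real c * (st * \<gamma>) \<le> st * \<gamma> * (real c + 1)" using st1 \<gamma>0 by (simp add: algebra_simps)
    thus ?thesis using st\<gamma> by linarith
  qed
  have c\<gamma>: "real c * \<gamma> \<le> 1 / 40"
    using order_trans[OF mult_left_mono[OF \<gamma>st, of "real c"] cst\<gamma>] by simp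
  have \<gamma>1: "\<gamma> \<le> 1 / 120" using \<gamma>st st\<gamma>2 by linarith
  have \<gamma>1': "\<gamma> \<le> 1" using \<gamma>1 by linarith
  have M4: "real (card A) \<le> \<gamma> / 2 / 2 * real M"
  proof -
    have "4 * s' / \<gamma> \<le> real M" unfolding M_def by linarith
    thus ?thesis using \<gamma>0 by (simp add: field_simps s'_def)
  qed
  have K10: "0 \<le> K1" by (simp add: K1_def)
  have K20: "0 \<le> K2" using K by (simp add: K2_def)
  obtain N0 where N0: "\<And>G :: 'b graph. simple_graph G \<Longrightarrow> N0 \<le> card (verts G) \<Longrightarrow> \<not> embeds F G \<Longrightarrow>
     \<forall>v\<in>verts G. card (verts G) \<le> 2 * card (nbrs G v) \<Longrightarrow>
     \<exists>X Y W. verts G = W \<union> (X \<union> Y) \<and> X \<inter> Y = {} \<and> W \<inter> (X \<union> Y) = {} \<and>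
       (\<forall>x\<in>X. dg G x X \<le> \<gamma> * card (verts G)) \<and> (\<forall>y\<in>Y. dg G y Y \<le> \<gamma> * card (verts G)) \<and>
       (\<forall>x\<in>X. card Y \<le> dg G x Y + 2 * \<gamma> * card (verts G)) \<and>
       (\<forall>y\<in>Y. card X \<le> dg G y X + 2 * \<gamma> * card (verts G)) \<and>
       (\<forall>w\<in>W. \<gamma> / 2 * card (verts G) \<le> dg G w X \<and> \<gamma> / 2 * card (verts G) \<le> dg G w Y) \<and>
       card (verts G) / 2 - \<gamma> * card (verts G) \<le> card X \<and>
       card (verts G) / 2 - \<gamma> * card (verts G) \<le> card Y"
    by (fact cleaned_partition[OF \<gamma>0 \<gamma>1'])
  define N where "N = N0 + 4 * Q + nat \<lceil>2 * Q / \<gamma>\<rceil> + nat \<lceil>real (card B) * 2 ^ M * 4 / \<gamma>\<rceil> +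
    nat \<lceil>4 * (K1 + K2)\<rceil> + nat \<lceil>K2 / (st * \<gamma>)\<rceil> + 1"
  have main: "\<exists>X Y W. verts G = W \<union> (X \<union> Y) \<and> X \<inter> Y = {} \<and> W \<inter> (X \<union> Y) = {} \<and> card W = card A - 1 \<and>
       rich G c Q (W \<union> X) Y \<and> rich G c Q (W \<union> Y) X"
    if G: "simple_graph G" and n: "N \<le> card (verts G)" and free: "\<not> embeds F G"
      and deg: "\<forall>v\<in>verts G. card (verts G) \<le> 2 * card (nbrs G v)"
      and eG: "(real (card (verts G)))\<^sup>2 / 4 + (real (card A) - 1) / 2 * real (card (verts G)) - K
        \<le> real (card (edges G))" for G :: "'b graph"
  proof -
    define n' where "n' = real (card (verts G))"
    have finV: "finite (verts G)" using G by (simp add: simple_graph_def)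
    have nN: "real N \<le> n'" using n by (simp add: n'_def)
    have big: "4 * real Q \<le> n'" "2 * Q / \<gamma> \<le> n'" "real (card B) * 2 ^ M * 4 / \<gamma> \<le> n'"
      "4 * (K1 + K2) < n'" "K2 / (st * \<gamma>) \<le> n'" "0 < n'"
      using nN K10 K20 unfolding N_def by linarith+
    have big2: "real Q \<le> \<gamma> / 2 * n'" using big(2) \<gamma>0 by (simp add: field_simps)
    have big3: "real (card B) * 2 ^ M \<le> \<gamma> / 2 / 2 * n'" using big(3) \<gamma>0 by (simp add: field_simps)
    have big5: "K2 \<le> st * \<gamma> * n'" using big(5) \<gamma>0 st1 by (simp add: field_simps)
    have "N0 \<le> card (verts G)" using n by (simp add: N_def)
    from N0[OF G this free deg] obtain X Y W where
      V: "verts G = W \<union> (X \<union> Y)" "X \<inter> Y = {}" "W \<inter> (X \<union> Y) = {}"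
      and own: "\<forall>x\<in>X. dg G x X \<le> \<gamma> * n'" "\<forall>y\<in>Y. dg G y Y \<le> \<gamma> * n'"
      and miss: "\<forall>x\<in>X. card Y \<le> dg G x Y + 2 * \<gamma> * n'" "\<forall>y\<in>Y. card X \<le> dg G y X + 2 * \<gamma> * n'"
      and Wsee: "\<forall>w\<in>W. \<gamma> / 2 * n' \<le> dg G w X \<and> \<gamma> / 2 * n' \<le> dg G w Y"
      and sz: "n' / 2 - \<gamma> * n' \<le> card X" "n' / 2 - \<gamma> * n' \<le> card Y"
      unfolding n'_def by (elim exE conjE)
    have fin: "finite W" "finite X" "finite Y" using V(1) finV by auto
    have sub: "W \<subseteq> verts G" "X \<subseteq> verts G" "Y \<subseteq> verts G" unfolding V(1) by auto
    have V': "verts G = W \<union> (Y \<union> X)" "Y \<inter> X = {}" "W \<inter> (Y \<union> X) = {}" using V by auto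
    define h where "h = real (card W)"
    have hn: "n' = h + (real (card X) + real (card Y))"
    proof -
      have "card (verts G) = card W + (card X + card Y)"
        unfolding V(1) using fin V(2,3) by (simp add: card_Un_disjoint)
      thus ?thesis by (simp add: n'_def h_def)
    qed
    have \<gamma>n: "\<gamma> * n' \<le> n' / 120" using mult_right_mono[OF \<gamma>1, of n'] big(6) by simp
    have c\<gamma>n: "real c * (2 * \<gamma> * n') \<le> n' / 20" using mult_right_mono[OF c\<gamma>, of n'] big(6) by simp
    have szQ: "real Q + real c * (2 * \<gamma> * n') \<le> card X" "real Q + real c * (2 * \<gamma> * n') \<le> card Y"
      using c\<gamma>n \<gamma>n sz big(1,6) by linarith+
    have nn2: "0 \<le> 2 * \<gamma> * n'" using \<gamma>0 big(6) by simp
    have rXY: "rich G c Q X Y"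
      by (rule rich_if_few_missing[where \<mu> = "2 * \<gamma> * n'"])
        (use fin sub miss szQ nn2 in auto)
    have rYX: "rich G c Q Y X"
      by (rule rich_if_few_missing[where \<mu> = "2 * \<gamma> * n'"])
        (use fin sub miss szQ nn2 in auto)
    have hX: "hub G Q X" by (rule rich_hub[OF G rXY rYX c2 sub(2,3)])
    have hY: "hub G Q Y" by (rule rich_hub[OF G rYX rXY c2 sub(3,2)])
    have seeW: "Q \<le> dg G w X" "Q \<le> dg G w Y" if "w \<in> W" for w
    proof -
      have "real Q \<le> real (dg G w X)" "real Q \<le> real (dg G w Y)"
        using Wsee that big2 by force+
      thus "Q \<le> dg G w X" "Q \<le> dg G w Y" by linarith+
    qed
    have seeX: "Q \<le> dg G x Y" if "x \<in> X" for x
      using rich_sees[OF rXY _ that sub(3)] c2 by (simp add: dg_def)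
    have seeY: "Q \<le> dg G y X" if "y \<in> Y" for y
      using rich_sees[OF rYX _ that sub(2)] c2 by (simp add: dg_def)
    have few: "card {x\<in>X. \<forall>w\<in>J. adj G w x} < card B" if "J \<subseteq> W" "card J = card A" for J
      by (rule few_common_neighbours[OF G free V(1,3) hY Q(1) seeW(2) seeX that])
    have few': "card {y\<in>Y. \<forall>w\<in>J. adj G w y} < card B" if "J \<subseteq> W" "card J = card A" for J
      by (rule few_common_neighbours[OF G free V'(1,3) hX Q(1) seeW(1) seeY that])
    have WM: "card W < M"
    proof (rule ccontr)
      assume "\<not> card W < M"
      hence le: "M \<le> card W" by simp
      obtain I where I: "I \<subseteq> W" "card I = M" "finite I" by (fact obtain_subset_with_card_n[OF le])
      have Ine: "I \<noteq> {}" using I(2) by (auto simp: M_def)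
      have Vne: "verts G \<noteq> {}" using big(6) by (auto simp: n'_def)
      have "\<exists>J\<subseteq>I. card J = card A \<and> \<gamma> / 2 / 2 * real (card (verts G)) \<le>
          2 ^ card I * real (card {v\<in>verts G. \<forall>w\<in>J. v \<in> nbrs G w \<inter> X})"
      proof (rule dense_family[OF I(3) finV Ine Vne])
        show "\<gamma> / 2 * real (card (verts G)) \<le> real (card (nbrs G w \<inter> X))" if "w \<in> I" for w
          using Wsee that I(1) by (auto simp: n'_def dg_def)
        show "nbrs G w \<inter> X \<subseteq> verts G" for w by (auto simp: nbrs_simps)
      qed (use \<gamma>0 M4 I in auto)
      then obtain J where J: "J \<subseteq> I" "card J = card A"
        "\<gamma> / 2 / 2 * n' \<le> 2 ^ M * real (card {v\<in>verts G. \<forall>w\<in>J. v \<in> nbrs G w \<inter> X})"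
        unfolding n'_def I(2) by (elim exE conjE)
      have "J \<noteq> {}" using J(2) s by auto
      hence "{v\<in>verts G. \<forall>w\<in>J. v \<in> nbrs G w \<inter> X} \<subseteq> {x\<in>X. \<forall>w\<in>J. adj G w x}" by (auto simp: nbrs_simps)
      hence "card {v\<in>verts G. \<forall>w\<in>J. v \<in> nbrs G w \<inter> X} \<le> card {x\<in>X. \<forall>w\<in>J. adj G w x}"
        using fin by (intro card_mono) auto
      also have "\<dots> < card B" using few[of J] J I(1) by blast
      finally have "2 ^ M * real (card {v\<in>verts G. \<forall>w\<in>J. v \<in> nbrs G w \<inter> X}) < 2 ^ M * real (card B)"
        by simp
      moreover have "2 ^ M * real (card B) = real (card B) * 2 ^ M" by simp
      ultimately show False using J(3) big3 by linarith
    qed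
    have A1: "1 \<le> card A" using s by linarith
    define DW where "DW = real (\<Sum>w\<in>W. dg G w X) + real (\<Sum>w\<in>W. dg G w Y)"
    have kk: "real (2 ^ card W * card B * card W) \<le> 2 ^ M * real (card B) * real M"
    proof -
      have "(2::nat) ^ card W \<le> 2 ^ M" using WM by (intro power_increasing) auto
      hence "2 ^ card W * card B * card W \<le> 2 ^ M * card B * M" using WM by (intro mult_mono) auto
      hence "real (2 ^ card W * card B * card W) \<le> real (2 ^ M * card B * M)" by (rule of_nat_mono)
      thus ?thesis by simp
    qed
    have rA1: "real (card A - 1) = s' - 1" using A1 by (simp add: s'_def of_nat_diff)
    have dle: "real (\<Sum>w\<in>W. dg G w S) \<le> (s' - 1) * real (card S) + 2 ^ M * real (card B) * real M"
      if S: "S \<subseteq> verts G" "\<And>J. J \<subseteq> W \<Longrightarrow> card J = card A \<Longrightarrow> card {x\<in>S. \<forall>w\<in>J. adj G w x} < card B" for S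
    proof -
      have "(\<Sum>w\<in>W. dg G w S) \<le> (card A - 1) * card S + 2 ^ card W * card B * card W"
        by (rule sum_dg_exceptional_le[OF G S(1) sub(1) A1 S(2)])
      hence "real (\<Sum>w\<in>W. dg G w S) \<le> real ((card A - 1) * card S + 2 ^ card W * card B * card W)"
        by (rule of_nat_mono)
      also have "\<dots> = (s' - 1) * real (card S) + real (2 ^ card W * card B * card W)"
        unfolding of_nat_add of_nat_mult rA1 ..
      finally show ?thesis using kk by linarith
    qed
    have h0: "0 \<le> h" by (simp add: h_def)
    have "DW \<le> (s' - 1) * real (card X) + (s' - 1) * real (card Y) + K1"
      using dle[OF sub(2) few] dle[OF sub(3) few'] unfolding DW_def K1_def by linarith
    also have "\<dots> = (s' - 1) * (n' - h) + K1" unfolding hn by (simp add: algebra_simps)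
    also have "\<dots> \<le> (s' - 1) * n' + K1" using s2 h0 by (simp add: mult_left_mono)
    finally have up: "DW \<le> (s' - 1) * n' + K1" .
    define k where "k = nat \<lfloor>\<gamma> * n'\<rfloor>"
    have kr: "real k \<le> \<gamma> * n'" using \<gamma>0 big(6) by (simp add: k_def)
    have kX: "dg G x X \<le> k" if "x \<in> X" for x using own(1) that unfolding k_def by (simp add: le_nat_floor)
    have kY: "dg G y Y \<le> k" if "y \<in> Y" for y using own(2) that unfolding k_def by (simp add: le_nat_floor)
    have "ins G X + ins G Y \<le> 4 * (card A * card B) * k"
      by (rule inside_edges_le[OF G free sub(2,3) V(2) rXY rYX c c2 Q kX kY])
    hence "real (ins G X + ins G Y) \<le> real (4 * (card A * card B) * k)" by (rule of_nat_mono)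
    also have "\<dots> = 4 * st * real k" by (simp add: st_def)
    also have "\<dots> \<le> 4 * st * (\<gamma> * n')" using kr st1 by (intro mult_left_mono) auto
    finally have inXY: "real (ins G X) + real (ins G Y) \<le> 4 * (st * \<gamma>) * n'" by (simp add: algebra_simps)
    have st\<gamma>n: "2 * (st * \<gamma>) * n' \<le> n' / 60" using mult_right_mono[OF st\<gamma>2, of n'] big(6) by simp
    have M2: "h\<^sup>2 \<le> (real M)\<^sup>2" using WM by (simp add: h_def)
    have inW: "real (ins G W) \<le> (real M)\<^sup>2"
    proof -
      have "ins G W \<le> (\<Sum>w\<in>W. card W)" unfolding ins_def by (intro sum_mono dg_le_card fin)
      hence "ins G W \<le> card W * card W" by simp
      hence "real (ins G W) \<le> real (card W * card W)" by (rule of_nat_mono)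
      thus ?thesis using M2 by (simp add: h_def power2_eq_square)
    qed
    have XY: "real (\<Sum>x\<in>X. dg G x Y) \<le> n'\<^sup>2 / 4 - h * n' / 2 + (real M)\<^sup>2 / 4"
    proof -
      have "(\<Sum>x\<in>X. dg G x Y) \<le> (\<Sum>x\<in>X. card Y)" by (intro sum_mono dg_le_card fin)
      hence "(\<Sum>x\<in>X. dg G x Y) \<le> card X * card Y" by simp
      hence "real (\<Sum>x\<in>X. dg G x Y) \<le> real (card X * card Y)" by (rule of_nat_mono)
      also have "\<dots> \<le> (real (card X) + real (card Y))\<^sup>2 / 4"
        using zero_le_power2[of "real (card X) - real (card Y)"]
        by (simp add: power2_eq_square algebra_simps)
      also have "real (card X) + real (card Y) = n' - h" using hn by simp
      also have "(n' - h)\<^sup>2 / 4 = n'\<^sup>2 / 4 - h * n' / 2 + h\<^sup>2 / 4"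
        by (simp add: power2_eq_square field_simps)
      finally show ?thesis using M2 by linarith
    qed
    have "2 * card (edges G) = ins G W + ins G X + ins G Y + 2 * (\<Sum>x\<in>X. dg G x Y)
      + 2 * (\<Sum>w\<in>W. dg G w X) + 2 * (\<Sum>w\<in>W. dg G w Y)"
      using handshake[OF G] ins_partition[OF G V] by simp
    from arg_cong[OF this, of real]
    have "2 * real (card (edges G)) = real (ins G W) + real (ins G X) + real (ins G Y)
      + 2 * real (\<Sum>x\<in>X. dg G x Y) + 2 * DW"
      unfolding DW_def of_nat_add of_nat_mult of_nat_numeral by simp
    hence e2: "2 * real (card (edges G)) \<le> 4 * (st * \<gamma>) * n' + n'\<^sup>2 / 2 - h * n' + 3 / 2 * (real M)\<^sup>2 + 2 * DW"
      using inW inXY XY by linarith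
    have eG': "n'\<^sup>2 / 4 + (s' - 1) * n' / 2 - K \<le> real (card (edges G))" using eG by (simp add: n'_def s'_def)
    have M0: "0 \<le> (real M)\<^sup>2" by simp
    \<comment> \<open>The \<open>h\<close> vertices outside the classes reduce the number of
      crossing pairs by about \<open>h * n' / 2\<close>, and the edges at \<open>W\<close> have to
      make up for it.\<close>
    have low: "(h + (s' - 1)) * n' / 2 - 2 * (st * \<gamma>) * n' - K2 \<le> DW"
  proof -
      define P R S m where "P = h * n'" and "R = (s' - 1) * n'" and "S = st * \<gamma> * n'" and "m = (real M)\<^sup>2"
      have "2 * real (card (edges G)) \<le> 4 * S + n'\<^sup>2 / 2 - P + 3 / 2 * m + 2 * DW"
        using e2 by (simp add: P_def S_def m_def)
      moreover have "n'\<^sup>2 / 4 + R / 2 - K \<le> real (card (edges G))" using eG' by (simp add: R_def)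
      moreover have "0 \<le> m" by (simp add: m_def)
      ultimately have "(P + R) / 2 - 2 * S - (K + m) \<le> DW" by (simp add: field_simps)
      thus ?thesis by (simp add: P_def R_def S_def m_def K2_def distrib_right)
    qed
    define hN sN SN where "hN = h * n'" and "sN = s' * n'" and "SN = st * \<gamma> * n'"
    have low2: "hN + sN - n' - 4 * SN - 2 * K2 \<le> 2 * DW"
      using low unfolding hN_def sN_def SN_def by (simp add: field_simps)
    have big4: "4 * K1 + 4 * K2 < n'" using big(4) by simp
    have up2: "DW \<le> sN - n' + K1" using up unfolding sN_def by (simp add: algebra_simps)
    have S2: "2 * SN \<le> n' / 60" using st\<gamma>n by (simp add: SN_def)
    have K5: "K2 \<le> SN" using big5 by (simp add: SN_def)
    have hle: "card W \<le> card A - 1"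
    proof (rule ccontr)
      assume "\<not> ?thesis"
      hence "s' \<le> h" unfolding s'_def h_def by simp
      hence "sN \<le> hN" unfolding sN_def hN_def using big(6) by (intro mult_right_mono) auto
      thus False using low2 up2 S2 big4 big(6) K20 K10 by linarith
    qed
    have dwle: "real (dg G w X) + real (dg G w Y) \<le> n'" for w
    proof -
      have "dg G w X + dg G w Y \<le> card X + card Y" by (intro add_mono dg_le_card fin)
      thus ?thesis using hn h0 by linarith
    qed
    have DWsum: "DW = (\<Sum>w\<in>W. real (dg G w X) + real (dg G w Y))" by (simp add: DW_def sum.distrib)
    have hge: "card A - 1 \<le> card W"
    proof (rule ccontr)
      assume "\<not> ?thesis"
      hence "h \<le> s' - 2" using s unfolding s'_def h_def by linarith
      hence "hN \<le> (s' - 2) * n'" unfolding hN_def using big(6) by (intro mult_right_mono) auto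
      hence 1: "hN \<le> sN - 2 * n'" by (simp add: sN_def algebra_simps)
      have "DW \<le> (\<Sum>w\<in>W. n')" unfolding DWsum by (rule sum_mono) (rule dwle)
      hence "DW \<le> hN" by (simp add: h_def hN_def)
      thus False using low2 1 S2 big4 big(6) K20 K10 by linarith
    qed
    have cW: "card W = card A - 1" using hle hge by simp
    have hs: "h = s' - 1" unfolding h_def cW by (rule rA1)
    \<comment> \<open>With \<open>h = s - 1\<close> the lower bound on \<open>DW\<close> is within
      \<open>3 * SN\<close> of the maximum, so no single member of \<open>W\<close> can miss more
      than that. This is what makes \<open>W\<close> rich along with the classes.\<close>
    have missW: "real (card X) + real (card Y) \<le> real (dg G w X) + real (dg G w Y) + 3 * (st * \<gamma>) * n'"
      if w: "w \<in> W" for w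
    proof -
      have "DW = (real (dg G w X) + real (dg G w Y)) + (\<Sum>v\<in>W - {w}. real (dg G v X) + real (dg G v Y))"
        unfolding DWsum using fin(1) w by (rule sum.remove)
      also have "(\<Sum>v\<in>W - {w}. real (dg G v X) + real (dg G v Y)) \<le> (\<Sum>v\<in>W - {w}. n')"
        by (rule sum_mono) (rule dwle)
      also have "\<dots> = (s' - 2) * n'"
      proof -
        have "card (W - {w}) = card A - 2" using cW fin(1) w by simp
        thus ?thesis using s by (simp add: s'_def of_nat_diff)
      qed
      finally have "DW \<le> (real (dg G w X) + real (dg G w Y)) + (sN - 2 * n')"
        by (simp add: sN_def algebra_simps)
      moreover have "hN = sN - n'" unfolding hN_def sN_def hs by (simp add: algebra_simps)
      moreover have "real (card X) + real (card Y) \<le> n'" using hn h0 by linarith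
      ultimately have "real (card X) + real (card Y) \<le> real (dg G w X) + real (dg G w Y) + 3 * SN"
        using low2 K5 by linarith
      thus ?thesis by (simp add: SN_def)
    qed
    have dX: "real (dg G w X) \<le> card X" "real (dg G w Y) \<le> card Y" for w
      using dg_le_card[OF fin(2), of G w] dg_le_card[OF fin(3), of G w] by auto
    have c3: "real c * (3 * (st * \<gamma>) * n') \<le> 3 / 40 * n'" using mult_right_mono[OF cst\<gamma>, of "3 * n'"] big(6) by (simp add: algebra_simps)
    have \<gamma>3: "2 * \<gamma> * n' \<le> 3 * (st * \<gamma>) * n'"
    proof (rule mult_right_mono)
      show "2 * \<gamma> \<le> 3 * (st * \<gamma>)" using \<gamma>st \<gamma>0 by linarith
    qed (use big(6) in simp)
    have nn: "0 \<le> 3 * (st * \<gamma>) * n'" using st1 \<gamma>0 big(6) by simp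
    have szQ3: "real Q + real c * (3 * (st * \<gamma>) * n') \<le> card X" "real Q + real c * (3 * (st * \<gamma>) * n') \<le> card Y"
      using c3 \<gamma>n sz big(1,6) by linarith+
    have rWX: "rich G c Q (W \<union> X) Y"
    proof (rule rich_if_few_missing[where \<mu> = "3 * (st * \<gamma>) * n'"])
      fix v assume "v \<in> W \<union> X"
      thus "real (card Y) \<le> real (dg G v Y) + 3 * (st * \<gamma>) * n'"
      proof
        assume "v \<in> W" from missW[OF this] dX(1)[of v] show ?thesis by linarith
      next
        assume "v \<in> X" thus ?thesis using miss(1) \<gamma>3 by fastforce
      qed
    qed (use fin sub nn szQ3 in auto)
    have rWY: "rich G c Q (W \<union> Y) X"
    proof (rule rich_if_few_missing[where \<mu> = "3 * (st * \<gamma>) * n'"])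
      fix v assume "v \<in> W \<union> Y"
      thus "real (card X) \<le> real (dg G v X) + 3 * (st * \<gamma>) * n'"
      proof
        assume "v \<in> W" from missW[OF this] dX(2)[of v] show ?thesis by linarith
      next
        assume "v \<in> Y" thus ?thesis using miss(2) \<gamma>3 by fastforce
      qed
    qed (use fin sub nn szQ3 in auto)
    show ?thesis
      by (rule exI[of _ X], rule exI[of _ Y], rule exI[of _ W]) (intro conjI V cW rWX rWY)
  qed
  show thesis by (rule that[of N]) (rule main)
qed

section \<open>Exact structure\<close>

text \<open>Four times a product is the square of the sum minus the square of the difference. For a
  fixed sum the product is therefore maximal exactly when the difference is 0 or 1.\<close>

lemma balanced_product:
  fixes x y :: nat
  defines "p \<equiv> (x + y) div 2" and "q \<equiv> (x + y + 1) div 2"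
  shows "x * y \<le> p * q" and "x * y = p * q \<Longrightarrow> x \<le> y + 1 \<and> y \<le> x + 1"
proof -
  have pq: "p + q = x + y" "q = p \<or> q = p + 1" by (auto simp: p_def q_def)
  have "4 * (int p * int q) = (int p + int q)\<^sup>2 - (int q - int p)\<^sup>2" by (simp add: power2_eq_square algebra_simps)
  moreover have "4 * (int x * int y) = (int x + int y)\<^sup>2 - (int x - int y)\<^sup>2" by (simp add: power2_eq_square algebra_simps)
  moreover have "int p + int q = int x + int y" using pq(1) by linarith
  ultimately have *: "4 * (int p * int q) + (int q - int p)\<^sup>2 = 4 * (int x * int y) + (int x - int y)\<^sup>2" by simp
  have qp: "(int q - int p)\<^sup>2 = 0 \<and> q = p \<or> (int q - int p)\<^sup>2 = 1 \<and> q = p + 1" using pq(2) by auto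
  have xy: "(int x - int y)\<^sup>2 \<ge> 1" if "x \<noteq> y"
  proof -
    have "(int x - int y)\<^sup>2 > 0" using that by simp
    thus ?thesis by linarith
  qed
  have ne: "x \<noteq> y" if "q = p + 1" using that pq(1) by presburger
  have "4 * (int x * int y) \<le> 4 * (int p * int q)"
    using * qp xy ne zero_le_power2[of "int x - int y"] by fastforce
  hence "int (x * y) \<le> int (p * q)" by simp
  thus "x * y \<le> p * q" by linarith
  assume eq: "x * y = p * q"
  hence "int x * int y = int p * int q" by (metis of_nat_mult)
  hence "(int x - int y)\<^sup>2 = (int q - int p)\<^sup>2" using * by simp
  hence "(int x - int y)\<^sup>2 \<le> 1\<^sup>2" using qp by auto
  hence "\<bar>int x - int y\<bar> \<le> \<bar>1\<bar>" by (simp only: abs_le_square_iff)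
  thus "x \<le> y + 1 \<and> y \<le> x + 1" by linarith
qed

text \<open>The claimed extremal number over the naturals: the two integer quotients are floor and
  ceiling, and \<open>3\<close> is added before \<open>3 * t\<close> is subtracted so that nothing
  is truncated.\<close>

definition fex :: "nat \<Rightarrow> nat \<Rightarrow> nat \<Rightarrow> nat" where
  "fex s t n = ((n - s + 1) div 2) * ((n - s + 1 + 1) div 2) + (s - 1) * (n - s + 1) +
     ((s - 1) choose 2) + (t * t + 3 - 3 * t)"

text \<open>The vertex \<open>v\<close> itself is excluded because \<open>S\<close> may contain it,
  as happens for pairs within \<open>W\<close>.\<close>

definition mis :: "'b graph \<Rightarrow> 'b \<Rightarrow> 'b set \<Rightarrow> nat" where
  "mis G v S = card {u\<in>S. u \<noteq> v \<and> \<not> adj G v u}"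

lemma dg_conv: "S \<subseteq> verts G \<Longrightarrow> dg G v S = card {u\<in>S. adj G v u}"
  unfolding dg_def by (auto intro!: arg_cong[of _ _ card] simp: nbrs_simps)

lemma dg_mis:
  assumes G: "simple_graph G" and S: "S \<subseteq> verts G" "finite S"
  shows "dg G v S + mis G v S = card (S - {v})"
proof -
  have "S - {v} = {u\<in>S. adj G v u} \<union> {u\<in>S. u \<noteq> v \<and> \<not> adj G v u}" using adj_verts(3)[OF G] by auto
  hence "card (S - {v}) = card {u\<in>S. adj G v u} + card {u\<in>S. u \<noteq> v \<and> \<not> adj G v u}"
    using S(2) by (simp add: card_Un_disjoint disjoint_iff)
  thus ?thesis by (simp add: dg_conv[OF S(1)] mis_def)
qed

lemma mis_0D: "mis G v S = 0 \<Longrightarrow> finite S \<Longrightarrow> u \<in> S \<Longrightarrow> u \<noteq> v \<Longrightarrow> adj G v u"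
  unfolding mis_def by auto

section \<open>Forbidden configurations inside the classes\<close>

locale structured = balloon A B ps F for A B :: "'a set" and ps F +
  fixes G :: "'b graph" and X Y W :: "'b set" and c Q :: nat
  assumes G: "simple_graph G" and free: "\<not> embeds F G"
    and V: "verts G = W \<union> (X \<union> Y)" "X \<inter> Y = {}" "W \<inter> (X \<union> Y) = {}"
    and s2: "2 \<le> card A" and t3: "3 \<le> card B" and cW: "card W = card A - 1"
    and rX: "rich G c Q (W \<union> X) Y" and rY: "rich G c Q (W \<union> Y) X"
    and c: "card A + card A * card B \<le> c"
    and Q: "qF \<le> Q" "2 * (card A * card B) + card A + card B \<le> Q"
begin

abbreviation "s \<equiv> card A"
abbreviation "t \<equiv> card B"

lemma fin: "finite W" "finite X" "finite Y"
  using G V(1) by (auto simp: simple_graph_def)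

lemma sub: "W \<subseteq> verts G" "X \<subseteq> verts G" "Y \<subseteq> verts G"
  unfolding V(1) by auto

lemma c2: "2 \<le> c" using c s2 by linarith

text \<open>All hypotheses are symmetric in the two classes, so what is shown for \<open>X\<close>
  can be transferred to \<open>Y\<close> by reinterpreting the locale.\<close>

lemma swap: "structured A B ps F G Y X W c Q"
  by unfold_locales (use G free V s2 t3 cW rX rY c Q in auto)

definition L :: "'b \<Rightarrow> 'b \<Rightarrow> bool" where
  "L a b \<longleftrightarrow> adj G a b \<and> (a \<in> X \<and> b \<in> X \<or> a \<in> Y \<and> b \<in> Y)"

definition M :: "'b \<Rightarrow> 'b \<Rightarrow> bool" where
  "M a b \<longleftrightarrow> \<not> adj G a b \<and> (a \<in> X \<and> b \<in> Y \<or> a \<in> Y \<and> b \<in> X)"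

text \<open>\<open>W\<close> together with \<open>a\<close> forms the branch side of size
  \<open>s\<close>. Only \<open>a\<close> needs gadgets, one for each of the \<open>t\<close>
  vertices opposite. For an edge inside \<open>Y\<close> the condition on \<open>M\<close> says that
  \<open>a\<close> is adjacent to its first end.\<close>

lemma star_matching_X:
  assumes a: "a \<in> X" and \<Gamma>: "finite \<Gamma>" "pairwise_disjoint \<Gamma>"
    and g: "\<And>g. g \<in> \<Gamma> \<Longrightarrow> a \<noteq> fst g \<and> a \<noteq> snd g \<and>
          ((fst g = snd g \<and> L a (fst g)) \<or> (L (fst g) (snd g) \<and> \<not> M a (fst g)))"
  shows "card \<Gamma> < t"
proof (rule ccontr)
  assume "\<not> ?thesis"
  hence le: "t \<le> card \<Gamma>" by simp
  obtain \<Gamma>' where \<Gamma>': "\<Gamma>' \<subseteq> \<Gamma>" "card \<Gamma>' = t" "finite \<Gamma>'" by (fact obtain_subset_with_card_n[OF le])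
  have "embeds F G"
  proof (rule embeds_if_gadgets[where W = W and ?A1.0 = "{a}" and \<Gamma> = \<Gamma>' and X = X and Y = Y and c = c and Q = Q])
    show "gadget G X Y a' g" if "a' \<in> {a}" "g \<in> \<Gamma>'" for a' g
    proof -
      have "g \<in> \<Gamma>" using that(2) \<Gamma>'(1) by blast
      from assms(4)[OF this] show ?thesis
        using that(1) a V(2) unfolding gadget_def L_def M_def by blast
    qed
    show "{fst g, snd g} \<inter> {fst g', snd g'} = {}" if "g \<in> \<Gamma>'" "g' \<in> \<Gamma>'" "g \<noteq> g'" for g g'
      using that \<Gamma>(2) \<Gamma>'(1) unfolding pairwise_disjoint_def by blast
    show "card W + card {a} = card A" using cW s2 by simp
  qed (use G sub V rX rY c c2 Q a \<Gamma>' fin in auto)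
  thus False using free by simp
qed

lemma LM_swap: "structured.L G Y X = L" "structured.M G Y X = M"
proof -
  interpret sw: structured A B ps F G Y X W c Q by (rule swap)
  show "structured.L G Y X = L" unfolding sw.L_def L_def by (intro ext) auto
  show "structured.M G Y X = M" unfolding sw.M_def M_def by (intro ext) auto
qed

lemma star_matching:
  assumes a: "a \<in> X \<union> Y" and \<Gamma>: "finite \<Gamma>" "pairwise_disjoint \<Gamma>"
    and g: "\<And>g. g \<in> \<Gamma> \<Longrightarrow> a \<noteq> fst g \<and> a \<noteq> snd g \<and>
          ((fst g = snd g \<and> L a (fst g)) \<or> (L (fst g) (snd g) \<and> \<not> M a (fst g)))"
  shows "card \<Gamma> < t"
proof (cases "a \<in> X")
  case True
  thus ?thesis using star_matching_X \<Gamma> g by blast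
next
  case False
  hence aY: "a \<in> Y" using a by simp
  interpret sw: structured A B ps F G Y X W c Q by (rule swap)
  show ?thesis using sw.star_matching_X[OF aY \<Gamma>] g unfolding LM_swap by blast
qed

text \<open>Richness provides a vertex \<open>a\<close> of \<open>X\<close> off the matching that is
  adjacent to all its first ends in \<open>Y\<close>; with this \<open>a\<close> every matching edge
  is a gadget.\<close>

lemma matching:
  assumes \<Gamma>: "finite \<Gamma>" "pairwise_disjoint \<Gamma>" and g: "\<And>g. g \<in> \<Gamma> \<Longrightarrow> L (fst g) (snd g)"
  shows "card \<Gamma> < t"
proof (rule ccontr)
  assume "\<not> ?thesis"
  hence le: "t \<le> card \<Gamma>" by simp
  obtain \<Gamma>' where \<Gamma>': "\<Gamma>' \<subseteq> \<Gamma>" "card \<Gamma>' = t" "finite \<Gamma>'" by (fact obtain_subset_with_card_n[OF le])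
  define V\<Gamma> where "V\<Gamma> = fst ` \<Gamma>' \<union> snd ` \<Gamma>'"
  have finV: "finite V\<Gamma>" using \<Gamma>' by (simp add: V\<Gamma>_def)
  have "card V\<Gamma> \<le> card (fst ` \<Gamma>') + card (snd ` \<Gamma>')" unfolding V\<Gamma>_def by (rule card_Un_le)
  also have "\<dots> \<le> card \<Gamma>' + card \<Gamma>'" using \<Gamma>' by (intro add_mono card_image_le)
  finally have cV: "card V\<Gamma> \<le> 2 * t" using \<Gamma>' by simp
  define T where "T = fst ` \<Gamma>' \<inter> Y"
  have "card T \<le> card (fst ` \<Gamma>')" unfolding T_def using \<Gamma>' by (intro card_mono) auto
  also have "\<dots> \<le> card \<Gamma>'" using \<Gamma>' by (intro card_image_le)
  finally have "card T \<le> t" using \<Gamma>' by simp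
  also have tst: "t \<le> s * t" using s2 by simp
  finally have cT: "card T \<le> c" using c by linarith
  have "T \<subseteq> W \<union> Y" "finite T" using \<Gamma>' by (auto simp: T_def)
  hence "Q \<le> card {x\<in>X. \<forall>v\<in>T. adj G v x}" using rY cT unfolding rich_def by blast
  moreover have "card {x\<in>X. \<forall>v\<in>T. adj G v x} - card V\<Gamma> \<le> card ({x\<in>X. \<forall>v\<in>T. adj G v x} - V\<Gamma>)"
    by (rule diff_card_le_card_Diff[OF finV])
  ultimately have "0 < card ({x\<in>X. \<forall>v\<in>T. adj G v x} - V\<Gamma>)" using cV Q(2) tst s2 by linarith
  hence "{x\<in>X. \<forall>v\<in>T. adj G v x} - V\<Gamma> \<noteq> {}" by (metis card.empty less_irrefl)
  then obtain a where a: "a \<in> {x\<in>X. \<forall>v\<in>T. adj G v x} - V\<Gamma>" by blast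
  have "card \<Gamma>' < t"
  proof (rule star_matching_X)
    show "a \<in> X" using a by simp
    show "pairwise_disjoint \<Gamma>'" using \<Gamma>(2) \<Gamma>'(1) unfolding pairwise_disjoint_def by blast
    fix h assume h: "h \<in> \<Gamma>'"
    have "a \<noteq> fst h \<and> a \<noteq> snd h" using h a unfolding V\<Gamma>_def by blast
    moreover have "L (fst h) (snd h)" using g h \<Gamma>'(1) by blast
    moreover have "\<not> M a (fst h)"
    proof
      assume M: "M a (fst h)"
      hence "fst h \<in> Y" using a V(2) by (auto simp: M_def)
      hence "fst h \<in> T" using h by (simp add: T_def)
      hence "adj G (fst h) a" using a by blast
      thus False using M adj_sym[of G "fst h" a] by (auto simp: M_def)
    qed
    ultimately show "a \<noteq> fst h \<and> a \<noteq> snd h \<and>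
          ((fst h = snd h \<and> L a (fst h)) \<or> (L (fst h) (snd h) \<and> \<not> M a (fst h)))" by blast
  qed (use \<Gamma>' in simp)
  thus False using \<Gamma>' by simp
qed

text \<open>All vertices of \<open>W \<union> X\<close> see the hub \<open>Y\<close>, so such a
  complete bipartite graph extends to the odd-ballooning without gadgets. This is the other type of
  placement.\<close>

lemma no_complete_bipartite:
  assumes A': "A' \<subseteq> W \<union> X" "card A' = s" and B': "B' \<subseteq> W \<union> X" "card B' = t" and disj: "A' \<inter> B' = {}"
    and adj: "\<And>x y. x \<in> A' \<Longrightarrow> y \<in> B' \<Longrightarrow> adj G x y"
  shows False
proof -
  have r2: "rich G c Q X Y" "rich G c Q Y X" using rX rY by (auto intro: rich_subset)
  have hY: "hub G Q Y" by (rule rich_hub[OF G r2(2,1) c2 sub(3,2)])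
  have "embeds F G"
  proof (rule embeds_if_hub[OF G hY Q(1)])
    show "A' \<subseteq> verts G" "B' \<subseteq> verts G" using A'(1) B'(1) sub by blast+
    show "Q \<le> card (nbrs G x \<inter> Y)" if "x \<in> A' \<union> B'" for x
    proof -
      have "x \<in> W \<union> X" using that A'(1) B'(1) by blast
      thus ?thesis using rich_sees[OF rX _ _ sub(3)] c2 by simp
    qed
  qed (use A' B' disj adj in auto)
  thus False using free by simp
qed

section \<open>Exact edge count in terms of missing pairs\<close>

definition mW where "mW = (\<Sum>w\<in>W. mis G w W)"
definition mWX where "mWX = (\<Sum>w\<in>W. mis G w X)"
definition mWY where "mWY = (\<Sum>w\<in>W. mis G w Y)"
definition mXY where "mXY = (\<Sum>x\<in>X. mis G x Y)"
definition imb where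
  "imb = ((card X + card Y) div 2) * ((card X + card Y + 1) div 2) - card X * card Y"

lemma card_verts: "card (verts G) - s + 1 = card X + card Y"
proof -
  have "card (verts G) = card W + (card X + card Y)"
    unfolding V(1) using fin V(2,3) by (simp add: card_Un_disjoint)
  moreover have "Q \<le> card Y" using rX[unfolded rich_def, rule_format, of "{}"] by simp
  hence "1 \<le> card Y" using Q(2) s2 by linarith
  ultimately show ?thesis using cW s2 by linarith
qed

text \<open>Everything is doubled so that degree sums appear. \<open>mW\<close> sees each missing
  pair from both ends, whereas \<open>mWX\<close>, \<open>mWY\<close> and \<open>mXY\<close> see it
  once and get a factor 2. Read as a balance: the inside edges pay for
  \<open>t * t - 3 * t + 3\<close>, for the surplus \<open>exc\<close>, for every missing pair and
  for the imbalance of the classes.\<close>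

lemma edge_count:
  assumes "card (edges G) = fex s t (card (verts G)) + exc"
  shows "ins G X + ins G Y + 6 * t = 2 * t * t + 6 + 2 * exc + mW + 2 * mWX + 2 * mWY + 2 * mXY + 2 * imb"
proof -
  have dis: "S - {v} = S" if "v \<notin> S" for v :: 'b and S using that by simp
  have e1: "(\<Sum>w\<in>W. dg G w X) + mWX = (s - 1) * card X"
  proof -
    have "(\<Sum>w\<in>W. dg G w X) + mWX = (\<Sum>w\<in>W. card X)"
      unfolding mWX_def sum.distrib[symmetric]
      by (rule sum.cong) (use dg_mis[OF G sub(2) fin(2)] V(3) in \<open>auto simp: dis disjoint_iff\<close>)
    thus ?thesis by (simp add: cW)
  qed
  have e2: "(\<Sum>w\<in>W. dg G w Y) + mWY = (s - 1) * card Y"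
  proof -
    have "(\<Sum>w\<in>W. dg G w Y) + mWY = (\<Sum>w\<in>W. card Y)"
      unfolding mWY_def sum.distrib[symmetric]
      by (rule sum.cong) (use dg_mis[OF G sub(3) fin(3)] V(3) in \<open>auto simp: dis disjoint_iff\<close>)
    thus ?thesis by (simp add: cW)
  qed
  have e3: "(\<Sum>x\<in>X. dg G x Y) + mXY = card X * card Y"
  proof -
    have "(\<Sum>x\<in>X. dg G x Y) + mXY = (\<Sum>x\<in>X. card Y)"
      unfolding mXY_def sum.distrib[symmetric]
      by (rule sum.cong) (use dg_mis[OF G sub(3) fin(3)] V(2) in \<open>auto simp: dis disjoint_iff\<close>)
    thus ?thesis by simp
  qed
  have e4: "ins G W + mW = (s - 1) * (s - 2)"
  proof -
    have "ins G W + mW = (\<Sum>w\<in>W. s - 2)"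
      unfolding mW_def ins_def sum.distrib[symmetric]
      by (rule sum.cong) (use dg_mis[OF G sub(1) fin(1)] fin(1) cW in auto)
    thus ?thesis by (simp add: cW)
  qed
  have e5: "2 * ((s - 1) choose 2) = (s - 1) * (s - 2)"
  proof -
    have eq: "s - 1 - 1 = s - 2" by simp
    have "even ((s - 1) * (s - 1 - 1))" by simp
    thus ?thesis unfolding choose_two eq by (rule dvd_mult_div_cancel)
  qed
  have e6: "card X * card Y + imb = ((card X + card Y) div 2) * ((card X + card Y + 1) div 2)"
    using balanced_product(1)[of "card X" "card Y"] by (simp add: imb_def)
  have "3 * t \<le> t * t" using t3 by simp
  hence e7: "t * t + 3 - 3 * t + 3 * t = t * t + 3" by linarith
  define P where "P = ((card X + card Y) div 2) * ((card X + card Y + 1) div 2)"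
  have "card (edges G) = P + (s - 1) * (card X + card Y) + ((s - 1) choose 2) + (t * t + 3 - 3 * t) + exc"
    using assms unfolding fex_def card_verts P_def .
  hence "card (edges G) = P + ((s - 1) * card X + (s - 1) * card Y) + ((s - 1) choose 2) + (t * t + 3 - 3 * t) + exc"
    by (simp add: distrib_left)
  moreover have "2 * card (edges G) = ins G W + ins G X + ins G Y + 2 * (\<Sum>x\<in>X. dg G x Y)
      + 2 * (\<Sum>w\<in>W. dg G w X) + 2 * (\<Sum>w\<in>W. dg G w Y)"
    using handshake[OF G] ins_partition[OF G V] by simp
  moreover have "2 * t * t = 2 * (t * t)" by simp
  ultimately show ?thesis using e1 e2 e3 e4 e5 e6[folded P_def] e7 by linarith
qed

lemma sum_L: "(\<Sum>a\<in>X \<union> Y. card {b\<in>X \<union> Y. L a b}) = ins G X + ins G Y"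
proof -
  have "card {b\<in>X \<union> Y. L a b} = dg G a X" if "a \<in> X" for a
  proof -
    have "{b\<in>X \<union> Y. L a b} = {b\<in>X. adj G a b}" using that V(2) by (auto simp: L_def)
    thus ?thesis by (simp add: dg_conv[OF sub(2)])
  qed
  moreover have "card {b\<in>X \<union> Y. L a b} = dg G a Y" if "a \<in> Y" for a
  proof -
    have "{b\<in>X \<union> Y. L a b} = {b\<in>Y. adj G a b}" using that V(2) by (auto simp: L_def)
    thus ?thesis by (simp add: dg_conv[OF sub(3)])
  qed
  ultimately show ?thesis
    using sum.union_disjoint[OF fin(2,3) V(2), of "\<lambda>a. card {b\<in>X \<union> Y. L a b}"] by (simp add: ins_def)
qed

lemma sum_M: "(\<Sum>a\<in>X \<union> Y. card {b\<in>X \<union> Y. M a b}) = 2 * mXY"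
proof -
  have 1: "card {b\<in>X \<union> Y. M a b} = card {b\<in>Y. \<not> adj G a b}" if "a \<in> X" for a
    using that V(2) by (auto simp: M_def intro!: arg_cong[of _ _ card])
  have 2: "card {b\<in>X \<union> Y. M a b} = card {b\<in>X. \<not> adj G a b}" if "a \<in> Y" for a
    using that V(2) by (auto simp: M_def intro!: arg_cong[of _ _ card])
  have 3: "mXY = (\<Sum>a\<in>X. card {b\<in>Y. \<not> adj G a b})"
    unfolding mXY_def mis_def by (rule sum.cong) (use V(2) in \<open>auto intro!: arg_cong[of _ _ card]\<close>)
  have 4: "(\<Sum>a\<in>X. card {b\<in>Y. \<not> adj G a b}) = (\<Sum>b\<in>Y. card {a\<in>X. \<not> adj G b a})"
    by (rule sum_card_swap) (use fin adj_commute[of G] in auto)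
  have "(\<Sum>a\<in>X \<union> Y. card {b\<in>X \<union> Y. M a b}) =
      (\<Sum>a\<in>X. card {b\<in>X \<union> Y. M a b}) + (\<Sum>a\<in>Y. card {b\<in>X \<union> Y. M a b})"
    using fin V(2) by (intro sum.union_disjoint) auto
  thus ?thesis using 1 2 3 4 by simp
qed

lemma degree_L_le: "a \<in> X \<union> Y \<Longrightarrow> card {b\<in>X \<union> Y. L a b} \<le> t - 1"
proof -
  assume a: "a \<in> X \<union> Y"
  have "\<not> L a a" using adj_verts(3)[OF G, of a a] unfolding L_def by blast
  hence "card ((\<lambda>b. (b, b)) ` {b\<in>X \<union> Y. L a b}) < t"
    by (intro star_matching[OF a]) (use fin in \<open>auto simp: pairwise_disjoint_def\<close>)
  thus ?thesis by (simp add: card_image inj_on_def)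
qed

text \<open>Otherwise every net inside degree is at most \<open>t - 2\<close>, and inside edges
  minus missing cross pairs number at most \<open>(t - 1) * (t - 2)\<close>, which is one short of
  \<open>t * t - 3 * t + 3\<close>.\<close>

lemma ex_full_vertex:
  assumes "card (edges G) = fex s t (card (verts G)) + exc"
  shows "\<exists>v\<in>X \<union> Y. card {b\<in>X \<union> Y. L v b} = t - 1 \<and> card {b\<in>X \<union> Y. M v b} = 0"
proof (rule ccontr)
  assume n: "\<not> ?thesis"
  have D: "card {b\<in>X \<union> Y. L a b} \<le> t - 2 + card {b\<in>X \<union> Y. M a b}" if a: "a \<in> X \<union> Y" for a
  proof (rule ccontr)
    assume "\<not> ?thesis"
    hence "card {b\<in>X \<union> Y. L a b} = t - 1 \<and> card {b\<in>X \<union> Y. M a b} = 0"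
      using degree_L_le[OF a] t3 by linarith
    thus False using n a by blast
  qed
  have "(\<Sum>a\<in>X \<union> Y. card {b\<in>X \<union> Y. L a b}) \<le> (\<Sum>a\<in>X \<union> Y. card {b\<in>X \<union> Y. M a b}) + 2 * ((t - 1) * (t - 2))"
  proof (rule sum_degrees_le_if_net_degrees_small[OF _ t3])
    show "finite (X \<union> Y)" using fin by simp
    show "L b a" if "L a b" for a b using that adj_sym[of G a b] unfolding L_def by blast
    show "\<not> L a a" for a using adj_verts(3)[OF G, of a a] unfolding L_def by blast
    show "\<not> M a a" for a using V(2) unfolding M_def by blast
    show "a \<in> X \<union> Y \<and> b \<in> X \<union> Y" if "L a b" for a b using that unfolding L_def by blast
    show "card \<Gamma> < t" if "a \<in> X \<union> Y" "finite \<Gamma>" "\<And>g. g \<in> \<Gamma> \<Longrightarrow> a \<noteq> fst g \<and> a \<noteq> snd g \<and>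
          ((fst g = snd g \<and> L a (fst g)) \<or> (L (fst g) (snd g) \<and> \<not> M a (fst g)))"
        "pairwise_disjoint \<Gamma>" for a \<Gamma>
      by (rule star_matching[OF that(1,2,4,3)])
    show "card \<Gamma> < t" if "finite \<Gamma>" "\<And>g. g \<in> \<Gamma> \<Longrightarrow> L (fst g) (snd g)" "pairwise_disjoint \<Gamma>" for \<Gamma>
      by (rule matching[OF that(1,3,2)])
    show "card {b\<in>X \<union> Y. L a b} \<le> t - 2 + card {b\<in>X \<union> Y. M a b}" if "a \<in> X \<union> Y" for a
      by (rule D[OF that])
  qed
  hence "ins G X + ins G Y \<le> 2 * mXY + 2 * ((t - 1) * (t - 2))" by (simp only: sum_L sum_M)
  moreover have "2 * ((t - 1) * (t - 2)) + 6 * t = 2 * t * t + 4"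
  proof -
    obtain k where "t = k + 3" using t3 by (metis add.commute le_Suc_ex)
    thus ?thesis by (simp add: algebra_simps)
  qed
  ultimately show False using edge_count[OF assms] by linarith
qed

text \<open>One vertex \<open>w1\<close> of \<open>W\<close> joins \<open>R\<close> and the other
  \<open>s - 2\<close> join \<open>P\<close>, giving sides of sizes \<open>t\<close> and
  \<open>s\<close>. Nothing is missing within \<open>W\<close> or between \<open>W\<close> and
  \<open>X\<close>, so any such split is complete.\<close>

lemma no_complete_bipartite_2:
  assumes zero: "mW = 0" "mWX = 0" and P: "P \<subseteq> X" "card P = 2" and R: "R \<subseteq> X" "card R = t - 1"
    and disj: "P \<inter> R = {}" and adj: "\<And>p r. p \<in> P \<Longrightarrow> r \<in> R \<Longrightarrow> adj G p r"
  shows False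
proof -
  have "W \<noteq> {}" using cW s2 by auto
  then obtain w1 where w1: "w1 \<in> W" by blast
  have WX: "w \<notin> X" if "w \<in> W" for w using that V(3) by blast
  have adjWX: "adj G w x" if "w \<in> W" "x \<in> X" for w x
  proof -
    have "mis G w X = 0" using zero(2) that(1) fin(1) by (simp add: mWX_def)
    thus ?thesis using mis_0D fin(2) that WX by metis
  qed
  have adjWW: "adj G w w'" if "w \<in> W" "w' \<in> W" "w' \<noteq> w" for w w'
  proof -
    have "mis G w W = 0" using zero(1) that(1) fin(1) by (simp add: mW_def)
    thus ?thesis using mis_0D fin(1) that by metis
  qed
  have finPR: "finite P" "finite R" using P R fin(2) finite_subset by blast+
  have nw: "w \<notin> P" "w \<notin> R" if "w \<in> W" for w using WX[OF that] P R by blast+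
  show False
  proof (rule no_complete_bipartite[of "P \<union> (W - {w1})" "insert w1 R"])
    show "P \<union> (W - {w1}) \<subseteq> W \<union> X" "insert w1 R \<subseteq> W \<union> X" using P R w1 by blast+
    have "card (P \<union> (W - {w1})) = card P + card (W - {w1})"
      using finPR fin(1) nw by (intro card_Un_disjoint) auto
    thus "card (P \<union> (W - {w1})) = s" using P(2) w1 fin(1) cW s2 by simp
    show "card (insert w1 R) = t" using finPR nw w1 R(2) t3 by simp
    show "(P \<union> (W - {w1})) \<inter> insert w1 R = {}" using disj nw w1 by blast
    fix x y assume "x \<in> P \<union> (W - {w1})" "y \<in> insert w1 R"
    then consider "x \<in> P" "y = w1" | "x \<in> P" "y \<in> R" | "x \<in> W" "x \<noteq> w1" "y = w1" | "x \<in> W" "y \<in> R" by blast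
    thus "adj G x y"
    proof cases
      case 1 thus ?thesis using adjWX[OF w1, of x] P adj_sym[of G w1 x] by blast
    next
      case 2 thus ?thesis by (rule adj)
    next
      case 3 thus ?thesis using adjWW w1 by metis
    next
      case 4 thus ?thesis using adjWX R by blast
    qed
  qed
qed

text \<open>Here \<^term>\<open>U\<close> and \<^term>\<open>N\<close> are the classes of the bipartite graph inside \<^term>\<open>X\<close>. The
  embedding puts \<^term>\<open>w1\<close> and \<^term>\<open>N\<close> on one side, and the other good vertices of \<^term>\<open>W\<close>
  and full vertices of \<^term>\<open>U\<close> on the other side.\<close>

lemma non_edges_ge:
  assumes U: "U \<subseteq> X" "card U = t - 1" and N: "N \<subseteq> X" "card N = t - 1" and disj: "U \<inter> N = {}" and w1: "w1 \<in> W"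
  shows "t - 2 \<le> (\<Sum>u\<in>U. mis G u N) + mis G w1 U + mis G w1 W + (\<Sum>w\<in>W - {w1}. mis G w N)"
proof (rule ccontr)
  assume lt: "\<not> ?thesis"
  \<comment> \<open>A vertex can be placed opposite to \<open>insert w1 N\<close> if it is adjacent
    to \<open>w1\<close> and to all of \<open>N\<close>. \<open>U1\<close> and \<open>WA\<close>
    collect these vertices in \<open>U\<close> and in \<open>W\<close>, and every unusable vertex
    accounts for at least one non-edge in the sum.\<close>
  define U1 where "U1 = {u\<in>U. mis G u N = 0 \<and> adj G w1 u}"
  define Wb where "Wb = {w\<in>W - {w1}. mis G w N \<noteq> 0 \<or> \<not> adj G w1 w}"
  define WA where "WA = W - {w1} - Wb"
  have finU: "finite U" and finN: "finite N" using U N fin(2) finite_subset by blast+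
  have WX: "w \<notin> X" if "w \<in> W" for w using that V(3) by blast
  have "U \<subseteq> U1 \<union> ({u\<in>U. mis G u N \<noteq> 0} \<union> {u\<in>U. u \<noteq> w1 \<and> \<not> adj G w1 u})"
    using U(1) WX[OF w1] by (auto simp: U1_def)
  hence "card U \<le> card (U1 \<union> ({u\<in>U. mis G u N \<noteq> 0} \<union> {u\<in>U. u \<noteq> w1 \<and> \<not> adj G w1 u}))"
    using finU by (intro card_mono) (auto simp: U1_def)
  also have "\<dots> \<le> card U1 + card ({u\<in>U. mis G u N \<noteq> 0} \<union> {u\<in>U. u \<noteq> w1 \<and> \<not> adj G w1 u})"
    by (rule card_Un_le)
  also have "card ({u\<in>U. mis G u N \<noteq> 0} \<union> {u\<in>U. u \<noteq> w1 \<and> \<not> adj G w1 u}) \<le>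
      card {u\<in>U. mis G u N \<noteq> 0} + mis G w1 U"
    unfolding mis_def[of G w1] by (rule card_Un_le)
  also have "card {u\<in>U. mis G u N \<noteq> 0} \<le> (\<Sum>u\<in>U. mis G u N)"
  proof -
    have "card {u\<in>U. mis G u N \<noteq> 0} = (\<Sum>u\<in>{u\<in>U. mis G u N \<noteq> 0}. 1)" by simp
    also have "\<dots> \<le> (\<Sum>u\<in>{u\<in>U. mis G u N \<noteq> 0}. mis G u N)" by (rule sum_mono) auto
    also have "\<dots> \<le> (\<Sum>u\<in>U. mis G u N)" using finU by (intro sum_mono2) auto
    finally show ?thesis .
  qed
  finally have cU: "card U \<le> card U1 + ((\<Sum>u\<in>U. mis G u N) + mis G w1 U)" by simp
  have "card Wb \<le> card {w\<in>W - {w1}. mis G w N \<noteq> 0} + mis G w1 W"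
  proof -
    have "Wb = {w\<in>W - {w1}. mis G w N \<noteq> 0} \<union> {w\<in>W. w \<noteq> w1 \<and> \<not> adj G w1 w}" by (auto simp: Wb_def)
    hence "card Wb = card ({w\<in>W - {w1}. mis G w N \<noteq> 0} \<union> {w\<in>W. w \<noteq> w1 \<and> \<not> adj G w1 w})"
      by (rule arg_cong)
    also have "\<dots> \<le> card {w\<in>W - {w1}. mis G w N \<noteq> 0} + mis G w1 W"
      unfolding mis_def[of G w1] by (rule card_Un_le)
    finally show ?thesis .
  qed
  also have "card {w\<in>W - {w1}. mis G w N \<noteq> 0} \<le> (\<Sum>w\<in>W - {w1}. mis G w N)"
  proof -
    have "card {w\<in>W - {w1}. mis G w N \<noteq> 0} = (\<Sum>w\<in>{w\<in>W - {w1}. mis G w N \<noteq> 0}. 1)" by simp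
    also have "\<dots> \<le> (\<Sum>w\<in>{w\<in>W - {w1}. mis G w N \<noteq> 0}. mis G w N)" by (rule sum_mono) auto
    also have "\<dots> \<le> (\<Sum>w\<in>W - {w1}. mis G w N)" using fin(1) by (intro sum_mono2) auto
    finally show ?thesis .
  qed
  finally have cWb: "card Wb \<le> (\<Sum>w\<in>W - {w1}. mis G w N) + mis G w1 W" by simp
  have "card Wb \<le> card (W - {w1})" using fin(1) by (intro card_mono) (auto simp: Wb_def)
  moreover have "card (W - {w1}) = s - 2" using w1 fin(1) cW by simp
  moreover have "card WA = card (W - {w1}) - card Wb"
    unfolding WA_def using fin(1) by (intro card_Diff_subset) (auto simp: Wb_def)
  ultimately have cWA: "card WA + card Wb = s - 2" by linarith
  \<comment> \<open>Each unusable vertex of \<open>W\<close> is replaced by one more full row from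
    \<open>U\<close>: the sizes \<open>2 + card Wb\<close> and \<open>s - 2 - card Wb\<close> add up
    to \<open>s\<close>.\<close>
  have le: "2 + card Wb \<le> card U1" using lt cU cWb U(2) by linarith
  obtain P where P: "P \<subseteq> U1" "card P = 2 + card Wb" "finite P" by (fact obtain_subset_with_card_n[OF le])
  have PU: "P \<subseteq> U" using P(1) by (auto simp: U1_def)
  show False
  proof (rule no_complete_bipartite[of "P \<union> WA" "insert w1 N"])
    show "P \<union> WA \<subseteq> W \<union> X" "insert w1 N \<subseteq> W \<union> X" using PU U(1) N(1) w1 by (auto simp: WA_def)
    have WAP: "P \<inter> WA = {}" using PU U(1) WX by (auto simp: WA_def)
    thus "card (P \<union> WA) = s"
      using P cWA s2 fin(1) by (subst card_Un_disjoint) (auto simp: WA_def)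
    have w1N: "w1 \<notin> N" using WX[OF w1] N(1) by blast
    thus "card (insert w1 N) = t" using finN N(2) t3 by simp
    have "P \<inter> N = {}" "w1 \<notin> P" "WA \<inter> N = {}" "w1 \<notin> WA"
      using PU disj U(1) N(1) WX w1 by (auto simp: WA_def)
    thus "(P \<union> WA) \<inter> insert w1 N = {}" by blast
    fix x y assume "x \<in> P \<union> WA" "y \<in> insert w1 N"
    then consider "x \<in> P" "y = w1" | "x \<in> P" "y \<in> N" | "x \<in> WA" "y = w1" | "x \<in> WA" "y \<in> N" by blast
    thus "adj G x y"
    proof cases
      case 1 thus ?thesis using P(1) adj_sym[of G w1 x] by (auto simp: U1_def)
    next
      case 2
      have "mis G x N = 0" using 2(1) P(1) by (auto simp: U1_def)
      moreover have "y \<noteq> x" using 2 PU disj by blast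
      ultimately show ?thesis using mis_0D finN 2(2) by metis
    next
      case 3 thus ?thesis using adj_sym[of G w1 x] by (auto simp: WA_def Wb_def)
    next
      case 4
      have "mis G x N = 0" "x \<in> W" using 4(1) by (auto simp: WA_def Wb_def)
      moreover have "y \<noteq> x" using \<open>x \<in> W\<close> 4(2) N(1) WX by blast
      ultimately show ?thesis using mis_0D finN 4(2) by metis
    qed
  qed
qed

end

lemma adj_if_sum_mis_0:
  assumes "(\<Sum>w\<in>S. mis G w T) = 0" "finite S" "finite T" "w \<in> S" "x \<in> T" "x \<noteq> w"
  shows "adj G w x"
proof -
  have "mis G w T = 0" using assms(1,2,4) by simp
  thus ?thesis using mis_0D assms(3,5,6) by metis
qed

context structured
begin

text \<open>Each \<open>u\<close> other than \<open>u0\<close> misses exactly one vertex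
  \<open>\<phi> u\<close> of \<open>N\<close>. As each vertex of \<open>N\<close> misses at most one
  of \<open>U\<close>, \<open>\<phi>\<close> is injective, and by counting it maps onto
  \<open>N - {v0}\<close>. The missing pairs are thus the matching removed in \<open>H\<close>, with
  index 1 kept for the full vertices \<open>u0\<close> and \<open>v0\<close>.\<close>

lemma is_Gst_if_matching:
  assumes U: "U \<subseteq> X" "card U = t - 1" and N: "N \<subseteq> X" "card N = t - 1" and disj: "U \<inter> N = {}"
    and bip: "\<And>a b. a \<in> X \<Longrightarrow> b \<in> X \<Longrightarrow> adj G a b \<Longrightarrow> a \<in> U \<and> b \<in> N \<or> a \<in> N \<and> b \<in> U"
    and Y: "\<And>a b. a \<in> Y \<Longrightarrow> b \<in> Y \<Longrightarrow> \<not> adj G a b"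
    and zero: "mW = 0" "mWX = 0" "mWY = 0" "mXY = 0" "imb = 0"
    and u0: "u0 \<in> U" "mis G u0 N = 0" and u1: "\<And>u. u \<in> U \<Longrightarrow> u \<noteq> u0 \<Longrightarrow> mis G u N = 1"
    and v0: "v0 \<in> N" "mis G v0 U = 0" and v1: "\<And>v. v \<in> N \<Longrightarrow> v \<noteq> v0 \<Longrightarrow> mis G v U = 1"
  shows "is_Gst s t (card (verts G)) G"
proof -
  have finU: "finite U" and finN: "finite N" using U N fin(2) finite_subset by blast+
  define Qe where "Qe = {{a, b} | a b. a \<in> U \<and> b \<in> N \<and> adj G a b}"
  define QQ where "QQ = (U \<union> N, Qe)"
  have "\<exists>b. b \<in> N \<and> \<not> adj G u b \<and> (\<forall>b'. b' \<in> N \<and> \<not> adj G u b' \<longrightarrow> b' = b)" if u: "u \<in> U" "u \<noteq> u0" for u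
  proof -
    have "card {b\<in>N. b \<noteq> u \<and> \<not> adj G u b} = 1" using u1[OF u] by (simp add: mis_def)
    then obtain b where b: "{b\<in>N. b \<noteq> u \<and> \<not> adj G u b} = {b}" by (rule card_1_singletonE)
    have "b' \<noteq> u" if "b' \<in> N" for b' using that u(1) disj by blast
    thus ?thesis using b by blast
  qed
  then obtain \<phi> where \<phi>: "\<And>u. u \<in> U \<Longrightarrow> u \<noteq> u0 \<Longrightarrow> \<phi> u \<in> N \<and> \<not> adj G u (\<phi> u) \<and>
      (\<forall>b'. b' \<in> N \<and> \<not> adj G u b' \<longrightarrow> b' = \<phi> u)" by metis
  have \<phi>N: "\<phi> u \<in> N" and \<phi>na: "\<not> adj G u (\<phi> u)" if "u \<in> U" "u \<noteq> u0" for u using \<phi>[OF that] by blast+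
  have \<phi>un: "b = \<phi> u" if "u \<in> U" "u \<noteq> u0" "b \<in> N" "\<not> adj G u b" for u b using \<phi>[OF that(1,2)] that(3,4) by blast
  have full_u0: "adj G u0 b" if "b \<in> N" for b
    using mis_0D[OF u0(2) finN that] that u0(1) disj by blast
  have full_v0: "adj G a v0" if "a \<in> U" for a
    using mis_0D[OF v0(2) finU that] that v0(1) disj adj_sym[of G v0 a] by blast
  have \<phi>v0: "\<phi> u \<noteq> v0" if "u \<in> U" "u \<noteq> u0" for u using \<phi>na[OF that] full_v0[OF that(1)] by metis
  have inj: "inj_on \<phi> (U - {u0})"
  proof (rule inj_onI)
    fix u u' assume uu: "u \<in> U - {u0}" "u' \<in> U - {u0}" "\<phi> u = \<phi> u'"
    have "card {a\<in>U. a \<noteq> \<phi> u \<and> \<not> adj G (\<phi> u) a} = 1"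
      using v1[of "\<phi> u"] \<phi>N[of u] \<phi>v0[of u] uu by (simp add: mis_def)
    then obtain a where a: "{a\<in>U. a \<noteq> \<phi> u \<and> \<not> adj G (\<phi> u) a} = {a}" by (rule card_1_singletonE)
    have U': "u \<in> U" "u \<noteq> u0" "u' \<in> U" "u' \<noteq> u0" using uu by auto
    have "\<phi> u \<notin> U" using \<phi>N[OF U'(1,2)] disj by blast
    hence "\<phi> u \<noteq> u" "\<phi> u \<noteq> u'" using U' by auto
    moreover have "\<not> adj G (\<phi> u) u" using \<phi>na[OF U'(1,2)] adj_sym[of G "\<phi> u" u] by blast
    moreover have "\<not> adj G (\<phi> u) u'"
      unfolding uu(3) using \<phi>na[OF U'(3,4)] adj_sym[of G "\<phi> u'" u'] by blast
    ultimately have "u \<in> {a\<in>U. a \<noteq> \<phi> u \<and> \<not> adj G (\<phi> u) a}" "u' \<in> {a\<in>U. a \<noteq> \<phi> u \<and> \<not> adj G (\<phi> u) a}"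
      using U' by auto
    from this[unfolded a] show "u = u'" by simp
  qed
  have im\<phi>: "\<phi> ` (U - {u0}) = N - {v0}"
  proof (rule card_subset_eq)
    show "\<phi> ` (U - {u0}) \<subseteq> N - {v0}" using \<phi>N \<phi>v0 by blast
    show "card (\<phi> ` (U - {u0})) = card (N - {v0})"
      using card_image[OF inj] finU finN u0(1) v0(1) U(2) N(2) by simp
  qed (use finN in simp)
  have "card {2..t - 1} = card (U - {u0})" using finU u0(1) U(2) by simp
  then obtain h where h: "bij_betw h {2..t - 1} (U - {u0})"
    using finite_same_card_bij[of "{2..t - 1}" "U - {u0}"] finU by auto
  define u where "u i = (if i = 1 then u0 else h i)" for i :: nat
  define v where "v i = (if i = 1 then v0 else \<phi> (h i))" for i :: nat
  have ins1: "{1..t - 1} = insert 1 {2..t - 1}" using t3 by auto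
  have hU: "h i \<in> U - {u0}" if "i \<in> {2..t - 1}" for i using h that by (auto simp: bij_betw_def)
  have imh: "h ` {2..t - 1} = U - {u0}" using h by (simp add: bij_betw_def)
  have imu: "u ` {1..t - 1} = U"
  proof -
    have "u ` {2..t - 1} = h ` {2..t - 1}" by (rule image_cong) (auto simp: u_def)
    moreover have "u 1 = u0" by (simp add: u_def)
    ultimately show ?thesis unfolding ins1 image_insert using u0(1) imh by auto
  qed
  have imv: "v ` {1..t - 1} = N"
  proof -
    have "v ` {2..t - 1} = \<phi> ` h ` {2..t - 1}" unfolding image_image by (rule image_cong) (auto simp: v_def)
    moreover have "v 1 = v0" by (simp add: v_def)
    ultimately show ?thesis unfolding ins1 image_insert using v0(1) imh im\<phi> by auto
  qed
  have H: "is_H t QQ"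
    unfolding is_H_def Let_def
  proof (intro exI conjI)
    show "inj_on u {1..t - 1}" by (rule eq_card_imp_inj_on) (use imu U(2) in auto)
    show "inj_on v {1..t - 1}" by (rule eq_card_imp_inj_on) (use imv N(2) in auto)
    show "u ` {1..t - 1} \<inter> v ` {1..t - 1} = {}" unfolding imu imv by (rule disj)
    have "Qe = {{a, b} |a b. a \<in> U \<and> b \<in> N} - {{u i, v i} |i. i \<in> {2..t - 1}}"
    proof (intro equalityI subsetI)
      fix e assume "e \<in> Qe"
      then obtain a b where e: "e = {a, b}" "a \<in> U" "b \<in> N" "adj G a b" by (auto simp: Qe_def)
      have "e \<notin> {{u i, v i} |i. i \<in> {2..t - 1}}"
      proof
        assume "e \<in> {{u i, v i} |i. i \<in> {2..t - 1}}"
        then obtain i where i: "i \<in> {2..t - 1}" "e = {u i, v i}" by blast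
        have "u i = h i" "v i = \<phi> (h i)" using i(1) by (auto simp: u_def v_def)
        moreover have "h i \<in> U" "\<phi> (h i) \<in> N" "\<not> adj G (h i) (\<phi> (h i))" using hU[OF i(1)] \<phi>N \<phi>na by auto
        ultimately show False using e i(2) disj by (auto simp: doubleton_eq_iff)
      qed
      thus "e \<in> {{a, b} |a b. a \<in> U \<and> b \<in> N} - {{u i, v i} |i. i \<in> {2..t - 1}}" using e by blast
    next
      fix e assume e: "e \<in> {{a, b} |a b. a \<in> U \<and> b \<in> N} - {{u i, v i} |i. i \<in> {2..t - 1}}"
      then obtain a b where ab: "e = {a, b}" "a \<in> U" "b \<in> N" by blast
      have "adj G a b"
      proof (rule ccontr)
        assume n: "\<not> adj G a b"
        hence "a \<noteq> u0" using full_u0 ab(3) by blast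
        hence "a \<in> h ` {2..t - 1}" unfolding imh using ab(2) by blast
        then obtain i where i: "a = h i" "i \<in> {2..t - 1}" by (rule imageE)
        have "b = \<phi> a" using \<phi>un[OF ab(2) \<open>a \<noteq> u0\<close> ab(3) n] .
        hence "e = {u i, v i}" using i ab(1) by (auto simp: u_def v_def)
        thus False using e i(2) by blast
      qed
      thus "e \<in> Qe" using ab by (auto simp: Qe_def)
    qed
    thus "QQ = (verts (complete_bipartite (u ` {1..t - 1}) (v ` {1..t - 1})),
      edges (complete_bipartite (u ` {1..t - 1}) (v ` {1..t - 1})) - {{u i, v i} |i. i \<in> {2..t - 1}})"
      unfolding imu imv by (simp add: QQ_def complete_bipartite_def)
  qed
  have adjWX: "adj G w x" if "w \<in> W" "x \<in> X" for w x
    using zero(2) V(3) that by (intro adj_if_sum_mis_0[OF _ fin(1,2) that]) (auto simp: mWX_def)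
  have adjWY: "adj G w y" if "w \<in> W" "y \<in> Y" for w y
    using zero(3) V(3) that by (intro adj_if_sum_mis_0[OF _ fin(1,3) that]) (auto simp: mWY_def)
  have adjXY: "adj G x y" if "x \<in> X" "y \<in> Y" for x y
    using zero(4) V(2) that by (intro adj_if_sum_mis_0[OF _ fin(2,3) that]) (auto simp: mXY_def)
  have adjWW: "adj G w w'" if "w \<in> W" "w' \<in> W" "w \<noteq> w'" for w w'
    using zero(1) that(3) by (intro adj_if_sum_mis_0[OF _ fin(1,1) that(1,2)]) (auto simp: mW_def)
  define J where "J = graph_join (complete_bipartite X Y) (complete_graph W)"
  have vJ: "verts J = X \<union> Y \<union> W" by (simp add: J_def graph_join_def complete_bipartite_def complete_graph_def)
  have eJ: "edges J = {{x, y} |x y. x \<in> X \<and> y \<in> Y} \<union> nsets W 2 \<union> {{x, w} |x w. x \<in> X \<union> Y \<and> w \<in> W}"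
    by (simp add: J_def graph_join_def complete_bipartite_def complete_graph_def)
  have emb: "embedded_in_join (card (verts G) - s + 1) (s - 1) QQ G"
    unfolding embedded_in_join_def
  proof (intro exI conjI)
    have "card X * card Y = ((card X + card Y) div 2) * ((card X + card Y + 1) div 2)"
      using zero(5) balanced_product(1)[of "card X" "card Y"] by (simp add: imb_def)
    from balanced_product(2)[OF this] show "balanced_classes (card (verts G) - s + 1) X Y"
      unfolding balanced_classes_def card_verts using fin V(2) by auto
    show "finite W" "card W = s - 1" "W \<inter> (X \<union> Y) = {}" using fin cW V(3) by auto
    show "verts QQ \<subseteq> X" using U N by (simp add: QQ_def)
    have "edges G = edges J \<union> Qe"
    proof (intro equalityI subsetI)
      fix e assume e: "e \<in> edges G"
      hence "e \<in> nsets (verts G) 2" using G by (auto simp: simple_graph_def)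
      then obtain a b where ab: "e = {a, b}" "a \<in> verts G" "b \<in> verts G" "a \<noteq> b"
        by (auto simp: nsets_2_eq)
      have adj: "adj G a b" using e ab(1) by (simp add: adj_def)
      have XX: "e \<in> Qe" if "a \<in> X" "b \<in> X"
        using bip[OF that adj] adj ab(1) adj_sym[OF adj] by (auto simp: Qe_def insert_commute)
      have sym: "{a, b} = {b, a}" by (rule insert_commute)
      consider "a \<in> W" "b \<in> W" | "a \<in> W" "b \<in> X \<union> Y" | "a \<in> X \<union> Y" "b \<in> W" | "a \<in> X" "b \<in> X"
        | "a \<in> X" "b \<in> Y" | "a \<in> Y" "b \<in> X" | "a \<in> Y" "b \<in> Y" using ab(2,3) V(1) by blast
      thus "e \<in> edges J \<union> Qe"
      proof cases
        case 1 thus ?thesis using ab by (simp add: eJ)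
      next
        case 2 thus ?thesis unfolding eJ ab(1) sym by blast
      next
        case 3 thus ?thesis unfolding eJ ab(1) by blast
      next
        case 4 thus ?thesis using XX by blast
      next
        case 5 thus ?thesis unfolding eJ ab(1) by blast
      next
        case 6 thus ?thesis unfolding eJ ab(1) sym by blast
      next
        case 7 thus ?thesis using Y adj by blast
      qed
    next
      fix e assume "e \<in> edges J \<union> Qe"
      then consider x y where "e = {x, y}" "x \<in> X" "y \<in> Y" | w w' where "e = {w, w'}" "w \<in> W" "w' \<in> W" "w \<noteq> w'"
        | x w where "e = {w, x}" "x \<in> X \<union> Y" "w \<in> W" | "e \<in> Qe"
        unfolding eJ nsets_2_eq by blast
      thus "e \<in> edges G"
      proof cases
        case 1 thus ?thesis using adjXY by (simp add: adj_def)
      next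
        case 2 thus ?thesis using adjWW by (simp add: adj_def)
      next
        case 3 thus ?thesis using adjWX adjWY by (auto simp: adj_def)
      next
        case 4 thus ?thesis by (auto simp: Qe_def adj_def)
      qed
    qed
    moreover have "verts G = verts J" unfolding vJ V(1) by blast
    ultimately have "G = (verts J, edges J \<union> edges QQ)" by (simp add: QQ_def prod_eq_iff)
    thus "let J = graph_join (complete_bipartite X Y) (complete_graph W) in G = (verts J, edges J \<union> edges QQ)"
      by (simp only: Let_def J_def)
  qed
  show ?thesis unfolding is_Gst_def using H emb by blast
qed

text \<open>The star of a vertex with \<open>t - 1\<close> inside neighbours that misses nothing
  across would, with one further disjoint inside edge, give \<open>t\<close> gadgets. So
  \<open>Y\<close> is independent and the neighbourhood of such a vertex meets all inside edges;
  then the balance \<open>edge_count\<close> is played against \<open>non_edges_ge\<close>.\<close>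

lemma exact_X:
  assumes e: "card (edges G) = fex s t (card (verts G)) + exc"
    and v: "v \<in> X" "card {b\<in>X \<union> Y. L v b} = t - 1" "card {b\<in>X \<union> Y. M v b} = 0"
  shows "exc = 0 \<and> (4 \<le> t \<longrightarrow> is_Gst s t (card (verts G)) G)"
proof -
  note count = edge_count[OF e]
  have vM: "\<not> M v b" for b
  proof
    assume M: "M v b"
    hence "b \<in> {b\<in>X \<union> Y. M v b}" by (auto simp: M_def)
    moreover have "finite {b\<in>X \<union> Y. M v b}" using fin by simp
    ultimately show False using v(3) by auto
  qed
  define LX where "LX a b \<longleftrightarrow> a \<in> X \<and> b \<in> X \<and> adj G a b" for a b
  have LXL: "L a b" if "LX a b" for a b using that by (auto simp: LX_def L_def)
  have Lset: "{b\<in>X \<union> Y. L a b} = {b\<in>X. LX a b}" if "a \<in> X" for a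
    using that V(2) by (auto simp: LX_def L_def)
  have LXirr: "\<not> LX a a" for a using adj_verts(3)[OF G, of a a] by (auto simp: LX_def)
  have star_plus: False
    if x: "x \<in> X" "card {b\<in>X. LX x b} = t - 1" and ab: "L a b" "\<not> M x a" "a \<noteq> x" "b \<noteq> x" "\<not> LX x a" "\<not> LX x b" for x a b
  proof -
    define S where "S = (\<lambda>z. (z, z)) ` {z\<in>X. LX x z}"
    have finS: "finite S" using fin by (simp add: S_def)
    have new: "(a, b) \<notin> S" using ab(5,6) by (auto simp: S_def)
    have cS: "card S = t - 1" using x(2) by (simp add: S_def card_image inj_on_def)
    have "card (insert (a, b) S) < t"
    proof (rule star_matching_X[OF x(1)])
      have "pairwise_disjoint S" by (auto simp: S_def pairwise_disjoint_def)
      thus "pairwise_disjoint (insert (a, b) S)"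
        by (rule pairwise_disjoint_insert) (use ab in \<open>auto simp: S_def\<close>)
      fix g assume "g \<in> insert (a, b) S"
      thus "x \<noteq> fst g \<and> x \<noteq> snd g \<and>
          (fst g = snd g \<and> L x (fst g) \<or> L (fst g) (snd g) \<and> \<not> M x (fst g))"
        using ab LXL LXirr[of x] by (auto simp: S_def)
    qed (use finS in simp)
    thus False using new finS cS t3 by simp
  qed
  have dv: "card {b\<in>X. LX v b} = t - 1" using v(2) Lset[OF v(1)] by simp
  have Yind: "\<not> adj G a b" if ab: "a \<in> Y" "b \<in> Y" for a b
  proof
    assume adj: "adj G a b"
    show False
    proof (rule star_plus[OF v(1) dv])
      show "L a b" using adj ab by (simp add: L_def)
    qed (use vM ab v(1) V(2) in \<open>auto simp: LX_def\<close>)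
  qed
  have insY: "ins G Y = 0"
  proof -
    have "dg G y Y = 0" if "y \<in> Y" for y
    proof -
      have "{u\<in>Y. adj G y u} = {}" using Yind that by blast
      thus ?thesis using dg_conv[OF sub(3), of y] by (metis card.empty)
    qed
    thus ?thesis by (simp add: ins_def)
  qed
  have LXdg: "card {b\<in>X. LX a b} = dg G a X" if "a \<in> X" for a
    using that dg_conv[OF sub(2), of a] by (auto simp: LX_def intro!: arg_cong[of _ _ card])
  have sumX: "(\<Sum>a\<in>X. card {b\<in>X. LX a b}) = ins G X" unfolding ins_def using LXdg by simp
  have "(\<exists>U N. U \<subseteq> X \<and> N \<subseteq> X \<and> U \<inter> N = {} \<and> card U = t - 1 \<and> card N = t - 1 \<and>
             (\<forall>a b. LX a b \<longrightarrow> a \<in> U \<and> b \<in> N \<or> a \<in> N \<and> b \<in> U)) \<or>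
         (2 * t * t + 6 = (\<Sum>a\<in>X. card {b\<in>X. LX a b}) + 6 * t \<and>
          (4 \<le> t \<longrightarrow> (\<exists>P Q. P \<subseteq> X \<and> Q \<subseteq> X \<and> P \<inter> Q = {} \<and> card P = 2 \<and> card Q = t - 1 \<and>
             (\<forall>p\<in>P. \<forall>q\<in>Q. LX p q))))"
  proof (rule structure_of_covered_graph[OF fin(2) t3 _ LXirr _ _ v(1) dv])
    show "LX b a" if "LX a b" for a b using that adj_sym[of G a b] by (auto simp: LX_def)
    show "a \<in> X \<and> b \<in> X" if "LX a b" for a b using that by (simp add: LX_def)
    show "card {b\<in>X. LX a b} \<le> t - 1" if "a \<in> X" for a using degree_L_le[of a] Lset[OF that] that by simp
    show "LX x a \<or> LX x b" if "x \<in> X" "card {b\<in>X. LX x b} = t - 1" "LX a b" for x a b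
    proof (rule ccontr)
      assume n: "\<not> (LX x a \<or> LX x b)"
      have "LX b a" using that(3) adj_sym[of G a b] by (auto simp: LX_def)
      show False
      proof (rule star_plus[OF that(1,2)])
        show "L a b" using LXL that(3) .
        show "\<not> M x a" using that(1,3) V(2) by (auto simp: M_def LX_def)
        show "a \<noteq> x" "b \<noteq> x" using n that(3) \<open>LX b a\<close> by auto
      qed (use n in auto)
    qed
    show "2 * t * t + 6 \<le> (\<Sum>a\<in>X. card {b\<in>X. LX a b}) + 6 * t" using count insY sumX by linarith
  qed
  thus ?thesis
  proof
    assume B: "2 * t * t + 6 = (\<Sum>a\<in>X. card {b\<in>X. LX a b}) + 6 * t \<and>
          (4 \<le> t \<longrightarrow> (\<exists>P Q. P \<subseteq> X \<and> Q \<subseteq> X \<and> P \<inter> Q = {} \<and> card P = 2 \<and> card Q = t - 1 \<and>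
             (\<forall>p\<in>P. \<forall>q\<in>Q. LX p q)))"
    \<comment> \<open>In this alternative the inside degree sum is exactly what the balance demands
      with no surplus and no missing pair, so all of these vanish.\<close>
    have "exc = 0" "mW = 0" "mWX = 0" using B count insY sumX by linarith+
    moreover have "\<not> 4 \<le> t"
    proof
      assume "4 \<le> t"
      then obtain P R where PR: "P \<subseteq> X" "R \<subseteq> X" "P \<inter> R = {}" "card P = 2" "card R = t - 1"
        "\<forall>p\<in>P. \<forall>q\<in>R. LX p q" using B by blast
      show False
        by (rule no_complete_bipartite_2[OF \<open>mW = 0\<close> \<open>mWX = 0\<close> PR(1,4,2,5,3)]) (use PR(6) in \<open>simp add: LX_def\<close>)
    qed
    ultimately show ?thesis by simp
  next
    assume "\<exists>U N. U \<subseteq> X \<and> N \<subseteq> X \<and> U \<inter> N = {} \<and> card U = t - 1 \<and> card N = t - 1 \<and>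
             (\<forall>a b. LX a b \<longrightarrow> a \<in> U \<and> b \<in> N \<or> a \<in> N \<and> b \<in> U)"
    then obtain U N where U: "U \<subseteq> X" "card U = t - 1" and N: "N \<subseteq> X" "card N = t - 1"
      and disj: "U \<inter> N = {}" and bip: "\<And>a b. LX a b \<Longrightarrow> a \<in> U \<and> b \<in> N \<or> a \<in> N \<and> b \<in> U" by blast
    have finU: "finite U" and finN: "finite N" using U N fin(2) finite_subset by blast+
    have WX: "w \<notin> X" if "w \<in> W" for w using that V(3) by blast
    define D where "D = (\<Sum>u\<in>U. mis G u N)"
    have D': "D = (\<Sum>v\<in>N. mis G v U)"
      unfolding D_def mis_def by (rule sum_card_swap[OF finU finN]) (use adj_commute[of G] in auto)
    have dgU: "dg G u X + mis G u N = t - 1" if "u \<in> U" for u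
    proof -
      have "{b\<in>X. adj G u b} = {b\<in>N. adj G u b}"
        using that bip[of u] U N disj by (auto simp: LX_def)
      hence "dg G u X = dg G u N" using dg_conv[OF sub(2), of u] dg_conv[of N G u] N sub(2) by simp
      moreover have "dg G u N + mis G u N = card (N - {u})"
        using dg_mis[OF G _ finN, of u] N sub(2) by blast
      moreover have "N - {u} = N" using that disj by blast
      ultimately show ?thesis using N(2) by simp
    qed
    have dgN: "dg G v X + mis G v U = t - 1" if "v \<in> N" for v
    proof -
      have "{b\<in>X. adj G v b} = {b\<in>U. adj G v b}"
        using that bip[of v] U N disj by (auto simp: LX_def)
      hence "dg G v X = dg G v U" using dg_conv[OF sub(2), of v] dg_conv[of U G v] U sub(2) by simp
      moreover have "dg G v U + mis G v U = card (U - {v})"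
        using dg_mis[OF G _ finU, of v] U sub(2) by blast
      moreover have "U - {v} = U" using that disj by blast
      ultimately show ?thesis using U(2) by simp
    qed
    have dg0: "dg G a X = 0" if "a \<in> X - (U \<union> N)" for a
    proof -
      have "{b\<in>X. adj G a b} = {}" using that bip[of a] by (auto simp: LX_def)
      thus ?thesis using dg_conv[OF sub(2), of a] by (metis card.empty)
    qed
    have insX: "ins G X + 2 * D = 2 * ((t - 1) * (t - 1))"
    proof -
      have "ins G X = (\<Sum>a\<in>U \<union> N. dg G a X)"
        unfolding ins_def by (rule sum.mono_neutral_right[OF fin(2)]) (use U N dg0 in auto)
      also have "\<dots> = (\<Sum>a\<in>U. dg G a X) + (\<Sum>a\<in>N. dg G a X)"
        using finU finN disj by (rule sum.union_disjoint)
      finally have "ins G X + 2 * D = ((\<Sum>a\<in>U. dg G a X) + D) + ((\<Sum>a\<in>N. dg G a X) + D)" by simp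
      also have "(\<Sum>a\<in>U. dg G a X) + D = (\<Sum>a\<in>U. t - 1)"
        unfolding D_def sum.distrib[symmetric] using dgU by simp
      also have "(\<Sum>a\<in>N. dg G a X) + D = (\<Sum>a\<in>N. t - 1)"
        unfolding D' sum.distrib[symmetric] using dgN by simp
      finally show ?thesis using U(2) N(2) by simp
    qed
    have "(t - 1) * (t - 1) + 2 * t = t * t + 1" using t3 by (cases t) auto
    hence "2 * ((t - 1) * (t - 1)) + 4 * t = 2 * t * t + 2" by simp
    hence bal: "2 * t = 4 + 2 * D + 2 * exc + mW + 2 * mWX + 2 * mWY + 2 * mXY + 2 * imb"
      using count insY insX by linarith
    \<comment> \<open>The bound of \<open>non_edges_ge\<close> is added for \<open>(U, N)\<close>
      and for \<open>(N, U)\<close> with the same \<open>w1\<close>, and the sum is compared with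
      \<open>bal\<close>. Non-edges from \<open>W\<close> to \<open>X\<close> enter
      \<open>bal\<close> with weight 2 but the two bounds together with weight at most 1, so one
      copy of \<open>mWX\<close> survives on the left.\<close>
    have key: "2 * exc + mW + mWX + 2 * mWY + 2 * mXY + 2 * imb \<le> 2 * mis G w1 W" if w1: "w1 \<in> W" for w1
    proof -
      have disj': "N \<inter> U = {}" using disj by blast
      have 1: "t - 2 \<le> D + mis G w1 U + mis G w1 W + (\<Sum>w\<in>W - {w1}. mis G w N)"
        unfolding D_def by (rule non_edges_ge[OF U N disj w1])
      have 2: "t - 2 \<le> D + mis G w1 N + mis G w1 W + (\<Sum>w\<in>W - {w1}. mis G w U)"
        unfolding D' by (rule non_edges_ge[OF N U disj' w1])
      have UN: "mis G w U + mis G w N \<le> mis G w X" for w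
      proof -
        have "mis G w U + mis G w N = card ({u\<in>U. u \<noteq> w \<and> \<not> adj G w u} \<union> {u\<in>N. u \<noteq> w \<and> \<not> adj G w u})"
          unfolding mis_def using finU finN disj by (subst card_Un_disjoint) auto
        also have "\<dots> \<le> mis G w X" unfolding mis_def using U N fin(2) by (intro card_mono) auto
        finally show ?thesis .
      qed
      have "mWX = mis G w1 X + (\<Sum>w\<in>W - {w1}. mis G w X)"
        unfolding mWX_def using fin(1) w1 by (rule sum.remove)
      moreover have "(\<Sum>w\<in>W - {w1}. mis G w U) + (\<Sum>w\<in>W - {w1}. mis G w N) \<le> (\<Sum>w\<in>W - {w1}. mis G w X)"
        unfolding sum.distrib[symmetric] by (rule sum_mono) (rule UN)
      ultimately show ?thesis using 1 2 UN[of w1] bal t3 by linarith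
    qed
    \<comment> \<open>A non-edge at \<open>w1\<close> within \<open>W\<close> is counted in
      \<open>mW\<close> from both of its ends. Together with \<open>key\<close> this leaves no room
      for any other defect.\<close>
    have half: "2 * mis G w1 W \<le> mW" if w1: "w1 \<in> W" for w1
    proof -
      have "mW = mis G w1 W + (\<Sum>w\<in>W - {w1}. mis G w W)"
        unfolding mW_def using fin(1) w1 by (rule sum.remove)
      moreover have "mis G w1 W \<le> (\<Sum>w\<in>W - {w1}. mis G w W)"
      proof -
        have "mis G w1 W = (\<Sum>w\<in>{w\<in>W. w \<noteq> w1 \<and> \<not> adj G w1 w}. 1)" by (simp add: mis_def)
        also have "\<dots> \<le> (\<Sum>w\<in>{w\<in>W. w \<noteq> w1 \<and> \<not> adj G w1 w}. mis G w W)"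
        proof (rule sum_mono)
          fix w assume w: "w \<in> {w\<in>W. w \<noteq> w1 \<and> \<not> adj G w1 w}"
          hence "w1 \<in> {u\<in>W. u \<noteq> w \<and> \<not> adj G w u}" using w1 adj_sym[of G w w1] by blast
          hence "0 < card {u\<in>W. u \<noteq> w \<and> \<not> adj G w u}" using fin(1) by (auto simp: card_gt_0_iff)
          thus "1 \<le> mis G w W" by (simp add: mis_def)
        qed
        also have "\<dots> \<le> (\<Sum>w\<in>W - {w1}. mis G w W)" using fin(1) by (intro sum_mono2) auto
        finally show ?thesis .
      qed
      ultimately show ?thesis by linarith
    qed
    have "W \<noteq> {}" using cW s2 by auto
    then obtain w0 where w0: "w0 \<in> W" by blast
    have z: "exc = 0" "mWX = 0" "mWY = 0" "mXY = 0" "imb = 0" using key[OF w0] half[OF w0] by linarith+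
    have mWeq: "mW = 2 * mis G w1 W" if "w1 \<in> W" for w1 using key[OF that] half[OF that] by linarith
    have bip': "a \<in> U \<and> b \<in> N \<or> a \<in> N \<and> b \<in> U" if "a \<in> X" "b \<in> X" "adj G a b" for a b
      using bip that by (simp add: LX_def)
    have adjWX: "adj G w x" if "w \<in> W" "x \<in> X" for w x
      using z(2) V(3) that by (intro adj_if_sum_mis_0[OF _ fin(1,2) that]) (auto simp: mWX_def)
    have nonfull: "card {u\<in>S. mis G u T \<noteq> 0} \<le> (\<Sum>u\<in>S. mis G u T)" if "finite S" for S T
    proof -
      have "card {u\<in>S. mis G u T \<noteq> 0} = (\<Sum>u\<in>{u\<in>S. mis G u T \<noteq> 0}. 1)" by simp
      also have "\<dots> \<le> (\<Sum>u\<in>{u\<in>S. mis G u T \<noteq> 0}. mis G u T)" by (rule sum_mono) auto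
      also have "\<dots> \<le> (\<Sum>u\<in>S. mis G u T)" using that by (intro sum_mono2) auto
      finally show ?thesis .
    qed
    have "is_Gst s t (card (verts G)) G" if t4: "4 \<le> t"
    proof (cases "mW = 0")
      case True
      have Dt: "D = t - 2" using bal z True by linarith
      \<comment> \<open>There are \<open>t - 2\<close> missing pairs in \<open>t - 1\<close> rows,
        so some row is full. Two full rows would give the graph excluded by
        \<open>no_complete_bipartite_2\<close>, hence every other row misses exactly one.\<close>
      have ex1: "\<exists>u0\<in>S. mis G u0 T = 0 \<and> (\<forall>u\<in>S. u \<noteq> u0 \<longrightarrow> mis G u T = 1)"
        if S: "S \<subseteq> X" "card S = t - 1" and T: "T \<subseteq> X" "card T = t - 1" and ST: "S \<inter> T = {}" and DS: "(\<Sum>u\<in>S. mis G u T) = t - 2" for S T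
      proof -
        have finS: "finite S" and finT: "finite T" using S T fin(2) finite_subset by blast+
        define S0 where "S0 = {u\<in>S. mis G u T = 0}"
        have "card S0 + card {u\<in>S. mis G u T \<noteq> 0} = card S"
        proof -
          have "S = S0 \<union> {u\<in>S. mis G u T \<noteq> 0}" by (auto simp: S0_def)
          from arg_cong[OF this, of card] show ?thesis
            using finS by (simp add: S0_def card_Un_disjoint disjoint_iff)
        qed
        hence c1: "1 \<le> card S0" and c1': "card S0 + card {u\<in>S. mis G u T \<noteq> 0} = t - 1"
          using nonfull[OF finS, of T] DS S(2) t3 by linarith+
        have c2': "card S0 < 2"
        proof (rule ccontr)
          assume "\<not> card S0 < 2"
          hence le: "2 \<le> card S0" by simp
          obtain P where P: "P \<subseteq> S0" "card P = 2" "finite P" by (fact obtain_subset_with_card_n[OF le])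
          show False
          proof (rule no_complete_bipartite_2[OF True z(2), of P T])
            show "P \<subseteq> X" "P \<inter> T = {}" using P(1) S(1) ST by (auto simp: S0_def)
            fix p r assume pr: "p \<in> P" "r \<in> T"
            have "mis G p T = 0" "r \<noteq> p" using pr P(1) ST by (auto simp: S0_def)
            thus "adj G p r" using mis_0D finT pr(2) by metis
          qed (use P T in auto)
        qed
        have "card S0 = 1" using c1 c2' by linarith
        then obtain u0 where u0: "S0 = {u0}" by (rule card_1_singletonE)
        have "(\<Sum>u\<in>S. mis G u T) = mis G u0 T + (\<Sum>u\<in>S - {u0}. mis G u T)"
          using finS u0 by (intro sum.remove) (auto simp: S0_def)
        moreover have m0: "mis G u0 T = 0" "u0 \<in> S" using u0 by (auto simp: S0_def)
        moreover have "card (S - {u0}) = t - 2" using m0 finS S(2) by simp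
        ultimately have eq: "(\<Sum>u\<in>S - {u0}. 1) = (\<Sum>u\<in>S - {u0}. mis G u T)" using DS by simp
        have "mis G u T = 1" if u: "u \<in> S - {u0}" for u
        proof -
          have "1 \<le> mis G a T" if "a \<in> S - {u0}" for a
          proof -
            have "a \<notin> S0" using that u0 by blast
            thus ?thesis using that by (auto simp: S0_def)
          qed
          hence "1 = mis G u T" by (rule sum_mono_inv[OF eq]) (use u finS in auto)
          thus ?thesis by simp
        qed
        thus ?thesis using m0 by blast
      qed
      have NU: "N \<inter> U = {}" using disj by blast
      obtain u0 where u0: "u0 \<in> U" "mis G u0 N = 0" "\<forall>u\<in>U. u \<noteq> u0 \<longrightarrow> mis G u N = 1"
        using ex1[OF U N disj] Dt unfolding D_def by blast
      obtain v0 where v0: "v0 \<in> N" "mis G v0 U = 0" "\<forall>v\<in>N. v \<noteq> v0 \<longrightarrow> mis G v U = 1"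
        using ex1[OF N U NU] Dt unfolding D' by blast
      show ?thesis
        by (rule is_Gst_if_matching[OF U N disj bip' Yind True z(2-5) u0(1,2) _ v0(1,2)])
          (use u0(3) v0(3) in auto)
    next
      case False
      \<comment> \<open>\<open>mW\<close> is twice the value of every single row, so all rows agree;
        as they are not zero, \<open>W\<close> has two elements, and these are not adjacent.\<close>
      have "mW = (\<Sum>w\<in>W. mis G w0 W)" unfolding mW_def
        by (rule sum.cong) (use mWeq[OF w0] mWeq in auto)
      hence "2 * mis G w0 W = card W * mis G w0 W" using mWeq[OF w0] by simp
      hence cW2: "card W = 2" using False mWeq[OF w0] by simp
      hence s3: "s = 3" using cW by simp
      have "mis G w0 W \<le> card (W - {w0})" unfolding mis_def using fin(1) by (intro card_mono) auto
      also have "\<dots> = 1" using cW2 w0 fin(1) by simp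
      finally have "mis G w0 W = 1" using mWeq[OF w0] False by (cases "mis G w0 W") auto
      hence "mW = 2" using mWeq[OF w0] by simp
      hence Dt: "D = t - 3" using bal z by linarith
      define U1 where "U1 = {u\<in>U. mis G u N = 0}"
      have "card U1 + card {u\<in>U. mis G u N \<noteq> 0} = card U"
      proof -
        have "U = U1 \<union> {u\<in>U. mis G u N \<noteq> 0}" by (auto simp: U1_def)
        from arg_cong[OF this, of card] show ?thesis
          using finU by (simp add: U1_def card_Un_disjoint disjoint_iff)
      qed
      hence le: "2 \<le> card U1" using nonfull[OF finU, of N] Dt U(2) t4 unfolding D_def by linarith
      obtain P where P: "P \<subseteq> U1" "card P = 2" "finite P" by (fact obtain_subset_with_card_n[OF le])
      have PU: "P \<subseteq> U" using P(1) by (auto simp: U1_def)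
      \<comment> \<open>Here \<open>s = 3\<close>: the rows \<open>P\<close> and \<open>u2\<close>
        are to face \<open>W\<close> and \<open>t - 2\<close> vertices of \<open>N\<close>. Both
        elements of \<open>W\<close> are on the same side, so the non-edge between them is harmless.
        The \<open>t - 3\<close> rows outside \<open>P\<close> share at most \<open>t - 3\<close>
        missing pairs, so one of them has at most one.\<close>
      have "\<exists>u\<in>U - P. mis G u N \<le> 1"
      proof (rule ccontr)
        assume "\<not> ?thesis"
        hence g2: "2 \<le> mis G u N" if "u \<in> U - P" for u
        proof -
          have "\<not> mis G u N \<le> 1" using that \<open>\<not> (\<exists>u\<in>U - P. mis G u N \<le> 1)\<close> by blast
          thus ?thesis by linarith
        qed
        have "card (U - P) = t - 3" using card_Diff_subset[OF P(3) PU] U(2) P(2) by simp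
        hence "2 * (t - 3) = (\<Sum>u\<in>U - P. 2)" by simp
        also have "\<dots> \<le> (\<Sum>u\<in>U - P. mis G u N)" by (rule sum_mono) (rule g2)
        also have "\<dots> \<le> D" unfolding D_def using finU by (intro sum_mono2) auto
        finally show False using Dt t4 by simp
      qed
      then obtain u2 where u2: "u2 \<in> U" "u2 \<notin> P" "mis G u2 N \<le> 1" by blast
      have "dg G u2 N + mis G u2 N = card (N - {u2})"
        using dg_mis[OF G _ finN, of u2] N sub(2) by blast
      moreover have "N - {u2} = N" using u2(1) disj by blast
      ultimately have "t - 2 \<le> dg G u2 N" using u2(3) N(2) by simp
      hence le2: "t - 2 \<le> card {b\<in>N. adj G u2 b}" using dg_conv[of N G u2] N sub(2) by simp
      obtain R where R: "R \<subseteq> {b\<in>N. adj G u2 b}" "card R = t - 2" "finite R"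
        by (fact obtain_subset_with_card_n[OF le2])
      have RN: "R \<subseteq> N" using R(1) by blast
      have False
      proof (rule no_complete_bipartite[of "insert u2 P" "W \<union> R"])
        show "insert u2 P \<subseteq> W \<union> X" "W \<union> R \<subseteq> W \<union> X" using u2 PU RN U(1) N(1) by blast+
        show "card (insert u2 P) = s" using P u2 s3 by simp
        have "W \<inter> R = {}" using RN N(1) WX by blast
        thus "card (W \<union> R) = t" using fin(1) R(2,3) cW2 t4 by (subst card_Un_disjoint) auto
        show "insert u2 P \<inter> (W \<union> R) = {}" using u2 PU RN disj U(1) WX by blast
        fix x y assume xy: "x \<in> insert u2 P" "y \<in> W \<union> R"
        have xU: "x \<in> U" using xy(1) u2 PU by blast
        show "adj G x y"
        proof (cases "y \<in> W")
          case True
          thus ?thesis using adjWX[of y x] xU U(1) adj_sym[of G y x] by blast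
        next
          case False
          hence yR: "y \<in> R" using xy by blast
          show ?thesis
          proof (cases "x = u2")
            case True
            thus ?thesis using yR R(1) by blast
          next
            case False
            hence "mis G x N = 0" using xy(1) P(1) by (auto simp: U1_def)
            moreover have "y \<noteq> x" using yR RN xU disj by blast
            ultimately show ?thesis using mis_0D[of G x N y] finN yR RN by blast
          qed
        qed
      qed
      thus ?thesis ..
    qed
    thus ?thesis using z(1) by blast
  qed
qed

end

lemma is_Gst_structured:
  assumes "structured A B ps F G X Y W c Q"
    and e: "card (edges G) = fex (card A) (card B) (card (verts G)) + exc"
  shows "exc = 0 \<and> (4 \<le> card B \<longrightarrow> is_Gst (card A) (card B) (card (verts G)) G)"
proof -
  interpret structured A B ps F G X Y W c Q by (fact assms(1))
  interpret sw: structured A B ps F G Y X W c Q by (rule swap)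
  obtain v where v: "v \<in> X \<union> Y" "card {b\<in>X \<union> Y. L v b} = card B - 1" "card {b\<in>X \<union> Y. M v b} = 0"
    using ex_full_vertex[OF e] by blast
  show ?thesis
  proof (cases "v \<in> X")
    case True
    show ?thesis by (rule exact_X[OF e True v(2,3)])
  next
    case False
    hence vY: "v \<in> Y" using v(1) by blast
    have "card {b\<in>Y \<union> X. sw.L v b} = card B - 1" "card {b\<in>Y \<union> X. sw.M v b} = 0"
      using v(2,3) unfolding LM_swap by (simp_all add: Un_commute)
    from sw.exact_X[OF e vY this] show ?thesis .
  qed
qed

section \<open>Freeness of the extremal graphs\<close>

lemma successively_alternating:
  assumes "successively (\<lambda>u v. P u \<noteq> P v) xs" "xs \<noteq> []"
  shows "(P (last xs) \<longleftrightarrow> P (hd xs)) \<longleftrightarrow> odd (length xs)"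
  using assms
proof (induction xs rule: induct_list012)
  case (3 x y zs)
  thus ?case by auto
qed auto

section \<open>Joins with a clique, in flattened form\<close>

definition join_embedding :: "'b set \<Rightarrow> 'b set \<Rightarrow> 'b set \<Rightarrow> 'b graph \<Rightarrow> 'b graph \<Rightarrow> bool" where
  "join_embedding X Y S Q G \<longleftrightarrow> finite X \<and> finite Y \<and> finite S \<and> X \<inter> Y = {} \<and> S \<inter> (X \<union> Y) = {} \<and>
     edges Q \<subseteq> nsets X 2 \<and> verts G = X \<union> Y \<union> S \<and>
     edges G = {{x, y} | x y. x \<in> X \<and> y \<in> Y} \<union> nsets S 2 \<union> {{x, w} | x w. x \<in> X \<union> Y \<and> w \<in> S} \<union> edges Q"

lemma embedded_in_joinD:
  assumes "embedded_in_join m k Q G" "edges Q \<subseteq> nsets (verts Q) 2"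
  shows "\<exists>X Y S. join_embedding X Y S Q G \<and> balanced_classes m X Y \<and> card S = k"
proof -
  obtain X Y S where *: "balanced_classes m X Y" "finite S" "card S = k" "S \<inter> (X \<union> Y) = {}" "verts Q \<subseteq> X"
    "let J = graph_join (complete_bipartite X Y) (complete_graph S) in G = (verts J, edges J \<union> edges Q)"
    using assms(1) unfolding embedded_in_join_def by blast
  have "edges Q \<subseteq> nsets X 2" using assms(2) nsets_mono[OF *(5)] by blast
  hence "join_embedding X Y S Q G"
    using * unfolding join_embedding_def balanced_classes_def graph_join_def complete_bipartite_def
      complete_graph_def Let_def by simp
  thus ?thesis using * by blast
qed

lemma join_embeddingD:
  assumes "join_embedding X Y S Q G"
  shows "finite X" "finite Y" "finite S" "X \<inter> Y = {}" "S \<inter> (X \<union> Y) = {}" "edges Q \<subseteq> nsets X 2"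
    "verts G = X \<union> Y \<union> S"
    "edges G = {{x, y} | x y. x \<in> X \<and> y \<in> Y} \<union> nsets S 2 \<union> {{x, w} | x w. x \<in> X \<union> Y \<and> w \<in> S} \<union> edges Q"
  using assms by (simp_all only: join_embedding_def)

lemma join_embedding_simple:
  assumes "join_embedding X Y S Q G"
  shows "simple_graph G"
proof -
  have je: "finite X" "finite Y" "finite S" "X \<inter> Y = {}" "S \<inter> (X \<union> Y) = {}" "edges Q \<subseteq> nsets X 2"
    "verts G = X \<union> Y \<union> S"
    and e: "edges G = {{x, y} | x y. x \<in> X \<and> y \<in> Y} \<union> nsets S 2 \<union> {{x, w} | x w. x \<in> X \<union> Y \<and> w \<in> S} \<union> edges Q"
    using join_embeddingD[OF assms(1)] by (simp_all only: refl)
  have "nsets S 2 \<subseteq> nsets (verts G) 2" "nsets X 2 \<subseteq> nsets (verts G) 2"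
    unfolding je(7) by (rule nsets_mono; blast)+
  moreover have "{x, y} \<in> nsets (verts G) 2" if "x \<in> X" "y \<in> Y" for x y
    unfolding doubleton_in_nsets_2 je(7) using that je(4) by blast
  moreover have "{x, w} \<in> nsets (verts G) 2" if "x \<in> X \<union> Y" "w \<in> S" for x w
    unfolding doubleton_in_nsets_2 je(7) using that je(5) by blast
  ultimately have "edges G \<subseteq> nsets (verts G) 2" unfolding e using je(6) by blast
  thus ?thesis unfolding simple_graph_def je(7) using je by simp
qed

lemma join_embedding_adj_XX:
  assumes "join_embedding X Y S Q G" "{x, x'} \<in> edges G" "x \<in> X" "x' \<in> X"
  shows "{x, x'} \<in> edges Q"
proof -
  have je: "X \<inter> Y = {}" "S \<inter> (X \<union> Y) = {}"
    and e: "edges G = {{x, y} | x y. x \<in> X \<and> y \<in> Y} \<union> nsets S 2 \<union> {{x, w} | x w. x \<in> X \<union> Y \<and> w \<in> S} \<union> edges Q"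
    using join_embeddingD[OF assms(1)] by (simp_all only: refl)
  have "x \<notin> Y" "x \<notin> S" "x' \<notin> Y" "x' \<notin> S" using je assms(3,4) by blast+
  moreover from this have "{x, x'} \<notin> nsets S 2" by simp
  ultimately show ?thesis using assms(2) unfolding e by (auto simp: doubleton_eq_iff)
qed

lemma card_cross:
  assumes "finite X" "finite Y" "X \<inter> Y = {}"
  shows "card {{x, y} | x y. x \<in> X \<and> y \<in> Y} = card X * card Y"
proof -
  have "{{x, y} | x y. x \<in> X \<and> y \<in> Y} = (\<lambda>(x, y). {x, y}) ` (X \<times> Y)" by auto
  moreover have "inj_on (\<lambda>(x, y). {x, y}) (X \<times> Y)"
    using assms(3) by (auto simp: inj_on_def doubleton_eq_iff)
  ultimately show ?thesis by (simp add: card_image card_cartesian_product)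
qed

lemma join_embedding_card:
  assumes je: "join_embedding X Y S Q G" and bal: "balanced_classes m X Y"
  shows "card (verts G) = m + card S"
    and "card (edges G) = (m div 2) * ((m + 1) div 2) + card S * m + (card S choose 2) + card (edges Q)"
proof -
  have f: "finite X" "finite Y" "finite S" "X \<inter> Y = {}" "S \<inter> (X \<union> Y) = {}" "edges Q \<subseteq> nsets X 2"
    "verts G = X \<union> Y \<union> S"
    and e: "edges G = {{x, y} | x y. x \<in> X \<and> y \<in> Y} \<union> nsets S 2 \<union> {{x, w} | x w. x \<in> X \<union> Y \<and> w \<in> S} \<union> edges Q"
    using join_embeddingD[OF je] by (simp_all only: refl)
  have b: "card X + card Y = m" "card X \<le> card Y + 1" "card Y \<le> card X + 1"
    using bal by (auto simp: balanced_classes_def)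
  have cXY: "card (X \<union> Y) = m" using f b by (simp add: card_Un_disjoint)
  show "card (verts G) = m + card S"
    unfolding f(7) using f cXY by (subst card_Un_disjoint) auto
  have "finite (nsets (verts G) 2)" by (rule finite_imp_finite_nsets) (use f in simp)
  hence finE: "finite (edges G)" using join_embedding_simple[OF je] unfolding simple_graph_def
    by (meson finite_subset)
  define E1 E2 E3 where "E1 = {{x, y} | x y. x \<in> X \<and> y \<in> Y}" and "E2 = nsets S 2"
    and "E3 = {{x, w} | x w. x \<in> X \<union> Y \<and> w \<in> S}"
  have fE: "finite E1" "finite E2" "finite E3" "finite (edges Q)"
    using finE unfolding e E1_def[symmetric] E2_def[symmetric] E3_def[symmetric] by auto
  have d12: "E1 \<inter> E2 = {}" using f(5) unfolding E1_def E2_def nsets_def by blast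
  have d3: "(E1 \<union> E2) \<inter> E3 = {}"
  proof -
    have "E1 \<inter> E3 = {}" using f(5) unfolding E1_def E3_def by (auto simp: doubleton_eq_iff)
    moreover have "E2 \<inter> E3 = {}" using f(5) unfolding E2_def E3_def nsets_def by blast
    ultimately show ?thesis by blast
  qed
  have dQ: "(E1 \<union> E2 \<union> E3) \<inter> edges Q = {}"
  proof -
    have sX: "q \<subseteq> X \<and> q \<noteq> {}" if "q \<in> edges Q" for q using f(6) that by (auto simp: nsets_def)
    have "E1 \<inter> edges Q = {}" using sX f(4) unfolding E1_def by fastforce
    moreover have "E2 \<inter> edges Q = {}" using sX f(5) unfolding E2_def nsets_def by blast
    moreover have "E3 \<inter> edges Q = {}" using sX f(5) unfolding E3_def by fastforce
    ultimately show ?thesis by blast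
  qed
  have "card (edges G) = card E1 + card E2 + card E3 + card (edges Q)"
    unfolding e E1_def[symmetric] E2_def[symmetric] E3_def[symmetric]
    using fE d12 d3 dQ by (simp add: card_Un_disjoint)
  moreover have "card E1 = card X * card Y" unfolding E1_def by (rule card_cross[OF f(1,2,4)])
  moreover have "card X * card Y = (m div 2) * ((m + 1) div 2)"
  proof -
    consider "card X = card Y" | "card X = card Y + 1" | "card Y = card X + 1" using b by linarith
    thus ?thesis using b(1) by cases auto
  qed
  moreover have "card E2 = card S choose 2" unfolding E2_def by (rule card_nsets)
  moreover have "card E3 = m * card S"
    unfolding E3_def using card_cross[of "X \<union> Y" S] f cXY by (simp add: Int_commute)
  ultimately show "card (edges G) = (m div 2) * ((m + 1) div 2) + card S * m + (card S choose 2) + card (edges Q)"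
    by (simp add: mult.commute)
qed

context balloon
begin

definition cyc :: "'a \<times> 'a \<Rightarrow> 'a set" where
  "cyc p = insert (fst p) (insert (snd p) (set (ps (fst p) (snd p))))"

text \<open>New vertices belong to one cycle only, so two different cycles can meet only in a branch
  vertex common to both index pairs.\<close>

lemma cyc_inter:
  assumes "a \<in> A" "b \<in> B" "a' \<in> A" "b' \<in> B" "(a, b) \<noteq> (a', b')" "z \<in> cyc (a, b)" "z \<in> cyc (a', b')"
  shows "z = a \<and> a = a' \<or> z = b \<and> b = b'"
proof -
  have "set (ps a b) \<inter> set (ps a' b') = {}" using assms ps_disj by blast
  moreover have "set (ps a b) \<inter> (A \<union> B) = {}" "set (ps a' b') \<inter> (A \<union> B) = {}" using assms ps_AB by blast+
  ultimately show ?thesis using assms AB unfolding cyc_def fst_conv snd_conv by blast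
qed

text \<open>Without \<open>S\<close> and without the edges of \<open>Q\<close> the graph is
  bipartite, so an odd cycle that avoids \<open>S\<close> must use an edge of
  \<open>Q\<close>.\<close>

lemma inside_edge_of_cycle:
  assumes je: "join_embedding X Y S Q G" and g: "\<forall>e\<in>edges F. g ` e \<in> edges G"
    and ab: "a \<in> A" "b \<in> B" and S: "g ` cyc (a, b) \<inter> S = {}"
  shows "\<exists>e\<in>edges F. e \<subseteq> cyc (a, b) \<and> g ` e \<in> edges Q"
proof (rule ccontr)
  assume n: "\<not> ?thesis"
  define E where "E = insert {a, b} (path_edges (a # ps a b @ [b]))"
  have EF: "E \<subseteq> edges F" unfolding E_def edges_F using ab by blast
  have Ecyc: "e \<subseteq> cyc (a, b)" if "e \<in> E" for e
    using that in_path_edges_subset[of e "a # ps a b @ [b]"] unfolding E_def cyc_def by auto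
  define P where "P v \<longleftrightarrow> g v \<in> X" for v
  have cross: "P u \<noteq> P w" if uw: "{u, w} \<in> E" for u w
  proof -
    have "g ` {u, w} \<in> edges G" using g EF uw by blast
    moreover have "g ` {u, w} \<notin> edges Q" using n Ecyc[OF uw] EF uw by blast
    moreover have "g u \<notin> S" "g w \<notin> S" using S Ecyc[OF uw] by blast+
    ultimately have "{g u, g w} \<in> {{x, y} | x y. x \<in> X \<and> y \<in> Y}"
      using je unfolding join_embedding_def nsets_def by (auto simp: doubleton_eq_iff)
    moreover have "X \<inter> Y = {}" using join_embeddingD(4)[OF je] .
    ultimately show ?thesis unfolding P_def by (auto simp: doubleton_eq_iff)
  qed
  \<comment> \<open>An auxiliary graph joining vertices of different colours; it lets the path edges
    be read as an alternating list.\<close>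
  define H where "H = (UNIV :: 'a set, {{u, w} | u w. P u \<noteq> P w})"
  have aH: "adj H u w \<longleftrightarrow> P u \<noteq> P w" for u w by (auto simp: H_def adj_def doubleton_eq_iff)
  have "path_edges (a # ps a b @ [b]) \<subseteq> edges H"
  proof
    fix e assume e: "e \<in> path_edges (a # ps a b @ [b])"
    then obtain u w where uw: "e = {u, w}" unfolding path_edges_def by blast
    have "{u, w} \<in> E" using e uw by (simp add: E_def)
    thus "e \<in> edges H" using cross uw unfolding H_def by auto
  qed
  hence "successively (\<lambda>u w. P u \<noteq> P w) (a # ps a b @ [b])" unfolding path_edges_subset_iff aH .
  from successively_alternating[OF this] have "P b \<longleftrightarrow> P a" using odd_ps[OF ab] by simp
  moreover have "P a \<noteq> P b" by (rule cross) (simp add: E_def)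
  ultimately show False by blast
qed

end

section \<open>Where an embedded odd-ballooning must meet the clique and the inside edges\<close>

locale join_hom = balloon A B ps F for A B :: "'a set" and ps F +
  fixes G Q :: "'b graph" and X Y S :: "'b set" and g :: "'a \<Rightarrow> 'b"
  assumes je: "join_embedding X Y S Q G" and cS: "card S = card A - 1"
    and s1: "1 \<le> card A" and inj: "inj_on g (verts F)" and g: "\<forall>e\<in>edges F. g ` e \<in> edges G"
begin

definition "A' = {a\<in>A. g a \<notin> S}"
definition "B' = {b\<in>B. g b \<notin> S}"
definition "R = {p\<in>A' \<times> B'. g ` set (ps (fst p) (snd p)) \<inter> S \<noteq> {}}"

lemma fin': "finite A'" "finite B'" "finite R"
  using finA finB by (auto simp: A'_def B'_def R_def)

lemma sub': "A' \<subseteq> A" "B' \<subseteq> B" "R \<subseteq> A' \<times> B'"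
  by (auto simp: A'_def B'_def R_def)

text \<open>The new vertices on different cycles are different from each other and from all branch
  vertices, and \<open>g\<close> is injective. So each pair in \<open>T\<close> and each chosen
  branch vertex occupies its own place in \<open>Z\<close>.\<close>

lemma card_new:
  assumes C: "C \<subseteq> A" "D \<subseteq> B" "T \<subseteq> A \<times> B" "\<And>p. p \<in> T \<Longrightarrow> \<exists>z\<in>set (ps (fst p) (snd p)). g z \<in> Z"
    and gZ: "g ` C \<subseteq> Z" "g ` D \<subseteq> Z" and finZ: "finite Z"
  shows "card C + card D + card T \<le> card Z"
proof -
  have finC: "finite C" "finite D" "finite T"
    using C finA finB by (meson finite_SigmaI finite_subset)+
  obtain z where z: "\<And>p. p \<in> T \<Longrightarrow> z p \<in> set (ps (fst p) (snd p)) \<and> g (z p) \<in> Z" using C(4) by metis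
  have injz: "inj_on z T"
  proof (rule inj_onI)
    fix p p' assume p: "p \<in> T" "p' \<in> T" "z p = z p'"
    have m: "fst p \<in> A" "snd p \<in> B" "fst p' \<in> A" "snd p' \<in> B" using C(3) p by auto
    show "p = p'"
    proof (rule ccontr)
      assume "p \<noteq> p'"
      hence "(fst p, snd p) \<noteq> (fst p', snd p')" by (simp add: prod_eq_iff)
      from ps_disj[OF m this] show False using z p by (metis IntI empty_iff)
    qed
  qed
  have zn: "z p \<notin> A \<union> B" "z p \<in> verts F" if "p \<in> T" for p
  proof -
    have m: "fst p \<in> A" "snd p \<in> B" using C(3) that by auto
    show "z p \<notin> A \<union> B" using z[OF that] ps_AB[OF m] by blast
    show "z p \<in> verts F" unfolding verts_F using z[OF that] m by blast
  qed
  have "card C + card D + card T = card (C \<union> D \<union> z ` T)"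
  proof -
    have "C \<inter> D = {}" using C AB by blast
    moreover have "(C \<union> D) \<inter> z ` T = {}" using C zn by blast
    ultimately show ?thesis using finC injz by (simp add: card_Un_disjoint card_image)
  qed
  also have "\<dots> = card (g ` (C \<union> D \<union> z ` T))"
  proof (rule card_image[symmetric])
    have "C \<union> D \<union> z ` T \<subseteq> verts F" using C(1,2) zn(2) unfolding verts_F by blast
    thus "inj_on g (C \<union> D \<union> z ` T)" by (rule inj_on_subset[OF inj])
  qed
  also have "\<dots> \<le> card Z" by (rule card_mono[OF finZ]) (use gZ z in auto)
  finally show ?thesis .
qed

lemma finS: "finite S"
  using join_embeddingD(3)[OF je] .

text \<open>The \<open>card A - 1\<close> vertices of \<open>S\<close> absorb the lost branch
  vertices and one new vertex for each pair in \<open>R\<close>.\<close>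

lemma card_A'B': "card B + 1 + card R \<le> card A' + card B'"
proof -
  have "card (A - A') + card (B - B') + card R \<le> card S"
    by (rule card_new) (use sub' finS in \<open>auto simp: A'_def B'_def R_def\<close>)
  moreover have "card (A - A') = card A - card A'" "card (B - B') = card B - card B'"
    using sub' fin' by (auto intro: card_Diff_subset)
  moreover have "card A' \<le> card A" "card B' \<le> card B" using sub' finA finB by (auto intro: card_mono)
  ultimately show ?thesis using cS s1 by linarith
qed

lemma inside_edge:
  assumes "p \<in> A' \<times> B' - R"
  shows "\<exists>e\<in>edges F. e \<subseteq> cyc p \<and> g ` e \<in> edges Q"
proof -
  have "fst p \<in> A" "snd p \<in> B" "g ` cyc (fst p, snd p) \<inter> S = {}"
    using assms by (auto simp: A'_def B'_def R_def cyc_def)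
  from inside_edge_of_cycle[OF je g this] show ?thesis by simp
qed

text \<open>If branch vertices \<open>Ao\<close> and \<open>Bo\<close> on both sides escape
  \<open>U\<close>, each of their pairs outside \<open>R\<close> needs a private new vertex in
  \<open>U\<close>, as its cycle uses an edge of \<open>Q\<close>. Counting gives
  \<open>card Ao * card Bo + 2 \<le> card Ao + card Bo\<close>, which is impossible when both are
  positive.\<close>

lemma one_side_covered:
  assumes U: "finite U" "card U + 1 \<le> card B" "\<And>e. e \<in> edges Q \<Longrightarrow> e \<inter> U \<noteq> {}"
  shows "g ` A' \<subseteq> U \<or> g ` B' \<subseteq> U"
proof -
  define Ao where "Ao = {a\<in>A'. g a \<notin> U}"
  define Bo where "Bo = {b\<in>B'. g b \<notin> U}"
  have fo: "finite Ao" "finite Bo" using fin' by (auto simp: Ao_def Bo_def)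
  have "card (A' - Ao) + card (B' - Bo) + card (Ao \<times> Bo - R) \<le> card U"
  proof (rule card_new)
    fix p assume p: "p \<in> Ao \<times> Bo - R"
    hence "p \<in> A' \<times> B' - R" by (auto simp: Ao_def Bo_def)
    from inside_edge[OF this] obtain e where e: "e \<subseteq> cyc p" "g ` e \<in> edges Q" by blast
    then obtain z where z: "z \<in> e" "g z \<in> U" using U(3)[OF e(2)] by blast
    have "z \<noteq> fst p" "z \<noteq> snd p" using p z(2) by (auto simp: Ao_def Bo_def)
    hence "z \<in> set (ps (fst p) (snd p))" using z(1) e(1) by (auto simp: cyc_def)
    thus "\<exists>z\<in>set (ps (fst p) (snd p)). g z \<in> U" using z(2) by blast
  qed (use sub' U in \<open>auto simp: Ao_def Bo_def\<close>)
  moreover have "card (A' - Ao) + card Ao = card A'"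
    using fin' fo by (metis (no_types, lifting) Ao_def card_Diff_subset card_mono le_add_diff_inverse2 mem_Collect_eq subsetI)
  moreover have "card (B' - Bo) + card Bo = card B'"
    using fin' fo by (metis (no_types, lifting) Bo_def card_Diff_subset card_mono le_add_diff_inverse2 mem_Collect_eq subsetI)
  moreover have "card Ao * card Bo \<le> card (Ao \<times> Bo - R) + card R"
    using diff_card_le_card_Diff[OF fin'(3), of "Ao \<times> Bo"] by (simp add: card_cartesian_product)
  ultimately have ineq: "card Ao * card Bo + 2 \<le> card Ao + card Bo" using card_A'B' U(2) by linarith
  have "card Ao = 0 \<or> card Bo = 0"
  proof (rule ccontr)
    assume "\<not> ?thesis"
    then obtain x y where "card Ao = Suc x" "card Bo = Suc y" by (metis not0_implies_Suc)
    thus False using ineq by simp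
  qed
  thus ?thesis using fo by (auto simp: Ao_def Bo_def)
qed

lemma A'B'_nonempty: "card A \<le> card B \<Longrightarrow> A' \<noteq> {} \<and> B' \<noteq> {}"
proof -
  assume le: "card A \<le> card B"
  have "card A' \<le> card A" "card B' \<le> card B" using sub' finA finB by (auto intro: card_mono)
  hence "0 < card A'" "0 < card B'" using card_A'B' le by linarith+
  thus ?thesis by auto
qed

lemma A'B'_edge:
  assumes "a \<in> A'" "b \<in> B'" "g a \<in> X" "g b \<in> X"
  shows "{g a, g b} \<in> edges Q"
proof -
  have "{a, b} \<in> edges F" unfolding edges_F using assms sub' by blast
  hence "g ` {a, b} \<in> edges G" using g by blast
  thus ?thesis using join_embedding_adj_XX[OF je] assms(3,4) by simp
qed

lemma inj_AB: "inj_on g A'" "inj_on g B'"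
proof -
  have "A' \<subseteq> verts F" "B' \<subseteq> verts F" unfolding verts_F using sub' by blast+
  thus "inj_on g A'" "inj_on g B'" using inj inj_on_subset by blast+
qed

end

text \<open>No index from 2 on may be used on both sides, so the two index sets within
  \<open>{1..t - 1}\<close> overlap at most in 1.\<close>

lemma H_complete_bound:
  assumes uv: "inj_on u {1..t - 1}" "inj_on v {1..t - 1}" and t: "1 \<le> t"
    and P: "P \<subseteq> u ` {1..t - 1}" and R: "R \<subseteq> v ` {1..t - 1}"
    and no: "\<And>i. i \<in> {2..t - 1} \<Longrightarrow> \<not> (u i \<in> P \<and> v i \<in> R)"
  shows "card P + card R \<le> t"
proof -
  define I where "I = {i\<in>{1..t - 1}. u i \<in> P}"
  define J where "J = {i\<in>{1..t - 1}. v i \<in> R}"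
  have "P = u ` I" "R = v ` J" using P R by (auto simp: I_def J_def)
  moreover have "I \<subseteq> {1..t - 1}" "J \<subseteq> {1..t - 1}" by (auto simp: I_def J_def)
  hence "inj_on u I" "inj_on v J" using uv inj_on_subset by blast+
  ultimately have c: "card P = card I" "card R = card J" by (auto simp: card_image)
  have "I \<inter> J \<subseteq> {1}"
  proof
    fix i assume i: "i \<in> I \<inter> J"
    hence "i \<notin> {2..t - 1}" using no by (auto simp: I_def J_def)
    thus "i \<in> {1}" using i by (auto simp: I_def)
  qed
  hence "card (I \<inter> J) \<le> 1" using card_mono[of "{1::nat}"] by simp
  moreover have "card (I \<union> J) \<le> card {1..t - 1}" by (rule card_mono) (auto simp: I_def J_def)
  moreover have "card I + card J = card (I \<union> J) + card (I \<inter> J)"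
    by (rule card_Un_Int) (auto simp: I_def J_def)
  ultimately show ?thesis using c t by simp
qed

lemma is_HD:
  assumes "is_H t Q"
  obtains u v where "inj_on u {1..t - 1}" "inj_on v {1..t - 1}" "u ` {1..t - 1} \<inter> v ` {1..t - 1} = {}"
    "verts Q = u ` {1..t - 1} \<union> v ` {1..t - 1}"
    "edges Q = {{a, b} | a b. a \<in> u ` {1..t - 1} \<and> b \<in> v ` {1..t - 1}} - {{u i, v i} | i. i \<in> {2..t - 1}}"
proof -
  from assms obtain u v where *: "inj_on u {1..t - 1}" "inj_on v {1..t - 1}"
    "u ` {1..t - 1} \<inter> v ` {1..t - 1} = {}"
    "Q = (verts (complete_bipartite (u ` {1..t - 1}) (v ` {1..t - 1})),
      edges (complete_bipartite (u ` {1..t - 1}) (v ` {1..t - 1})) - {{u i, v i} |i. i \<in> {2..t - 1}})"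
    unfolding is_H_def Let_def by (elim exE conjE)
  show thesis by (rule that[OF *(1-3)]) (simp_all only: *(4) complete_bipartite_def fst_conv snd_conv)
qed

lemma is_H_edges:
  assumes "is_H t Q"
  shows "edges Q \<subseteq> nsets (verts Q) 2"
proof -
  obtain u v where uv: "u ` {1..t - 1} \<inter> v ` {1..t - 1} = {}"
    "verts Q = u ` {1..t - 1} \<union> v ` {1..t - 1}"
    "edges Q = {{a, b} | a b. a \<in> u ` {1..t - 1} \<and> b \<in> v ` {1..t - 1}} - {{u i, v i} | i. i \<in> {2..t - 1}}"
    using assms by (rule is_HD)
  have "{a, b} \<in> nsets (verts Q) 2" if "a \<in> u ` {1..t - 1}" "b \<in> v ` {1..t - 1}" for a b
    unfolding doubleton_in_nsets_2 uv(2) using that uv(1) by blast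
  thus ?thesis unfolding uv(3) by blast
qed

lemma is_H_card:
  assumes "is_H t Q" "2 \<le> t"
  shows "card (edges Q) = t * t + 3 - 3 * t"
proof -
  obtain u v where uv: "inj_on u {1..t - 1}" "inj_on v {1..t - 1}" "u ` {1..t - 1} \<inter> v ` {1..t - 1} = {}"
    "edges Q = {{a, b} | a b. a \<in> u ` {1..t - 1} \<and> b \<in> v ` {1..t - 1}} - {{u i, v i} | i. i \<in> {2..t - 1}}"
    using assms(1) by (rule is_HD)
  have c: "card (u ` {1..t - 1}) = t - 1" "card (v ` {1..t - 1}) = t - 1" using uv by (auto simp: card_image)
  have sub: "{{u i, v i} | i. i \<in> {2..t - 1}} \<subseteq> {{a, b} | a b. a \<in> u ` {1..t - 1} \<and> b \<in> v ` {1..t - 1}}"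
    by fastforce
  have "{{u i, v i} | i. i \<in> {2..t - 1}} = (\<lambda>i. {u i, v i}) ` {2..t - 1}" by auto
  moreover have "inj_on (\<lambda>i. {u i, v i}) {2..t - 1}"
  proof (rule inj_onI)
    fix i j assume ij: "i \<in> {2..t - 1}" "j \<in> {2..t - 1}" "{u i, v i} = {u j, v j}"
    have m: "i \<in> {1..t - 1}" "j \<in> {1..t - 1}" using ij by auto
    have "u i \<noteq> v j" using uv(3) m by blast
    hence "u i = u j" using ij(3) by (auto simp: doubleton_eq_iff)
    thus "i = j" using uv(1) m by (auto dest: inj_onD)
  qed
  ultimately have c2: "card {{u i, v i} | i. i \<in> {2..t - 1}} = t - 2" by (simp add: card_image)
  have "card (edges Q) = (t - 1) * (t - 1) - (t - 2)"
    unfolding uv(4) using card_Diff_subset[OF _ sub] c2 card_cross[OF _ _ uv(3)] c by simp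
  also have "\<dots> = t * t + 3 - 3 * t"
  proof -
    obtain k where "t = k + 2" using assms(2) by (metis add.commute le_Suc_ex)
    thus ?thesis by (simp add: algebra_simps)
  qed
  finally show ?thesis .
qed

text \<open>Each class of \<open>H\<close> has \<open>t - 1\<close> vertices and meets every edge of
  \<open>H\<close>, so \<open>one_side_covered\<close> applies to both and sends \<open>A'\<close>
  into one class and \<open>B'\<close> into the other. Their images span a complete bipartite
  subgraph of \<open>H\<close> with at least \<open>t + 1\<close> vertices, but at most
  \<open>t\<close> are possible.\<close>

lemma (in balloon) Gst_free:
  fixes G :: "'b graph"
  assumes st: "1 \<le> card A" "card A \<le> card B" and H: "is_H (card B) Q"
    and je: "join_embedding X Y S Q G" and cS: "card S = card A - 1"
  shows "\<not> embeds F G"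
proof
  assume "embeds F G"
  then obtain g where g: "inj_on g (verts F)" "\<forall>e\<in>edges F. g ` e \<in> edges G" unfolding embeds_def by blast
  interpret join_hom A B ps F G Q X Y S g by unfold_locales (use je cS st g in auto)
  define t where "t = card B"
  have t1: "1 \<le> t" using st by (simp add: t_def)
  obtain u v where uv: "inj_on u {1..t - 1}" "inj_on v {1..t - 1}" "u ` {1..t - 1} \<inter> v ` {1..t - 1} = {}"
    "edges Q = {{a, b} | a b. a \<in> u ` {1..t - 1} \<and> b \<in> v ` {1..t - 1}} - {{u i, v i} | i. i \<in> {2..t - 1}}"
    using H unfolding t_def by (rule is_HD)
  define U where "U = u ` {1..t - 1}"
  define N where "N = v ` {1..t - 1}"
  have c: "finite U" "card U + 1 \<le> card B" "finite N" "card N + 1 \<le> card B"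
    using uv(1,2) t1 unfolding t_def[symmetric] by (auto simp: U_def N_def card_image)
  have eUN: "e \<inter> U \<noteq> {} \<and> e \<inter> N \<noteq> {}" if "e \<in> edges Q" for e
    using that unfolding uv(4) U_def N_def by blast
  have eX: "e \<subseteq> X" if "e \<in> edges Q" for e using that join_embeddingD(6)[OF je] by (auto simp: nsets_def)
  \<comment> \<open>Every vertex of \<open>H\<close> lies on an edge, since \<open>u 1\<close> and
    \<open>v 1\<close> are full; for \<open>t = 1\<close> there are no indices at all.\<close>
  have UX: "U \<subseteq> X \<or> t = 1" "N \<subseteq> X \<or> t = 1"
  proof -
    have "u i \<in> X \<and> v i \<in> X" if i: "i \<in> {1..t - 1}" for i
    proof -
      have "{u i, v 1} \<in> edges Q" "{u 1, v i} \<in> edges Q"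
      proof -
        have o: "1 \<in> {1..t - 1}" using i by auto
        have "{u i, v 1} \<noteq> {u j, v j}" "{u 1, v i} \<noteq> {u j, v j}" if j: "j \<in> {2..t - 1}" for j
        proof -
          have jm: "j \<in> {1..t - 1}" using j by auto
          have "u 1 \<noteq> u j" "v 1 \<noteq> v j" using inj_onD[OF uv(1) _ o jm] inj_onD[OF uv(2) _ o jm] j by auto
          moreover have "u i \<noteq> v j" "v i \<noteq> u j" "v 1 \<noteq> u j" "u 1 \<noteq> v j" using uv(3) i o jm by blast+
          ultimately show "{u i, v 1} \<noteq> {u j, v j}" "{u 1, v i} \<noteq> {u j, v j}"
            by (auto simp: doubleton_eq_iff)
        qed
        thus "{u i, v 1} \<in> edges Q" "{u 1, v i} \<in> edges Q" unfolding uv(4) using i o by blast+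
      qed
      thus ?thesis using eX by blast
    qed
    thus "U \<subseteq> X \<or> t = 1" "N \<subseteq> X \<or> t = 1" by (auto simp: U_def N_def)
  qed
  have ne: "A' \<noteq> {}" "B' \<noteq> {}" using A'B'_nonempty st(2) by auto
  have card_ge: "t + 1 \<le> card A' + card B'" using card_A'B' by (simp add: t_def)
  have dUN: "U \<inter> N = {}" using uv(3) by (simp add: U_def N_def)
  have edge: "{g a, g b} \<in> edges Q" if "a \<in> A'" "b \<in> B'" "g a \<in> U \<union> N" "g b \<in> U \<union> N" for a b
  proof -
    have "U \<union> N \<subseteq> X"
    proof (cases "t = 1")
      case True thus ?thesis using that(3) by (simp add: U_def N_def)
    next
      case False thus ?thesis using UX by blast
    qed
    thus ?thesis using A'B'_edge that by blast
  qed
  consider "g ` A' \<subseteq> U" "g ` B' \<subseteq> N" | "g ` B' \<subseteq> U" "g ` A' \<subseteq> N"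
    using one_side_covered[OF c(1,2)] one_side_covered[OF c(3,4)] eUN ne dUN by blast
  thus False
  proof cases
    case 1
    have "card (g ` A') + card (g ` B') \<le> t"
    proof (rule H_complete_bound[OF uv(1,2) t1])
      show "g ` A' \<subseteq> u ` {1..t - 1}" "g ` B' \<subseteq> v ` {1..t - 1}" using 1 by (auto simp: U_def N_def)
      show "\<not> (u i \<in> g ` A' \<and> v i \<in> g ` B')" if "i \<in> {2..t - 1}" for i
      proof
        assume "u i \<in> g ` A' \<and> v i \<in> g ` B'"
        then obtain a b where ab: "a \<in> A'" "u i = g a" "b \<in> B'" "v i = g b" by blast
        have "{g a, g b} \<in> edges Q" using edge[OF ab(1,3)] 1 ab by blast
        thus False unfolding uv(4) ab(2,4)[symmetric] using that by blast
      qed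
    qed
    thus False using card_ge inj_AB by (simp add: card_image)
  next
    case 2
    have "card (g ` B') + card (g ` A') \<le> t"
    proof (rule H_complete_bound[OF uv(1,2) t1])
      show "g ` B' \<subseteq> u ` {1..t - 1}" "g ` A' \<subseteq> v ` {1..t - 1}" using 2 by (auto simp: U_def N_def)
      show "\<not> (u i \<in> g ` B' \<and> v i \<in> g ` A')" if "i \<in> {2..t - 1}" for i
      proof
        assume "u i \<in> g ` B' \<and> v i \<in> g ` A'"
        then obtain a b where ab: "b \<in> B'" "u i = g b" "a \<in> A'" "v i = g a" by blast
        have "{g a, g b} \<in> edges Q" using edge[OF ab(3,1)] 2 ab by blast
        hence "{u i, v i} \<in> edges Q" using ab by (simp add: insert_commute)
        thus False unfolding uv(4) using that by blast
      qed
    qed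
    thus False using card_ge inj_AB by (simp add: card_image)
  qed
qed

lemma no_triangle_star:
  assumes T: "card T = 3" and I: "card I = 3" and f: "inj_on f I" "f ` I \<subseteq> nsets T 2"
    and star: "\<And>i j. i \<in> I \<Longrightarrow> j \<in> I \<Longrightarrow> i \<noteq> j \<Longrightarrow> f i \<inter> f j \<subseteq> {c}"
  shows False
proof -
  obtain x y z where xyz: "T = {x, y, z}" "x \<noteq> y" "y \<noteq> z" "x \<noteq> z" using T by (auto simp: card_3_iff)
  have "card (nsets T 2) = 3" unfolding card_nsets T by (simp add: choose_two)
  moreover have "finite (nsets T 2)" by (rule finite_imp_finite_nsets) (simp add: xyz)
  ultimately have "f ` I = nsets T 2" using f I by (intro card_subset_eq) (auto simp: card_image)
  moreover have "{x, y} \<in> nsets T 2" "{y, z} \<in> nsets T 2" "{x, z} \<in> nsets T 2" using xyz by auto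
  ultimately obtain i j k where ijk: "i \<in> I" "f i = {x, y}" "j \<in> I" "f j = {y, z}" "k \<in> I" "f k = {x, z}"
    by (metis imageE)
  have "i \<noteq> j" "i \<noteq> k" using ijk xyz by (auto simp: doubleton_eq_iff)
  hence "f i \<inter> f j \<subseteq> {c}" "f i \<inter> f k \<subseteq> {c}" using star ijk by blast+
  hence "y = c" "x = c" using ijk by auto
  thus False using xyz by simp
qed

text \<open>Cycles that avoid \<open>S\<close> use different edges of the triangle, so at most three
  of them do. This forces one surviving branch vertex against three, and then the three triangle
  edges could pairwise meet only in the image of that one vertex, which they do not.\<close>

lemma (in balloon) G33'_free:
  fixes G :: "'b graph"
  assumes st: "card A = 3" "card B = 3" and T: "card T = 3" "edges Q = nsets T 2"
    and je: "join_embedding X Y S Q G" and cS: "card S = 2"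
  shows "\<not> embeds F G"
proof
  assume "embeds F G"
  then obtain g where g: "inj_on g (verts F)" "\<forall>e\<in>edges F. g ` e \<in> edges G" unfolding embeds_def by blast
  interpret join_hom A B ps F G Q X Y S g by unfold_locales (use je cS st g in auto)
  define I where "I = A' \<times> B' - R"
  have "\<exists>e. e \<in> edges F \<and> e \<subseteq> cyc p \<and> g ` e \<in> edges Q" if "p \<in> I" for p
    using inside_edge that unfolding I_def by blast
  then obtain e where e: "\<And>p. p \<in> I \<Longrightarrow> e p \<in> edges F \<and> e p \<subseteq> cyc p \<and> g ` e p \<in> edges Q" by metis
  define f where "f p = g ` e p" for p
  have cycF: "cyc p \<subseteq> verts F" if "p \<in> I" for p
  proof -
    have "fst p \<in> A" "snd p \<in> B" using that sub' unfolding I_def by auto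
    thus ?thesis unfolding cyc_def verts_F by blast
  qed
  have inter: "w = g (fst p) \<and> fst p = fst p' \<or> w = g (snd p) \<and> snd p = snd p'"
    if p: "p \<in> I" "p' \<in> I" "p \<noteq> p'" "w \<in> f p" "w \<in> f p'" for p p' w
  proof -
    obtain z z' where z: "z \<in> e p" "w = g z" "z' \<in> e p'" "w = g z'" using p(4,5) unfolding f_def by blast
    have zc: "z \<in> cyc p" "z' \<in> cyc p'" using z e p by blast+
    hence "z \<in> verts F" "z' \<in> verts F" using cycF[OF p(1)] cycF[OF p(2)] by blast+
    hence "z = z'" using inj_onD[OF inj, of z z'] z(2,4) by simp
    moreover have "fst p \<in> A" "snd p \<in> B" "fst p' \<in> A" "snd p' \<in> B" using p sub' unfolding I_def by auto
    ultimately show ?thesis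
      using cyc_inter[of "fst p" "snd p" "fst p'" "snd p'" z] zc z(2) p(3) by (auto simp: prod_eq_iff)
  qed
  have fT: "f p \<in> nsets T 2" if "p \<in> I" for p using e[OF that] T(2) by (simp add: f_def)
  have injf: "inj_on f I"
  proof (rule inj_onI)
    fix p p' assume p: "p \<in> I" "p' \<in> I" "f p = f p'"
    show "p = p'"
    proof (rule ccontr)
      assume ne: "p \<noteq> p'"
      have "card (f p) = 2" using fT[OF p(1)] by (simp add: nsets_def)
      then obtain x y where xy: "f p = {x, y}" "x \<noteq> y" by (auto simp: card_2_iff)
      have "x = g (fst p) \<and> fst p = fst p' \<or> x = g (snd p) \<and> snd p = snd p'"
        "y = g (fst p) \<and> fst p = fst p' \<or> y = g (snd p) \<and> snd p = snd p'"
        using inter[OF p(1,2) ne] p(3) xy by auto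
      thus False using xy(2) ne by (auto simp: prod_eq_iff)
    qed
  qed
  have finT: "finite T" using T(1) by (intro card_ge_0_finite) simp
  have "card I = card (f ` I)" using injf by (simp add: card_image)
  also have "\<dots> \<le> card (nsets T 2)"
    by (rule card_mono) (use finite_imp_finite_nsets[OF finT] fT in auto)
  also have "\<dots> = 3" unfolding card_nsets T by (simp add: choose_two)
  finally have cI: "card I \<le> 3" .
  have cI2: "card A' * card B' \<le> card I + card R"
    using diff_card_le_card_Diff[OF fin'(3), of "A' \<times> B'"] by (simp add: card_cartesian_product I_def)
  have le3: "card A' \<le> 3" "card B' \<le> 3" using card_mono[OF finA sub'(1)] card_mono[OF finB sub'(2)] st by auto
  have sum: "4 + card R \<le> card A' + card B'" using card_A'B' st by simp
  \<comment> \<open>The product of the sizes is at most \<open>3 + card R\<close> and their sum is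
    at least \<open>4 + card R\<close>, with neither above 3.\<close>
  have small: "card A' = 1 \<and> card B' = 3 \<or> card A' = 3 \<and> card B' = 1"
  proof -
    have "card A' = 1 \<or> card A' = 2 \<or> card A' = 3" "card B' = 1 \<or> card B' = 2 \<or> card B' = 3"
      using le3 sum by linarith+
    thus ?thesis using cI cI2 sum by auto
  qed
  have R0: "R = {}" "card I = 3"
  proof -
    have "card R = 0" using small sum by auto
    thus "R = {}" using fin'(3) by simp
    hence "card I = card A' * card B'" by (simp add: I_def card_cartesian_product)
    thus "card I = 3" using small by auto
  qed
  from small show False
  proof
    assume "card A' = 1 \<and> card B' = 3"
    hence "card A' = 1" by simp
    then obtain a where a: "A' = {a}" by (rule card_1_singletonE)
    show False
    proof (rule no_triangle_star[OF T(1) R0(2) injf])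
      show "f ` I \<subseteq> nsets T 2" using fT by blast
      fix p p' assume p: "p \<in> I" "p' \<in> I" "p \<noteq> p'"
      have "fst p \<in> A'" "fst p' \<in> A'" using p(1,2) unfolding I_def by auto
      hence "fst p = a" "fst p' = a" unfolding a by simp_all
      hence ne: "snd p \<noteq> snd p'" using p(3) by (simp add: prod_eq_iff)
      show "f p \<inter> f p' \<subseteq> {g a}"
      proof
        fix w assume "w \<in> f p \<inter> f p'"
        hence "w = g (fst p)" using inter[OF p, of w] ne by simp
        thus "w \<in> {g a}" using \<open>fst p = a\<close> by simp
      qed
    qed
  next
    assume "card A' = 3 \<and> card B' = 1"
    hence "card B' = 1" by simp
    then obtain b where b: "B' = {b}" by (rule card_1_singletonE)
    show False
    proof (rule no_triangle_star[OF T(1) R0(2) injf])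
      show "f ` I \<subseteq> nsets T 2" using fT by blast
      fix p p' assume p: "p \<in> I" "p' \<in> I" "p \<noteq> p'"
      have "snd p \<in> B'" "snd p' \<in> B'" using p(1,2) unfolding I_def by auto
      hence "snd p = b" "snd p' = b" unfolding b by simp_all
      hence ne: "fst p \<noteq> fst p'" using p(3) by (simp add: prod_eq_iff)
      show "f p \<inter> f p' \<subseteq> {g b}"
      proof
        fix w assume "w \<in> f p \<inter> f p'"
        hence "w = g (snd p)" using inter[OF p, of w] ne by simp
        thus "w \<in> {g b}" using \<open>snd p = b\<close> by simp
      qed
    qed
  qed
qed

section \<open>The extremal number\<close>

lemma ex_embedded_in_join:
  fixes Q :: "nat graph"
  assumes "verts Q \<subseteq> {..<(m + 1) div 2}"
  shows "\<exists>G :: nat graph. embedded_in_join m k Q G"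
proof -
  define J where "J = graph_join (complete_bipartite {..<(m + 1) div 2} {(m + 1) div 2..<m}) (complete_graph {m..<m + k})"
  have "balanced_classes m {..<(m + 1) div 2} {(m + 1) div 2..<m}"
    unfolding balanced_classes_def by auto
  moreover have "{m..<m + k} \<inter> ({..<(m + 1) div 2} \<union> {(m + 1) div 2..<m}) = {}" by auto
  ultimately have "embedded_in_join m k Q (verts J, edges J \<union> edges Q)"
    unfolding embedded_in_join_def Let_def using assms
    by (intro exI[of _ "{..<(m + 1) div 2}"] exI[of _ "{(m + 1) div 2..<m}"] exI[of _ "{m..<m + k}"])
      (auto simp: J_def)
  thus ?thesis by blast
qed

lemma ex_Gst:
  assumes "4 * t \<le> n - s + 1"
  shows "\<exists>G :: nat graph. is_Gst s t n G"
proof -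
  define u v where "u i = i" and "v i = t + i" for i :: nat
  define K where "K = complete_bipartite (u ` {1..t - 1}) (v ` {1..t - 1})"
  define Q where "Q = (verts K, edges K - {{u i, v i} | i. i \<in> {2..t - 1}})"
  have "is_H t Q"
    unfolding is_H_def Let_def
  proof (intro exI conjI)
    show "inj_on u {1..t - 1}" "inj_on v {1..t - 1}" by (auto simp: u_def v_def inj_on_def)
    show "u ` {1..t - 1} \<inter> v ` {1..t - 1} = {}" by (auto simp: u_def v_def)
  qed (simp add: Q_def K_def)
  moreover have "verts Q \<subseteq> {..<(n - s + 1 + 1) div 2}"
    using assms by (auto simp: Q_def K_def complete_bipartite_def u_def v_def)
  then obtain G :: "nat graph" where "embedded_in_join (n - s + 1) (s - 1) Q G"
    using ex_embedded_in_join by blast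
  ultimately show ?thesis unfolding is_Gst_def by blast
qed

lemma ex_G33':
  assumes "6 \<le> n - 2"
  shows "\<exists>G :: nat graph. is_G33' n G"
proof -
  have "verts (complete_graph {0, 1, 2::nat}) \<subseteq> {..<(n - 2 + 1) div 2}"
    using assms by (auto simp: complete_graph_def)
  then obtain G :: "nat graph" where "embedded_in_join (n - 2) 2 (complete_graph {0, 1, 2}) G"
    using ex_embedded_in_join by blast
  moreover have "card {0, 1, 2::nat} = 3" by simp
  ultimately show ?thesis unfolding is_G33'_def by blast
qed

lemma is_GstD:
  assumes "is_Gst s t n G" and st: "1 \<le> s" "s \<le> n" "2 \<le> t"
  obtains Q X Y S where "is_H t Q" "join_embedding X Y S Q G" "card S = s - 1"
    "simple_graph G" "card (verts G) = n" "card (edges G) = fex s t n"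
proof -
  obtain Q where Q: "is_H t Q" "embedded_in_join (n - s + 1) (s - 1) Q G"
    using assms(1) unfolding is_Gst_def by blast
  obtain X Y S where je: "join_embedding X Y S Q G" and bal: "balanced_classes (n - s + 1) X Y" and cS: "card S = s - 1"
    using embedded_in_joinD[OF Q(2) is_H_edges[OF Q(1)]] by blast
  have "card (verts G) = n" using join_embedding_card(1)[OF je bal] cS st by simp
  moreover have "card (edges G) = fex s t n"
    using join_embedding_card(2)[OF je bal] cS is_H_card[OF Q(1) st(3)] by (simp add: fex_def)
  ultimately show thesis using that Q(1) je cS join_embedding_simple[OF je] by blast
qed

lemma is_G33'D:
  assumes "is_G33' n G" and n: "3 \<le> n"
  obtains T Q X Y S where "card T = 3" "edges Q = nsets T 2" "join_embedding X Y S Q G" "card S = 2"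
    "card X + card Y = n - 2" "card X \<le> card Y + 1"
    "simple_graph G" "card (verts G) = n" "card (edges G) = fex 3 3 n"
proof -
  obtain T where T: "card T = 3" "embedded_in_join (n - 2) 2 (complete_graph T) G"
    using assms(1) unfolding is_G33'_def by blast
  obtain X Y S where je: "join_embedding X Y S (complete_graph T) G" and bal: "balanced_classes (n - 2) X Y" and cS: "card S = 2"
    using embedded_in_joinD[OF T(2)] by (auto simp: complete_graph_def)
  have e: "edges (complete_graph T) = nsets T 2" by (simp add: complete_graph_def)
  have "card (verts G) = n" using join_embedding_card(1)[OF je bal] cS n by simp
  moreover have "card (edges G) = fex 3 3 n"
  proof -
    have eq: "n - 3 + 1 = n - 2" using n by simp
    show ?thesis
      unfolding join_embedding_card(2)[OF je bal] cS fex_def eq e card_nsets T(1) by (simp add: choose_two)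
  qed
  moreover have "card X + card Y = n - 2" "card X \<le> card Y + 1" using bal by (auto simp: balanced_classes_def)
  ultimately show thesis using that[OF T(1) e je cS] join_embedding_simple[OF je] by blast
qed

text \<open>The two extremal graphs for \<^term>\<open>t = (3::nat)\<close> are told apart by their clique numbers.\<close>

lemma Gst_no_large_clique:
  assumes je: "join_embedding X Y S Q G" and H: "is_H t Q" and C: "C \<subseteq> verts G" "nsets C 2 \<subseteq> edges G"
  shows "card C \<le> card S + 3"
proof -
  have fin: "finite X" "finite Y" "finite S" using join_embeddingD[OF je] by auto
  have V: "verts G = X \<union> Y \<union> S" by (rule join_embeddingD(7)[OF je])
  have disj: "X \<inter> Y = {}" "S \<inter> (X \<union> Y) = {}" using join_embeddingD[OF je] by auto
  obtain u v where uv: "u ` {1..t - 1} \<inter> v ` {1..t - 1} = {}"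
    "edges Q = {{a, b} | a b. a \<in> u ` {1..t - 1} \<and> b \<in> v ` {1..t - 1}} - {{u i, v i} | i. i \<in> {2..t - 1}}"
    using H by (rule is_HD)
  define U where "U = u ` {1..t - 1}"
  define N where "N = v ` {1..t - 1}"
  have edge: "{a, b} \<in> edges G" if "a \<in> C" "b \<in> C" "a \<noteq> b" for a b
    using C(2) that by (meson doubleton_in_nsets_2 subsetD)
  have QUN: "a \<in> U \<and> b \<in> N \<or> a \<in> N \<and> b \<in> U" if "{a, b} \<in> edges Q" for a b
    using that unfolding uv(2) U_def N_def by (auto simp: doubleton_eq_iff)
  have UN: "U \<inter> N = {}" using uv(1) by (simp add: U_def N_def)
  have le1: "card D \<le> 1" if D: "finite D" "\<And>a b. a \<in> D \<Longrightarrow> b \<in> D \<Longrightarrow> a = b" for D :: "'a set"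
    using D by (metis One_nat_def card_le_Suc0_iff_eq)
  have XX: "{a, b} \<in> edges Q" if "a \<in> C \<inter> X" "b \<in> C \<inter> X" "a \<noteq> b" for a b
    using join_embedding_adj_XX[OF je edge[of a b]] that by blast
  \<comment> \<open>Edges of \<open>Q\<close> run between \<open>U\<close> and \<open>N\<close>, so
    within \<open>X\<close> a clique has at most one vertex in \<open>U\<close> and at most one
    outside it.\<close>
  have CX1: "card (C \<inter> X \<inter> U) \<le> 1"
    by (rule le1) (use fin XX QUN UN in blast)+
  have CX2: "card ((C \<inter> X) - U) \<le> 1"
    by (rule le1) (use fin XX QUN UN in blast)+
  have CY: "card (C \<inter> Y) \<le> 1"
  proof (rule le1)
    fix a b assume ab: "a \<in> C \<inter> Y" "b \<in> C \<inter> Y"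
    show "a = b"
    proof (rule ccontr)
      assume "a \<noteq> b"
      hence e: "{a, b} \<in> edges G" using edge ab by blast
      have "a \<notin> X" "a \<notin> S" "b \<notin> X" "b \<notin> S" using ab disj by blast+
      hence n: "{a, b} \<notin> {{x, y} |x y. x \<in> X \<and> y \<in> Y}" "{a, b} \<notin> nsets S 2"
        "{a, b} \<notin> {{x, w} |x w. x \<in> X \<union> Y \<and> w \<in> S}" "{a, b} \<notin> nsets X 2"
        by (auto simp: doubleton_eq_iff)
      have "{a, b} \<notin> edges Q" using n(4) join_embeddingD(6)[OF je] by blast
      thus False using e n(1-3) unfolding join_embeddingD(8)[OF je] by blast
    qed
  qed (use fin in simp)
  have "C \<subseteq> (C \<inter> X \<inter> U) \<union> ((C \<inter> X) - U) \<union> (C \<inter> Y) \<union> S" using C(1) unfolding V by blast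
  hence "card C \<le> card ((C \<inter> X \<inter> U) \<union> ((C \<inter> X) - U) \<union> (C \<inter> Y) \<union> S)"
    using fin by (intro card_mono) auto
  also have "\<dots> \<le> card ((C \<inter> X \<inter> U) \<union> ((C \<inter> X) - U) \<union> (C \<inter> Y)) + card S" by (rule card_Un_le)
  also have "card ((C \<inter> X \<inter> U) \<union> ((C \<inter> X) - U) \<union> (C \<inter> Y)) \<le> card ((C \<inter> X \<inter> U) \<union> ((C \<inter> X) - U)) + card (C \<inter> Y)"
    by (rule card_Un_le)
  also have "card ((C \<inter> X \<inter> U) \<union> ((C \<inter> X) - U)) \<le> card (C \<inter> X \<inter> U) + card ((C \<inter> X) - U)" by (rule card_Un_le)
  finally show ?thesis using CX1 CX2 CY by linarith
qed

text \<open>The triangle, the two vertices of \<open>S\<close> and any vertex of \<open>Y\<close>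
  are pairwise adjacent. The other graph with the same \<open>S\<close> only reaches 5.\<close>

lemma G33'_clique:
  assumes T: "card T = 3" "edges Q = nsets T 2" and je: "join_embedding X Y S Q G" and cS: "card S = 2"
    and Y: "Y \<noteq> {}"
  shows "\<exists>C\<subseteq>verts G. card C = 6 \<and> nsets C 2 \<subseteq> edges G"
proof -
  obtain y where y: "y \<in> Y" using Y by blast
  have fin: "finite S" using join_embeddingD[OF je] by auto
  have V: "verts G = X \<union> Y \<union> S" by (rule join_embeddingD(7)[OF je])
  have disj: "X \<inter> Y = {}" "S \<inter> (X \<union> Y) = {}" using join_embeddingD[OF je] by auto
  have finT: "finite T" using T(1) by (intro card_ge_0_finite) simp
  have TX: "T \<subseteq> X"
  proof
    fix a assume a: "a \<in> T"
    have "T \<noteq> {a}" using T(1) by auto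
    then obtain b where "b \<in> T" "b \<noteq> a" using a by blast
    hence "{a, b} \<in> nsets T 2" using a by simp
    hence "{a, b} \<in> nsets X 2" using join_embeddingD(6)[OF je] unfolding T(2) by blast
    thus "a \<in> X" by simp
  qed
  define C where "C = insert y (T \<union> S)"
  have d: "T \<inter> S = {}" "y \<notin> T \<union> S" using TX y disj by blast+
  have "card C = 6" unfolding C_def using d finT fin T(1) cS by (simp add: card_Un_disjoint)
  moreover have "C \<subseteq> verts G" unfolding C_def V using TX y by blast
  moreover have "nsets C 2 \<subseteq> edges G"
  proof
    fix e assume "e \<in> nsets C 2"
    then obtain a b where ab: "e = {a, b}" "a \<in> C" "b \<in> C" "a \<noteq> b" by (auto simp: nsets_2_eq)
    have key: "{a, b} \<in> edges G" if ab: "a \<in> C" "b \<in> C" "a \<noteq> b" "b \<in> S \<or> (a \<in> T \<and> b \<in> T) \<or> (a \<in> T \<and> b = y)" for a b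
    proof -
      consider "a \<in> S" "b \<in> S" | "a \<in> X \<union> Y" "b \<in> S" | "a \<in> T" "b \<in> T" | "a \<in> X" "b \<in> Y"
        using ab TX y unfolding C_def by blast
      thus ?thesis
      proof cases
        case 1 thus ?thesis unfolding join_embeddingD(8)[OF je] using ab(3) by simp
      next
        case 2 thus ?thesis unfolding join_embeddingD(8)[OF je] by blast
      next
        case 3 thus ?thesis unfolding join_embeddingD(8)[OF je] T(2) using ab(3) by simp
      next
        case 4 thus ?thesis unfolding join_embeddingD(8)[OF je] by blast
      qed
    qed
    have "b \<in> S \<or> (a \<in> T \<and> b \<in> T) \<or> (a \<in> T \<and> b = y) \<or> a \<in> S \<or> (b \<in> T \<and> a = y)"
      using ab unfolding C_def by blast
    thus "e \<in> edges G" using key[OF ab(2-4)] key[OF ab(3,2)] ab(1,4) by (auto simp: insert_commute)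
  qed
  ultimately show ?thesis by blast
qed

lemma graph_iso_clique:
  assumes iso: "graph_iso G G'" and G: "edges G \<subseteq> nsets (verts G) 2"
    and C: "C \<subseteq> verts G'" "nsets C 2 \<subseteq> edges G'"
  shows "\<exists>D\<subseteq>verts G. card D = card C \<and> nsets D 2 \<subseteq> edges G"
proof -
  obtain f where f: "bij_betw f (verts G) (verts G')" "edges G' = (\<lambda>e. f ` e) ` edges G"
    using iso unfolding graph_iso_def by blast
  define D where "D = {v\<in>verts G. f v \<in> C}"
  have inj: "inj_on f (verts G)" using f(1) by (simp add: bij_betw_def)
  have "f ` D = C" using f(1) C(1) unfolding D_def bij_betw_def by auto
  moreover have "inj_on f D" using inj by (rule inj_on_subset) (auto simp: D_def)
  ultimately have "card D = card C" by (metis card_image)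
  moreover have "nsets D 2 \<subseteq> edges G"
  proof
    fix e assume "e \<in> nsets D 2"
    then obtain a b where ab: "e = {a, b}" "a \<in> D" "b \<in> D" "a \<noteq> b" by (auto simp: nsets_2_eq)
    have v: "a \<in> verts G" "b \<in> verts G" "f a \<in> C" "f b \<in> C" using ab by (auto simp: D_def)
    hence "f a \<noteq> f b" using inj ab(4) by (auto dest: inj_onD)
    hence "{f a, f b} \<in> edges G'" using C(2) v by (meson doubleton_in_nsets_2 subsetD)
    then obtain e' where e': "e' \<in> edges G" "f ` e' = f ` {a, b}" unfolding f(2) by auto
    have "e' \<subseteq> verts G" using e'(1) G by (auto simp: nsets_def)
    hence "e' = {a, b}" using inj_on_image_eq_iff[OF inj, of e' "{a, b}"] e'(2) v by blast
    thus "e \<in> edges G" using e'(1) ab(1) by simp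
  qed
  ultimately show ?thesis by (intro exI[of _ D]) (auto simp: D_def)
qed

section \<open>Deleting vertices of small degree\<close>

definition gmin :: "nat \<Rightarrow> nat \<Rightarrow> nat" where
  "gmin s n = (n - s + 1) div 2 + (s - 1)"

text \<open>Deleting a vertex of degree below this increment raises the excess over
  \<open>fex\<close>. For \<open>s \<ge> 2\<close> and \<open>n \<ge> s\<close> the increment
  \<open>gmin s n\<close> is at least \<open>n / 2\<close>, which turns it into the minimum degree
  condition of the structural part.\<close>

lemma fex_Suc:
  assumes "s \<le> n"
  shows "fex s t (Suc n) = fex s t n + gmin s (Suc n)"
proof -
  define m where "m = n - s + 1"
  have m: "Suc n - s + 1 = m + 1" using assms by (simp add: m_def)
  have "((m + 1) div 2) * ((m + 1 + 1) div 2) = (m div 2) * ((m + 1) div 2) + (m + 1) div 2"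
    by (simp add: algebra_simps)
  moreover have "(s - 1) * (m + 1) = (s - 1) * m + (s - 1)" unfolding distrib_left by simp
  ultimately show ?thesis unfolding fex_def gmin_def m m_def[symmetric] by linarith
qed

definition delete_vertex :: "'b graph \<Rightarrow> 'b \<Rightarrow> 'b graph" where
  "delete_vertex G v = (verts G - {v}, {e \<in> edges G. v \<notin> e})"

lemma delete_vertex_simple: "simple_graph G \<Longrightarrow> simple_graph (delete_vertex G v)"
  unfolding simple_graph_def delete_vertex_def by (auto simp: nsets_def)

lemma delete_vertex_embeds: "embeds F (delete_vertex G v) \<Longrightarrow> embeds F G"
  unfolding embeds_def delete_vertex_def by auto

lemma delete_vertex_card:
  assumes G: "simple_graph G" and v: "v \<in> verts G"
  shows "card (edges G) = card (edges (delete_vertex G v)) + card (nbrs G v)"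
proof -
  have finV: "finite (verts G)" using G by (simp add: simple_graph_def)
  have finE: "finite (edges G)" using G finite_imp_finite_nsets[OF finV, of 2]
    unfolding simple_graph_def by (meson finite_subset)
  have "{e\<in>edges G. v \<in> e} = (\<lambda>u. {v, u}) ` nbrs G v"
  proof (intro equalityI subsetI)
    fix e assume e: "e \<in> {e\<in>edges G. v \<in> e}"
    hence "e \<in> nsets (verts G) 2" using G by (auto simp: simple_graph_def)
    then obtain a b where ab: "e = {a, b}" "a \<in> verts G" "b \<in> verts G" by (auto simp: nsets_2_eq)
    have "v = a \<or> v = b" using e ab by auto
    thus "e \<in> (\<lambda>u. {v, u}) ` nbrs G v"
    proof
      assume "v = a"
      thus ?thesis using e ab by (auto simp: nbrs_simps adj_def)
    next
      assume "v = b"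
      hence "e = {v, a}" using ab(1) by auto
      thus ?thesis using e ab by (auto simp: nbrs_simps adj_def)
    qed
  qed (auto simp: nbrs_simps adj_def)
  moreover have "inj_on (\<lambda>u. {v, u}) (nbrs G v)" by (auto simp: inj_on_def doubleton_eq_iff)
  ultimately have "card {e\<in>edges G. v \<in> e} = card (nbrs G v)" by (simp add: card_image)
  moreover have "card (edges G) = card {e\<in>edges G. v \<notin> e} + card {e\<in>edges G. v \<in> e}"
  proof -
    have "card (edges G) = card ({e\<in>edges G. v \<notin> e} \<union> {e\<in>edges G. v \<in> e})"
      by (rule arg_cong[of _ _ card]) auto
    also have "\<dots> = card {e\<in>edges G. v \<notin> e} + card {e\<in>edges G. v \<in> e}"
      using finE by (intro card_Un_disjoint) auto
    finally show ?thesis .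
  qed
  ultimately show ?thesis by (simp add: delete_vertex_def)
qed

text \<open>Rounding loses at most 1 in \<open>m * m\<close>, and passing from \<open>n\<close> to
  \<open>m = n - (s - 1)\<close> costs at most \<open>(s - 1)^2\<close>; both are absorbed by a
  constant.\<close>

lemma fex_lower:
  assumes "1 \<le> s" "s \<le> n"
  shows "(real n)\<^sup>2 / 4 + (real s - 1) / 2 * real n - ((real s - 1)\<^sup>2 + 1) \<le> real (fex s t n)"
proof -
  define m where "m = n - s + 1"
  have m: "real m = real n - (real s - 1)" using assms by (simp add: m_def of_nat_diff)
  have "m * m \<le> 4 * ((m div 2) * ((m + 1) div 2)) + 1"
  proof (cases "even m")
    case True
    then obtain k where "m = 2 * k" by (rule evenE)
    thus ?thesis by simp
  next
    case False
    then obtain k where "m = 2 * k + 1" by (rule oddE)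
    thus ?thesis by (simp add: algebra_simps)
  qed
  hence "real (m * m) \<le> real (4 * ((m div 2) * ((m + 1) div 2)) + 1)" by (rule of_nat_mono)
  hence 1: "(real m)\<^sup>2 \<le> 4 * real ((m div 2) * ((m + 1) div 2)) + 1" by (simp add: power2_eq_square)
  have "real ((m div 2) * ((m + 1) div 2) + (s - 1) * m) \<le> real (fex s t n)"
    unfolding fex_def m_def[symmetric] by (rule of_nat_mono) simp
  moreover have "real (s - 1) = real s - 1" using assms by (simp add: of_nat_diff)
  ultimately have 2: "real ((m div 2) * ((m + 1) div 2)) + (real s - 1) * real m \<le> real (fex s t n)"
    by (metis of_nat_add of_nat_mult)
  have 3: "(real m)\<^sup>2 = (real n)\<^sup>2 - 2 * ((real s - 1) * real n) + (real s - 1)\<^sup>2"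
    "(real s - 1) * real m = (real s - 1) * real n - (real s - 1)\<^sup>2"
    unfolding m by (simp_all add: power2_eq_square algebra_simps)
  have 4: "0 \<le> (real s - 1)\<^sup>2" by simp
  have 5: "(real s - 1) / 2 * real n = ((real s - 1) * real n) / 2" by simp
  define P where "P = (real s - 1) * real n"
  show ?thesis using 1 2 3 4 unfolding 5 P_def[symmetric] by linarith
qed

context balloon
begin

text \<open>The surplus \<open>exc\<close> is a parameter because two uses are made of it: a
  positive value is refuted, which bounds the number of edges, and the value 0 yields the extremal
  graph.\<close>

lemma core:
  assumes s: "2 \<le> card A" and t: "3 \<le> card B"
  obtains N where "\<And>(G :: 'b graph) exc. simple_graph G \<Longrightarrow> N \<le> card (verts G) \<Longrightarrow> \<not> embeds F G \<Longrightarrow>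
     \<forall>v\<in>verts G. gmin (card A) (card (verts G)) \<le> card (nbrs G v) \<Longrightarrow>
     card (edges G) = fex (card A) (card B) (card (verts G)) + exc \<Longrightarrow>
     exc = 0 \<and> (4 \<le> card B \<longrightarrow> is_Gst (card A) (card B) (card (verts G)) G)"
proof -
  define K where "K = (real (card A) - 1)\<^sup>2 + 1"
  define c where "c = card A + card A * card B"
  define Q where "Q = qF + 2 * (card A * card B) + card A + card B"
  have h: "1 \<le> card B" "card A + card A * card B \<le> c" "qF \<le> Q"
    "2 * (card A * card B) + card A + card B \<le> Q" "0 \<le> K" using t by (auto simp: c_def Q_def K_def)
  obtain N where N: "\<And>G :: 'b graph. simple_graph G \<Longrightarrow> N \<le> card (verts G) \<Longrightarrow> \<not> embeds F G \<Longrightarrow>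
     \<forall>v\<in>verts G. card (verts G) \<le> 2 * card (nbrs G v) \<Longrightarrow>
     (real (card (verts G)))\<^sup>2 / 4 + (real (card A) - 1) / 2 * real (card (verts G)) - K
        \<le> real (card (edges G)) \<Longrightarrow>
     \<exists>X Y W. verts G = W \<union> (X \<union> Y) \<and> X \<inter> Y = {} \<and> W \<inter> (X \<union> Y) = {} \<and> card W = card A - 1 \<and>
       rich G c Q (W \<union> X) Y \<and> rich G c Q (W \<union> Y) X"
    by (fact exceptional_set[OF s h])
  show thesis
  proof (rule that[of "N + card A"])
    fix G :: "'b graph" and exc
    assume G: "simple_graph G" and n: "N + card A \<le> card (verts G)" and free: "\<not> embeds F G"
      and deg: "\<forall>v\<in>verts G. gmin (card A) (card (verts G)) \<le> card (nbrs G v)"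
      and e: "card (edges G) = fex (card A) (card B) (card (verts G)) + exc"
    have "card (verts G) \<le> 2 * gmin (card A) (card (verts G))"
      unfolding gmin_def using s n by presburger
    hence deg': "\<forall>v\<in>verts G. card (verts G) \<le> 2 * card (nbrs G v)" using deg by fastforce
    have lo: "(real (card (verts G)))\<^sup>2 / 4 + (real (card A) - 1) / 2 * real (card (verts G)) - K
        \<le> real (card (edges G))"
      unfolding K_def using fex_lower[of "card A" "card (verts G)" "card B"] s n e by simp
    have nN: "N \<le> card (verts G)" using n by simp
    obtain X Y W where X: "verts G = W \<union> (X \<union> Y)" "X \<inter> Y = {}" "W \<inter> (X \<union> Y) = {}" "card W = card A - 1"
       "rich G c Q (W \<union> X) Y" "rich G c Q (W \<union> Y) X"
      using N[OF G nN free deg' lo] by (elim exE conjE)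
    have "structured A B ps F G X Y W c Q"
      by unfold_locales (fact G free X s t h)+
    from is_Gst_structured[OF this e]
    show "exc = 0 \<and> (4 \<le> card B \<longrightarrow> is_Gst (card A) (card B) (card (verts G)) G)" .
  qed
qed

text \<open>Removes the minimum degree condition from \<open>core\<close>. A graph with too many
  edges must contain a vertex of small degree, and deleting it leaves an even larger excess, until
  the number of edges is impossible.\<close>

lemma extremal:
  assumes s: "2 \<le> card A" and t: "3 \<le> card B"
  obtains N where "\<And>G :: 'b graph. simple_graph G \<Longrightarrow> N \<le> card (verts G) \<Longrightarrow> \<not> embeds F G \<Longrightarrow>
     card (edges G) \<le> fex (card A) (card B) (card (verts G)) \<and>
     (card (edges G) = fex (card A) (card B) (card (verts G)) \<longrightarrow> 4 \<le> card B \<longrightarrow>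
       is_Gst (card A) (card B) (card (verts G)) G)"
proof -
  define f where "f n = fex (card A) (card B) n" for n
  define gm where "gm n = gmin (card A) n" for n
  obtain N0 where N0: "\<And>(G :: 'b graph) exc. simple_graph G \<Longrightarrow> N0 \<le> card (verts G) \<Longrightarrow> \<not> embeds F G \<Longrightarrow>
     \<forall>v\<in>verts G. gmin (card A) (card (verts G)) \<le> card (nbrs G v) \<Longrightarrow>
     card (edges G) = fex (card A) (card B) (card (verts G)) + exc \<Longrightarrow>
     exc = 0 \<and> (4 \<le> card B \<longrightarrow> is_Gst (card A) (card B) (card (verts G)) G)"
    by (fact core[OF s t])
  define N1 where "N1 = N0 + card A"
  define K where "K = N1 choose 2"
  have fS: "f (Suc n) = f n + gm (Suc n)" if "N1 \<le> n" for n
    unfolding f_def gm_def by (rule fex_Suc) (use that in \<open>simp add: N1_def\<close>)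
  have low: "\<exists>v\<in>verts G. card (nbrs G v) < gm (card (verts G))"
    if "simple_graph G" "N1 \<le> card (verts G)" "\<not> embeds F G" "f (card (verts G)) < card (edges G)" for G :: "'b graph"
  proof (rule ccontr)
    assume "\<not> ?thesis"
    hence 1: "\<forall>v\<in>verts G. gmin (card A) (card (verts G)) \<le> card (nbrs G v)" by (auto simp: gm_def not_less)
    have 2: "card (edges G) = fex (card A) (card B) (card (verts G)) + (card (edges G) - f (card (verts G)))"
      using that(4) by (simp add: f_def)
    have "N0 \<le> card (verts G)" using that(2) by (simp add: N1_def)
    from N0[OF that(1) this that(3) 1 2] have "card (edges G) - f (card (verts G)) = 0" by blast
    thus False using that(4) by simp
  qed
  \<comment> \<open>By induction from \<open>N1\<close> vertices upwards, where the excess is at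
    most \<open>K\<close> trivially: each further vertex lowers the possible excess by at least
    one.\<close>
  have claim: "card (edges G) \<le> f n \<or> card (edges G) + (n - N1) \<le> f n + K"
    if "N1 \<le> n" "simple_graph G" "card (verts G) = n" "\<not> embeds F G" for n and G :: "'b graph"
    using that
  proof (induction n arbitrary: G rule: dec_induct)
    case base
    have finV: "finite (verts G)" using base by (simp add: simple_graph_def)
    have "card (edges G) \<le> card (nsets (verts G) 2)"
      using base finite_imp_finite_nsets[OF finV] by (intro card_mono) (auto simp: simple_graph_def)
    thus ?case using base by (simp add: card_nsets K_def)
  next
    case (step n)
    show ?case
    proof (cases "card (edges G) \<le> f (Suc n)")
      case False
      hence "f (card (verts G)) < card (edges G)" using step.prems by simp
      then obtain v where v: "v \<in> verts G" "card (nbrs G v) < gm (Suc n)"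
        using low[OF step.prems(1) _ step.prems(3)] step.prems(2) step.hyps by auto
      define G' where "G' = delete_vertex G v"
      have e: "card (edges G) = card (edges G') + card (nbrs G v)"
        unfolding G'_def by (rule delete_vertex_card[OF step.prems(1) v(1)])
      have "card (verts G') = n" using v(1) step.prems(1,2) by (simp add: G'_def delete_vertex_def simple_graph_def)
      moreover have "simple_graph G'" unfolding G'_def by (rule delete_vertex_simple[OF step.prems(1)])
      moreover have "\<not> embeds F G'"
        using step.prems(3) delete_vertex_embeds[of F G v] unfolding G'_def by metis
      ultimately have "card (edges G') \<le> f n \<or> card (edges G') + (n - N1) \<le> f n + K" using step.IH by blast
      moreover have "f n < card (edges G')" using False e v(2) fS[OF step.hyps(1)] by linarith
      ultimately have "card (edges G') + (n - N1) \<le> f n + K" by linarith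
      thus ?thesis using e v(2) fS[OF step.hyps(1)] step.hyps(1) by linarith
    qed simp
  qed
  have bound: "card (edges G) \<le> f (card (verts G))"
    if "N1 + K + 1 \<le> card (verts G)" "simple_graph G" "\<not> embeds F G" for G :: "'b graph"
    using claim[OF _ that(2) refl that(3)] that(1) by linarith
  show thesis
  \<comment> \<open>One more than \<open>bound\<close> requires, so that \<open>bound\<close> still
    applies after a vertex is deleted.\<close>
  proof (rule that[of "N1 + K + 2"])
    fix G :: "'b graph"
    assume G: "simple_graph G" and n: "N1 + K + 2 \<le> card (verts G)" and free: "\<not> embeds F G"
    have le: "card (edges G) \<le> f (card (verts G))" using bound[OF _ G free] n by simp
    have "is_Gst (card A) (card B) (card (verts G)) G"
      if eq: "card (edges G) = f (card (verts G))" and t4: "4 \<le> card B"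
    proof -
      have "\<forall>v\<in>verts G. gmin (card A) (card (verts G)) \<le> card (nbrs G v)"
      proof (rule ccontr)
        assume "\<not> ?thesis"
        then obtain v where v: "v \<in> verts G" "card (nbrs G v) < gm (card (verts G))"
          by (auto simp: gm_def not_le)
        define G' where "G' = delete_vertex G v"
        define n' where "n' = card (verts G) - 1"
        have nS: "card (verts G) = Suc n'" using n by (simp add: n'_def)
        have cv: "card (verts G') = n'" using v(1) G by (simp add: G'_def delete_vertex_def simple_graph_def n'_def)
        have "simple_graph G'" unfolding G'_def by (rule delete_vertex_simple[OF G])
        moreover have "\<not> embeds F G'"
          using free delete_vertex_embeds[of F G v] unfolding G'_def by metis
        ultimately have "card (edges G') \<le> f n'" using bound[of G'] cv n nS by simp
        moreover have "card (edges G) = card (edges G') + card (nbrs G v)"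
          unfolding G'_def by (rule delete_vertex_card[OF G v(1)])
        moreover have "f (card (verts G)) = f n' + gm (card (verts G))"
          unfolding nS by (rule fS) (use n nS in simp)
        ultimately show False using eq v(2) by linarith
      qed
      thus ?thesis using N0[OF G _ free, of 0] n eq t4 by (simp add: N1_def f_def)
    qed
    thus "card (edges G) \<le> fex (card A) (card B) (card (verts G)) \<and>
     (card (edges G) = fex (card A) (card B) (card (verts G)) \<longrightarrow> 4 \<le> card B \<longrightarrow>
       is_Gst (card A) (card B) (card (verts G)) G)" using le unfolding f_def by blast
  qed
qed

end

lemma int_fex:
  assumes "1 \<le> s" "s \<le> n" "3 \<le> t"
  shows "int (fex s t n) = \<lceil>(real n - real s + 1) / 2\<rceil> * \<lfloor>(real n - real s + 1) / 2\<rfloor>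
        + (int s - 1) * (int n - int s + 1) + int ((s - 1) choose 2)
        + (int t)\<^sup>2 - 3 * int t + 3"
proof -
  define m where "m = n - s + 1"
  have m: "real n - real s + 1 = real m" "int n - int s + 1 = int m" using assms by (auto simp: m_def of_nat_diff)
  have fl: "\<lfloor>real m / 2\<rfloor> = int (m div 2)" using floor_divide_of_nat_eq[of m 2] by simp
  have ce: "\<lceil>real m / 2\<rceil> = int ((m + 1) div 2)"
  proof (cases "even m")
    case True
    then obtain k where "m = 2 * k" by (rule evenE)
    thus ?thesis by simp
  next
    case False
    then obtain k where k: "m = 2 * k + 1" by (rule oddE)
    show ?thesis unfolding k by (rule ceiling_unique) (simp_all add: field_simps)
  qed
  have "3 * t \<le> t * t" using assms(3) by simp
  hence "int (t * t + 3 - 3 * t) = int (t * t + 3) - int (3 * t)" by (intro of_nat_diff) linarith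
  hence t: "int (t * t + 3 - 3 * t) = (int t)\<^sup>2 - 3 * int t + 3" by (simp add: power2_eq_square)
  have s: "int (s - 1) = int s - 1" using assms by (simp add: of_nat_diff)
  show ?thesis
    unfolding m fl ce fex_def m_def[symmetric] of_nat_add of_nat_mult t s by (simp add: algebra_simps)
qed

theorem theorem4:
  fixes s t :: nat and K F :: "'a graph" and C :: "'a set \<Rightarrow> 'a graph"
  assumes "2 \<le> s" and "s \<le> t" and "(s, t) \<notin> {(2, 2), (2, 3)}"
    and "is_complete_bipartite s t K"
    and "odd_ballooning K C F"
    and "\<forall>e\<in>edges K. 5 \<le> card (verts (C e))"
  shows "\<exists>N. \<forall>n\<ge>N.
      int (turan_number n F) =
        \<lceil>(real n - real s + 1) / 2\<rceil> * \<lfloor>(real n - real s + 1) / 2\<rfloor>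
        + (int s - 1) * (int n - int s + 1) + int ((s - 1) choose 2)
        + (int t)\<^sup>2 - 3 * int t + 3 \<and>
      (t \<ge> 4 \<longrightarrow> (\<forall>G. extremal_graph n F G \<longleftrightarrow> is_Gst s t n G)) \<and>
      (t = 3 \<longrightarrow>
         (\<exists>G :: nat graph. is_Gst 3 3 n G) \<and> (\<exists>G' :: nat graph. is_G33' n G') \<and>
         (\<forall>G. is_Gst 3 3 n G \<longrightarrow> extremal_graph n F G) \<and>
         (\<forall>G'. is_G33' n G' \<longrightarrow> extremal_graph n F G') \<and>
         (\<forall>(G :: nat graph) (G' :: nat graph).
            is_Gst 3 3 n G \<and> is_G33' n G' \<longrightarrow> \<not> graph_iso G G'))"
proof -
  \<comment> \<open>The excluded pair \<open>(2, 2)\<close> is the only one with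
    \<open>2 \<le> s \<le> t\<close> and \<open>t < 3\<close>.\<close>
  have t3: "3 \<le> t" using assms(1-3) by auto
  have s1: "1 \<le> s" "1 \<le> t" using assms(1,2) by auto
  obtain A B ps where bal: "balloon A B ps F" and cA: "card A = s" and cB: "card B = t"
    using odd_ballooning_imp_balloon[OF assms(4-6) s1] by blast
  interpret balloon A B ps F by (rule bal)
  have s2': "2 \<le> card A" and t3': "3 \<le> card B" using cA cB assms(1) t3 by auto
  obtain N0 where N0: "\<And>G :: nat graph. simple_graph G \<Longrightarrow> N0 \<le> card (verts G) \<Longrightarrow> \<not> embeds F G \<Longrightarrow>
     card (edges G) \<le> fex (card A) (card B) (card (verts G)) \<and>
     (card (edges G) = fex (card A) (card B) (card (verts G)) \<longrightarrow> 4 \<le> card B \<longrightarrow>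
       is_Gst (card A) (card B) (card (verts G)) G)"
    by (fact extremal[OF s2' t3'])
  \<comment> \<open>The summand \<open>4 * t\<close> makes room in one class for the copy of
    \<open>H\<close> with labels below \<open>2 * t\<close>, and \<open>8\<close> makes room for the
    triangle.\<close>
  define N where "N = N0 + s + 4 * t + 8"
  show ?thesis
  proof (intro exI[of _ N] allI impI)
    fix n assume n: "N \<le> n"
    have sn: "s \<le> n" "4 * t \<le> n - s + 1" "6 \<le> n - 2" "N0 \<le> n" "3 \<le> n" using n by (auto simp: N_def)
    have t2: "2 \<le> t" using t3 by simp
    have upper: "card (edges G) \<le> fex s t n"
      if "simple_graph G" "card (verts G) = n" "graph_free F G" for G :: "nat graph"
      using N0[of G] that sn(4) cA cB unfolding graph_free_iff by simp
    have Gst: "simple_graph G \<and> card (verts G) = n \<and> graph_free F G \<and> card (edges G) = fex s t n"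
      if gst: "is_Gst s t n G" for G :: "nat graph"
    proof -
      obtain Q X Y S where Q: "is_H t Q" "join_embedding X Y S Q G" "card S = s - 1"
        "simple_graph G" "card (verts G) = n" "card (edges G) = fex s t n"
        by (rule is_GstD[OF gst s1(1) sn(1) t2])
      have "\<not> embeds F G"
        using Gst_free[of Q X Y S G] Q cA cB assms(2) s1 by simp
      thus ?thesis using Q unfolding graph_free_iff by blast
    qed
    have tur: "turan_number n F = fex s t n"
      unfolding turan_number_def
    proof (rule Max_eqI)
      show "finite {card (edges G) |G :: nat graph. simple_graph G \<and> card (verts G) = n \<and> graph_free F G}"
        by (rule finite_subset[of _ "{..fex s t n}"]) (use upper in auto)
      show "y \<le> fex s t n"
        if "y \<in> {card (edges G) |G :: nat graph. simple_graph G \<and> card (verts G) = n \<and> graph_free F G}" for y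
        using that upper by auto
      obtain G :: "nat graph" where "is_Gst s t n G" using ex_Gst[OF sn(2)] by blast
      from Gst[OF this]
      show "fex s t n \<in> {card (edges G) |G :: nat graph. simple_graph G \<and> card (verts G) = n \<and> graph_free F G}"
        unfolding mem_Collect_eq by (intro exI[of _ G]) simp
    qed
    have ext: "extremal_graph n F G \<longleftrightarrow> simple_graph G \<and> card (verts G) = n \<and> graph_free F G \<and> card (edges G) = fex s t n"
      for G unfolding extremal_graph_def tur ..
    have uniq: "extremal_graph n F G \<longleftrightarrow> is_Gst s t n G" if "4 \<le> t" for G
    proof
      assume "extremal_graph n F G"
      hence G: "simple_graph G" "card (verts G) = n" "\<not> embeds F G" "card (edges G) = fex s t n"
        unfolding ext graph_free_iff by blast+
      show "is_Gst s t n G" using N0[OF G(1) _ G(3)] G(2,4) sn(4) that cA cB by simp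
    next
      assume "is_Gst s t n G"
      thus "extremal_graph n F G" unfolding ext by (rule Gst)
    qed
    have three: "(\<exists>G :: nat graph. is_Gst 3 3 n G) \<and> (\<exists>G' :: nat graph. is_G33' n G') \<and>
         (\<forall>G. is_Gst 3 3 n G \<longrightarrow> extremal_graph n F G) \<and>
         (\<forall>G'. is_G33' n G' \<longrightarrow> extremal_graph n F G') \<and>
         (\<forall>(G :: nat graph) (G' :: nat graph).
            is_Gst 3 3 n G \<and> is_G33' n G' \<longrightarrow> \<not> graph_iso G G')" if t: "t = 3"
    proof (intro conjI allI impI)
      \<comment> \<open>For \<open>t = 3\<close> the excluded pair \<open>(2, 3)\<close> leaves only
        this value.\<close>
      have s: "s = 3" using assms(1-3) t by auto
      show "\<exists>G :: nat graph. is_Gst 3 3 n G" using ex_Gst[OF sn(2)] s t by simp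
      show "\<exists>G' :: nat graph. is_G33' n G'" by (rule ex_G33'[OF sn(3)])
      show "extremal_graph n F G" if "is_Gst 3 3 n G" for G
        unfolding ext using Gst[of G] that s t by simp
      show "extremal_graph n F G'" if g33: "is_G33' n G'" for G'
      proof -
        obtain T Q X Y S where Q: "card T = 3" "edges Q = nsets T 2" "join_embedding X Y S Q G'" "card S = 2"
          "card X + card Y = n - 2" "card X \<le> card Y + 1"
          "simple_graph G'" "card (verts G') = n" "card (edges G') = fex 3 3 n"
          by (rule is_G33'D[OF g33 sn(5)])
        have "\<not> embeds F G'" using G33'_free[OF _ _ Q(1-4)] cA cB s t by simp
        thus ?thesis unfolding ext graph_free_iff using Q s t by simp
      qed
      fix G G' :: "nat graph"
      assume *: "is_Gst 3 3 n G \<and> is_G33' n G'"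
      have n3: "3 \<le> n" using sn s by simp
      obtain Q X Y S where Q: "is_H 3 Q" "join_embedding X Y S Q G" "card S = 3 - 1"
        "simple_graph G" "card (verts G) = n" "card (edges G) = fex 3 3 n"
        by (rule is_GstD[OF conjunct1[OF *] _ n3]) auto
      obtain T Q' X' Y' S' where Q': "card T = 3" "edges Q' = nsets T 2" "join_embedding X' Y' S' Q' G'" "card S' = 2"
        "card X' + card Y' = n - 2" "card X' \<le> card Y' + 1"
        "simple_graph G'" "card (verts G') = n" "card (edges G') = fex 3 3 n"
        by (rule is_G33'D[OF conjunct2[OF *] sn(5)])
      have "Y' \<noteq> {}" using Q'(5,6) sn(3) by auto
      then obtain C where C: "C \<subseteq> verts G'" "card C = 6" "nsets C 2 \<subseteq> edges G'"
        using G33'_clique[OF Q'(1-4)] by blast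
      show "\<not> graph_iso G G'"
      proof
        assume iso: "graph_iso G G'"
        have "edges G \<subseteq> nsets (verts G) 2" using Q(4) by (simp add: simple_graph_def)
        then obtain D where D: "D \<subseteq> verts G" "card D = 6" "nsets D 2 \<subseteq> edges G"
          using graph_iso_clique[OF iso _ C(1,3)] C(2) by auto
        from Gst_no_large_clique[OF Q(2,1) D(1,3)] show False using D(2) Q(3) by simp
      qed
    qed
    show "int (turan_number n F) =
        \<lceil>(real n - real s + 1) / 2\<rceil> * \<lfloor>(real n - real s + 1) / 2\<rfloor>
        + (int s - 1) * (int n - int s + 1) + int ((s - 1) choose 2)
        + (int t)\<^sup>2 - 3 * int t + 3 \<and>
      (t \<ge> 4 \<longrightarrow> (\<forall>G. extremal_graph n F G \<longleftrightarrow> is_Gst s t n G)) \<and>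
      (t = 3 \<longrightarrow>
         (\<exists>G :: nat graph. is_Gst 3 3 n G) \<and> (\<exists>G' :: nat graph. is_G33' n G') \<and>
         (\<forall>G. is_Gst 3 3 n G \<longrightarrow> extremal_graph n F G) \<and>
         (\<forall>G'. is_G33' n G' \<longrightarrow> extremal_graph n F G') \<and>
         (\<forall>(G :: nat graph) (G' :: nat graph).
            is_Gst 3 3 n G \<and> is_G33' n G' \<longrightarrow> \<not> graph_iso G G'))"
      using int_fex[OF s1(1) sn(1) t3] tur uniq three by simp
  qed
qed

end
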